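(* Let $W$ be a graphon, fix $r\ge 2$, set $t_r=t(K_r,W)$, and let $X_{n,r}$ be the number of $r$-cliques in $\mathbb{G}(n,W)$. Then: (a) If $W$ is $K_r$-free then almost surely $X_{n,r}=0$; if $W$ is complete then almost surely $X_{n,r}=\binom nr$. (b) If $W$ is not $K_r$-regular, then $$\frac{X_{n,r}-\binom nr t_r}{n^{r-1/2}}\to \hat\sigma_{r,W}\,Z\quad\text{in distribution},$$ where $Z$ is standard normal and $\hat\sigma_{r,W}=\frac{1}{(r-1)!}\big(t(K_r\ominus_1K_r,W)-t_r^2\big)^{1/2}>0$. (c) If $W$ is $K_r$-regular and neither $K_r$-free nor complete, then $$\frac{X_{n,r}-\binom nr t_r}{n^{r-1}}\to \sigma_{r,W}\,Z+\frac{1}{2(r-2)!}\sum_{\lambda\in\mathrm{Spec}^-(V_W^{(r)})}\lambda\,(Z_\lambda^2-1)\quad\text{in distribution},$$ where $Z$ and $(Z_\lambda)_{\lambda\in\mathrm{Spec}^-(V_W^{(r)})}$ are independent standard normal random variables (indexed with multiplicity) and the series converges almost surely and in $L^2$.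
   Context: A graphon is a symmetric measurable $W:[0,1]^2\to[0,1]$. $\mathbb{G}(n,W)$: draw i.i.d. uniform types $U_1,\dots,U_n$ on $[0,1]$, then join each pair $\{i,j\}$ independently with probability $W(U_i,U_j)$. For a multigraph $H$ on vertex set $[k]$, $t(H,W)=\mathbb{E}\prod_{\{i,j\}\in E(H)}W(U_i,U_j)$ with $U_1,\dots,U_k$ i.i.d. uniform (an edge of multiplicity $m$ contributes $W^m$). For marked vertices $J\subseteq[k]$ and $\mathbf x=(x_j)_{j\in J}$, $t_{\mathbf x}(H,W)=\mathbb{E}[\prod_{\{i,j\}\in E(H)}W(U_i,U_j)\mid U_j=x_j,\ j\in J]$; $t_x(K_r^\bullet,W)$ and $t_{x,y}(K_r^{\bullet\bullet},W)$ denote this for $K_r$ with one, resp. two, marked vertices. $W$ is $K_r$-free if $t(K_r,W)=0$, complete if $W=1$ a.e., and $K_r$-regular if $t_x(K_r^\bullet,W)=t(K_r,W)$ for a.e. $x$. $K_r\ominus_jK_r$ is the simple graph on $2r-j$ vertices formed by two copies of $K_r$ sharing exactly $j$ vertices; $K_r\oplus_2K_r$ is the multigraph obtained from $K_r\ominus_2K_r$ by doubling the edge between the two shared vertices. $V_W^{(r)}(x,y):=t_{x,y}(K_r^{\bullet\bullet},W)$ (a graphon). $\sigma_{r,W}^2:=\frac{1}{2((r-2)!)^2}\big(t(K_r\ominus_2K_r,W)-t(K_r\oplus_2K_r,W)\big)$ (this is $\ge 0$), $\sigma_{r,W}\ge0$. For a graphon $U$, $\mathrm{Spec}(U)$ is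 the multiset of nonzero eigenvalues of the Hilbert–Schmidt integral operator $(T_Uf)(x)=\int_0^1U(x,y)f(y)\,dy$ on $L^2[0,1]$. When $W$ is $K_r$-regular, $V_W^{(r)}$ has constant degree function $\int_0^1V_W^{(r)}(x,y)dy\equiv t_r$, so $t_r$ is an eigenvalue; $\mathrm{Spec}^-(V_W^{(r)})$ is $\mathrm{Spec}(V_W^{(r)})$ with the multiplicity of $t_r$ decreased by one. *)

theory Defs
  imports "HOL-Probability.Probability"
begin

abbreviation unif :: "real measure" where
  "unif \<equiv> uniform_measure lborel {0..1}"

definition graphon :: "(real \<Rightarrow> real \<Rightarrow> real) \<Rightarrow> bool" where
  "graphon W \<longleftrightarrow> (\<lambda>(x, y). W x y) \<in> borel_measurable borel
     \<and> (\<forall>x\<in>{0..1}. \<forall>y\<in>{0..1}. W x y = W y x \<and> 0 \<le> W x y \<and> W x y \<le> 1)"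

text \<open>Homomorphism density of a multigraph H on vertex set {0..<k}, given by its
  edge multiplicity function E (only E i j with i < j < k is used), with the vertices
  in J marked and fixed to the values x j.  Unmarked vertices get i.i.d. uniform types.\<close>
definition hdens :: "(real \<Rightarrow> real \<Rightarrow> real) \<Rightarrow> nat \<Rightarrow> (nat \<Rightarrow> nat \<Rightarrow> nat)
    \<Rightarrow> nat set \<Rightarrow> (nat \<Rightarrow> real) \<Rightarrow> real" where
  "hdens W k E J x =
     (\<integral>\<omega>. (\<Prod>i<k. \<Prod>j\<in>{i<..<k}.
          W (if i \<in> J then x i else \<omega> i) (if j \<in> J then x j else \<omega> j) ^ E i j)
      \<partial>(PiM ({..<k} - J) (\<lambda>_. unif)))"

definition tdens :: "(real \<Rightarrow> real \<Rightarrow> real) \<Rightarrow> nat \<Rightarrow> (nat \<Rightarrow> nat \<Rightarrow> nat) \<Rightarrow> real" where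
  "tdens W k E = hdens W k E {} (\<lambda>_. 0)"

definition Kr :: "nat \<Rightarrow> nat \<Rightarrow> nat \<Rightarrow> nat" where
  "Kr r i j = (if i \<noteq> j \<and> i < r \<and> j < r then 1 else 0)"

text \<open>Two copies of K_r on {0..<2r-s}: first copy on {0..<r}, second copy on
  {0..<s} \<union> {r..<2r-s}; they share exactly the s vertices {0..<s}.
  Counting edges with multiplicity (edges inside the shared part are doubled).\<close>
definition in_copy2 :: "nat \<Rightarrow> nat \<Rightarrow> nat \<Rightarrow> bool" where
  "in_copy2 r s i \<longleftrightarrow> i < s \<or> (r \<le> i \<and> i < 2 * r - s)"

definition two_copies_mult :: "nat \<Rightarrow> nat \<Rightarrow> nat \<Rightarrow> nat \<Rightarrow> nat" where
  "two_copies_mult r s i j =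
     (if i \<noteq> j \<and> i < r \<and> j < r then 1 else 0) +
     (if i \<noteq> j \<and> in_copy2 r s i \<and> in_copy2 r s j then 1 else 0)"

definition Kr_ominus :: "nat \<Rightarrow> nat \<Rightarrow> nat \<Rightarrow> nat \<Rightarrow> nat" where
  "Kr_ominus r s i j = min 1 (two_copies_mult r s i j)"

definition Kr_oplus2 :: "nat \<Rightarrow> nat \<Rightarrow> nat \<Rightarrow> nat" where
  "Kr_oplus2 r = two_copies_mult r 2"

definition Kfree :: "nat \<Rightarrow> (real \<Rightarrow> real \<Rightarrow> real) \<Rightarrow> bool" where
  "Kfree r W \<longleftrightarrow> tdens W r (Kr r) = 0"

definition complete_graphon :: "(real \<Rightarrow> real \<Rightarrow> real) \<Rightarrow> bool" where
  "complete_graphon W \<longleftrightarrow> (AE p in unif \<Otimes>\<^sub>M unif. W (fst p) (snd p) = 1)"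

definition t1 :: "nat \<Rightarrow> (real \<Rightarrow> real \<Rightarrow> real) \<Rightarrow> real \<Rightarrow> real" where
  "t1 r W x = hdens W r (Kr r) {0} (\<lambda>_. x)"

definition VW :: "nat \<Rightarrow> (real \<Rightarrow> real \<Rightarrow> real) \<Rightarrow> real \<Rightarrow> real \<Rightarrow> real" where
  "VW r W x y = hdens W r (Kr r) {0, 1} (\<lambda>i. if i = 0 then x else y)"

definition Kregular :: "nat \<Rightarrow> (real \<Rightarrow> real \<Rightarrow> real) \<Rightarrow> bool" where
  "Kregular r W \<longleftrightarrow> (AE x in unif. t1 r W x = tdens W r (Kr r))"

definition sigma_rW :: "nat \<Rightarrow> (real \<Rightarrow> real \<Rightarrow> real) \<Rightarrow> real" where
  "sigma_rW r W = sqrt ((tdens W (2 * r - 2) (Kr_ominus r 2) - tdens W (2 * r - 2) (Kr_oplus2 r))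
                         / (2 * (fact (r - 2))^2))"

definition sigma_hat_rW :: "nat \<Rightarrow> (real \<Rightarrow> real \<Rightarrow> real) \<Rightarrow> real" where
  "sigma_hat_rW r W = (1 / fact (r - 1)) * sqrt (tdens W (2 * r - 1) (Kr_ominus r 1) - (tdens W r (Kr r))^2)"

text \<open>Multiplicity of \<mu> as an eigenvalue of T_U: the maximal size of an L^2-orthonormal
  family of eigenfunctions (T_U f = \<mu> f a.e.) = dimension of the eigenspace.\<close>
definition eig_mult :: "(real \<Rightarrow> real \<Rightarrow> real) \<Rightarrow> real \<Rightarrow> enat" where
  "eig_mult U \<mu> = (SUP m \<in> {m::nat. \<exists>f :: nat \<Rightarrow> real \<Rightarrow> real.
       (\<forall>i<m. f i \<in> borel_measurable borel \<and> integrable unif (\<lambda>x. (f i x)^2)) \<and>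
       (\<forall>i<m. \<forall>j<m. (\<integral>x. f i x * f j x \<partial>unif) = (if i = j then 1 else 0)) \<and>
       (\<forall>i<m. AE x in unif. (\<integral>y. U x y * f i y \<partial>unif) = \<mu> * f i x)}. enat m)"

definition spec_minus_mult :: "nat \<Rightarrow> (real \<Rightarrow> real \<Rightarrow> real) \<Rightarrow> real \<Rightarrow> enat" where
  "spec_minus_mult r W \<mu> =
     (if \<mu> = 0 then 0
      else eig_mult (VW r W) \<mu> - (if \<mu> = tdens W r (Kr r) then 1 else 0))"

text \<open>Sample space of G(n,W): types U_i = \<omega> (Inl i), i < n, and auxiliary uniforms
  \<omega> (Inr (i,j)), i < j < n; the pair {i,j} is an edge iff \<omega> (Inr (i,j)) < W(U_i,U_j),
  which happens independently with probability W(U_i,U_j) given the types.\<close>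
definition Gidx :: "nat \<Rightarrow> (nat + nat \<times> nat) set" where
  "Gidx n = Inl ` {..<n} \<union> Inr ` {(i, j). i < j \<and> j < n}"

definition Gspace :: "nat \<Rightarrow> (nat + nat \<times> nat \<Rightarrow> real) measure" where
  "Gspace n = PiM (Gidx n) (\<lambda>_. unif)"

definition Gedge :: "(real \<Rightarrow> real \<Rightarrow> real) \<Rightarrow> (nat + nat \<times> nat \<Rightarrow> real) \<Rightarrow> nat \<Rightarrow> nat \<Rightarrow> bool" where
  "Gedge W \<omega> i j \<longleftrightarrow> i \<noteq> j \<and>
     \<omega> (Inr (min i j, max i j)) < W (\<omega> (Inl i)) (\<omega> (Inl j))"

definition clique_count :: "(real \<Rightarrow> real \<Rightarrow> real) \<Rightarrow> nat \<Rightarrow> nat \<Rightarrow> (nat + nat \<times> nat \<Rightarrow> real) \<Rightarrow> nat" where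
  "clique_count W n r \<omega> =
     card {S. S \<subseteq> {..<n} \<and> card S = r \<and> (\<forall>i\<in>S. \<forall>j\<in>S. i \<noteq> j \<longrightarrow> Gedge W \<omega> i j)}"

section \<open>Limit space: independent standard normals Z = \<xi> None, Z_k = \<xi> (Some k)\<close>

definition Nspace :: "(nat option \<Rightarrow> real) measure" where
  "Nspace = PiM UNIV (\<lambda>_. std_normal_distribution)"

end

theory Submission
  imports Defs
begin

text \<open>
  Write the clique count as a sum over r-sets S of the clique indicators A S. Conditioning A S on the
  types and edge variables of a subset P gives B P, and the orthogonality of the Hoeffding
  decomposition shows that the centred count is, up to a negligible L2 error, a multiple of
  the sum Y d n of B P - t over d-sets P, where d is the first non-degenerate order. Outside the regular case d = 1
  and Y is a sum of iid terms, so the classical CLT applies. In the regular case d = 2. Given the types, the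
  edge variables in Y are independent and contribute an independent Gaussian; what remains is the
  quadratic form of the kernel V - t in the types. Its spectral expansion reduces it to finite
  rank, where a Lindeberg exchange replaces the eigenfunctions by Gaussians, and all limits are
  identified through characteristic functions.\<close>

text \<open>The conditional expectations of a clique indicator given one and two vertices are the
  degree \<open>t1\<close> and an edge indicator times \<open>h2\<close>; both limits come from
  these two functions. The factor 1/(r-d)! is the limit of the number of r-sets through a fixed
  d-set over n^(r-d), and the 1/2 before the weighted squares reflects that each unordered pair
  counts once. In the regular case the obstacle is that edge noise and type fluctuation live on the
  same scale n, while the variance of the noise depends on the types. A law of large numbers makes
  this conditional variance deterministic, so the noise leaves only a constant Gaussian factor in
  the characteristic function; this is where the independence of Z comes from. The eigenvalue t_r
  loses one multiplicity because regularity makes the constant 1 an eigenfunction of V, and V - t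
  kills exactly this direction. As \<open>lam\<close> is known only through multiplicities, matching
  eigenfunctions have to be chosen; their expansion is complete because any eigenvalue left in a
  residual kernel must occur later in \<open>lam\<close>.\<close>

abbreviation stdn :: "real measure" where "stdn \<equiv> std_normal_distribution"

section \<open>Spectral theory of bounded symmetric kernels\<close>

text \<open>The integral of (B f - C g)^2 equals B (A B - C^2) and is nonnegative. Dividing by B
  needs B > 0; if B = 0 then g vanishes almost everywhere, which forces C = 0.\<close>

lemma Cauchy_Schwarz_integral:
  fixes f g :: "'a => real" and N :: "'a measure"
  assumes f: "integrable N (\<lambda>x. (f x)^2)" and g: "integrable N (\<lambda>x. (g x)^2)"
    and fg: "integrable N (\<lambda>x. f x * g x)" and gm: "g \<in> borel_measurable N"
  shows "(LINT x|N. f x * g x)^2 \<le> (LINT x|N. (f x)^2) * (LINT x|N. (g x)^2)"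
proof -
  define A B C :: real where "A = (LINT x|N. (f x)^2)" and "B = (LINT x|N. (g x)^2)" and "C = (LINT x|N. f x * g x)"
  have "(LINT x|N. (B * f x - C * g x)^2) = (LINT x|N. B^2 * (f x)^2 - 2 * B * C * (f x * g x) + C^2 * (g x)^2)"
    by (intro Bochner_Integration.integral_cong) (auto simp: power2_eq_square algebra_simps)
  also have "\<dots> = B^2 * A - 2 * B * C * C + C^2 * B"
    using f g fg by (simp add: A_def B_def C_def)
  finally have eq: "(LINT x|N. (B * f x - C * g x)^2) = B^2 * A - 2 * B * C * C + C^2 * B" .
  have *: "B * (A * B - C\<^sup>2) \<ge> 0"
  proof -
    have "0 \<le> (LINT x|N. (B * f x - C * g x)^2)" by simp
    also have "\<dots> = B^2 * A - 2 * B * C * C + C^2 * B" by (rule eq)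
    finally show ?thesis by (simp add: power2_eq_square algebra_simps)
  qed
  have B0: "B \<ge> 0" unfolding B_def by (auto intro: integral_nonneg_AE)
  show ?thesis
  proof (cases "B = 0")
    case True
    have "AE x in N. (g x)^2 = 0"
      using True g integral_nonneg_eq_0_iff_AE[of N "\<lambda>x. (g x)^2"] by (auto simp: B_def)
    then have "AE x in N. f x * g x = 0" by eventually_elim auto
    then have "C = 0" unfolding C_def using integral_cong_AE[of "\<lambda>x. f x * g x" N "\<lambda>x. 0"] fg by auto
    then show ?thesis using True by (simp add: A_def B_def C_def)
  next
    case False
    then have "A * B - C\<^sup>2 \<ge> 0" using * B0 by (metis less_eq_real_def zero_le_mult_iff not_less)
    then show ?thesis by (simp add: A_def B_def C_def)
  qed
qed

lemma abs_mult_le_bounds: "\<bar>a\<bar> \<le> A ==> \<bar>b\<bar> \<le> B ==> \<bar>a * b\<bar> \<le> \<bar>A\<bar> * \<bar>B\<bar>" for a b A B :: real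
  unfolding abs_mult by (intro mult_mono) auto

text \<open>With \<open>space M = UNIV\<close>, bounds, sections and eigenvalue equations can be
  asked for at every point, free of membership conditions. The uniform law on [0,1], as a measure on
  the whole line, is of this kind, and so are products of such spaces.\<close>

locale kernel_space = prob_space M for M :: "'a measure" +
  assumes space_UNIV[simp]: "space M = UNIV"
begin

text \<open>The bound holds everywhere rather than almost everywhere, so the class is stable under
  sums, products and partial integrals, and integrability is automatic on a probability
  space.\<close>

definition bm1 :: "('a => real) => bool" where
  "bm1 f \<longleftrightarrow> f \<in> borel_measurable M \<and> (\<exists>B. \<forall>x. \<bar>f x\<bar> \<le> B)"

definition bm2 :: "('a => 'a => real) => bool" where
  "bm2 R \<longleftrightarrow> (\<lambda>(x, y). R x y) \<in> borel_measurable (M \<Otimes>\<^sub>M M) \<and> (\<exists>B. \<forall>x y. \<bar>R x y\<bar> \<le> B)"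

sublocale PP: pair_prob_space M M ..

lemma prob_UNIV[simp]: "prob UNIV = 1" using prob_space by simp

lemma bm1_integrable: "bm1 f ==> integrable M f"
  unfolding bm1_def using integrable_const_bound[of f] by auto

lemma bm1_measurable: "bm1 f ==> f \<in> borel_measurable M"
  unfolding bm1_def by auto

lemma bm2_measurable: "bm2 R ==> (\<lambda>(x, y). R x y) \<in> borel_measurable (M \<Otimes>\<^sub>M M)"
  unfolding bm2_def by auto

lemma bm2_measurable': "bm2 R ==> f \<in> measurable N M ==> g \<in> measurable N M
    ==> (\<lambda>x. R (f x) (g x)) \<in> borel_measurable N"
  using measurable_compose[OF measurable_Pair[of f N M g M] bm2_measurable, of R] by simp

lemma bm1_const[intro]: "bm1 (\<lambda>x. c)" by (auto simp: bm1_def)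

lemma bm1_mult[intro]: "bm1 f ==> bm1 g ==> bm1 (\<lambda>x. f x * g x)"
proof -
  assume "bm1 f" "bm1 g"
  then obtain A B where "\<And>x. \<bar>f x\<bar> \<le> A" "\<And>x. \<bar>g x\<bar> \<le> B" by (auto simp: bm1_def)
  then have "\<bar>f x * g x\<bar> \<le> \<bar>A\<bar> * \<bar>B\<bar>" for x
    by (intro abs_mult_le_bounds) auto
  then show ?thesis using \<open>bm1 f\<close> \<open>bm1 g\<close> by (auto simp: bm1_def)
qed

lemma bm1_power2[intro]: "bm1 f ==> bm1 (\<lambda>x. (f x)^2)"
  unfolding power2_eq_square by (rule bm1_mult)

lemma bm1_add[intro]: "bm1 f ==> bm1 g ==> bm1 (\<lambda>x. f x + g x)"
proof -
  assume "bm1 f" "bm1 g"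
  then obtain A B where "\<And>x. \<bar>f x\<bar> \<le> A" "\<And>x. \<bar>g x\<bar> \<le> B" by (auto simp: bm1_def)
  then have "\<bar>f x + g x\<bar> \<le> A + B" for x by (intro order_trans[OF abs_triangle_ineq] add_mono)
  then show ?thesis using \<open>bm1 f\<close> \<open>bm1 g\<close> by (auto simp: bm1_def)
qed

lemma bm1_diff[intro]: "bm1 f ==> bm1 g ==> bm1 (\<lambda>x. f x - g x)"
  using bm1_add[of f "\<lambda>x. (-1) * g x"] bm1_mult[of "\<lambda>x. -1" g] by auto

lemma bm1_sum[intro]: "(\<And>k. k \<in> I ==> bm1 (f k)) ==> bm1 (\<lambda>x. \<Sum>k\<in>I. f k x)"
  by (induction I rule: infinite_finite_induct) auto

lemma bm2_mult[intro]: "bm2 f ==> bm2 g ==> bm2 (\<lambda>x y. f x y * g x y)"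
proof -
  assume f: "bm2 f" and g: "bm2 g"
  then obtain A B where "\<And>x y. \<bar>f x y\<bar> \<le> A" "\<And>x y. \<bar>g x y\<bar> \<le> B" by (auto simp: bm2_def)
  then have *: "\<bar>f x y * g x y\<bar> \<le> \<bar>A\<bar> * \<bar>B\<bar>" for x y
    by (intro abs_mult_le_bounds) auto
  have [measurable]: "(\<lambda>(x, y). f x y) \<in> borel_measurable (M \<Otimes>\<^sub>M M)" "(\<lambda>(x, y). g x y) \<in> borel_measurable (M \<Otimes>\<^sub>M M)"
    using f g by (auto simp: bm2_def)
  show ?thesis using * unfolding bm2_def by (auto simp: split_beta')
qed

lemma bm2_const[intro]: "bm2 (\<lambda>x y. c)" by (auto simp: bm2_def)

lemma bm2_power2[intro]: "bm2 f ==> bm2 (\<lambda>x y. (f x y)^2)"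
  unfolding power2_eq_square by (rule bm2_mult)

lemma bm2_add[intro]: "bm2 f ==> bm2 g ==> bm2 (\<lambda>x y. f x y + g x y)"
proof -
  assume f: "bm2 f" and g: "bm2 g"
  then obtain A B where "\<And>x y. \<bar>f x y\<bar> \<le> A" "\<And>x y. \<bar>g x y\<bar> \<le> B" by (auto simp: bm2_def)
  then have *: "\<bar>f x y + g x y\<bar> \<le> A + B" for x y by (intro order_trans[OF abs_triangle_ineq] add_mono)
  have [measurable]: "(\<lambda>(x, y). f x y) \<in> borel_measurable (M \<Otimes>\<^sub>M M)" "(\<lambda>(x, y). g x y) \<in> borel_measurable (M \<Otimes>\<^sub>M M)"
    using f g by (auto simp: bm2_def)
  show ?thesis using * unfolding bm2_def by (auto simp: split_beta')
qed

lemma bm2_diff[intro]: "bm2 f ==> bm2 g ==> bm2 (\<lambda>x y. f x y - g x y)"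
  using bm2_add[of f "\<lambda>x y. (-1) * g x y"] bm2_mult[of "\<lambda>x y. -1" g] by auto

lemma bm2_sum[intro]: "(\<And>k. k \<in> I ==> bm2 (f k)) ==> bm2 (\<lambda>x y. \<Sum>k\<in>I. f k x y)"
  by (induction I rule: infinite_finite_induct) auto

lemma bm2_fst[intro]: "bm1 f ==> bm2 (\<lambda>x y. f x)"
  by (auto simp: bm1_def bm2_def split_beta')

lemma bm2_snd[intro]: "bm1 f ==> bm2 (\<lambda>x y. f y)"
  by (auto simp: bm1_def bm2_def split_beta')

lemma bm2_sec1: "bm2 R ==> bm1 (R x)"
proof -
  assume R: "bm2 R"
  have "R x \<in> borel_measurable M" using measurable_Pair2[OF bm2_measurable[OF R], of x] by simp
  then show ?thesis using R unfolding bm1_def bm2_def by blast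
qed

lemma bm2_sec2: "bm2 R ==> bm1 (\<lambda>x. R x y)"
proof -
  assume R: "bm2 R"
  have "(\<lambda>x. R x y) \<in> borel_measurable M" using measurable_Pair1[OF bm2_measurable[OF R], of y] by simp
  then show ?thesis using R unfolding bm1_def bm2_def by blast
qed

lemma bm2_flip: "bm2 R ==> bm2 (\<lambda>x y. R y x)"
proof -
  assume R: "bm2 R"
  have "(\<lambda>(x, y). R y x) \<in> borel_measurable (M \<Otimes>\<^sub>M M)"
    unfolding split_beta' by (rule bm2_measurable'[OF R measurable_snd measurable_fst])
  then show ?thesis using R unfolding bm2_def by blast
qed

lemma abs_integral_le_bound:
  fixes f :: "'a => real"
  assumes "\<And>x. \<bar>f x\<bar> \<le> B" shows "\<bar>(LINT x|M. f x)\<bar> \<le> B"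
proof (cases "integrable M f")
  case True
  have "\<bar>(LINT x|M. f x)\<bar> \<le> (LINT x|M. \<bar>f x\<bar>)" using integral_norm_bound[of M f] by simp
  also have "\<dots> \<le> (LINT x|M. B)" using True assms by (intro integral_mono) auto
  finally show ?thesis by (simp add: prob_space)
next
  case False then show ?thesis using assms order_trans[OF abs_ge_zero assms] by (auto simp: not_integrable_integral_eq)
qed

lemma bm2_int[intro]: "bm2 R ==> bm1 (\<lambda>x. (LINT y|M. R x y))"
proof -
  assume R: "bm2 R"
  then obtain B where B: "\<And>x y. \<bar>R x y\<bar> \<le> B" by (auto simp: bm2_def)
  have "(\<lambda>x. (LINT y|M. R x y)) \<in> borel_measurable M"
    using bm2_measurable[OF R] by (rule borel_measurable_lebesgue_integral)
  then show ?thesis using abs_integral_le_bound[of "R _", OF B] by (auto simp: bm1_def)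
qed

lemma bm2_int'[intro]: "bm2 R ==> bm1 (\<lambda>y. (LINT x|M. R x y))"
  using bm2_int[OF bm2_flip] .

lemma bm2_comp[intro]: "bm2 R ==> bm2 S ==> bm2 (\<lambda>x y. (LINT z|M. R x z * S z y))"
proof -
  assume R: "bm2 R" and S: "bm2 S"
  then obtain A B where A: "\<And>x y. \<bar>R x y\<bar> \<le> A" and B: "\<And>x y. \<bar>S x y\<bar> \<le> B" by (auto simp: bm2_def)
  have *: "\<bar>R x z * S z y\<bar> \<le> \<bar>A\<bar> * \<bar>B\<bar>" for x y z
    using abs_mult_le_bounds[OF A B] .
  have m: "(\<lambda>(p, z). R (fst p) z * S z (snd p)) \<in> borel_measurable ((M \<Otimes>\<^sub>M M) \<Otimes>\<^sub>M M)"
    unfolding split_beta' by (intro borel_measurable_times bm2_measurable'[OF R] bm2_measurable'[OF S]) auto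
  have "(\<lambda>p. (LINT z|M. R (fst p) z * S z (snd p))) \<in> borel_measurable (M \<Otimes>\<^sub>M M)"
    using m by (rule borel_measurable_lebesgue_integral)
  then show ?thesis using abs_integral_le_bound[of "\<lambda>z. R _ z * S z _", OF *] unfolding bm2_def split_beta' by blast
qed

lemma bm2_integrable: "bm2 R ==> integrable (M \<Otimes>\<^sub>M M) (\<lambda>(x, y). R x y)"
proof -
  assume R: "bm2 R"
  then obtain B where "\<And>x y. \<bar>R x y\<bar> \<le> B" by (auto simp: bm2_def)
  then show ?thesis using bm2_measurable[OF R] by (intro PP.integrable_const_bound[where B=B] AE_I2) auto
qed

lemma bm2_fubini: "bm2 R ==> (LINT x|M. (LINT y|M. R x y)) = (LINT y|M. (LINT x|M. R x y))"
  by (rule PP.Fubini_integral[OF bm2_integrable, symmetric])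

lemma bm2_pair: "bm2 R ==> (LINT p|(M \<Otimes>\<^sub>M M). R (fst p) (snd p)) = (LINT x|M. (LINT y|M. R x y))"
  using PP.integral_fst'[OF bm2_integrable, of R] unfolding split_beta' by simp

text \<open>The Hilbert-Schmidt inner product, kept as an iterated integral so that sections and
  Fubini apply directly.\<close>

definition ip2 :: "('a => 'a => real) => ('a => 'a => real) => real" where
  "ip2 R S = (LINT x|M. (LINT y|M. R x y * S x y))"

lemma CS1: "bm1 f ==> bm1 g ==> (LINT x|M. f x * g x)^2 \<le> (LINT x|M. (f x)^2) * (LINT x|M. (g x)^2)"
  by (intro Cauchy_Schwarz_integral bm1_integrable) (auto simp: bm1_measurable)

lemma CS2: "bm2 R ==> bm2 S ==> (ip2 R S)^2 \<le> ip2 R R * ip2 S S"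
proof -
  assume R: "bm2 R" and S: "bm2 S"
  have "(LINT p|(M \<Otimes>\<^sub>M M). R (fst p) (snd p) * S (fst p) (snd p))^2
     \<le> (LINT p|(M \<Otimes>\<^sub>M M). (R (fst p) (snd p))^2) * (LINT p|(M \<Otimes>\<^sub>M M). (S (fst p) (snd p))^2)"
    using bm2_integrable[OF bm2_mult[OF R S]] bm2_integrable[OF bm2_power2[OF R]]
       bm2_integrable[OF bm2_power2[OF S]] bm2_measurable[OF S]
    by (intro Cauchy_Schwarz_integral) (auto simp: split_beta')
  then show ?thesis
    unfolding ip2_def power2_eq_square
    using bm2_pair[OF bm2_mult[OF R S]] bm2_pair[OF bm2_mult[OF R R]] bm2_pair[OF bm2_mult[OF S S]]
    by (simp add: power2_eq_square)
qed

lemma ip2_nonneg: "ip2 R R \<ge> 0"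
  unfolding ip2_def by (intro integral_nonneg_AE AE_I2) auto

lemma ip2_add_left: "bm2 R ==> bm2 S ==> bm2 T ==> ip2 (\<lambda>x y. R x y + S x y) T = ip2 R T + ip2 S T"
proof -
  assume b: "bm2 R" "bm2 S" "bm2 T"
  have "ip2 (\<lambda>x y. R x y + S x y) T = (LINT x|M. (LINT y|M. R x y * T x y) + (LINT y|M. S x y * T x y))"
    unfolding ip2_def distrib_right using b
    by (intro Bochner_Integration.integral_cong refl Bochner_Integration.integral_add bm1_integrable
        bm2_sec1[OF bm2_mult[OF b(1,3)]] bm2_sec1[OF bm2_mult[OF b(2,3)]])
  also have "\<dots> = ip2 R T + ip2 S T"
    unfolding ip2_def using b
    by (intro Bochner_Integration.integral_add bm1_integrable bm2_int bm2_mult)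
  finally show ?thesis .
qed

lemma ip2_scale_left: "ip2 (\<lambda>x y. c * R x y) T = c * ip2 R T"
  unfolding ip2_def by (simp add: mult.assoc)

lemma ip2_commute: "ip2 R S = ip2 S R"
  unfolding ip2_def by (simp add: mult.commute)

lemma ip2_scale_right: "ip2 T (\<lambda>x y. c * R x y) = c * ip2 T R"
  by (simp add: ip2_commute[of T] ip2_scale_left)

lemma ip2_diff_left: "bm2 R ==> bm2 S ==> bm2 T ==> ip2 (\<lambda>x y. R x y - S x y) T = ip2 R T - ip2 S T"
  using ip2_add_left[of R "\<lambda>x y. (-1) * S x y" T] ip2_scale_left[of "-1" S T]
    bm2_mult[OF bm2_const[of "-1"], of S] by simp

lemma ip2_diff_right: "bm2 R ==> bm2 S ==> bm2 T ==> ip2 T (\<lambda>x y. R x y - S x y) = ip2 T R - ip2 T S"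
  by (simp add: ip2_commute[of T] ip2_diff_left)

lemma ip2_sum_left: "(\<And>k. k \<in> I ==> bm2 (R k)) ==> bm2 T ==>
    ip2 (\<lambda>x y. \<Sum>k\<in>I. R k x y) T = (\<Sum>k\<in>I. ip2 (R k) T)"
proof (induction I rule: infinite_finite_induct)
  case (insert k I)
  have 1: "bm2 (R k)" using insert.prems(1)[of k] by simp
  have 2: "bm2 (\<lambda>x y. \<Sum>k\<in>I. R k x y)" by (rule bm2_sum) (simp add: insert.prems(1))
  have 3: "ip2 (\<lambda>x y. \<Sum>k\<in>I. R k x y) T = (\<Sum>k\<in>I. ip2 (R k) T)"
    by (rule insert.IH) (simp_all add: insert.prems)
  show ?case using ip2_add_left[OF 1 2 insert.prems(2)] 3 insert.hyps by simp
qed (auto simp: ip2_def)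

text \<open>The kernel of the (n+1)-st power of the integral operator. Normalised even iterates converge in L2 to an
  eigenprojection for the largest squared eigenvalue, which yields eigenfunctions without compactness arguments.\<close>

primrec It :: "('a => 'a => real) => nat => 'a => 'a => real" where
  "It R 0 x y = R x y"
| "It R (Suc n) x y = (LINT z|M. R x z * It R n z y)"

lemma It_0: "It R 0 = R" by (intro ext) simp
lemma It_Suc: "It R (Suc n) = (\<lambda>x y. (LINT z|M. R x z * It R n z y))" by (intro ext) simp

lemma bm2_It: "bm2 R ==> bm2 (It R n)"
proof (induction n)
  case 0 then show ?case by (simp add: It_0)
next
  case (Suc n) then show ?case unfolding It_Suc by (intro bm2_comp) auto
qed

text \<open>Associativity of composition, by Fubini. Since \<open>It R n\<close> belongs to the
  power n+1, the indices n and m combine to n+m+1.\<close>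

lemma It_comp: "bm2 R ==> It R (n + m + 1) x y = (LINT z|M. It R n x z * It R m z y)"
proof (induction n arbitrary: x)
  case (Suc n)
  note R = Suc.prems
  have b: "bm2 (It R n)" "bm2 (It R m)" by (rule bm2_It[OF R])+
  have "It R (Suc n + m + 1) x y = (LINT z|M. R x z * (LINT w|M. It R n z w * It R m w y))"
    using Suc by simp
  also have "\<dots> = (LINT z|M. (LINT w|M. R x z * It R n z w * It R m w y))"
    by (simp add: mult.assoc)
  also have "\<dots> = (LINT w|M. (LINT z|M. R x z * It R n z w * It R m w y))"
    by (intro bm2_fubini bm2_mult bm2_fst[OF bm2_sec1[OF R]] b bm2_snd[OF bm2_sec2[OF b(2)]])
  also have "\<dots> = (LINT w|M. It R (Suc n) x w * It R m w y)" by simp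
  finally show ?case .
qed simp

context
  fixes R :: "'a => 'a => real"
  assumes R: "bm2 R" and sym: "\<And>x y. R x y = R y x"
begin

lemma It_sym: "It R n x y = It R n y x"
proof (induction n arbitrary: x y)
  case 0 show ?case by (simp add: sym)
next
  case (Suc n)
  have "It R (Suc n) y x = It R (n + 0 + 1) y x" by simp
  also have "\<dots> = (LINT z|M. It R n y z * R z x)" by (subst It_comp[OF R]) simp
  also have "\<dots> = It R (Suc n) x y" by (simp add: Suc[of y] sym[of x] mult.commute)
  finally show ?case ..
qed

lemma ip2_It: "ip2 (It R n) (It R m) = (LINT x|M. It R (n + m + 1) x x)"
proof -
  have "It R n x y * It R m x y = It R n x y * It R m y x" for x y by (simp only: It_sym[of m x y])
  then show ?thesis unfolding ip2_def It_comp[OF R] by (intro Bochner_Integration.integral_cong refl)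
qed

text \<open>In spectral terms this is the sum of the powers 2k+2 of the eigenvalues.\<close>

definition "nrm k = ip2 (It R k) (It R k)"

text \<open>By symmetry the inner product is a trace that depends on n+m alone. All later norm
  computations use this freedom to redistribute exponents.\<close>

lemma ip2_It_even: "n + m = 2 * k ==> ip2 (It R n) (It R m) = nrm k"
proof -
  assume "n + m = 2 * k"
  then have "n + m + 1 = k + k + 1" by simp
  then show ?thesis unfolding nrm_def ip2_It by simp
qed

lemma nrm_nonneg: "nrm k \<ge> 0" unfolding nrm_def by (rule ip2_nonneg)

text \<open>Cauchy-Schwarz for the iterates k and k+2, whose inner product is again
  \<open>nrm (Suc k)\<close>.\<close>

lemma nrm_logconvex: "(nrm (Suc k))^2 \<le> nrm k * nrm (Suc (Suc k))"
proof -
  have "ip2 (It R k) (It R (Suc (Suc k))) = nrm (Suc k)" by (rule ip2_It_even) simp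
  then show ?thesis using CS2[OF bm2_It[OF R] bm2_It[OF R], of k "Suc (Suc k)"]
    unfolding nrm_def[symmetric] by metis
qed

text \<open>Cauchy-Schwarz under the composition integral, at each pair of points: the
  Hilbert-Schmidt norm is submultiplicative.\<close>

lemma nrm_submult: "nrm (n + m + 1) \<le> nrm n * nrm m"
proof -
  have b: "bm2 (It R n)" "bm2 (It R m)" by (rule bm2_It[OF R])+
  have "nrm (n + m + 1) = (LINT x|M. (LINT y|M. (LINT z|M. It R n x z * It R m z y)^2))"
    unfolding nrm_def ip2_def It_comp[OF R] power2_eq_square ..
  also have "\<dots> \<le> (LINT x|M. (LINT y|M. (LINT z|M. (It R n x z)^2) * (LINT z|M. (It R m z y)^2)))"
  proof -
    have c: "bm2 (\<lambda>x y. (LINT z|M. It R n x z * It R m z y)^2)" by (rule bm2_power2[OF bm2_comp[OF b]])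
    have d: "bm2 (\<lambda>x y. (LINT z|M. (It R n x z)^2) * (LINT z|M. (It R m z y)^2))"
      by (rule bm2_mult[OF bm2_fst[OF bm2_int[OF bm2_power2[OF b(1)]]] bm2_snd[OF bm2_int'[OF bm2_power2[OF b(2)]]]])
    show ?thesis
      by (intro integral_mono bm1_integrable bm2_int[OF c] bm2_int[OF d] bm2_sec1[OF c] bm2_sec1[OF d]
          CS1 bm2_sec1[OF b(1)] bm2_sec2[OF b(2)])
  qed
  also have "\<dots> = nrm n * nrm m"
    unfolding nrm_def ip2_def bm2_fubini[OF bm2_mult[OF b(2) b(2)]] by (simp add: power2_eq_square)
  finally show ?thesis .
qed

end
end

text \<open>Log-convexity makes the successive ratios increase, submultiplicativity bounds them by a
  0, and \<rho> is their limit. For a = \<open>nrm R\<close> it is the largest squared eigenvalue.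
  The lower bound on a k is the limit in m of a (m+k+1) / a m, which never exceeds a k.\<close>

lemma logconvex_submult_growth:
  fixes a :: "nat => real"
  assumes pos: "\<And>k. a k > 0" and lc: "\<And>k. (a (Suc k))^2 \<le> a k * a (Suc (Suc k))"
    and sm: "\<And>n m. a (n + m + 1) \<le> a n * a m"
  shows "\<exists>\<rho>. \<rho> \<ge> a 1 / a 0 \<and> (\<forall>k. a (Suc k) \<le> \<rho> * a k) \<and> (\<forall>k. a k \<ge> \<rho> ^ Suc k)"
proof -
  define q where "q k = a (Suc k) / a k" for k
  have inc: "incseq q"
  proof (rule incseq_SucI)
    fix k show "q k \<le> q (Suc k)"
      using lc[of k] pos[of k] pos[of "Suc k"] by (simp add: q_def field_simps power2_eq_square)
  qed
  have bd: "q k \<le> a 0" for k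
    using sm[of k 0] pos[of k] by (simp add: q_def field_simps)
  obtain \<rho> where lim: "q \<longlonglongrightarrow> \<rho>" and le: "\<And>k. q k \<le> \<rho>"
    using incseq_convergent[OF inc, of "a 0"] bd by auto
  \<comment> \<open>The quotient is a product of j consecutive ratios, each tending to
    \<rho>.\<close>
  have lim2: "(\<lambda>m. a (m + j) / a m) \<longlonglongrightarrow> \<rho> ^ j" for j
  proof (induction j)
    case 0 have "a m / a m = 1" for m using pos[of m] by simp
    then show ?case by simp
  next
    case (Suc j)
    have "(\<lambda>m. q (m + j) * (a (m + j) / a m)) \<longlonglongrightarrow> \<rho> * \<rho> ^ j"
      by (intro tendsto_mult Suc LIMSEQ_ignore_initial_segment lim)
    moreover have "(\<lambda>m. q (m + j) * (a (m + j) / a m)) = (\<lambda>m. a (m + Suc j) / a m)"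
      using pos[of "_ + j"] by (auto simp: q_def fun_eq_iff less_le)
    ultimately show ?case by simp
  qed
  have "a k \<ge> \<rho> ^ Suc k" for k
  proof (rule LIMSEQ_le_const2[OF lim2])
    have "a (m + Suc k) / a m \<le> a k" for m
      using sm[of k m] pos[of m] by (simp add: field_simps)
    then show "\<exists>N. \<forall>m\<ge>N. a (m + Suc k) / a m \<le> a k" by blast
  qed
  moreover have "a (Suc k) \<le> \<rho> * a k" for k
    using le[of k] pos[of k] by (simp add: q_def field_simps)
  moreover have "\<rho> \<ge> a 1 / a 0" using le[of 0] by (simp add: q_def)
  ultimately show ?thesis by blast
qed

section \<open>Existence of an eigenfunction for a symmetric kernel\<close>

context kernel_space begin

abbreviation kop :: "('a => 'a => real) => ('a => real) => 'a => real" where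
  "kop R f x \<equiv> (LINT y|M. R x y * f y)"

lemma bm1_kop: "bm2 R ==> bm1 f ==> bm1 (kop R f)"
  by (rule bm2_int[OF bm2_mult[OF _ bm2_snd]])

lemma kop_It1: "bm2 R ==> bm1 f ==> kop (It R 1) f x = kop R (kop R f) x"
proof -
  assume R: "bm2 R" and f: "bm1 f"
  have "kop (It R 1) f x = (LINT y|M. (LINT z|M. R x z * R z y * f y))" by simp
  also have "\<dots> = (LINT z|M. (LINT y|M. R x z * R z y * f y))"
    by (rule bm2_fubini[symmetric, OF bm2_mult[OF bm2_mult[OF bm2_fst[OF bm2_sec1[OF R]] R] bm2_snd[OF f]]])
  also have "\<dots> = kop R (kop R f) x" by (simp add: mult.assoc)
  finally show ?thesis .
qed

lemma kop_sym: "bm2 R ==> (\<And>x y. R x y = R y x) ==> bm1 f ==> bm1 g ==>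
   (LINT x|M. kop R f x * g x) = (LINT x|M. f x * kop R g x)"
proof -
  assume R: "bm2 R" and sym: "\<And>x y. R x y = R y x" and f: "bm1 f" and g: "bm1 g"
  have "(LINT x|M. kop R f x * g x) = (LINT x|M. (LINT y|M. R x y * f y * g x))" by simp
  also have "\<dots> = (LINT y|M. (LINT x|M. R x y * f y * g x))"
    by (rule bm2_fubini[OF bm2_mult[OF bm2_mult[OF R bm2_snd[OF f]] bm2_fst[OF g]]])
  also have "\<dots> = (LINT y|M. (LINT x|M. f y * (R y x * g x)))"
    by (intro Bochner_Integration.integral_cong refl) (simp add: sym[of _ y for y] ac_simps)
  also have "\<dots> = (LINT x|M. f x * kop R g x)" by simp
  finally show ?thesis .
qed

context
  fixes R :: "'a => 'a => real"
  assumes R: "bm2 R" and sym: "\<And>x y. R x y = R y x"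
begin

text \<open>Since the squared norm of R g is the form of R^2 at g, a second Cauchy-Schwarz bounds it
  by the Hilbert-Schmidt norm of R^2; hence the fourth power. The bound is by \<open>nrm R 1\<close>
  because for the residual kernels below it is this quantity that eigenvalue estimates control,
  whereas convergence of \<open>nrm R 0\<close> is the goal itself.\<close>

lemma kop_form_bound:
  assumes f: "bm1 f" and g: "bm1 g"
  shows "(LINT x|M. f x * kop R g x) ^ 4 \<le> (LINT x|M. (f x)^2)^2 * (LINT x|M. (g x)^2)^2 * nrm R 1"
proof -
  define F G where "F = (LINT x|M. (f x)^2)" and "G = (LINT x|M. (g x)^2)"
  have G0: "G \<ge> 0" and F0: "F \<ge> 0" unfolding G_def F_def by auto
  have Tg: "bm1 (kop R g)" by (rule bm1_kop[OF R g])
  have I: "bm2 (It R 1)" by (rule bm2_It[OF R])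
  have Ig: "bm1 (kop (It R 1) g)" by (rule bm1_kop[OF I g])
  have 1: "(LINT x|M. f x * kop R g x)^2 \<le> F * (LINT x|M. (kop R g x)^2)"
    unfolding F_def by (rule CS1[OF f Tg])
  have "(LINT x|M. (kop R g x)^2) = (LINT x|M. g x * kop R (kop R g) x)"
    unfolding power2_eq_square by (rule kop_sym[OF R sym g Tg])
  also have "\<dots> = (LINT x|M. g x * kop (It R 1) g x)" using kop_It1[OF R g] by simp
  finally have "(LINT x|M. (kop R g x)^2)^2 = (LINT x|M. g x * kop (It R 1) g x)^2" by simp
  also have "\<dots> \<le> G * (LINT x|M. (kop (It R 1) g x)^2)"
    unfolding G_def by (rule CS1[OF g Ig])
  also have "(LINT x|M. (kop (It R 1) g x)^2) \<le> (LINT x|M. (LINT z|M. (It R 1 x z)^2) * G)"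
    unfolding G_def
    by (intro integral_mono CS1[OF bm2_sec1[OF I] g] bm1_integrable[OF bm1_power2[OF Ig]]
        bm1_integrable[OF bm1_mult[OF bm2_int[OF bm2_power2[OF I]] bm1_const]])
  also have "\<dots> = nrm R 1 * G" by (simp add: nrm_def[OF R sym] ip2_def power2_eq_square del: It.simps)
  finally have 2: "(LINT x|M. (kop R g x)^2)^2 \<le> G * (nrm R 1 * G)" using G0 by (simp add: mult_left_mono)
  have "(LINT x|M. f x * kop R g x) ^ 4 = ((LINT x|M. f x * kop R g x)^2)^2" by simp
  also have "\<dots> \<le> (F * (LINT x|M. (kop R g x)^2))^2" using 1 by (intro power_mono) auto
  also have "\<dots> = F^2 * (LINT x|M. (kop R g x)^2)^2" by (simp add: power_mult_distrib)
  also have "\<dots> \<le> F^2 * (G * (nrm R 1 * G))" using 2 by (intro mult_left_mono) auto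
  finally show ?thesis by (simp add: F_def G_def power2_eq_square ac_simps)
qed

text \<open>With m^2 = \<rho>, the functions R \<phi> + m \<phi> and R \<phi> - m \<phi> satisfy the
  eigenvalue equation for m and -m. They cannot both be null, because their difference is 2 m
  \<phi>.\<close>

lemma eigenfunction_of_square:
  assumes \<phi>: "bm1 \<phi>" and pos: "(LINT x|M. (\<phi> x)^2) > 0" and \<rho>: "\<rho> > 0"
    and eig: "\<And>x. kop R (kop R \<phi>) x = \<rho> * \<phi> x"
  shows "\<exists>\<mu> \<psi>. \<mu>^2 = \<rho> \<and> bm1 \<psi> \<and> (LINT x|M. (\<psi> x)^2) > 0 \<and> (\<forall>x. kop R \<psi> x = \<mu> * \<psi> x)"
proof -
  define m where "m = sqrt \<rho>"
  have m: "m^2 = \<rho>" "m > 0" using \<rho> by (auto simp: m_def)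
  define p where "p s x = kop R \<phi> x + s * \<phi> x" for s x
  have T: "bm1 (kop R \<phi>)" by (rule bm1_kop[OF R \<phi>])
  have bp: "bm1 (p s)" for s unfolding p_def by (rule bm1_add[OF T bm1_mult[OF bm1_const \<phi>]])
  have e: "kop R (p s) x = s * p s x" if "s^2 = \<rho>" for s x
  proof -
    have "kop R (p s) x = (LINT y|M. R x y * kop R \<phi> y + s * (R x y * \<phi> y))"
      unfolding p_def by (simp add: algebra_simps)
    also have "\<dots> = kop R (kop R \<phi>) x + s * kop R \<phi> x"
      by (subst Bochner_Integration.integral_add)
         (use bm1_integrable[OF bm1_mult[OF bm2_sec1[OF R] T]] bm1_integrable[OF bm1_mult[OF bm2_sec1[OF R] \<phi>]] in simp_all)
    also have "\<dots> = s * p s x" using that eig[of x] by (simp add: p_def algebra_simps power2_eq_square)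
    finally show ?thesis .
  qed
  have "(LINT x|M. (p m x)^2) > 0 \<or> (LINT x|M. (p (-m) x)^2) > 0"
  proof (rule ccontr)
    assume neg: "\<not> ?thesis"
    have i: "integrable M (\<lambda>x. (p s x)^2)" for s by (rule bm1_integrable[OF bm1_power2[OF bp]])
    have "4 * \<rho> * (LINT x|M. (\<phi> x)^2) = (LINT x|M. 4 * \<rho> * (\<phi> x)^2)" by simp
    also have "\<dots> \<le> (LINT x|M. 2 * (p m x)^2 + 2 * (p (-m) x)^2)"
    proof (rule integral_mono)
      show "integrable M (\<lambda>x. 4 * \<rho> * (\<phi> x)^2)" using bm1_integrable[OF bm1_power2[OF \<phi>]] by simp
      show "integrable M (\<lambda>x. 2 * (p m x)^2 + 2 * (p (-m) x)^2)" using i by simp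
      fix x
      have "2 * (p m x)^2 + 2 * (p (-m) x)^2 = 4 * (kop R \<phi> x)^2 + 4 * m^2 * (\<phi> x)^2"
        unfolding p_def by (simp add: power2_eq_square algebra_simps)
      then show "4 * \<rho> * (\<phi> x)^2 \<le> 2 * (p m x)^2 + 2 * (p (-m) x)^2" using m by simp
    qed
    also have "\<dots> = 2 * (LINT x|M. (p m x)^2) + 2 * (LINT x|M. (p (-m) x)^2)" using i by simp
    also have "\<dots> \<le> 0" using neg by auto
    finally show False using pos \<rho> by (simp add: mult_le_0_iff)
  qed
  then show ?thesis
  proof
    assume "(LINT x|M. (p m x)^2) > 0" then show ?thesis using e[of m] bp[of m] m by blast
  next
    assume "(LINT x|M. (p (-m) x)^2) > 0" then show ?thesis using e[of "-m"] bp[of "-m"] m by (intro exI[of _ "-m"] exI[of _ "p (-m)"]) auto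
  qed
qed

text \<open>The inner products of the normalised iterates are values of one decreasing sequence
  \<open>d\<close>, so the iterates are Cauchy in L2. Composing with R on both sides turns this into
  convergence at every point, and each column of the limit kernel solves the eigenvalue equation of
  R^2 everywhere.\<close>

lemma iterate_kernel_limit:
  assumes pos: "nrm R 1 > 0"
  shows "\<exists>\<rho> \<phi>. \<rho> \<ge> nrm R 1 / nrm R 0 \<and> \<rho> > 0 \<and> bm1 \<phi> \<and> (LINT x|M. (\<phi> x)^2) > 0 \<and> (\<forall>x. kop R (kop R \<phi>) x = \<rho> * \<phi> x)"
proof -
  note nsub = nrm_submult[OF R sym] and nlog = nrm_logconvex[OF R sym] and nn = nrm_nonneg[OF R sym]
  have p0: "nrm R 0 > 0" using nsub[of 0 0] pos nn[of 0] by (metis One_nat_def add.commute add_0 less_eq_real_def linorder_not_less mult_zero_left plus_1_eq_Suc)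
  have p: "nrm R k > 0 \<and> nrm R (Suc k) > 0" for k
  proof (induction k)
    case (Suc k)
    then show ?case using nlog[of k] nn[of "Suc (Suc k)"]
      by (metis less_eq_real_def linorder_not_less mult_zero_right zero_less_power)
  qed (use pos p0 in simp)
  obtain \<rho> where \<rho>0: "\<rho> \<ge> nrm R 1 / nrm R 0" and r1: "\<And>k. nrm R (Suc k) \<le> \<rho> * nrm R k"
    and r2: "\<And>k. nrm R k \<ge> \<rho> ^ Suc k"
    using logconvex_submult_growth[of "nrm R"] p nlog nsub by blast
  have \<rho>: "\<rho> > 0" using \<rho>0 p0 pos by (meson divide_pos_pos less_le_trans)
  define d where "d k = nrm R k / \<rho> ^ k" for k
  have "decseq d"
  proof (rule decseq_SucI)
    fix k show "d (Suc k) \<le> d k" using r1[of k] \<rho> by (simp add: d_def field_simps)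
  qed
  have dge: "d k \<ge> \<rho>" for k using r2[of k] \<rho> by (simp add: d_def field_simps)
  obtain D where D: "d \<longlonglongrightarrow> D" and dD: "\<And>k. D \<le> d k"
    using decseq_convergent[OF \<open>decseq d\<close>, of \<rho>] dge by auto
  \<comment> \<open>The power 2n+2 over \<rho>^n: constant in n on the part of the spectrum with
    squared eigenvalue \<rho>, decaying geometrically on the rest.\<close>
  define P where "P n x y = It R (2 * n + 1) x y / \<rho> ^ n" for n x y
  have bI: "bm2 (It R n)" for n by (rule bm2_It[OF R])
  have Peq: "P n = (\<lambda>x y. (1 / \<rho> ^ n) * It R (2 * n + 1) x y)" for n unfolding P_def by (intro ext) (simp del: It.simps)
  have bP: "bm2 (P n)" for n unfolding Peq by (rule bm2_mult[OF bm2_const bI])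
  have ipP: "ip2 (P n) (P m) = \<rho> * d (n + m + 1)" for n m
  proof -
    have "ip2 (P n) (P m) = (1 / \<rho> ^ n) * ((1 / \<rho> ^ m) * nrm R (n + m + 1))"
      unfolding Peq ip2_scale_left ip2_scale_right by (subst ip2_It_even[OF R sym, of _ _ "n + m + 1"]) auto
    then show ?thesis using \<rho> by (simp add: d_def power_add field_simps)
  qed
  obtain B where B: "\<And>x y. \<bar>R x y\<bar> \<le> B" using R by (auto simp: bm2_def)
  have B0: "B \<ge> 0" using order_trans[OF abs_ge_zero B] .
  \<comment> \<open>Each P (Suc n) is R composed with P n and R, over \<rho>. As R is bounded, this
    smoothing bounds values at every point by an L2 norm.\<close>
  define S where "S F x y = (1 / \<rho>) * (LINT u|M. R x u * (LINT v|M. F u v * R v y))" for F x y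
  have PS: "P (Suc n) x y = S (P n) x y" for n x y
  proof -
    have "It R (2 * n + 2) u y = (LINT v|M. It R (2 * n + 1) u v * R v y)" for u
      using It_comp[OF R, of "2 * n + 1" 0 u y] by (simp del: It.simps(2))
    then have "It R (2 * Suc n + 1) x y = (LINT u|M. R x u * (LINT v|M. It R (2 * n + 1) u v * R v y))"
      using It.simps(2)[of R "2 * n + 2" x y] by (simp del: It.simps)
    then show ?thesis using \<rho> by (simp add: P_def S_def del: It.simps)
  qed
  have Sb: "\<bar>S F x y\<bar> \<le> (1 / \<rho>) * B^2 * sqrt (ip2 F F)" if F: "bm2 F" for F x y
  proof -
    have aF: "bm2 (\<lambda>u v. \<bar>F u v\<bar>)" using F unfolding bm2_def by (auto simp: split_beta')
    have b1: "bm1 (\<lambda>u. (LINT v|M. F u v * R v y))" by (rule bm2_int[OF bm2_mult[OF F bm2_snd[OF bm2_sec2[OF R]]]])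
    have "\<bar>(LINT u|M. R x u * (LINT v|M. F u v * R v y))\<bar> \<le> (LINT u|M. \<bar>R x u * (LINT v|M. F u v * R v y)\<bar>)"
      by (rule integral_abs_bound)
    also have "\<dots> \<le> (LINT u|M. B * (LINT v|M. \<bar>F u v\<bar> * B))"
    proof (rule integral_mono)
      show "integrable M (\<lambda>u. \<bar>R x u * (LINT v|M. F u v * R v y)\<bar>)"
        by (rule integrable_abs[OF bm1_integrable[OF bm1_mult[OF bm2_sec1[OF R] b1]]])
      show "integrable M (\<lambda>u. B * (LINT v|M. \<bar>F u v\<bar> * B))"
        by (rule bm1_integrable[OF bm1_mult[OF bm1_const bm2_int[OF bm2_mult[OF aF bm2_const]]]])
      fix u
      have "\<bar>(LINT v|M. F u v * R v y)\<bar> \<le> (LINT v|M. \<bar>F u v * R v y\<bar>)" by (rule integral_abs_bound)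
      also have "\<dots> \<le> (LINT v|M. \<bar>F u v\<bar> * B)"
        unfolding abs_mult using B
        by (intro integral_mono mult_left_mono
           bm1_integrable[OF bm1_mult[OF bm2_sec1[OF aF] bm1_const]]
           integrable_abs[OF bm1_integrable[OF bm1_mult[OF bm2_sec1[OF F] bm2_sec2[OF R]]], unfolded abs_mult]) auto
      finally show "\<bar>R x u * (LINT v|M. F u v * R v y)\<bar> \<le> B * (LINT v|M. \<bar>F u v\<bar> * B)"
        unfolding abs_mult[of "R x u"] using B0 B[of x u] by (intro mult_mono) auto
    qed
    also have "\<dots> = B^2 * ip2 (\<lambda>u v. \<bar>F u v\<bar>) (\<lambda>u v. 1)" by (simp add: ip2_def power2_eq_square)
    also have "ip2 (\<lambda>u v. \<bar>F u v\<bar>) (\<lambda>u v. 1) \<le> sqrt (ip2 F F)"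
    proof (rule real_le_rsqrt)
      show "(ip2 (\<lambda>u v. \<bar>F u v\<bar>) (\<lambda>u v. 1))^2 \<le> ip2 F F"
        using CS2[OF aF bm2_const[of 1]] by (simp add: ip2_def)
    qed
    finally have "\<bar>(LINT u|M. R x u * (LINT v|M. F u v * R v y))\<bar> \<le> B^2 * sqrt (ip2 F F)"
      by (simp add: mult_left_mono)
    then show ?thesis unfolding S_def abs_mult using \<rho> by (simp add: divide_right_mono)
  qed
  have Sdiff: "S F x y - S G x y = S (\<lambda>u v. F u v - G u v) x y" if F: "bm2 F" and G: "bm2 G" for F G x y
  proof -
    have i: "bm1 (\<lambda>v. F u v * R v y)" if "bm2 F" for F u by (rule bm1_mult[OF bm2_sec1[OF that] bm2_sec2[OF R]])
    have j: "bm1 (\<lambda>u. R x u * (LINT v|M. F u v * R v y))" if "bm2 F" for F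
      by (rule bm1_mult[OF bm2_sec1[OF R] bm2_int[OF bm2_mult[OF that bm2_snd[OF bm2_sec2[OF R]]]]])
    have "(LINT v|M. (F u v - G u v) * R v y) = (LINT v|M. F u v * R v y) - (LINT v|M. G u v * R v y)" for u
      using bm1_integrable[OF i[OF F]] bm1_integrable[OF i[OF G]] by (simp add: left_diff_distrib)
    then show ?thesis
      using bm1_integrable[OF j[OF F]] bm1_integrable[OF j[OF G]] by (simp add: S_def right_diff_distrib)
  qed
  have cau: "Cauchy (\<lambda>n. P n x y)" for x y
  proof (rule metric_CauchyI)
    fix e :: real assume e: "e > 0"
    \<comment> \<open>Chosen so that an L2 distance squared of at most 2 \<rho> \<delta> becomes
      less than e after the bound \<open>Sb\<close>. The term B^2 + 1 replaces B^2 to keep the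
      denominator positive when B = 0.\<close>
    define \<delta> where "\<delta> = (e * \<rho> / (B^2 + 1))^2 / (4 * \<rho>)"
    have "B^2 + 1 > 0" by (simp add: add_nonneg_pos)
    then have \<delta>: "\<delta> > 0" using e \<rho> by (simp add: \<delta>_def)
    obtain N where N: "\<And>n. n \<ge> N ==> \<bar>d n - D\<bar> < \<delta>" using LIMSEQ_D[OF D \<delta>] by auto
    have "dist (P (Suc n) x y) (P (Suc m) x y) < e" if "n \<ge> N" "m \<ge> N" for n m
    proof -
      define \<Delta> where "\<Delta> u v = P n u v - P m u v" for u v
      have b\<Delta>: "bm2 \<Delta>" unfolding \<Delta>_def by (rule bm2_diff[OF bP bP])
      have "ip2 \<Delta> \<Delta> = ip2 (P n) (P n) - ip2 (P n) (P m) - (ip2 (P m) (P n) - ip2 (P m) (P m))"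
        unfolding \<Delta>_def using bP bm2_diff[OF bP bP] by (simp add: ip2_diff_left ip2_diff_right)
      also have "\<dots> = \<rho> * (d (n + n + 1) + d (m + m + 1) - 2 * d (n + m + 1))"
        unfolding ipP by (simp add: algebra_simps add.commute)
      also have "\<dots> \<le> \<rho> * (2 * \<delta>)"
        using N[of "n + n + 1"] N[of "m + m + 1"] dD[of "n + m + 1"] that \<rho> by (intro mult_left_mono) auto
      also have "\<dots> < (e * \<rho> / (B^2 + 1))^2" using \<rho> e \<open>B^2 + 1 > 0\<close> by (simp add: \<delta>_def)
      finally have "sqrt (ip2 \<Delta> \<Delta>) < e * \<rho> / (B^2 + 1)"
        using e \<rho> \<open>B^2 + 1 > 0\<close> by (intro real_less_lsqrt) auto
      then have *: "(B^2 + 1) * sqrt (ip2 \<Delta> \<Delta>) < e * \<rho>" using \<open>B^2 + 1 > 0\<close> by (simp add: field_simps)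
      have "B^2 * sqrt (ip2 \<Delta> \<Delta>) \<le> (B^2 + 1) * sqrt (ip2 \<Delta> \<Delta>)" using ip2_nonneg[of \<Delta>] by (simp add: algebra_simps)
      then have "B^2 * sqrt (ip2 \<Delta> \<Delta>) < e * \<rho>" using * by linarith
      then have "(1 / \<rho>) * B^2 * sqrt (ip2 \<Delta> \<Delta>) < e" using \<rho> by (simp add: field_simps)
      then show ?thesis using Sb[OF b\<Delta>, of x y] Sdiff[OF bP bP, of n x y m]
        unfolding dist_real_def PS \<Delta>_def by simp
    qed
    then show "\<exists>M. \<forall>m\<ge>M. \<forall>n\<ge>M. dist (P m x y) (P n x y) < e"
      by (intro exI[of _ "Suc N"]) (metis Suc_le_D Suc_le_mono)
  qed
  define Q where "Q x y = lim (\<lambda>n. P n x y)" for x y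
  have PQ: "(\<lambda>n. P n x y) \<longlonglongrightarrow> Q x y" for x y
    unfolding Q_def using Cauchy_convergent[OF cau] by (simp add: convergent_LIMSEQ_iff)
  define C where "C = (1 / \<rho>) * B^2 * sqrt (\<rho> * d 0)"
  \<comment> \<open>The uniform bound comes from \<open>S\<close> and thus starts at index 1;
    \<open>d 0\<close> is the largest value of the decreasing sequence.\<close>
  have PC: "\<bar>P (Suc n) x y\<bar> \<le> C" for n x y
  proof -
    have "\<bar>P (Suc n) x y\<bar> \<le> (1 / \<rho>) * B^2 * sqrt (\<rho> * d (n + n + 1))"
      using Sb[OF bP, of n x y] unfolding PS ipP .
    also have "\<dots> \<le> C" unfolding C_def using \<rho> decseqD[OF \<open>decseq d\<close>, of 0 "n + n + 1"]
      by (intro mult_left_mono) auto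
    finally show ?thesis .
  qed
  have PQ1: "(\<lambda>n. P (Suc n) x y) \<longlonglongrightarrow> Q x y" for x y using LIMSEQ_Suc[OF PQ] .
  have QC: "\<bar>Q x y\<bar> \<le> C" for x y
    by (rule LIMSEQ_le_const2[OF tendsto_rabs[OF PQ1]]) (use PC in auto)
  have bQ: "bm2 Q"
  proof -
    have "(\<lambda>p. Q (fst p) (snd p)) \<in> borel_measurable (M \<Otimes>\<^sub>M M)"
      by (rule borel_measurable_LIMSEQ_real[of _ "\<lambda>n p. P n (fst p) (snd p)"])
         (use PQ bm2_measurable[OF bP] in \<open>simp_all add: split_beta'\<close>)
    then show ?thesis unfolding bm2_def split_beta' using QC by blast
  qed
  have Qeq: "kop (It R 1) (\<lambda>z. Q z y) x = \<rho> * Q x y" for x y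
  proof -
    have "(\<lambda>n. (LINT z|M. It R 1 x z * P (Suc n) z y)) \<longlonglongrightarrow> (LINT z|M. It R 1 x z * Q z y)"
    proof (rule integral_dominated_convergence[where w="\<lambda>z. \<bar>It R 1 x z\<bar> * C"])
      show "(\<lambda>z. It R 1 x z * Q z y) \<in> borel_measurable M"
        by (rule bm1_measurable[OF bm1_mult[OF bm2_sec1[OF bI] bm2_sec2[OF bQ]]])
      show "(\<lambda>z. It R 1 x z * P (Suc n) z y) \<in> borel_measurable M" for n
        by (rule bm1_measurable[OF bm1_mult[OF bm2_sec1[OF bI] bm2_sec2[OF bP]]])
      show "integrable M (\<lambda>z. \<bar>It R 1 x z\<bar> * C)"
        by (rule integrable_mult_left[OF integrable_abs[OF bm1_integrable[OF bm2_sec1[OF bI]]]])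
      show "AE z in M. (\<lambda>n. It R 1 x z * P (Suc n) z y) \<longlonglongrightarrow> It R 1 x z * Q z y"
        by (intro AE_I2 tendsto_mult tendsto_const PQ1)
      show "AE z in M. norm (It R 1 x z * P (Suc n) z y) \<le> \<bar>It R 1 x z\<bar> * C" for n
        by (intro AE_I2) (simp only: real_norm_def abs_mult mult_left_mono[OF PC abs_ge_zero])
    qed
    moreover have "(LINT z|M. It R 1 x z * P (Suc n) z y) = \<rho> * P (Suc (Suc n)) x y" for n
    proof -
      have "It R (2 * Suc (Suc n) + 1) x y = (LINT z|M. It R 1 x z * It R (2 * Suc n + 1) z y)"
        using It_comp[OF R, of 1 "2 * Suc n + 1" x y] by (simp del: It.simps)
      then show ?thesis using \<rho> unfolding P_def by (simp del: It.simps)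
    qed
    ultimately have "(\<lambda>n. \<rho> * P (Suc (Suc n)) x y) \<longlonglongrightarrow> (LINT z|M. It R 1 x z * Q z y)" by simp
    moreover have "(\<lambda>n. \<rho> * P (Suc (Suc n)) x y) \<longlonglongrightarrow> \<rho> * Q x y"
      by (intro tendsto_mult tendsto_const LIMSEQ_Suc[OF PQ1])
    ultimately show ?thesis by (rule LIMSEQ_unique)
  qed
  \<comment> \<open>This prevents a zero limit: all iterates have squared norm at least \<rho>^2,
    and bounded convergence passes it on to Q. Hence some column of Q is not null.\<close>
  have ipQ: "ip2 Q Q \<ge> \<rho>^2"
  proof -
    have e: "ip2 F F = (LINT p|(M \<Otimes>\<^sub>M M). (F (fst p) (snd p))^2)" if "bm2 F" for F
      unfolding ip2_def power2_eq_square by (rule bm2_pair[symmetric, OF bm2_mult[OF that that]])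
    have "(\<lambda>n. ip2 (P (Suc n)) (P (Suc n))) \<longlonglongrightarrow> ip2 Q Q"
      unfolding e[OF bP] e[OF bQ]
    proof (rule integral_dominated_convergence[where w="\<lambda>_. C^2"])
      show "(\<lambda>p. (Q (fst p) (snd p))^2) \<in> borel_measurable (M \<Otimes>\<^sub>M M)"
        using bm2_measurable[OF bm2_power2[OF bQ]] by (simp add: split_beta')
      show "(\<lambda>p. (P (Suc n) (fst p) (snd p))^2) \<in> borel_measurable (M \<Otimes>\<^sub>M M)" for n
        using bm2_measurable[OF bm2_power2[OF bP]] by (simp add: split_beta')
      show "integrable (M \<Otimes>\<^sub>M M) (\<lambda>_. C^2)" by simp
      show "AE p in M \<Otimes>\<^sub>M M. (\<lambda>n. (P (Suc n) (fst p) (snd p))^2) \<longlonglongrightarrow> (Q (fst p) (snd p))^2"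
        by (intro AE_I2 tendsto_power PQ1)
      have "(P (Suc n) x y)^2 \<le> C^2" for n x y using PC[of n x y] by (simp add: abs_le_square_iff[symmetric])
      then show "AE p in M \<Otimes>\<^sub>M M. norm ((P (Suc n) (fst p) (snd p))^2) \<le> C^2" for n by (intro AE_I2) simp
    qed
    then show ?thesis
    proof (rule LIMSEQ_le_const)
      show "\<exists>N. \<forall>n\<ge>N. \<rho>^2 \<le> ip2 (P (Suc n)) (P (Suc n))"
        unfolding ipP power2_eq_square using dge \<rho> by (auto intro!: exI[of _ 0] mult_left_mono)
    qed
  qed
  have "\<exists>y. (LINT x|M. (Q x y)^2) > 0"
  proof (rule ccontr)
    assume "\<not> ?thesis"
    then have "(LINT x|M. (Q x y)^2) = 0" for y
      by (metis Bochner_Integration.integral_nonneg less_eq_real_def zero_le_power2)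
    then have "ip2 Q Q = 0"
      unfolding ip2_def bm2_fubini[OF bm2_mult[OF bQ bQ]] by (simp add: power2_eq_square)
    then show False using ipQ \<rho> by (simp add: power2_eq_square mult_le_0_iff)
  qed
  then obtain y where y: "(LINT x|M. (Q x y)^2) > 0" by blast
  have "kop R (kop R (\<lambda>z. Q z y)) x = \<rho> * Q x y" for x
    using kop_It1[OF R bm2_sec2[OF bQ], of x y] unfolding Qeq by (rule HOL.sym)
  then show ?thesis using \<rho>0 \<rho> bm2_sec2[OF bQ, of y] y
    by (intro exI[of _ \<rho>] exI[of _ "\<lambda>z. Q z y"] conjI allI)
qed

text \<open>The quotient is a lower bound for the largest squared eigenvalue: the sum of fourth
  powers is at most that maximum times the sum of squares. It will bound \<open>nrm R 1\<close> by
  an eigenvalue.\<close>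

lemma eigenfunction_exists:
  assumes pos: "nrm R 1 > 0"
  shows "\<exists>\<mu> \<psi>. \<mu>^2 \<ge> nrm R 1 / nrm R 0 \<and> \<mu> \<noteq> 0 \<and> bm1 \<psi> \<and> (LINT x|M. (\<psi> x)^2) > 0 \<and> (\<forall>x. kop R \<psi> x = \<mu> * \<psi> x)"
proof -
  from iterate_kernel_limit[OF pos]
  obtain \<rho> \<phi> where 1: "\<rho> \<ge> nrm R 1 / nrm R 0" "\<rho> > 0" "bm1 \<phi>" "(LINT x|M. (\<phi> x)^2) > 0" "\<And>x. kop R (kop R \<phi>) x = \<rho> * \<phi> x" by (elim exE conjE) (rule that, auto)
  from eigenfunction_of_square[OF 1(3,4,2,5)]
  obtain \<mu> \<psi> where 2: "\<mu>^2 = \<rho>" "bm1 \<psi>" "(LINT x|M. (\<psi> x)^2) > 0" "\<And>x. kop R \<psi> x = \<mu> * \<psi> x" by (elim exE conjE) (rule that, auto)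
  have "\<mu> \<noteq> 0" using 2(1) 1(2) by auto
  then show ?thesis using 1(1) 2 by (intro exI[of _ \<mu>] exI[of _ \<psi>] conjI allI) auto
qed

end

section \<open>Weak convergence and the L2 expansion along eigenfunctions\<close>

lemma weak_null_approx:
  assumes R: "\<And>n. bm1 (R n)" and C: "\<And>n. (LINT x|M. (R n x)^2) \<le> C" and F: "bm1 F"
    and app: "\<And>e. e > 0 ==> \<exists>G. bm1 G \<and> (\<lambda>n. (LINT x|M. G x * R n x)) \<longlonglongrightarrow> 0 \<and> (LINT x|M. (F x - G x)^2) \<le> e"
  shows "(\<lambda>n. (LINT x|M. F x * R n x)) \<longlonglongrightarrow> 0"
proof (rule LIMSEQ_I)
  fix e :: real assume e: "e > 0"
  define C' where "C' = \<bar>C\<bar> + 1"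
  have C': "C' > 0" "\<And>n. (LINT x|M. (R n x)^2) \<le> C'" using C by (auto simp: C'_def intro: order_trans[OF C])
  define \<delta> where "\<delta> = (e / 2)^2 / C' / 2"
  have \<delta>: "\<delta> > 0" using e C' by (simp add: \<delta>_def)
  obtain G where G: "bm1 G" "(\<lambda>n. (LINT x|M. G x * R n x)) \<longlonglongrightarrow> 0" "(LINT x|M. (F x - G x)^2) \<le> \<delta>"
    using app[OF \<delta>] by blast
  obtain N where N: "\<And>n. n \<ge> N ==> \<bar>(LINT x|M. G x * R n x)\<bar> < e / 2"
    using LIMSEQ_D[OF G(2), of "e/2"] e by auto
  have "\<bar>(LINT x|M. F x * R n x)\<bar> < e" if "n \<ge> N" for n
  proof -
    have bd: "bm1 (\<lambda>x. F x - G x)" by (rule bm1_diff[OF F G(1)])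
    have "(LINT x|M. F x * R n x) = (LINT x|M. (F x - G x) * R n x) + (LINT x|M. G x * R n x)"
      using bm1_integrable[OF bm1_mult[OF F R]] bm1_integrable[OF bm1_mult[OF G(1) R]]
      by (simp add: left_diff_distrib)
    moreover have "\<bar>(LINT x|M. (F x - G x) * R n x)\<bar> < e / 2"
    proof -
      have "(LINT x|M. (F x - G x) * R n x)^2 \<le> (LINT x|M. (F x - G x)^2) * (LINT x|M. (R n x)^2)"
        by (rule CS1[OF bd R])
      also have "\<dots> \<le> \<delta> * C'" using G(3) C'(2)[of n] \<delta> by (intro mult_mono) auto
      also have "\<dots> < (e / 2)^2" using e C' by (simp add: \<delta>_def)
      finally show ?thesis using e by (metis abs_ge_zero abs_le_square_iff abs_of_pos half_gt_zero linorder_not_le)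
    qed
    ultimately show ?thesis using N[OF that] by linarith
  qed
  then show "\<exists>N. \<forall>n\<ge>N. norm ((LINT x|M. F x * R n x) - 0) < e" by auto
qed

lemma bm1_indicator: "A \<in> sets M ==> bm1 (indicator A)"
  unfolding bm1_def by (auto intro!: exI[of _ 1] simp: indicator_def)

lemma weak_null_sum:
  assumes R: "\<And>n. bm1 (R n)" and G: "\<And>i. i \<in> I ==> bm1 (G i)" "finite I"
   and lim: "\<And>i. i \<in> I ==> (\<lambda>n. (LINT x|M. G i x * R n x)) \<longlonglongrightarrow> (0::real)"
  shows "(\<lambda>n. (LINT x|M. (\<Sum>i\<in>I. c i * G i x) * R n x)) \<longlonglongrightarrow> 0"
proof -
  have "(LINT x|M. (\<Sum>i\<in>I. c i * G i x) * R n x) = (\<Sum>i\<in>I. c i * (LINT x|M. G i x * R n x))" for n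
    unfolding sum_distrib_right
    by (subst Bochner_Integration.integral_sum)
       (use bm1_integrable[OF bm1_mult[OF G(1) R]] in \<open>auto simp: mult.assoc\<close>)
  moreover have "(\<lambda>n. \<Sum>i\<in>I. c i * (LINT x|M. G i x * R n x)) \<longlonglongrightarrow> (\<Sum>i\<in>I. c i * 0)"
    by (intro tendsto_sum tendsto_mult tendsto_const lim)
  ultimately show ?thesis by simp
qed

text \<open>A bounded sequence in L2 that tends weakly to 0 on a generating \<pi>-system does so
  against every bounded function: the sets for which it holds form a Dynkin system, and bounded
  functions are uniform limits of simple ones.\<close>

lemma weak_null:
  assumes G: "Int_stable G" "UNIV \<in> G" "sets M = sigma_sets UNIV G"
    and R: "\<And>n. bm1 (R n)" and C: "\<And>n. (LINT x|M. (R n x)^2) \<le> C"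
    and rect: "\<And>A. A \<in> G ==> (\<lambda>n. (LINT x|M. indicator A x * R n x)) \<longlonglongrightarrow> 0"
    and F: "bm1 F"
  shows "(\<lambda>n. (LINT x|M. F x * R n x)) \<longlonglongrightarrow> 0"
proof -
  have GM: "G \<subseteq> sets M" using G(3) by auto
  have set: "(\<lambda>n. (LINT x|M. indicator A x * R n x)) \<longlonglongrightarrow> 0" if "A \<in> sets M" for A
    using G(1) subset_UNIV[of G, folded Pow_UNIV] that unfolding G(3)
  proof (induction rule: sigma_sets_induct_disjoint)
    case (compl A)
    have A: "A \<in> sets M" using compl G(3) by simp
    have ih: "(\<lambda>n. (LINT x|M. indicator A x * R n x)) \<longlonglongrightarrow> 0" by (rule compl)
    have e: "(LINT x|M. indicator (UNIV - A) x * R n x) = (LINT x|M. indicator UNIV x * R n x) - (LINT x|M. indicator A x * R n x)" for n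
    proof -
      have "(LINT x|M. indicator UNIV x * R n x) - (LINT x|M. indicator A x * R n x) = (LINT x|M. indicator UNIV x * R n x - indicator A x * R n x)"
        by (intro Bochner_Integration.integral_diff[symmetric] bm1_integrable[OF bm1_mult[OF bm1_indicator R]] A)
           (use sets.top[of M] in simp)
      also have "\<dots> = (LINT x|M. indicator (UNIV - A) x * R n x)"
        by (intro Bochner_Integration.integral_cong) (auto simp: indicator_def)
      finally show ?thesis ..
    qed
    show ?case unfolding e using tendsto_diff[OF rect[OF G(2)] ih] by simp
  next
    case (union A)
    have A: "range A \<subseteq> sets M" using union G(3) by simp
    have dis: "disjoint_family A" using union by simp
    have ih: "(\<lambda>n. (LINT x|M. indicator (A i) x * R n x)) \<longlonglongrightarrow> 0" for i by (rule union)
    have Ai: "A i \<in> sets M" for i using A by auto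
    show ?case
    proof (rule weak_null_approx[OF R C bm1_indicator])
      show "(\<Union>i. A i) \<in> sets M" using A by auto
      fix e :: real assume e: "e > 0"
      \<comment> \<open>A countable disjoint union is approximated in L2 by its finite parts, for
        which the claim is linear.\<close>
      have "(\<lambda>n. prob (\<Union>i<n. A i)) \<longlonglongrightarrow> prob (\<Union>n. \<Union>i<n. A i)"
      proof (rule finite_Lim_measure_incseq)
        show "range (\<lambda>n. \<Union>i<n. A i) \<subseteq> sets M" using A by auto
        show "incseq (\<lambda>n. \<Union>i<n. A i)" unfolding incseq_def by (intro allI impI UN_mono) auto
      qed
      moreover have "(\<Union>n. \<Union>i<n. A i) = (\<Union>i. A i)" by auto
      ultimately have "(\<lambda>n. prob (\<Union>i<n. A i)) \<longlonglongrightarrow> prob (\<Union>i. A i)" by simp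
      from LIMSEQ_D[OF this e] obtain m where m: "\<bar>prob (\<Union>i<m. A i) - prob (\<Union>i. A i)\<bar> < e" by auto
      define X where "X = (\<Union>i<m. A i)"
      have X: "X \<in> sets M" "X \<subseteq> (\<Union>i. A i)" using A by (auto simp: X_def)
      have sumeq: "indicator X x = (\<Sum>i<m. 1 * indicator (A i) x :: real)" for x
        unfolding X_def using dis
        by (subst indicator_UN_disjoint) (auto simp: disjoint_family_on_def)
      show "\<exists>G. bm1 G \<and> (\<lambda>n. (LINT x|M. G x * R n x)) \<longlonglongrightarrow> 0 \<and> (LINT x|M. (indicator (\<Union>i. A i) x - G x)^2) \<le> e"
      proof (intro exI[of _ "indicator X"] conjI)
        show "bm1 (indicator X)" by (rule bm1_indicator[OF X(1)])
        show "(\<lambda>n. (LINT x|M. indicator X x * R n x)) \<longlonglongrightarrow> 0"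
          unfolding sumeq by (rule weak_null_sum[OF R]) (use bm1_indicator[OF Ai] ih in auto)
        have "(LINT x|M. (indicat_real (\<Union>i. A i) x - indicat_real X x)^2) = (LINT x|M. indicat_real ((\<Union>i. A i) - X) x)"
          using X by (intro Bochner_Integration.integral_cong) (auto simp: indicator_def)
        also have "\<dots> = prob ((\<Union>i. A i) - X)" using A X by (auto intro!: integral_indicator)
        also have "\<dots> = prob (\<Union>i. A i) - prob X" using A X by (intro finite_measure_Diff) auto
        also have "\<dots> \<le> e" using m by (simp add: X_def)
        finally show "(LINT x|M. (indicat_real (\<Union>i. A i) x - indicat_real X x)^2) \<le> e" .
      qed
    qed
  qed (use rect in auto)
  obtain B where B: "\<And>x. \<bar>F x\<bar> \<le> B" using F by (auto simp: bm1_def)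
  have Fm: "F \<in> borel_measurable M" by (rule bm1_measurable[OF F])
  show ?thesis
  proof (rule weak_null_approx[OF R C F])
    fix e :: real assume e: "e > 0"
    \<comment> \<open>F is rounded down to multiples of 1/m, which costs at most 1/m at each point.
      As F is bounded, only the finitely many levels between -L and L occur.\<close>
    obtain m :: nat where m: "m > 0" "1 / real m < sqrt e" using e real_arch_inverse[of "sqrt e"] by (auto simp: inverse_eq_divide)
    define L where "L = \<lceil>B * m\<rceil> + 1"
    define E where "E j = {x. \<lfloor>F x * m\<rfloor> = j}" for j :: int
    have E: "E j \<in> sets M" for j
    proof -
      have "E j = {x\<in>space M. \<lfloor>F x * m\<rfloor> = j}" by (simp add: E_def)
      also have "\<dots> \<in> sets M" using Fm by measurable
      finally show ?thesis .
    qed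
    define G' where "G' x = (\<Sum>j\<in>{-L..L}. (of_int j / m) * indicator (E j) x)" for x :: 'a
    have fl: "G' x = of_int \<lfloor>F x * m\<rfloor> / m" for x
    proof -
      have "\<bar>F x * m\<bar> \<le> B * m" using B[of x] by (simp add: abs_mult mult_right_mono)
      then have "\<lfloor>F x * m\<rfloor> \<in> {-L..L}" unfolding L_def by (auto simp: abs_le_iff; linarith)
      moreover have "G' x = (\<Sum>j\<in>{-L..L}. if j = \<lfloor>F x * m\<rfloor> then of_int j / m else 0)"
        unfolding G'_def by (intro sum.cong) (auto simp: E_def indicator_def)
      ultimately show ?thesis by (subst (asm) sum.delta) auto
    qed
    have bG: "bm1 G'" unfolding G'_def by (intro bm1_sum bm1_mult[OF bm1_const bm1_indicator[OF E]])
    show "\<exists>G. bm1 G \<and> (\<lambda>n. (LINT x|M. G x * R n x)) \<longlonglongrightarrow> 0 \<and> (LINT x|M. (F x - G x)^2) \<le> e"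
    proof (intro exI[of _ G'] conjI bG)
      show "(\<lambda>n. (LINT x|M. G' x * R n x)) \<longlonglongrightarrow> 0"
        unfolding G'_def by (rule weak_null_sum[OF R]) (use bm1_indicator[OF E] set[OF E] in auto)
      have "(F x - G' x)^2 \<le> e" for x
      proof -
        have "F x - G' x = (F x * m - of_int \<lfloor>F x * m\<rfloor>) / m" using m by (simp add: fl field_simps)
        moreover have "\<bar>F x * m - of_int \<lfloor>F x * m\<rfloor>\<bar> \<le> 1" by linarith
        ultimately have "\<bar>F x - G' x\<bar> \<le> 1 / m" using m by (simp add: divide_right_mono)
        also have "\<dots> \<le> sqrt e" using m by simp
        finally have "\<bar>F x - G' x\<bar>^2 \<le> (sqrt e)^2" by (intro power_mono) auto
        then show ?thesis using e by simp
      qed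
      then have "(LINT x|M. (F x - G' x)^2) \<le> (LINT x|M. e)"
        by (intro integral_mono bm1_integrable[OF bm1_power2[OF bm1_diff[OF F bG]]] bm1_integrable[OF bm1_const])
      then show "(LINT x|M. (F x - G' x)^2) \<le> e" by simp
    qed
  qed
qed

lemma kernel_space_pair: "kernel_space (M \<Otimes>\<^sub>M M)"
  by unfold_locales (simp add: space_pair_measure)

text \<open>Rectangles generate the product \<sigma>-algebra, and testing a kernel against a
  rectangle is its bilinear form at two indicators. Smallness of the operators in the sense of forms
  therefore already gives weak convergence of the kernels.\<close>

lemma ip2_weak_null:
  assumes R: "\<And>n. bm2 (R n)" and C: "\<And>n. ip2 (R n) (R n) \<le> C"
    and rect: "\<And>f g. bm1 f ==> bm1 g ==> (\<lambda>n. (LINT x|M. f x * kop (R n) g x)) \<longlonglongrightarrow> 0"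
    and F: "bm2 F"
  shows "(\<lambda>n. ip2 F (R n)) \<longlonglongrightarrow> 0"
proof -
  interpret K2: kernel_space "M \<Otimes>\<^sub>M M" by (rule kernel_space_pair)
  define G where "G = {A \<times> B | A B. A \<in> sets M \<and> B \<in> sets M}"
  have b: "K2.bm1 (\<lambda>p. S (fst p) (snd p))" if "bm2 S" for S
    using that unfolding K2.bm1_def bm2_def by (auto simp: split_beta')
  have "(\<lambda>n. (LINT p|(M \<Otimes>\<^sub>M M). F (fst p) (snd p) * R n (fst p) (snd p))) \<longlonglongrightarrow> 0"
  proof (rule K2.weak_null[where G=G and R="\<lambda>n p. R n (fst p) (snd p)" and F="\<lambda>p. F (fst p) (snd p)", OF _ _ _ b[OF R] _ _ b[OF F]])
    show "Int_stable G" unfolding G_def by (rule Int_stable_pair_measure_generator)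
    show "UNIV \<in> G" unfolding G_def using sets.top[of M] by (intro CollectI exI[of _ UNIV]) auto
    show "sets (M \<Otimes>\<^sub>M M) = sigma_sets UNIV G" unfolding sets_pair_measure G_def by simp
    show "(LINT p|(M \<Otimes>\<^sub>M M). (R n (fst p) (snd p))^2) \<le> C" for n
      using C[of n] bm2_pair[OF bm2_power2[OF R[of n]]] unfolding ip2_def by (simp add: power2_eq_square)
    fix X assume "X \<in> G"
    then obtain A B where X: "X = A \<times> B" "A \<in> sets M" "B \<in> sets M" by (auto simp: G_def)
    have "(LINT p|(M \<Otimes>\<^sub>M M). indicator X p * R n (fst p) (snd p)) = (LINT x|M. indicator A x * kop (R n) (indicator B) x)" for n
    proof -
      have "(LINT p|(M \<Otimes>\<^sub>M M). indicator X p * R n (fst p) (snd p)) = (LINT p|(M \<Otimes>\<^sub>M M). indicator A (fst p) * (R n (fst p) (snd p) * indicator B (snd p)))"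
        by (intro Bochner_Integration.integral_cong) (auto simp: X(1) indicator_def)
      also have "\<dots> = (LINT x|M. (LINT y|M. indicator A x * (R n x y * indicator B y)))"
        by (rule bm2_pair[OF bm2_mult[OF bm2_fst[OF bm1_indicator[OF X(2)]] bm2_mult[OF R bm2_snd[OF bm1_indicator[OF X(3)]]]]])
      finally show ?thesis by simp
    qed
    then show "(\<lambda>n. (LINT p|(M \<Otimes>\<^sub>M M). indicator X p * R n (fst p) (snd p))) \<longlonglongrightarrow> 0"
      using rect[OF bm1_indicator[OF X(2)] bm1_indicator[OF X(3)]] by simp
  qed
  then show ?thesis unfolding ip2_def bm2_pair[OF bm2_mult[OF F R]] .
qed

text \<open>The residuals first go to 0 as operators: an eigenfunction of \<open>Res N\<close> with
  nonzero eigenvalue is orthogonal to the functions already removed, so it belongs to K and, by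
  maximality, to an eigenvalue listed from N on. Weak convergence follows, and it is strong because
  \<open>Res N\<close> is an orthogonal remainder of K. Zero entries of \<open>lam\<close> pad a
  finite spectrum, which is why orthogonality is asked only at nonzero ones.\<close>

lemma spectral_decomposition:
  fixes K :: "'a => 'a => real" and lam :: "nat => real" and \<phi> :: "nat => 'a => real"
  defines "Res \<equiv> \<lambda>N x y. K x y - (\<Sum>k<N. lam k * (\<phi> k x * \<phi> k y))"
  assumes K: "bm2 K" and sym: "\<And>x y. K x y = K y x" and \<phi>: "\<And>k. bm1 (\<phi> k)"
    and orth: "\<And>i j. lam i \<noteq> 0 ==> lam j \<noteq> 0 ==> (LINT x|M. \<phi> i x * \<phi> j x) = (if i = j then 1 else 0)"
    and eig: "\<And>k x. lam k \<noteq> 0 ==> kop K (\<phi> k) x = lam k * \<phi> k x"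
    and maxl: "\<And>\<mu> \<psi>. \<mu> \<noteq> 0 ==> bm1 \<psi> ==> (\<forall>x. kop K \<psi> x = \<mu> * \<psi> x) ==>
        (\<forall>k. lam k = \<mu> \<longrightarrow> (LINT x|M. \<psi> x * \<phi> k x) = 0) ==> (LINT x|M. (\<psi> x)^2) = 0"
  shows "summable (\<lambda>k. (lam k)^2)" and "(\<lambda>N. ip2 (Res N) (Res N)) \<longlonglongrightarrow> 0"
proof -
  define E where "E k x y = lam k * (\<phi> k x * \<phi> k y)" for k x y
  have bE: "bm2 (E k)" for k unfolding E_def
    by (rule bm2_mult[OF bm2_const bm2_mult[OF bm2_fst[OF \<phi>] bm2_snd[OF \<phi>]]])
  have Res: "Res N = (\<lambda>x y. K x y - (\<Sum>k\<in>{..<N}. E k x y))" for N unfolding Res_def E_def ..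
  have bS: "bm2 (\<lambda>x y. \<Sum>k\<in>{..<N}. E k x y)" for N by (rule bm2_sum[OF bE])
  have bR: "bm2 (Res N)" for N unfolding Res by (rule bm2_diff[OF K bS])
  have symR: "Res N x y = Res N y x" for N x y unfolding Res_def using sym[of x y] by (simp add: mult.commute)
  have KE: "ip2 K (E k) = (lam k)^2" for k
  proof (cases "lam k = 0")
    case False
    have "ip2 K (E k) = (LINT x|M. lam k * (\<phi> k x * kop K (\<phi> k) x))"
      unfolding ip2_def E_def by (simp add: ac_simps flip: Bochner_Integration.integral_mult_right_zero)
    also have "\<dots> = (LINT x|M. (lam k)^2 * (\<phi> k x * \<phi> k x))" unfolding eig[OF False] by (simp add: power2_eq_square ac_simps)
    also have "\<dots> = (lam k)^2" using orth[OF False False] by simp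
    finally show ?thesis .
  qed (simp add: ip2_def E_def)
  have EE: "ip2 (E i) (E j) = (if i = j then (lam i)^2 else 0)" for i j
  proof (cases "lam i = 0 \<or> lam j = 0")
    case False
    have "ip2 (E i) (E j) = (LINT x|M. (LINT y|M. (lam i * lam j * (\<phi> i x * \<phi> j x)) * (\<phi> i y * \<phi> j y)))"
      unfolding ip2_def E_def by (simp add: ac_simps)
    also have "\<dots> = (LINT x|M. (lam i * lam j * (\<phi> i x * \<phi> j x)) * (LINT y|M. \<phi> i y * \<phi> j y))" by simp
    also have "\<dots> = lam i * lam j * (LINT y|M. \<phi> i y * \<phi> j y)^2" by (simp add: power2_eq_square)
    finally show ?thesis using orth[of i j] False by (simp add: power2_eq_square)
  qed (auto simp: ip2_def E_def)
  have RE: "ip2 (Res N) (E k) = 0" if "k < N" for k N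
  proof -
    have "ip2 (Res N) (E k) = ip2 K (E k) - (\<Sum>j<N. ip2 (E j) (E k))"
      unfolding Res ip2_diff_left[OF K bS bE] ip2_sum_left[OF bE bE] ..
    also have "\<dots> = 0" unfolding KE EE using that by simp
    finally show ?thesis .
  qed
  \<comment> \<open>The identity that upgrades weak to strong convergence: the norm of the residual
    is its inner product with the fixed kernel K.\<close>
  have RR: "ip2 (Res N) (Res N) = ip2 K (Res N)" for N
  proof -
    have "ip2 (Res N) (Res N) = ip2 K (Res N) - ip2 (\<lambda>x y. \<Sum>k\<in>{..<N}. E k x y) (Res N)"
      using ip2_diff_left[OF K bS bR, of N N] unfolding Res by simp
    also have "ip2 (\<lambda>x y. \<Sum>k\<in>{..<N}. E k x y) (Res N) = (\<Sum>k<N. ip2 (E k) (Res N))"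
      by (rule ip2_sum_left[OF bE bR])
    also have "\<dots> = 0" using RE by (simp add: ip2_commute[of "E _"])
    finally show ?thesis by simp
  qed
  have KR: "ip2 K (Res N) = ip2 K K - (\<Sum>k<N. (lam k)^2)" for N
  proof -
    have "ip2 K (Res N) = ip2 K K - ip2 K (\<lambda>x y. \<Sum>k\<in>{..<N}. E k x y)"
      unfolding Res by (rule ip2_diff_right[OF K bS K])
    also have "ip2 K (\<lambda>x y. \<Sum>k\<in>{..<N}. E k x y) = (\<Sum>k<N. ip2 K (E k))"
      by (simp only: ip2_commute[of K] ip2_sum_left[OF bE K])
    finally show ?thesis unfolding KE .
  qed
  have bessel: "(\<Sum>k<N. (lam k)^2) \<le> ip2 K K" for N using ip2_nonneg[of "Res N"] unfolding RR KR by simp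
  show sm: "summable (\<lambda>k. (lam k)^2)"
    by (rule bounded_imp_summable[where B="ip2 K K"]) (use bessel[of "Suc _"] in \<open>auto simp: lessThan_Suc_atMost\<close>)
  define tail where "tail N = (\<Sum>k. (lam k)^2) - (\<Sum>k<N. (lam k)^2)" for N
  have tail: "tail \<longlonglongrightarrow> 0" unfolding tail_def
    using tendsto_diff[OF tendsto_const summable_LIMSEQ[OF sm], of "\<Sum>k. (lam k)^2"] by simp
  have lamtail: "(lam k)^2 \<le> tail N" if "k \<ge> N" for k N
  proof -
    have "(\<Sum>k<N. (lam k)^2) + (lam k)^2 = (\<Sum>i\<in>insert k {..<N}. (lam i)^2)" using that by simp
    also have "\<dots> \<le> (\<Sum>k. (lam k)^2)" by (rule sum_le_suminf[OF sm]) auto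
    finally show ?thesis by (simp add: tail_def)
  qed
  have tail0: "tail N \<ge> 0" for N using lamtail[of N N] by (metis order_refl order_trans zero_le_power2)
  have kopR: "kop (Res N) \<psi> x = kop K \<psi> x - (\<Sum>k<N. lam k * \<phi> k x * (LINT y|M. \<psi> y * \<phi> k y))" if \<psi>: "bm1 \<psi>" for N \<psi> x
  proof -
    have iE: "integrable M (\<lambda>y. E k x y * \<psi> y)" for k by (rule bm1_integrable[OF bm1_mult[OF bm2_sec1[OF bE] \<psi>]])
    have "kop (Res N) \<psi> x = (LINT y|M. K x y * \<psi> y - (\<Sum>k<N. E k x y * \<psi> y))"
      unfolding Res by (simp add: left_diff_distrib sum_distrib_right)
    also have "\<dots> = kop K \<psi> x - (\<Sum>k<N. (LINT y|M. E k x y * \<psi> y))"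
      using iE bm1_integrable[OF bm1_mult[OF bm2_sec1[OF K] \<psi>]] by simp
    finally have 1: "kop (Res N) \<psi> x = kop K \<psi> x - (\<Sum>k<N. (LINT y|M. E k x y * \<psi> y))" .
    have "(LINT y|M. E k x y * \<psi> y) = lam k * \<phi> k x * (LINT y|M. \<psi> y * \<phi> k y)" for k
      unfolding E_def by (simp add: ac_simps flip: Bochner_Integration.integral_mult_right_zero)
    then show ?thesis unfolding 1 by simp
  qed
  have nrm0: "nrm (Res N) 0 \<le> ip2 K K" for N
    unfolding nrm_def[OF bR symR] It_0 RR KR by (simp add: sum_nonneg)
  \<comment> \<open>The largest squared eigenvalue of the residual is at most \<open>tail N\<close>,
    and \<open>nrm\<close> at 1 is at most this maximum times \<open>nrm\<close> at 0.\<close>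
  have nrm1: "nrm (Res N) 1 \<le> ip2 K K * tail N" for N
  proof (cases "nrm (Res N) 1 > 0")
    case True
    obtain \<mu> \<psi> where e: "\<mu>^2 \<ge> nrm (Res N) 1 / nrm (Res N) 0" "\<mu> \<noteq> 0" "bm1 \<psi>" "(LINT x|M. (\<psi> x)^2) > 0"
      "\<And>x. kop (Res N) \<psi> x = \<mu> * \<psi> x"
      using eigenfunction_exists[OF bR symR True] by blast
    have o: "(LINT x|M. \<psi> x * \<phi> k x) = 0" if k: "k < N" "lam k \<noteq> 0" for k
    proof -
      have z: "kop (Res N) (\<phi> k) x = 0" for x
      proof -
        have "(\<Sum>j<N. lam j * \<phi> j x * (LINT y|M. \<phi> k y * \<phi> j y)) = (\<Sum>j<N. if j = k then lam j * \<phi> j x else 0)"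
          using orth[OF k(2)] by (intro sum.cong) auto
        then show ?thesis unfolding kopR[OF \<phi>] using eig[OF k(2)] k by simp
      qed
      have "\<mu> * (LINT x|M. \<psi> x * \<phi> k x) = (LINT x|M. kop (Res N) \<psi> x * \<phi> k x)" unfolding e(5) by (simp add: mult.assoc)
      also have "\<dots> = (LINT x|M. \<psi> x * kop (Res N) (\<phi> k) x)" by (rule kop_sym[OF bR symR e(3) \<phi>])
      also have "\<dots> = 0" unfolding z by simp
      finally show ?thesis using e(2) by simp
    qed
    have Keig: "kop K \<psi> x = \<mu> * \<psi> x" for x
    proof -
      have "lam k * \<phi> k x * (LINT y|M. \<psi> y * \<phi> k y) = 0" if "k < N" for k using o[OF that] by (cases "lam k = 0") auto
      then have "(\<Sum>k<N. lam k * \<phi> k x * (LINT y|M. \<psi> y * \<phi> k y)) = 0" by (intro sum.neutral) simp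
      then show ?thesis using kopR[OF e(3), of N x] e(5)[of x] by linarith
    qed
    \<comment> \<open>Otherwise \<psi> would be orthogonal to every listed eigenfunction for \<mu>,
      including those before N by \<open>o\<close>, and maximality would make it null.\<close>
    have "\<exists>k\<ge>N. lam k = \<mu>"
    proof (rule ccontr)
      assume "\<not> ?thesis"
      then have "lam k = \<mu> \<longrightarrow> (LINT x|M. \<psi> x * \<phi> k x) = 0" for k using o[of k] e(2) by (metis not_le)
      then show False using maxl[OF e(2,3)] Keig e(4) by auto
    qed
    then have "\<mu>^2 \<le> tail N" using lamtail by blast
    moreover have p0: "nrm (Res N) 0 > 0"
      using nrm_submult[OF bR symR, of N 0 0] True nrm_nonneg[OF bR symR, of N 0]
      by (metis One_nat_def add.commute add_0 less_eq_real_def linorder_not_less mult_zero_left plus_1_eq_Suc)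
    ultimately have "nrm (Res N) 1 / nrm (Res N) 0 \<le> tail N" using e(1) by linarith
    then have "nrm (Res N) 1 \<le> nrm (Res N) 0 * tail N" using p0 by (simp add: pos_divide_le_eq mult.commute)
    also have "\<dots> \<le> ip2 K K * tail N" by (rule mult_right_mono[OF nrm0 tail0])
    finally show ?thesis .
  next
    case False then show ?thesis using mult_nonneg_nonneg[OF ip2_nonneg[of K] tail0[of N]] by linarith
  qed
  have "(\<lambda>N. ip2 K (Res N)) \<longlonglongrightarrow> 0"
  proof (rule ip2_weak_null[OF bR _ _ K])
    show "ip2 (Res N) (Res N) \<le> ip2 K K" for N unfolding RR KR by (simp add: sum_nonneg)
    fix f g assume f: "bm1 f" and g: "bm1 g"
    define c where "c = (LINT x|M. (f x)^2)^2 * (LINT x|M. (g x)^2)^2"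
    have c0: "c \<ge> 0" unfolding c_def by simp
    have "(\<lambda>N. (LINT x|M. f x * kop (Res N) g x) ^ 4) \<longlonglongrightarrow> 0"
    proof (rule tendsto_sandwich[OF _ _ tendsto_const])
      show "\<forall>\<^sub>F N in sequentially. 0 \<le> (LINT x|M. f x * kop (Res N) g x) ^ 4" by (intro always_eventually) simp
      have "(LINT x|M. f x * kop (Res N) g x) ^ 4 \<le> c * (ip2 K K * tail N)" for N
        using kop_form_bound[OF bR symR f g, of N] mult_left_mono[OF nrm1[of N] c0] unfolding c_def by linarith
      then show "\<forall>\<^sub>F N in sequentially. (LINT x|M. f x * kop (Res N) g x) ^ 4 \<le> c * (ip2 K K * tail N)"
        by (intro always_eventually) simp
      show "(\<lambda>N. c * (ip2 K K * tail N)) \<longlonglongrightarrow> 0" using tendsto_mult_right_zero[OF tendsto_mult_right_zero[OF tail]] .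
    qed
    then show "(\<lambda>N. (LINT x|M. f x * kop (Res N) g x)) \<longlonglongrightarrow> 0"
      by (subst (asm) power_tendsto_0_iff) auto
  qed
  then show "(\<lambda>N. ip2 (Res N) (Res N)) \<longlonglongrightarrow> 0" unfolding RR .
qed


text \<open>Bounded eigenfunctions satisfying the eigenvalue equation everywhere; for nonzero eigenvalues every L2
  eigenfunction has such a version, namely its own image under the operator divided by the eigenvalue.\<close>

definition bef :: "('a => 'a => real) => real => nat => (nat => 'a => real) => bool" where
  "bef V \<mu> m g \<longleftrightarrow> (\<forall>i<m. bm1 (g i)) \<and>
     (\<forall>i<m. \<forall>j<m. (LINT x|M. g i x * g j x) = (if i = j then 1 else 0)) \<and>
     (\<forall>i<m. \<forall>x. kop V (g i) x = \<mu> * g i x)"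

lemma bef_snoc:
  assumes g: "bef V \<mu> m g" and e: "bm1 e" "(LINT x|M. (e x)^2) > 0" "\<And>i. i < m ==> (LINT x|M. e x * g i x) = 0"
    "\<And>x. kop V e x = \<mu> * e x"
  shows "\<exists>h. bef V \<mu> (Suc m) h \<and> (\<forall>i<m. h i = g i)"
proof -
  define c where "c = 1 / sqrt (LINT x|M. (e x)^2)"
  have c2: "c * c * (LINT x|M. (e x)^2) = 1" using e(2) by (simp add: c_def)
  define h where "h = g(m := \<lambda>x. c * e x)"
  have 1: "bm1 (h i)" if "i < Suc m" for i
    using g that bm1_mult[OF bm1_const e(1), of c] by (auto simp: bef_def h_def less_Suc_eq)
  have 2: "(LINT x|M. h i x * h j x) = (if i = j then 1 else 0)" if "i < Suc m" "j < Suc m" for i j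
  proof -
    have mm: "(LINT x|M. (c * e x) * (c * e x)) = 1"
    proof -
      have "(LINT x|M. (c * e x) * (c * e x)) = (LINT x|M. c * c * (e x)^2)"
        by (intro Bochner_Integration.integral_cong) (auto simp: power2_eq_square)
      then show ?thesis using c2 by simp
    qed
    have im: "(LINT x|M. (c * e x) * g i x) = 0" if "i < m" for i
      using e(3)[OF that] by (simp add: mult.assoc)
    have mi: "(LINT x|M. g i x * (c * e x)) = 0" if "i < m" for i
      using im[OF that] by (simp add: mult.commute)
    show ?thesis using that g mm im mi unfolding bef_def h_def by (cases "i = m"; cases "j = m") auto
  qed
  have 3: "kop V (h i) x = \<mu> * h i x" if "i < Suc m" for i x
  proof (cases "i = m")
    case True
    have "kop V (h i) x = (LINT y|M. c * (V x y * e y))" using True by (simp add: h_def ac_simps)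
    also have "\<dots> = c * (\<mu> * e x)" using e(4)[of x] by simp
    finally show ?thesis using True by (simp add: h_def)
  next
    case False then show ?thesis using g that by (simp add: bef_def h_def)
  qed
  have "bef V \<mu> (Suc m) h" unfolding bef_def using 1 2 3 by blast
  then show ?thesis by (intro exI[of _ h]) (simp add: h_def)
qed

text \<open>One Gram-Schmidt step together with the Bessel identity; the norm identity shows when
  the residual can still be normalised.\<close>

lemma residual_norm:
  fixes h :: "nat => 'a => real" and f :: "'a => real"
  assumes f: "bm1 f" and h: "\<And>j. j < l ==> bm1 (h j)"
    and orth: "\<And>i j. i < l ==> j < l ==> (LINT x|M. h i x * h j x) = (if i = j then 1 else (0::real))"
  defines "c \<equiv> \<lambda>j. (LINT x|M. f x * h j x)"
  defines "e \<equiv> \<lambda>x. f x - (\<Sum>j<l. c j * h j x)"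
  shows "bm1 e" and "\<And>j. j < l ==> (LINT x|M. e x * h j x) = 0"
    and "(LINT x|M. (e x)^2) = (LINT x|M. (f x)^2) - (\<Sum>j<l. (c j)^2)"
proof -
  have bs: "bm1 (\<lambda>x. \<Sum>j\<in>{..<l}. c j * h j x)" by (rule bm1_sum[OF bm1_mult[OF bm1_const h]]) auto
  show be: "bm1 e" unfolding e_def by (rule bm1_diff[OF f bs])
  have gen: "(LINT x|M. e x * u x) = (LINT x|M. f x * u x) - (\<Sum>j<l. c j * (LINT x|M. h j x * u x))" if u: "bm1 u" for u
  proof -
    have i1: "integrable M (\<lambda>x. f x * u x)" by (rule bm1_integrable[OF bm1_mult[OF f u]])
    have i2: "integrable M (\<lambda>x. c j * (h j x * u x))" if "j < l" for j
      by (rule bm1_integrable[OF bm1_mult[OF bm1_const bm1_mult[OF h[OF that] u]]])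
    have "(LINT x|M. e x * u x) = (LINT x|M. f x * u x - (\<Sum>j<l. c j * (h j x * u x)))"
      unfolding e_def by (simp add: left_diff_distrib sum_distrib_right mult.assoc)
    also have "\<dots> = (LINT x|M. f x * u x) - (LINT x|M. (\<Sum>j<l. c j * (h j x * u x)))"
      by (rule Bochner_Integration.integral_diff[OF i1 Bochner_Integration.integrable_sum[OF i2]]) auto
    also have "(LINT x|M. (\<Sum>j<l. c j * (h j x * u x))) = (\<Sum>j<l. c j * (LINT x|M. h j x * u x))"
      by (subst Bochner_Integration.integral_sum[OF i2]) auto
    finally show ?thesis .
  qed
  show eo: "(LINT x|M. e x * h j x) = 0" if "j < l" for j
  proof -
    have "(\<Sum>i<l. c i * (LINT x|M. h i x * h j x)) = (\<Sum>i<l. if i = j then c i else 0)"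
      using orth that by (intro sum.cong) auto
    also have "\<dots> = c j" using that by simp
    finally show ?thesis using gen[OF h[OF that]] by (simp only: c_def diff_self)
  qed
  have "(LINT x|M. (e x)^2) = (LINT x|M. f x * e x) - (\<Sum>j<l. c j * (LINT x|M. h j x * e x))"
    using gen[OF be] by (simp add: power2_eq_square)
  also have "(\<Sum>j<l. c j * (LINT x|M. h j x * e x)) = 0" using eo by (simp add: mult.commute)
  also have "(LINT x|M. f x * e x) = (LINT x|M. f x * f x) - (\<Sum>j<l. c j * (LINT x|M. h j x * f x))"
    using gen[OF f] by (simp add: mult.commute)
  also have "(\<Sum>j<l. c j * (LINT x|M. h j x * f x)) = (\<Sum>j<l. (c j)^2)"
    by (simp add: c_def power2_eq_square mult.commute)
  finally show "(LINT x|M. (e x)^2) = (LINT x|M. (f x)^2) - (\<Sum>j<l. (c j)^2)" by (simp add: power2_eq_square)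
qed

text \<open>A dimension count without linear algebra. Bessel for each h j bounds the double sum of
  squared coefficients by l, so with m > l functions g i some g i has coefficient sum below 1. Its
  residual against the family h is then a nonzero eigenfunction orthogonal to h.\<close>

lemma bef_extend:
  assumes V: "bm2 V" and g: "bef V \<mu> m g" and h: "bef V \<mu> l h" and lm: "l < m"
  shows "\<exists>h'. bef V \<mu> (Suc l) h' \<and> (\<forall>i<l. h' i = h i)"
proof -
  define c where "c i j = (LINT x|M. g i x * h j x)" for i j
  have gb: "bm1 (g i)" "(LINT x|M. (g i x)^2) = 1" "kop V (g i) x = \<mu> * g i x" if "i < m" for i x
    using g that unfolding bef_def by (auto simp: power2_eq_square)
  have hb: "bm1 (h i)" "(LINT x|M. (h i x)^2) = 1" "kop V (h i) x = \<mu> * h i x" if "i < l" for i x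
    using h that unfolding bef_def by (auto simp: power2_eq_square)
  have bessel: "(\<Sum>i<m. (c i j)^2) \<le> 1" if "j < l" for j
  proof -
    have "0 \<le> (LINT x|M. (h j x - (\<Sum>i<m. (LINT x|M. h j x * g i x) * g i x))^2)" by simp
    also have "\<dots> = (LINT x|M. (h j x)^2) - (\<Sum>i<m. (LINT x|M. h j x * g i x)^2)"
      by (rule residual_norm(3)[OF hb(1)[OF that] gb(1)]) (use g in \<open>auto simp: bef_def\<close>)
    finally show ?thesis using hb(2)[OF that] by (simp add: c_def mult.commute)
  qed
  have "(\<Sum>i<m. \<Sum>j<l. (c i j)^2) = (\<Sum>j<l. \<Sum>i<m. (c i j)^2)" by (rule sum.swap)
  also have "\<dots> \<le> (\<Sum>j<l. 1)" using bessel by (intro sum_mono) auto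
  also have "\<dots> < (\<Sum>i<m. 1::real)" using lm by simp
  finally obtain i where i: "i < m" "(\<Sum>j<l. (c i j)^2) < 1"
    by (metis (no_types, lifting) lessThan_iff linorder_not_less sum_mono)
  define e where "e x = g i x - (\<Sum>j<l. c i j * h j x)" for x
  have ho: "\<And>i j. i < l ==> j < l ==> (LINT x|M. h i x * h j x) = (if i = j then 1 else (0::real))"
    using h unfolding bef_def by auto
  note rn = residual_norm[where f="g i" and h=h and l=l, folded c_def, folded e_def]
  have r: "bm1 e" "\<And>j. j < l ==> (LINT x|M. e x * h j x) = 0"
     "(LINT x|M. (e x)^2) = (LINT x|M. (g i x)^2) - (\<Sum>j<l. (c i j)^2)"
    by (rule rn; (rule gb(1)[OF i(1)] | erule hb(1) | erule (1) ho | assumption))+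
  have "kop V e x = \<mu> * e x" for x
  proof -
    have i1: "integrable M (\<lambda>y. V x y * g i y)" by (rule bm1_integrable[OF bm1_mult[OF bm2_sec1[OF V] gb(1)[OF i(1)]]])
    have i2: "integrable M (\<lambda>y. c i j * (V x y * h j y))" if "j < l" for j
      by (rule bm1_integrable[OF bm1_mult[OF bm1_const bm1_mult[OF bm2_sec1[OF V] hb(1)[OF that]]]])
    have "kop V e x = (LINT y|M. V x y * g i y - (\<Sum>j<l. c i j * (V x y * h j y)))"
      unfolding e_def by (simp add: right_diff_distrib sum_distrib_left ac_simps)
    also have "\<dots> = kop V (g i) x - (LINT y|M. (\<Sum>j<l. c i j * (V x y * h j y)))"
      by (rule Bochner_Integration.integral_diff[OF i1 Bochner_Integration.integrable_sum[OF i2]]) auto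
    also have "(LINT y|M. (\<Sum>j<l. c i j * (V x y * h j y))) = (\<Sum>j<l. c i j * kop V (h j) x)"
      by (subst Bochner_Integration.integral_sum[OF i2]) auto
    also have "(\<Sum>j<l. c i j * kop V (h j) x) = (\<Sum>j<l. \<mu> * (c i j * h j x))"
      by (intro sum.cong refl) (simp only: hb(3) lessThan_iff mult.left_commute)
    also have "kop V (g i) x = \<mu> * g i x" by (rule gb(3)[OF i(1)])
    finally show ?thesis by (simp only: e_def right_diff_distrib sum_distrib_left)
  qed
  moreover have "(LINT x|M. (e x)^2) > 0" using r(3) gb(2)[OF i(1)] i(2) by simp
  ultimately show ?thesis by (intro bef_snoc[OF h r(1) _ r(2)])
qed

text \<open>Used to complete a prescribed function, the constant one, to a full orthonormal family
  for its eigenvalue.\<close>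

lemma bef_extend_to:
  assumes V: "bm2 V" and g: "bef V \<mu> m g" and h: "bef V \<mu> l h" and lm: "l \<le> m"
  shows "\<exists>h'. bef V \<mu> m h' \<and> (\<forall>i<l. h' i = h i)"
  using lm
proof (induction rule: dec_induct)
  case base then show ?case using h by blast
next
  case (step n)
  then obtain h' where h': "bef V \<mu> n h'" "\<forall>i<l. h' i = h i" by blast
  obtain h'' where "bef V \<mu> (Suc n) h''" "\<forall>i<n. h'' i = h' i" using bef_extend[OF V g h'(1)] step by blast
  then show ?case using h' step by (intro exI[of _ h'']) auto
qed

end

section \<open>Eigenvalue multiplicities of kernels on the unit interval\<close>

lemma kernel_space_unif: "kernel_space unif"
proof -
  have "prob_space unif" by (rule prob_space_uniform_measure) auto
  then show ?thesis unfolding kernel_space_def kernel_space_axioms_def by simp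
qed

interpretation U: kernel_space unif by (rule kernel_space_unif)

lemma measurable_unif_borel[simp]: "measurable unif N = measurable borel N"
  by (rule measurable_cong_sets) auto

lemma integrable_mult_L2:
  fixes f g :: "real => real"
  assumes [measurable]: "f \<in> borel_measurable N" "g \<in> borel_measurable N"
    and "integrable N (\<lambda>x. (f x)^2)" "integrable N (\<lambda>x. (g x)^2)"
  shows "integrable N (\<lambda>x. f x * g x)"
proof (rule Bochner_Integration.integrable_bound[of _ "\<lambda>x. (f x)^2 + (g x)^2"])
  show "integrable N (\<lambda>x. (f x)^2 + (g x)^2)" using assms by simp
  have "\<bar>a * b\<bar> \<le> a^2 + b^2" for a b :: real
  proof -
    have "0 \<le> (\<bar>a\<bar> - \<bar>b\<bar>)^2" by simp
    then have "2 * (\<bar>a\<bar> * \<bar>b\<bar>) \<le> a^2 + b^2" by (simp add: power2_diff ac_simps)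
    moreover have "\<bar>a\<bar> * \<bar>b\<bar> \<ge> 0" by simp
    ultimately show ?thesis unfolding abs_mult by linarith
  qed
  then show "AE x in N. norm (f x * g x) \<le> norm ((f x)^2 + (g x)^2)" by (intro AE_I2) simp
qed simp

lemma bounded_eigenfunction:
  assumes V: "U.bm2 V" and \<mu>: "\<mu> \<noteq> 0" and f: "f \<in> borel_measurable borel" "integrable unif (\<lambda>x. (f x)^2)"
    and e: "AE x in unif. (LINT y|unif. V x y * f y) = \<mu> * f x"
  defines "g \<equiv> \<lambda>x. (1 / \<mu>) * (LINT y|unif. V x y * f y)"
  shows "U.bm1 g" "AE x in unif. g x = f x" "\<And>x. U.kop V g x = \<mu> * g x"
proof -
  obtain B where B: "\<And>x y. \<bar>V x y\<bar> \<le> B" using V by (auto simp: U.bm2_def)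
  have Vm: "V x \<in> borel_measurable borel" for x using U.bm1_measurable[OF U.bm2_sec1[OF V]] by simp
  have fi: "integrable unif f"
    using integrable_mult_L2[of f unif "\<lambda>_. 1"] f by simp
  have Vfi: "integrable unif (\<lambda>y. V x y * f y)" for x
  proof (rule Bochner_Integration.integrable_bound[of _ "\<lambda>y. B * f y"])
    show "integrable unif (\<lambda>y. B * f y)" using fi by simp
    show "(\<lambda>y. V x y * f y) \<in> borel_measurable unif" using Vm[of x] f(1) by simp
    have "\<bar>V x y * f y\<bar> \<le> \<bar>B * f y\<bar>" for y unfolding abs_mult
      using order_trans[OF B abs_ge_self] by (intro mult_right_mono) auto
    then show "AE y in unif. norm (V x y * f y) \<le> norm (B * f y)" by (intro AE_I2) simp
  qed
  have gm: "g \<in> borel_measurable unif"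
  proof -
    have "(\<lambda>(x, y). V x y * f y) \<in> borel_measurable (unif \<Otimes>\<^sub>M unif)"
      using U.bm2_measurable[OF V] f(1) by (auto simp: split_beta' intro!: borel_measurable_times measurable_compose[OF measurable_snd])
    then have "(\<lambda>x. (LINT y|unif. V x y * f y)) \<in> borel_measurable unif" by (rule U.borel_measurable_lebesgue_integral)
    then show ?thesis unfolding g_def by (rule borel_measurable_times[OF borel_measurable_const])
  qed
  have "\<bar>g x\<bar> \<le> \<bar>1 / \<mu>\<bar> * (\<bar>B\<bar> * (LINT y|unif. \<bar>f y\<bar>))" for x
  proof -
    have "\<bar>(LINT y|unif. V x y * f y)\<bar> \<le> (LINT y|unif. \<bar>V x y * f y\<bar>)" by (rule integral_abs_bound)
    also have "\<dots> \<le> (LINT y|unif. \<bar>B\<bar> * \<bar>f y\<bar>)"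
    proof (rule integral_mono)
      show "integrable unif (\<lambda>y. \<bar>V x y * f y\<bar>)" by (rule integrable_abs[OF Vfi])
      show "integrable unif (\<lambda>y. \<bar>B\<bar> * \<bar>f y\<bar>)" using integrable_abs[OF fi] by simp
      show "\<bar>V x y * f y\<bar> \<le> \<bar>B\<bar> * \<bar>f y\<bar>" for y unfolding abs_mult
        using order_trans[OF B abs_ge_self] by (intro mult_right_mono) auto
    qed
    finally show ?thesis unfolding g_def abs_mult[of "1 / \<mu>"] by (intro mult_left_mono) auto
  qed
  then show "U.bm1 g" unfolding U.bm1_def using gm by blast
  show ae: "AE x in unif. g x = f x" using e by eventually_elim (use \<mu> in \<open>simp add: g_def\<close>)
  \<comment> \<open>The operator does not distinguish g from f, which agree almost everywhere; its
    common value at x is \<mu> g x by the definition of g.\<close>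
  show "U.kop V g x = \<mu> * g x" for x
  proof -
    have "U.kop V g x = (LINT y|unif. V x y * f y)"
    proof (rule integral_cong_AE)
      show "(\<lambda>y. V x y * g y) \<in> borel_measurable unif" using Vm[of x] gm by simp
      show "(\<lambda>y. V x y * f y) \<in> borel_measurable unif" using Vm[of x] f(1) by simp
      show "AE y in unif. V x y * g y = V x y * f y" using ae by eventually_elim simp
    qed
    then show ?thesis using \<mu> by (simp add: g_def)
  qed
qed

lemma eig_mult_bef:
  assumes V: "U.bm2 V" and \<mu>: "\<mu> \<noteq> 0"
  shows "eig_mult V \<mu> = (SUP m \<in> {m. \<exists>g. U.bef V \<mu> m g}. enat m)"
proof -
  have "{m::nat. \<exists>f :: nat => real => real.
       (\<forall>i<m. f i \<in> borel_measurable borel \<and> integrable unif (\<lambda>x. (f i x)^2)) \<and>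
       (\<forall>i<m. \<forall>j<m. (LINT x|unif. f i x * f j x) = (if i = j then 1 else 0)) \<and>
       (\<forall>i<m. AE x in unif. (LINT y|unif. V x y * f i y) = \<mu> * f i x)} = {m. \<exists>g. U.bef V \<mu> m g}" (is "?A = ?B")
  proof (intro subset_antisym subsetI)
    fix m assume "m \<in> ?A"
    then obtain f where f: "\<And>i. i < m ==> f i \<in> borel_measurable borel" "\<And>i. i < m ==> integrable unif (\<lambda>x. (f i x)^2)"
      "\<And>i j. i < m ==> j < m ==> (LINT x|unif. f i x * f j x) = (if i = j then 1 else 0)"
      "\<And>i. i < m ==> AE x in unif. (LINT y|unif. V x y * f i y) = \<mu> * f i x" by blast
    define g where "g i x = (1 / \<mu>) * (LINT y|unif. V x y * f i y)" for i x
    note b = bounded_eigenfunction[OF V \<mu> f(1) f(2) f(4), folded g_def]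
    have "(LINT x|unif. g i x * g j x) = (if i = j then 1 else 0)" if ij: "i < m" "j < m" for i j
    proof -
      have "(LINT x|unif. g i x * g j x) = (LINT x|unif. f i x * f j x)"
      proof (rule integral_cong_AE)
        show "(\<lambda>x. g i x * g j x) \<in> borel_measurable unif"
          using U.bm1_measurable[OF U.bm1_mult[OF b(1)[OF ij(1) ij(1) ij(1)] b(1)[OF ij(2) ij(2) ij(2)]]] .
        show "(\<lambda>x. f i x * f j x) \<in> borel_measurable unif" using f(1)[OF ij(1)] f(1)[OF ij(2)] by simp
        show "AE x in unif. g i x * g j x = f i x * f j x"
          using b(2)[OF ij(1) ij(1) ij(1)] b(2)[OF ij(2) ij(2) ij(2)] by eventually_elim simp
      qed
      then show ?thesis using f(3)[OF ij] by simp
    qed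
    then have "U.bef V \<mu> m g" unfolding U.bef_def using b(1,3) by blast
    then show "m \<in> ?B" by blast
  next
    fix m assume "m \<in> ?B"
    then obtain g where g: "U.bef V \<mu> m g" by blast
    have "\<And>i. i < m ==> g i \<in> borel_measurable borel" "\<And>i. i < m ==> integrable unif (\<lambda>x. (g i x)^2)"
      using g U.bm1_measurable U.bm1_integrable[OF U.bm1_power2] unfolding U.bef_def by auto
    then show "m \<in> ?A" using g unfolding U.bef_def by (intro CollectI exI[of _ g]) auto
  qed
  then show ?thesis unfolding eig_mult_def by simp
qed

text \<open>A finite supremum of natural numbers is attained. This turns a multiplicity into an
  orthonormal family of exactly that size that cannot be enlarged.\<close>

lemma eig_mult_finiteD:
  assumes V: "U.bm2 V" and \<mu>: "\<mu> \<noteq> 0" and m: "eig_mult V \<mu> = enat m"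
  shows "\<exists>g. U.bef V \<mu> m g" and "\<And>l g. U.bef V \<mu> l g ==> l \<le> m"
proof -
  let ?A = "{m. \<exists>g. U.bef V \<mu> m g}"
  have S: "(SUP m \<in> ?A. enat m) = enat m" using eig_mult_bef[OF V \<mu>] m by simp
  show le: "l \<le> m" if "U.bef V \<mu> l g" for l g
  proof -
    have "enat l \<le> (SUP m \<in> ?A. enat m)" using that by (intro SUP_upper) auto
    then show ?thesis unfolding S by simp
  qed
  show "\<exists>g. U.bef V \<mu> m g"
  proof (rule ccontr)
    assume neg: "\<not> ?thesis"
    have "\<exists>g. U.bef V \<mu> 0 g" by (simp add: U.bef_def)
    with neg have m0: "m > 0" by (metis gr0I)
    have "(SUP m \<in> ?A. enat m) \<le> enat (m - 1)"
    proof (rule SUP_least)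
      fix l assume "l \<in> ?A"
      then have "l \<le> m" "l \<noteq> m" using le neg by auto
      then show "enat l \<le> enat (m - 1)" by simp
    qed
    then show False unfolding S using m0 by simp
  qed
qed

text \<open>The hypothesis only counts how often each value occurs in \<open>lam\<close>. For every
  nonzero value the indices carrying it are put in bijection with an orthonormal family of
  eigenfunctions; for t that family begins with the constant and the bijection skips it.
  Orthogonality across different eigenvalues is the symmetry of the operator.\<close>

lemma spectrum_enumeration:
  fixes V :: "real => real => real" and lam :: "nat => real"
  assumes V: "U.bm2 V" and sym: "\<And>x y. V x y = V y x" and t: "t \<noteq> 0"
    and one: "AE x in unif. (LINT y|unif. V x y) = t"
    and mult: "\<forall>\<mu>. \<mu> \<noteq> 0 \<longrightarrow> finite {i. lam i = \<mu>} \<and> enat (card {i. lam i = \<mu>}) = eig_mult V \<mu> - (if \<mu> = t then 1 else 0)"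
  shows "\<exists>\<phi>. (\<forall>k. U.bm1 (\<phi> k)) \<and>
     (\<forall>i j. lam i \<noteq> 0 \<longrightarrow> lam j \<noteq> 0 \<longrightarrow> (LINT x|unif. \<phi> i x * \<phi> j x) = (if i = j then 1 else 0)) \<and>
     (\<forall>k. lam k \<noteq> 0 \<longrightarrow> (LINT x|unif. \<phi> k x) = 0) \<and>
     (\<forall>k x. lam k \<noteq> 0 \<longrightarrow> U.kop V (\<phi> k) x = lam k * \<phi> k x) \<and>
     (\<forall>\<mu> \<psi>. \<mu> \<noteq> 0 \<longrightarrow> U.bm1 \<psi> \<longrightarrow> (LINT x|unif. \<psi> x) = 0 \<longrightarrow> (\<forall>x. U.kop V \<psi> x = \<mu> * \<psi> x) \<longrightarrow>
        (\<forall>k. lam k = \<mu> \<longrightarrow> (LINT x|unif. \<psi> x * \<phi> k x) = 0) \<longrightarrow> (LINT x|unif. (\<psi> x)^2) = 0)"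
proof -
  \<comment> \<open>A bounded version of the constant 1 for which the eigenvalue equation holds at
    every point; regularity gives it only almost everywhere. Integrating against u is taking the
    mean.\<close>
  define u where "u x = (1 / t) * (LINT y|unif. V x y * 1)" for x
  note u = bounded_eigenfunction[OF V t, of "\<lambda>_. 1", folded u_def]
  have ub: "U.bm1 u" "AE x in unif. u x = 1" "\<And>x. U.kop V u x = t * u x" using u one by auto
  have uint: "(LINT x|unif. f x * u x) = (LINT x|unif. f x)" if "U.bm1 f" for f
  proof (rule integral_cong_AE)
    show "(\<lambda>x. f x * u x) \<in> borel_measurable unif" by (rule U.bm1_measurable[OF U.bm1_mult[OF that ub(1)]])
    show "f \<in> borel_measurable unif" by (rule U.bm1_measurable[OF that])
    show "AE x in unif. f x * u x = f x" using ub(2) by eventually_elim simp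
  qed
  have uu: "(LINT x|unif. u x * u x) = 1"
  proof -
    have "(LINT x|unif. u x * u x) = (LINT x|unif. 1 * u x)" using uint[OF ub(1)] by simp
    also have "\<dots> = 1" using uint[OF U.bm1_const, of 1] by simp
    finally show ?thesis .
  qed
  have bu: "U.bef V t 1 (\<lambda>_. u)" unfolding U.bef_def using ub uu by simp
  \<comment> \<open>The shift past the position of u in the family of t; it restores the
    multiplicity that Spec^- takes away.\<close>
  define off :: "real => nat" where "off \<mu> = (if \<mu> = t then 1 else 0)" for \<mu>
  define cc where "cc \<mu> = card {i. lam i = \<mu>}" for \<mu>
  have em: "eig_mult V \<mu> = enat (cc \<mu> + off \<mu>)" if "\<mu> \<noteq> 0" for \<mu>
  proof -
    have e: "enat (cc \<mu>) = eig_mult V \<mu> - (if \<mu> = t then 1 else 0)" using mult[rule_format, OF that] by (simp add: cc_def)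
    show ?thesis
    proof (cases "\<mu> = t")
      case True
      have "enat 1 \<le> eig_mult V t" unfolding eig_mult_bef[OF V t] using bu by (intro SUP_upper) auto
      then show ?thesis using e True by (cases "eig_mult V t") (auto simp: off_def one_enat_def)
    next
      case False then show ?thesis using e by (simp add: off_def)
    qed
  qed
  have "\<exists>h. U.bef V \<mu> (cc \<mu> + off \<mu>) h \<and> (\<mu> = t \<longrightarrow> h 0 = u)" if \<mu>: "\<mu> \<noteq> 0" for \<mu>
  proof -
    obtain g where g: "U.bef V \<mu> (cc \<mu> + off \<mu>) g" using eig_mult_finiteD(1)[OF V \<mu> em[OF \<mu>]] by blast
    show ?thesis
    proof (cases "\<mu> = t")
      case True
      then show ?thesis using U.bef_extend_to[OF V g, of 1 "\<lambda>_. u"] bu by (auto simp: off_def)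
    qed (use g in auto)
  qed
  then obtain h where h: "\<And>\<mu>. \<mu> \<noteq> 0 ==> U.bef V \<mu> (cc \<mu> + off \<mu>) (h \<mu>)" "h t 0 = u" using t by metis
  have "\<exists>\<beta>. bij_betw \<beta> {i. lam i = \<mu>} {0..<cc \<mu>}" if "\<mu> \<noteq> 0" for \<mu>
    using ex_bij_betw_finite_nat[of "{i. lam i = \<mu>}"] mult[rule_format, OF that] unfolding cc_def by blast
  then obtain \<beta> where \<beta>: "\<And>\<mu>. \<mu> \<noteq> 0 ==> bij_betw (\<beta> \<mu>) {i. lam i = \<mu>} {0..<cc \<mu>}" by metis
  define ix where "ix k = \<beta> (lam k) k + off (lam k)" for k
  have ix: "ix k < cc (lam k) + off (lam k)" if "lam k \<noteq> 0" for k
    using bij_betwE[OF \<beta>[OF that]] by (auto simp: ix_def)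
  define \<phi> where "\<phi> k = (if lam k = 0 then (\<lambda>_. 0) else h (lam k) (ix k))" for k
  have b: "U.bm1 (\<phi> k)" for k
    using h(1)[of "lam k"] ix[of k] by (auto simp: \<phi>_def U.bef_def)
  have e: "U.kop V (\<phi> k) x = lam k * \<phi> k x" if "lam k \<noteq> 0" for k x
    using h(1)[OF that] ix[OF that] that by (auto simp: \<phi>_def U.bef_def)
  have ixinj: "i = j" if "lam i = lam j" "lam i \<noteq> 0" "ix i = ix j" for i j
    using \<beta>[OF that(2)] that unfolding bij_betw_def inj_on_def ix_def by auto
  have o: "(LINT x|unif. \<phi> i x * \<phi> j x) = (if i = j then 1 else 0)" if ij: "lam i \<noteq> 0" "lam j \<noteq> 0" for i j
  proof (cases "lam i = lam j")
    case True
    then have "(LINT x|unif. \<phi> i x * \<phi> j x) = (if ix i = ix j then 1 else 0)"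
      using h(1)[OF ij(1)] ix[OF ij(1)] ix[OF ij(2)] ij by (auto simp: \<phi>_def U.bef_def)
    then show ?thesis using ixinj[OF True ij(1)] by auto
  next
    case False
    have "lam i * (LINT x|unif. \<phi> i x * \<phi> j x) = (LINT x|unif. U.kop V (\<phi> i) x * \<phi> j x)" unfolding e[OF ij(1)] by (simp add: mult.assoc)
    also have "\<dots> = (LINT x|unif. \<phi> i x * U.kop V (\<phi> j) x)" by (rule U.kop_sym[OF V sym b b])
    also have "\<dots> = (LINT x|unif. lam j * (\<phi> i x * \<phi> j x))" unfolding e[OF ij(2)] by (simp add: ac_simps)
    also have "\<dots> = lam j * (LINT x|unif. \<phi> i x * \<phi> j x)" by simp
    finally have "(lam i - lam j) * (LINT x|unif. \<phi> i x * \<phi> j x) = 0" by (simp add: left_diff_distrib)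
    then show ?thesis using False by auto
  qed
  have z: "(LINT x|unif. \<phi> k x) = 0" if k: "lam k \<noteq> 0" for k
  proof (cases "lam k = t")
    case True
    have "(LINT x|unif. \<phi> k x * u x) = (LINT x|unif. h t (ix k) x * h t 0 x)" using True h(2) t by (simp add: \<phi>_def)
    also have "\<dots> = 0" using h(1)[OF t] ix[OF k] True by (auto simp: U.bef_def ix_def off_def)
    finally show ?thesis using uint[OF b] by simp
  next
    case False
    have "lam k * (LINT x|unif. \<phi> k x * u x) = (LINT x|unif. U.kop V (\<phi> k) x * u x)" unfolding e[OF k] by (simp add: mult.assoc)
    also have "\<dots> = (LINT x|unif. \<phi> k x * U.kop V u x)" by (rule U.kop_sym[OF V sym b ub(1)])
    also have "\<dots> = (LINT x|unif. t * (\<phi> k x * u x))" unfolding ub(3) by (simp add: ac_simps)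
    also have "\<dots> = t * (LINT x|unif. \<phi> k x * u x)" by simp
    finally have "(lam k - t) * (LINT x|unif. \<phi> k x * u x) = 0" by (simp add: left_diff_distrib)
    then show ?thesis using False uint[OF b] by auto
  qed
  have mx: "(LINT x|unif. (\<psi> x)^2) = 0" if \<mu>: "\<mu> \<noteq> 0" and \<psi>: "U.bm1 \<psi>" "(LINT x|unif. \<psi> x) = 0" "\<And>x. U.kop V \<psi> x = \<mu> * \<psi> x"
     "\<And>k. lam k = \<mu> ==> (LINT x|unif. \<psi> x * \<phi> k x) = 0" for \<mu> \<psi>
  proof (rule ccontr)
    assume ne: "(LINT x|unif. (\<psi> x)^2) \<noteq> 0"
    have "(LINT x|unif. (\<psi> x)^2) \<ge> 0" by simp
    with ne have pos: "(LINT x|unif. (\<psi> x)^2) > 0" by linarith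
    have orth: "(LINT x|unif. \<psi> x * h \<mu> i x) = 0" if i: "i < cc \<mu> + off \<mu>" for i
    proof (cases "i < off \<mu>")
      case True
      then have "\<mu> = t" "i = 0" by (auto simp: off_def split: if_splits)
      then show ?thesis using uint[OF \<psi>(1)] \<psi>(2) h(2) by simp
    next
      case False
      then have "i - off \<mu> \<in> {0..<cc \<mu>}" using i by auto
      then have "i - off \<mu> \<in> \<beta> \<mu> ` {i. lam i = \<mu>}" using \<beta>[OF \<mu>] by (simp add: bij_betw_def)
      then obtain k where k: "lam k = \<mu>" "\<beta> \<mu> k = i - off \<mu>" by auto
      then have "\<phi> k = h \<mu> i" using False \<mu> by (simp add: \<phi>_def ix_def)
      then show ?thesis using \<psi>(4)[OF k(1)] by simp
    qed
    \<comment> \<open>A further eigenfunction orthogonal to the whole family would exceed the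
      multiplicity.\<close>
    obtain g where "U.bef V \<mu> (Suc (cc \<mu> + off \<mu>)) g" using U.bef_snoc[OF h(1)[OF \<mu>] \<psi>(1) pos orth \<psi>(3)] by blast
    from eig_mult_finiteD(2)[OF V \<mu> em[OF \<mu>] this] show False by simp
  qed
  show ?thesis
    by (intro exI[of _ \<phi>] conjI allI impI b o z e mx) auto
qed

text \<open>Subtracting t annihilates the constants and changes nothing on functions of mean zero.
  The nonzero spectrum of V - t is thus that of V with one copy of t removed, and the general
  expansion applies to this kernel.\<close>

lemma graphon_spectral_expansion:
  fixes V :: "real => real => real" and lam :: "nat => real"
  assumes V: "U.bm2 V" and sym: "\<And>x y. V x y = V y x" and t: "t \<noteq> 0"
    and one: "AE x in unif. (LINT y|unif. V x y) = t"
    and mult: "\<forall>\<mu>. \<mu> \<noteq> 0 \<longrightarrow> finite {i. lam i = \<mu>} \<and> enat (card {i. lam i = \<mu>}) = eig_mult V \<mu> - (if \<mu> = t then 1 else 0)"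
  obtains \<phi> where "\<And>k. U.bm1 (\<phi> k)"
    "\<And>i j. lam i \<noteq> 0 ==> lam j \<noteq> 0 ==> (LINT x|unif. \<phi> i x * \<phi> j x) = (if i = j then 1 else 0)"
    "\<And>k. lam k \<noteq> 0 ==> (LINT x|unif. \<phi> k x) = 0"
    "summable (\<lambda>k. (lam k)^2)"
    "(\<lambda>N. (LINT x|unif. (LINT y|unif. (V x y - t - (\<Sum>k<N. lam k * (\<phi> k x * \<phi> k y)))^2))) \<longlonglongrightarrow> 0"
proof -
  from spectrum_enumeration[OF V sym t one mult]
  obtain \<phi> where p: "\<forall>k. U.bm1 (\<phi> k)"
     "\<forall>i j. lam i \<noteq> 0 \<longrightarrow> lam j \<noteq> 0 \<longrightarrow> (LINT x|unif. \<phi> i x * \<phi> j x) = (if i = j then 1 else 0)"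
     "\<forall>k. lam k \<noteq> 0 \<longrightarrow> (LINT x|unif. \<phi> k x) = 0"
     "\<forall>k x. lam k \<noteq> 0 \<longrightarrow> U.kop V (\<phi> k) x = lam k * \<phi> k x"
     and mx: "\<forall>\<mu> \<psi>. \<mu> \<noteq> 0 \<longrightarrow> U.bm1 \<psi> \<longrightarrow> (LINT x|unif. \<psi> x) = 0 \<longrightarrow> (\<forall>x. U.kop V \<psi> x = \<mu> * \<psi> x) \<longrightarrow>
        (\<forall>k. lam k = \<mu> \<longrightarrow> (LINT x|unif. \<psi> x * \<phi> k x) = 0) \<longrightarrow> (LINT x|unif. (\<psi> x)^2) = 0"
    by (elim exE conjE)
  note \<phi> = p[rule_format]
  define K where "K x y = V x y - t" for x y
  have bK: "U.bm2 K" unfolding K_def by (rule U.bm2_diff[OF V U.bm2_const])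
  have symK: "K x y = K y x" for x y unfolding K_def using sym by simp
  have kopK: "U.kop K \<psi> x = U.kop V \<psi> x - t * (LINT y|unif. \<psi> y)" if "U.bm1 \<psi>" for \<psi> x
    unfolding K_def left_diff_distrib
    using U.bm1_integrable[OF U.bm1_mult[OF U.bm2_sec1[OF V] that]] U.bm1_integrable[OF that] by simp
  have "U.kop V (\<lambda>_. 1) x = (LINT y|unif. V x y)" for x by simp
  \<comment> \<open>The range of V - t consists of functions of mean zero, by symmetry and constancy
    of the degree. Hence an eigenfunction for a nonzero eigenvalue has mean zero and is also one of
    V.\<close>
  have mean0: "(LINT x|unif. U.kop K \<psi> x) = 0" if \<psi>: "U.bm1 \<psi>" for \<psi>
  proof -
    have "(LINT x|unif. U.kop V \<psi> x * 1) = (LINT x|unif. \<psi> x * U.kop V (\<lambda>_. 1) x)"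
      by (rule U.kop_sym[OF V sym \<psi> U.bm1_const])
    also have "\<dots> = (LINT x|unif. t * \<psi> x)"
    proof (rule integral_cong_AE)
      show "(\<lambda>x. \<psi> x * U.kop V (\<lambda>_. 1) x) \<in> borel_measurable unif"
        by (rule U.bm1_measurable[OF U.bm1_mult[OF \<psi> U.bm1_kop[OF V U.bm1_const]]])
      show "(\<lambda>x. t * \<psi> x) \<in> borel_measurable unif" by (rule U.bm1_measurable[OF U.bm1_mult[OF U.bm1_const \<psi>]])
      show "AE x in unif. \<psi> x * U.kop V (\<lambda>_. 1) x = t * \<psi> x" using one by eventually_elim simp
    qed
    finally have 1: "(LINT x|unif. U.kop V \<psi> x) = t * (LINT x|unif. \<psi> x)" by simp
    show ?thesis unfolding kopK[OF \<psi>]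
      using U.bm1_integrable[OF U.bm1_kop[OF V \<psi>]] 1 by simp
  qed
  have e: "U.kop K (\<phi> k) x = lam k * \<phi> k x" if "lam k \<noteq> 0" for k x
    using kopK[OF \<phi>(1)[of k], of x] \<phi>(3,4)[OF that] by simp
  have mK: "(LINT x|unif. (\<psi> x)^2) = 0" if \<mu>: "\<mu> \<noteq> 0" and \<psi>: "U.bm1 \<psi>" "\<forall>x. U.kop K \<psi> x = \<mu> * \<psi> x"
     "\<forall>k. lam k = \<mu> \<longrightarrow> (LINT x|unif. \<psi> x * \<phi> k x) = 0" for \<mu> \<psi>
  proof -
    have "\<mu> * (LINT x|unif. \<psi> x) = 0" using mean0[OF \<psi>(1)] \<psi>(2) by simp
    then have "(LINT x|unif. \<psi> x) = 0" using \<mu> by simp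
    moreover from this have "\<forall>x. U.kop V \<psi> x = \<mu> * \<psi> x" using kopK[OF \<psi>(1)] \<psi>(2) by simp
    ultimately show ?thesis using mx \<mu> \<psi>(1) \<psi>(3) by simp
  qed
  note sd = U.spectral_decomposition[OF bK symK \<phi>(1) \<phi>(2) e mK]
  show ?thesis
  proof (rule that[OF \<phi>(1,2,3)])
    show "summable (\<lambda>k. (lam k)^2)" by (rule sd(1))
    show "(\<lambda>N. (LINT x|unif. (LINT y|unif. (V x y - t - (\<Sum>k<N. lam k * (\<phi> k x * \<phi> k y)))^2))) \<longlonglongrightarrow> 0"
      using sd(2) unfolding U.ip2_def K_def power2_eq_square .
  qed
qed

section \<open>Limits of finite-rank quadratic forms\<close>

definition qf :: "('a => 'a => real) => 'i set => ('i => 'a) => real" where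
  "qf \<kappa> I x = (\<Sum>i\<in>I. \<Sum>j\<in>I - {i}. \<kappa> (x i) (x j)) / 2"

text \<open>Isolates the dependence on a single coordinate. For a finite-rank kernel it is linear in
  the values p k at that coordinate, which is what allows the exchange of one coordinate at a
  time.\<close>

lemma qf_insert:
  assumes J: "finite J" "m \<notin> J" and sym: "\<And>x y. \<kappa> x y = \<kappa> y x"
  shows "qf \<kappa> (insert m J) x = qf \<kappa> J x + (\<Sum>j\<in>J. \<kappa> (x m) (x j))"
proof -
  have 1: "(\<Sum>j\<in>insert m J - {i}. \<kappa> (x i) (x j)) = (\<Sum>j\<in>J - {i}. \<kappa> (x i) (x j)) + \<kappa> (x i) (x m)" if "i \<in> J" for i
  proof -
    have "insert m J - {i} = insert m (J - {i})" using that J by auto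
    then show ?thesis using J by simp
  qed
  have "insert m J - {m} = J" using J by auto
  then have "(\<Sum>i\<in>insert m J. \<Sum>j\<in>insert m J - {i}. \<kappa> (x i) (x j)) =
     (\<Sum>j\<in>J. \<kappa> (x m) (x j)) + (\<Sum>i\<in>J. (\<Sum>j\<in>J - {i}. \<kappa> (x i) (x j)) + \<kappa> (x i) (x m))"
    using J 1 by simp
  also have "\<dots> = (\<Sum>i\<in>J. \<Sum>j\<in>J - {i}. \<kappa> (x i) (x j)) + 2 * (\<Sum>j\<in>J. \<kappa> (x m) (x j))"
    by (simp add: sum.distrib sym[of _ "x m"])
  finally show ?thesis by (simp add: qf_def)
qed

lemma qf_cong: "(\<And>i. i \<in> I ==> x i = y i) ==> qf \<kappa> I x = qf \<kappa> I y"
  unfolding qf_def by (intro arg_cong[where f="\<lambda>x. x / 2"] sum.cong refl) auto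

lemma sum_power4_le:
  fixes a :: "'i => real"
  assumes "finite J"
  shows "(\<Sum>j\<in>J. a j) ^ 4 \<le> (real (card J)) ^ 3 * (\<Sum>j\<in>J. (a j) ^ 4)"
proof -
  have CS: "(\<Sum>j\<in>J. f j)^2 \<le> real (card J) * (\<Sum>j\<in>J. (f j)^2)" for f :: "'i => real"
    using Cauchy_Schwarz_ineq_sum[of "\<lambda>_. 1" f J] by simp
  have "(\<Sum>j\<in>J. a j) ^ 4 = ((\<Sum>j\<in>J. a j)^2)^2" by simp
  also have "\<dots> \<le> (real (card J) * (\<Sum>j\<in>J. (a j)^2))^2" by (intro power_mono CS) auto
  also have "\<dots> = (real (card J))^2 * (\<Sum>j\<in>J. (a j)^2)^2" by (simp add: power_mult_distrib)
  also have "\<dots> \<le> (real (card J))^2 * (real (card J) * (\<Sum>j\<in>J. ((a j)^2)^2))" by (intro mult_left_mono CS) auto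
  also have "\<dots> = (real (card J)) ^ 3 * (\<Sum>j\<in>J. (a j) ^ 4)"
    by (simp add: power2_eq_square[of "real (card J)"] power3_eq_cube mult.assoc)
  finally show ?thesis .
qed

lemma abs_power_le4: "k \<le> 4 ==> \<bar>z ^ k\<bar> \<le> 1 + z ^ 4" for z :: real
proof (cases "\<bar>z\<bar> \<le> 1")
  case True
  then have "\<bar>z\<bar> ^ k \<le> 1" by (intro power_le_one) auto
  then show ?thesis by (simp add: power_abs add_increasing2)
next
  case False
  assume "k \<le> 4"
  then have "\<bar>z\<bar> ^ k \<le> \<bar>z\<bar> ^ 4" using False by (intro power_increasing) auto
  then show ?thesis by (simp add: power_abs power_even_abs)
qed

lemma (in prob_space) integrable_power_le4:
  fixes f :: "'a => real"
  assumes [measurable]: "f \<in> borel_measurable M" and "integrable M (\<lambda>x. f x ^ 4)" "k \<le> 4"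
  shows "integrable M (\<lambda>x. f x ^ k)"
proof (rule Bochner_Integration.integrable_bound[of _ "\<lambda>x. 1 + f x ^ 4"])
  show "AE x in M. norm (f x ^ k) \<le> norm (1 + f x ^ 4)"
    using abs_power_le4[OF assms(3)] by (intro AE_I2) (simp add: abs_of_nonneg)
qed (use assms in auto)

lemma integrable_PiM_component:
  fixes q :: "'a => 'b::{banach, second_countable_topology}"
  assumes "\<And>i. i \<in> I ==> prob_space (D i)" "j \<in> I" "integrable (D j) q"
  shows "integrable (PiM I D) (\<lambda>x. q (x j))" "(LINT x|PiM I D. q (x j)) = (LINT y|D j. q y)"
proof -
  have d: "distr (PiM I D) (D j) (\<lambda>\<omega>. \<omega> j) = D j" by (rule distr_PiM_component) (use assms in auto)
  have m: "(\<lambda>\<omega>. \<omega> j) \<in> measurable (PiM I D) (D j)" using assms by (intro measurable_component_singleton)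
  have q: "q \<in> borel_measurable (D j)" using assms by auto
  show "integrable (PiM I D) (\<lambda>x. q (x j))"
    using integrable_distr_eq[OF m q] d assms by simp
  show "(LINT x|PiM I D. q (x j)) = (LINT y|D j. q y)"
    using integral_distr[OF m q] d by simp
qed

text \<open>Induction on J, integrating out the last coordinate: odd moments of the partial sum meet
  mean zero and only 6 s^2 and the fourth moment remain. The laws may differ between coordinates
  because the exchange argument works with mixed arrays.\<close>

lemma PiM_sum_moments:
  fixes p :: "'e => real" and D :: "'i => 'e measure"
  assumes pr: "\<And>i. prob_space (D i)" and pm: "\<And>i. p \<in> borel_measurable (D i)"
    and i4: "\<And>i. integrable (D i) (\<lambda>x. p x ^ 4)" and m1: "\<And>i. (LINT x|D i. p x) = 0"
    and m2: "\<And>i. (LINT x|D i. (p x)^2) = 1" and m4: "\<And>i. (LINT x|D i. p x ^ 4) \<le> c" and c: "c \<ge> 1"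
    and J: "finite J"
  shows "integrable (PiM J D) (\<lambda>x. (\<Sum>j\<in>J. p (x j)) ^ 4)"
    and "(LINT x|PiM J D. (\<Sum>j\<in>J. p (x j)) ^ 4) \<le> 3 * c * (real (card J))^2"
proof -
  define s where "s J x = (\<Sum>j\<in>J. p (x j))" for J and x :: "'i => 'e"
  have prP: "prob_space (PiM J D)" for J by (rule prob_space_PiM[OF pr])
  have sm: "s J \<in> borel_measurable (PiM J D)" for J
    unfolding s_def
    by (intro borel_measurable_sum) (rule measurable_compose[OF measurable_component_singleton], assumption, rule pm)
  have s4: "integrable (PiM J D) (\<lambda>x. s J x ^ 4)" if "finite J" for J
  proof (rule Bochner_Integration.integrable_bound[of _ "\<lambda>x. (real (card J)) ^ 3 * (\<Sum>j\<in>J. (p (x j)) ^ 4)"])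
    show "integrable (PiM J D) (\<lambda>x. (real (card J)) ^ 3 * (\<Sum>j\<in>J. (p (x j)) ^ 4))"
      by (intro integrable_mult_right Bochner_Integration.integrable_sum integrable_PiM_component pr i4)
    show "(\<lambda>x. s J x ^ 4) \<in> borel_measurable (PiM J D)" using sm by (intro borel_measurable_power)
    show "AE x in PiM J D. norm (s J x ^ 4) \<le> norm ((real (card J)) ^ 3 * (\<Sum>j\<in>J. (p (x j)) ^ 4))"
      using sum_power4_le[OF that, of "\<lambda>j. p (_ j)"] by (intro AE_I2) (simp add: s_def abs_of_nonneg sum_nonneg)
  qed
  have sk: "integrable (PiM J D) (\<lambda>x. s J x ^ k)" if "finite J" "k \<le> 4" for J k
    by (rule prob_space.integrable_power_le4[OF prP sm s4[OF that(1)] that(2)])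
  have pk: "integrable (D i) (\<lambda>x. p x ^ k)" if "k \<le> 4" for i k
    by (rule prob_space.integrable_power_le4[OF pr pm i4 that])
  interpret product_sigma_finite D
    by (intro product_sigma_finite.intro prob_space_imp_sigma_finite pr)
  have step: "(LINT x|PiM (insert i J) D. s (insert i J) x ^ k) = (LINT x|PiM J D. (LINT y|D i. (s J x + p y) ^ k))"
    if J: "finite J" "i \<notin> J" and k: "k \<le> 4" for i J k
  proof -
    have "(LINT x|PiM (insert i J) D. s (insert i J) x ^ k) = (LINT x|PiM J D. (LINT y|D i. s (insert i J) (x(i := y)) ^ k))"
      by (rule product_integral_insert) (use J sk[of "insert i J" k] k in auto)
    moreover have "s (insert i J) (x(i := y)) = s J x + p y" for x y
    proof -
      have "(\<Sum>j\<in>J. p ((x(i := y)) j)) = (\<Sum>j\<in>J. p (x j))" using J by (intro sum.cong) auto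
      then show ?thesis using J by (simp add: s_def)
    qed
    ultimately show ?thesis by simp
  qed
  have mom: "(LINT x|PiM J D. s J x) = 0 \<and> (LINT x|PiM J D. (s J x)^2) = card J \<and>
     (LINT x|PiM J D. s J x ^ 4) \<le> 3 * c * (real (card J))^2" if "finite J" for J
    using that
  proof (induction J)
    case empty
    then show ?case by (simp add: s_def)
  next
    case (insert i J)
    interpret P: prob_space "PiM J D" by (rule prP)
    interpret Di: prob_space "D i" by (rule pr)
    have p1: "integrable (D i) p" using pk[of 1 i] by simp
    note pks = p1 pk[of 2 i] pk[of 3 i] pk[of 4 i]
    note sks = sk[OF insert(1), of 1] sk[OF insert(1), of 2] sk[OF insert(1), of 3] sk[OF insert(1), of 4]
    have s1: "integrable (PiM J D) (s J)" using sk[OF insert(1), of 1] by simp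
    have e1: "(LINT y|D i. s J x + p y) = s J x" for x using p1 m1[of i] by (simp add: Di.prob_space)
    have e2: "(LINT y|D i. (s J x + p y)^2) = (s J x)^2 + 1" for x
    proof -
      have "(LINT y|D i. (s J x + p y)^2) = (LINT y|D i. (s J x)^2 + 2 * s J x * p y + (p y)^2)"
        by (intro Bochner_Integration.integral_cong) (auto simp: power2_eq_square algebra_simps)
      also have "\<dots> = (s J x)^2 + 1" using pks m1[of i] m2[of i] by (simp add: Di.prob_space)
      finally show ?thesis .
    qed
    define m3 where "m3 = (LINT y|D i. p y ^ 3)"
    have e4: "(LINT y|D i. (s J x + p y) ^ 4) = s J x ^ 4 + 6 * (s J x)^2 + 4 * m3 * s J x + (LINT y|D i. p y ^ 4)" for x
    proof -
      have "(LINT y|D i. (s J x + p y) ^ 4) = (LINT y|D i. s J x ^ 4 + 4 * s J x ^ 3 * p y + 6 * (s J x)^2 * (p y)^2 + 4 * s J x * p y ^ 3 + p y ^ 4)"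
        by (intro Bochner_Integration.integral_cong) (auto simp: power2_eq_square power3_eq_cube power4_eq_xxxx algebra_simps)
      also have "\<dots> = s J x ^ 4 + 6 * (s J x)^2 + 4 * m3 * s J x + (LINT y|D i. p y ^ 4)"
        using pks m1[of i] m2[of i] by (simp add: Di.prob_space m3_def)
      finally show ?thesis .
    qed
    have "(LINT x|PiM (insert i J) D. s (insert i J) x) = 0"
      using step[of J i 1] insert e1 by simp
    moreover have "(LINT x|PiM (insert i J) D. (s (insert i J) x)^2) = card (insert i J)"
      using step[of J i 2] insert e2 sks by (simp add: P.prob_space)
    moreover have "(LINT x|PiM (insert i J) D. s (insert i J) x ^ 4) \<le> 3 * c * (real (card (insert i J)))^2"
    proof -
      have "(LINT x|PiM (insert i J) D. s (insert i J) x ^ 4) = (LINT x|PiM J D. s J x ^ 4 + 6 * (s J x)^2 + 4 * m3 * s J x + (LINT y|D i. p y ^ 4))"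
        using step[of J i 4] insert(1,2) e4 by simp
      also have "\<dots> = (LINT x|PiM J D. s J x ^ 4) + 6 * card J + (LINT y|D i. p y ^ 4)"
        using insert sks s1 by (simp add: P.prob_space)
      \<comment> \<open>The factor 3 c closes the induction: 3 c k^2 + 6 k + c is at most 3 c
        (k+1)^2 once c is at least 1.\<close>
      also have "\<dots> \<le> 3 * c * (real (card J))^2 + 6 * c * card J + 3 * c"
      proof -
        have "1 * (6 * real (card J)) \<le> c * (6 * real (card J))" by (rule mult_right_mono) (use c in auto)
        moreover have "(LINT x|PiM J D. s J x ^ 4) \<le> 3 * c * (real (card J))^2" using insert by blast
        ultimately show ?thesis using m4[of i] c by linarith
      qed
      also have "\<dots> = 3 * c * (real (card (insert i J)))^2"
        using insert by (simp add: power2_eq_square algebra_simps)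
      finally show ?thesis .
    qed
    ultimately show ?case by blast
  qed
  show "integrable (PiM J D) (\<lambda>x. (\<Sum>j\<in>J. p (x j)) ^ 4)" using s4[OF J] unfolding s_def .
  show "(LINT x|PiM J D. (\<Sum>j\<in>J. p (x j)) ^ 4) \<le> 3 * c * (real (card J))^2" using mom[OF J] unfolding s_def by blast
qed

text \<open>The exchange argument: replacing one coordinate of the array at a time changes the characteristic function of
  the quadratic form by a third-order term, since first and second moments agree.\<close>

locale quadratic_swap =
  fixes p :: "nat => 'e => real" and N :: nat and lam :: "nat => real" and c :: real
  assumes c1: "c \<ge> 1"
begin

text \<open>The means and covariances are fixed, so two such laws agree up to second order; the
  fourth moment controls the cubic remainder.\<close>

definition good :: "'e measure => bool" where
  "good \<rho> \<longleftrightarrow> prob_space \<rho> \<and> (\<forall>k<N. p k \<in> borel_measurable \<rho> \<and> integrable \<rho> (\<lambda>x. p k x ^ 4)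
      \<and> (LINT x|\<rho>. p k x) = 0 \<and> (LINT x|\<rho>. p k x ^ 4) \<le> c)
    \<and> (\<forall>k<N. \<forall>l<N. (LINT x|\<rho>. p k x * p l x) = (if k = l then 1 else 0))"

definition \<kappa> :: "'e => 'e => real" where
  "\<kappa> x y = (\<Sum>k<N. lam k * (p k x * p k y))"

lemma \<kappa>_sym: "\<kappa> x y = \<kappa> y x" unfolding \<kappa>_def by (simp add: mult.commute)

lemma good_prod_integrable:
  assumes "good \<rho>" "k < N" "l < N"
  shows "integrable \<rho> (\<lambda>x. p k x * p l x)"
proof -
  interpret prob_space \<rho> using assms by (simp add: good_def)
  have m: "p k \<in> borel_measurable \<rho>" "p l \<in> borel_measurable \<rho>" using assms by (auto simp: good_def)
  have i4: "integrable \<rho> (\<lambda>x. (p k x) ^ 4)" "integrable \<rho> (\<lambda>x. (p l x) ^ 4)"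
    using assms unfolding good_def by blast+
  have i: "integrable \<rho> (\<lambda>x. (p k x)^2)" "integrable \<rho> (\<lambda>x. (p l x)^2)"
    using integrable_power_le4[OF m(1) i4(1), of 2] integrable_power_le4[OF m(2) i4(2), of 2] by simp_all
  show ?thesis
  proof (rule Bochner_Integration.integrable_bound[of _ "\<lambda>x. (p k x)^2 + (p l x)^2"])
    show "integrable \<rho> (\<lambda>x. (p k x)^2 + (p l x)^2)" using i by simp
    show "(\<lambda>x. p k x * p l x) \<in> borel_measurable \<rho>" using m by simp
    have "\<bar>a * b\<bar> \<le> a^2 + b^2" for a b :: real
    proof -
      have "0 \<le> (\<bar>a\<bar> - \<bar>b\<bar>)^2" by simp
      then have "2 * (\<bar>a\<bar> * \<bar>b\<bar>) \<le> a^2 + b^2" by (simp add: power2_diff ac_simps)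
      moreover have "\<bar>a\<bar> * \<bar>b\<bar> \<ge> 0" by simp
      ultimately show ?thesis unfolding abs_mult by linarith
    qed
    then show "AE x in \<rho>. norm (p k x * p l x) \<le> norm ((p k x)^2 + (p l x)^2)" by (intro AE_I2) simp
  qed
qed

lemma linear_form:
  assumes \<rho>: "good \<rho>"
  defines "l \<equiv> \<lambda>a y. \<Sum>k<N. a k * p k y"
  shows "l a \<in> borel_measurable \<rho>" "integrable \<rho> (\<lambda>y. l a y ^ 4)" "(LINT y|\<rho>. l a y) = 0"
    "(LINT y|\<rho>. (l a y)^2) = (\<Sum>k<N. (a k)^2)" "(LINT y|\<rho>. l a y ^ 4) \<le> real N ^ 3 * c * (\<Sum>k<N. a k ^ 4)"
proof -
  interpret prob_space \<rho> using \<rho> by (simp add: good_def)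
  have pm: "\<And>k. k < N ==> p k \<in> borel_measurable \<rho>" and p4: "\<And>k. k < N ==> integrable \<rho> (\<lambda>x. p k x ^ 4)"
    and p1: "\<And>k. k < N ==> (LINT x|\<rho>. p k x) = 0" and pc: "\<And>k. k < N ==> (LINT x|\<rho>. p k x ^ 4) \<le> c"
    and po: "\<And>k l. k < N ==> l < N ==> (LINT x|\<rho>. p k x * p l x) = (if k = l then 1 else 0)"
    using \<rho> unfolding good_def by blast+
  have pi: "integrable \<rho> (p k)" if "k < N" for k using integrable_power_le4[OF pm[OF that] p4[OF that], of 1] by simp
  show lm: "l a \<in> borel_measurable \<rho>" unfolding l_def
    by (intro borel_measurable_sum borel_measurable_times borel_measurable_const pm) auto
  have bi: "integrable \<rho> (\<lambda>y. real N ^ 3 * (\<Sum>k<N. (a k * p k y) ^ 4))"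
    using p4 by (intro integrable_mult_right Bochner_Integration.integrable_sum) (auto simp: power_mult_distrib)
  have bd: "l a y ^ 4 \<le> real N ^ 3 * (\<Sum>k<N. (a k * p k y) ^ 4)" for y
    unfolding l_def using sum_power4_le[of "{..<N}"] by simp
  show l4: "integrable \<rho> (\<lambda>y. l a y ^ 4)"
    by (rule Bochner_Integration.integrable_bound[OF bi borel_measurable_power[OF lm]])
       (use bd in \<open>auto intro!: AE_I2 simp: abs_of_nonneg sum_nonneg\<close>)
  show "(LINT y|\<rho>. l a y) = 0" unfolding l_def
    by (subst Bochner_Integration.integral_sum) (use pi p1 in auto)
  have "(LINT y|\<rho>. (l a y)^2) = (LINT y|\<rho>. (\<Sum>k<N. \<Sum>j<N. a k * a j * (p k y * p j y)))"
    unfolding l_def power2_eq_square sum_product by (simp add: ac_simps)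
  also have "\<dots> = (\<Sum>k<N. \<Sum>j<N. a k * a j * (LINT y|\<rho>. p k y * p j y))"
    using good_prod_integrable[OF \<rho>]
    by (subst Bochner_Integration.integral_sum) (auto intro!: sum.cong simp: Bochner_Integration.integral_sum)
  also have "\<dots> = (\<Sum>k<N. \<Sum>j<N. if j = k then (a k)^2 else 0)"
    using po by (intro sum.cong refl) (auto simp: power2_eq_square)
  also have "\<dots> = (\<Sum>k<N. (a k)^2)" by (intro sum.cong refl) auto
  finally show "(LINT y|\<rho>. (l a y)^2) = (\<Sum>k<N. (a k)^2)" .
  have "(LINT y|\<rho>. l a y ^ 4) \<le> (LINT y|\<rho>. real N ^ 3 * (\<Sum>k<N. (a k * p k y) ^ 4))"
    by (rule integral_mono[OF l4 bi bd])
  also have "\<dots> = real N ^ 3 * (\<Sum>k<N. a k ^ 4 * (LINT y|\<rho>. p k y ^ 4))"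
    using p4 by (simp add: power_mult_distrib Bochner_Integration.integral_sum)
  also have "\<dots> \<le> real N ^ 3 * (\<Sum>k<N. a k ^ 4 * c)"
    using pc by (intro mult_left_mono sum_mono) auto
  finally show "(LINT y|\<rho>. l a y ^ 4) \<le> real N ^ 3 * c * (\<Sum>k<N. a k ^ 4)"
    by (simp add: sum_distrib_left sum_distrib_right ac_simps)
qed

text \<open>Lets fourth moments replace third absolute moments. The threshold b stays free and is
  later set to sqrt n.\<close>

lemma abs_cube_le: "b > 0 ==> \<bar>z\<bar> ^ 3 \<le> b ^ 3 + z ^ 4 / b" for b z :: real
proof (cases "\<bar>z\<bar> \<le> b")
  case True
  assume "b > 0"
  have "\<bar>z\<bar> ^ 3 \<le> b ^ 3" using True by (intro power_mono) auto
  moreover have "z ^ 4 / b \<ge> 0" using \<open>b > 0\<close> by simp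
  ultimately show ?thesis by linarith
next
  case False
  assume b: "b > 0"
  have "\<bar>z\<bar> ^ 3 * b \<le> \<bar>z\<bar> ^ 3 * \<bar>z\<bar>" using False by (intro mult_left_mono) auto
  also have "\<dots> = z ^ 4" by (simp add: power_even_abs flip: power_Suc2)
  finally have "\<bar>z\<bar> ^ 3 \<le> z ^ 4 / b" using b by (simp add: pos_le_divide_eq)
  then show ?thesis using b by (simp add: add_increasing)
qed

text \<open>Taylor expansion of order two. The main term depends only on the coefficients, so it
  cancels between any two good laws.\<close>

lemma char_linear_form:
  assumes \<rho>: "good \<rho>" and b: "b > 0"
  shows "cmod ((LINT y|\<rho>. iexp (\<tau> * (\<Sum>k<N. a k * p k y))) - complex_of_real (1 - \<tau>\<^sup>2 / 2 * (\<Sum>k<N. (a k)^2)))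
     \<le> \<bar>\<tau>\<bar> ^ 3 * (b ^ 3 + real N ^ 3 * c * (\<Sum>k<N. a k ^ 4) / b)"
proof -
  interpret prob_space \<rho> using \<rho> by (simp add: good_def)
  define l where "l y = (\<Sum>k<N. a k * p k y)" for y
  note lf = linear_form[OF \<rho>, of a, folded l_def]
  have li: "integrable \<rho> l" "integrable \<rho> (\<lambda>y. (l y)^2)"
    using integrable_power_le4[OF lf(1,2), of 1] integrable_power_le4[OF lf(1,2), of 2] by auto
  have ii: "integrable \<rho> (\<lambda>y. iexp (\<tau> * l y))"
    using lf(1) by (intro integrable_const_bound[where B=1]) auto
  define T where "T y = (\<Sum>k\<le>2. (\<i> * complex_of_real (\<tau> * l y)) ^ k / fact k)" for y
  have T: "T y = complex_of_real (1 - \<tau>\<^sup>2 / 2 * (l y)^2) + \<i> * complex_of_real (\<tau> * l y)" for y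
    unfolding T_def by (simp add: numeral_2_eq_2 power_mult_distrib algebra_simps)
  have i1: "integrable \<rho> (\<lambda>y. complex_of_real (1 - \<tau>\<^sup>2 / 2 * (l y)^2))"
    by (rule integrable_of_real) (use li in auto)
  have i2: "integrable \<rho> (\<lambda>y. \<i> * complex_of_real (\<tau> * l y))"
    by (rule integrable_mult_right[OF integrable_of_real]) (use li in auto)
  have iT: "integrable \<rho> T" unfolding T by (rule Bochner_Integration.integrable_add[OF i1 i2])
  have ET: "(LINT y|\<rho>. T y) = complex_of_real (1 - \<tau>\<^sup>2 / 2 * (\<Sum>k<N. (a k)^2))"
  proof -
    have "(LINT y|\<rho>. T y) = (LINT y|\<rho>. complex_of_real (1 - \<tau>\<^sup>2 / 2 * (l y)^2)) + (LINT y|\<rho>. \<i> * complex_of_real (\<tau> * l y))"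
      unfolding T by (rule Bochner_Integration.integral_add[OF i1 i2])
    also have "(LINT y|\<rho>. complex_of_real (1 - \<tau>\<^sup>2 / 2 * (l y)^2)) = complex_of_real (LINT y|\<rho>. 1 - \<tau>\<^sup>2 / 2 * (l y)^2)"
      by (rule integral_complex_of_real)
    also have "(LINT y|\<rho>. 1 - \<tau>\<^sup>2 / 2 * (l y)^2) = 1 - \<tau>\<^sup>2 / 2 * (\<Sum>k<N. (a k)^2)"
      using li lf(4) by (simp add: prob_space)
    also have "(LINT y|\<rho>. \<i> * complex_of_real (\<tau> * l y)) = \<i> * complex_of_real (LINT y|\<rho>. \<tau> * l y)"
      by (simp only: integral_mult_right_zero integral_complex_of_real)
    also have "(LINT y|\<rho>. \<tau> * l y) = 0" using lf(3) by simp
    finally show ?thesis by simp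
  qed
  have "cmod ((LINT y|\<rho>. iexp (\<tau> * l y)) - (LINT y|\<rho>. T y)) = cmod (LINT y|\<rho>. iexp (\<tau> * l y) - T y)"
    using ii iT by simp
  also have "\<dots> \<le> (LINT y|\<rho>. cmod (iexp (\<tau> * l y) - T y))" by (rule integral_norm_bound)
  also have "\<dots> \<le> (LINT y|\<rho>. \<bar>\<tau>\<bar> ^ 3 * (b ^ 3 + l y ^ 4 / b))"
  proof (rule integral_mono)
    show "integrable \<rho> (\<lambda>y. cmod (iexp (\<tau> * l y) - T y))" using ii iT by simp
    show "integrable \<rho> (\<lambda>y. \<bar>\<tau>\<bar> ^ 3 * (b ^ 3 + l y ^ 4 / b))" using lf(2) by simp
    fix y
    have "cmod (iexp (\<tau> * l y) - T y) \<le> \<bar>\<tau> * l y\<bar> ^ 3 / fact 3"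
      unfolding T_def using iexp_approx1[of "\<tau> * l y" 2] by (simp add: numeral_3_eq_3 numeral_2_eq_2)
    also have "\<dots> \<le> \<bar>\<tau> * l y\<bar> ^ 3" by (simp add: fact_numeral)
    also have "\<dots> = \<bar>\<tau>\<bar> ^ 3 * \<bar>l y\<bar> ^ 3" by (simp add: abs_mult power_mult_distrib)
    also have "\<dots> \<le> \<bar>\<tau>\<bar> ^ 3 * (b ^ 3 + l y ^ 4 / b)" by (intro mult_left_mono abs_cube_le b) auto
    finally show "cmod (iexp (\<tau> * l y) - T y) \<le> \<bar>\<tau>\<bar> ^ 3 * (b ^ 3 + l y ^ 4 / b)" .
  qed
  also have "\<dots> = \<bar>\<tau>\<bar> ^ 3 * (b ^ 3 + (LINT y|\<rho>. l y ^ 4) / b)" using lf(2) by (simp add: prob_space)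
  also have "\<dots> \<le> \<bar>\<tau>\<bar> ^ 3 * (b ^ 3 + real N ^ 3 * c * (\<Sum>k<N. a k ^ 4) / b)"
    using lf(5) b by (intro mult_left_mono add_left_mono divide_right_mono) auto
  finally show ?thesis unfolding ET l_def .
qed

lemma qf_measurable:
  assumes "\<And>i. i \<in> I ==> good (D i)"
  shows "qf \<kappa> I \<in> borel_measurable (PiM I D)"
proof -
  have "(\<lambda>x. p k (x i)) \<in> borel_measurable (PiM I D)" if "k < N" "i \<in> I" for k i
    using assms[OF that(2)] that by (intro measurable_compose[OF measurable_component_singleton]) (auto simp: good_def)
  then show ?thesis unfolding qf_def \<kappa>_def
    by (intro borel_measurable_divide borel_measurable_sum borel_measurable_times borel_measurable_const) auto
qed

text \<open>With the other coordinates fixed, the form is a constant plus a linear form with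
  coefficients \<open>lam k * s k x\<close>. Both conditional characteristic functions lie within H
  of the same G, whence the factor 2, and the fourth moments of the sums s k bound the mean of
  H.\<close>

lemma one_swap:
  fixes D :: "'i => 'e measure"
  assumes \<mu>: "good \<mu>" and \<nu>: "good \<nu>" and D: "\<And>i. good (D i)" and J: "finite J" "m \<notin> J" and b: "b > 0"
  shows "cmod ((LINT x|PiM (insert m J) (D(m := \<mu>)). iexp (\<tau> * qf \<kappa> (insert m J) x))
     - (LINT x|PiM (insert m J) (D(m := \<nu>)). iexp (\<tau> * qf \<kappa> (insert m J) x)))
    \<le> 2 * \<bar>\<tau>\<bar> ^ 3 * (b ^ 3 + real N ^ 3 * c * ((\<Sum>k<N. lam k ^ 4) * (3 * c * (real (card J))^2)) / b)"
proof -
  have prD: "prob_space (D i)" for i using D by (simp add: good_def)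
  interpret P: prob_space "PiM J D" by (rule prob_space_PiM[OF prD])
  define s where "s k x = (\<Sum>j\<in>J. p k (x j))" for k and x :: "'i => 'e"
  define \<Phi> where "\<Phi> \<rho> x = (LINT y|\<rho>. iexp (\<tau> * (\<Sum>k<N. (lam k * s k x) * p k y)))" for \<rho> x
  define G where "G x = complex_of_real (1 - \<tau>\<^sup>2 / 2 * (\<Sum>k<N. (lam k * s k x)^2))" for x
  define H where "H x = \<bar>\<tau>\<bar> ^ 3 * (b ^ 3 + real N ^ 3 * c * (\<Sum>k<N. (lam k * s k x) ^ 4) / b)" for x
  have red: "(LINT x|PiM (insert m J) (D(m := \<rho>)). iexp (\<tau> * qf \<kappa> (insert m J) x)) = (LINT x|PiM J D. iexp (\<tau> * qf \<kappa> J x) * \<Phi> \<rho> x)"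
    if \<rho>: "good \<rho>" for \<rho>
  proof -
    have gD: "good ((D(m := \<rho>)) i)" for i using D \<rho> by simp
    have prD': "prob_space ((D(m := \<rho>)) i)" for i using gD by (simp add: good_def)
    interpret product_sigma_finite "D(m := \<rho>)"
      by (intro product_sigma_finite.intro prob_space_imp_sigma_finite prD')
    interpret PI: prob_space "PiM (insert m J) (D(m := \<rho>))" by (rule prob_space_PiM[OF prD'])
    have "qf \<kappa> (insert m J) \<in> borel_measurable (PiM (insert m J) (D(m := \<rho>)))" by (rule qf_measurable[OF gD])
    then have int: "integrable (PiM (insert m J) (D(m := \<rho>))) (\<lambda>x. iexp (\<tau> * qf \<kappa> (insert m J) x))"
      by (intro PI.integrable_const_bound[where B=1]) auto
    have eq: "PiM J (D(m := \<rho>)) = PiM J D" by (rule PiM_cong) (use J in auto)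
    have "(LINT x|PiM (insert m J) (D(m := \<rho>)). iexp (\<tau> * qf \<kappa> (insert m J) x)) =
       (LINT x|PiM J D. (LINT y|\<rho>. iexp (\<tau> * qf \<kappa> (insert m J) (x(m := y)))))"
      using product_integral_insert[OF J int] by (simp add: eq)
    also have "\<dots> = (LINT x|PiM J D. iexp (\<tau> * qf \<kappa> J x) * \<Phi> \<rho> x)"
    proof (intro Bochner_Integration.integral_cong refl)
      fix x :: "'i => 'e"
      have "qf \<kappa> (insert m J) (x(m := y)) = qf \<kappa> J x + (\<Sum>k<N. (lam k * s k x) * p k y)" for y
      proof -
        have "qf \<kappa> (insert m J) (x(m := y)) = qf \<kappa> J (x(m := y)) + (\<Sum>j\<in>J. \<kappa> y ((x(m := y)) j))"
          using qf_insert[OF J \<kappa>_sym, where x="x(m := y)"] by simp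
        also have "qf \<kappa> J (x(m := y)) = qf \<kappa> J x" by (rule qf_cong) (use J in auto)
        also have "(\<Sum>j\<in>J. \<kappa> y ((x(m := y)) j)) = (\<Sum>j\<in>J. \<kappa> y (x j))" by (intro sum.cong) (use J in auto)
        also have "\<dots> = (\<Sum>k<N. (lam k * s k x) * p k y)"
          unfolding \<kappa>_def s_def by (subst sum.swap) (simp add: sum_distrib_left sum_distrib_right ac_simps)
        finally show ?thesis .
      qed
      then show "(LINT y|\<rho>. iexp (\<tau> * qf \<kappa> (insert m J) (x(m := y)))) = iexp (\<tau> * qf \<kappa> J x) * \<Phi> \<rho> x"
        unfolding \<Phi>_def by (simp add: distrib_left exp_add)
    qed
    finally show ?thesis .
  qed
  have bd: "cmod (\<Phi> \<rho> x - G x) \<le> H x" if "good \<rho>" for \<rho> x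
    unfolding \<Phi>_def G_def H_def by (rule char_linear_form[OF that b])
  have sm: "s k \<in> borel_measurable (PiM J D)" if "k < N" for k
    unfolding s_def using D that
    by (intro borel_measurable_sum measurable_compose[OF measurable_component_singleton]) (auto simp: good_def)
  have \<Phi>m: "\<Phi> \<rho> \<in> borel_measurable (PiM J D)" if \<rho>: "good \<rho>" for \<rho>
  proof -
    interpret R: prob_space \<rho> using \<rho> by (simp add: good_def)
    have "(\<lambda>(x, y). iexp (\<tau> * (\<Sum>k<N. (lam k * s k x) * p k y))) \<in> borel_measurable (PiM J D \<Otimes>\<^sub>M \<rho>)"
    proof -
      have [measurable]: "s k \<in> borel_measurable (PiM J D)" "p k \<in> borel_measurable \<rho>" if "k \<in> {..<N}" for k
        using sm that \<rho> by (auto simp: good_def)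
      have "(\<lambda>z. \<Sum>k<N. (lam k * s k (fst z)) * p k (snd z)) \<in> borel_measurable (PiM J D \<Otimes>\<^sub>M \<rho>)"
        by (intro borel_measurable_sum borel_measurable_times borel_measurable_const
            measurable_compose[OF measurable_fst] measurable_compose[OF measurable_snd]) auto
      then show ?thesis unfolding split_beta' by simp
    qed
    then show ?thesis unfolding \<Phi>_def by (rule R.borel_measurable_lebesgue_integral)
  qed
  have \<Phi>1: "cmod (\<Phi> \<rho> x) \<le> 1" if \<rho>: "good \<rho>" for \<rho> x
  proof -
    interpret R: prob_space \<rho> using \<rho> by (simp add: good_def)
    have "cmod (\<Phi> \<rho> x) \<le> (LINT y|\<rho>. cmod (iexp (\<tau> * (\<Sum>k<N. (lam k * s k x) * p k y))))"
      unfolding \<Phi>_def by (rule integral_norm_bound)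
    then show ?thesis by (simp add: R.prob_space)
  qed
  have int: "integrable (PiM J D) (\<lambda>x. iexp (\<tau> * qf \<kappa> J x) * \<Phi> \<rho> x)" if \<rho>: "good \<rho>" for \<rho>
    using \<Phi>m[OF \<rho>] \<Phi>1[OF \<rho>] qf_measurable[of J D, OF D]
    by (intro P.integrable_const_bound[where B=1]) (auto simp: norm_mult)
  have m4: "integrable (PiM J D) (\<lambda>x. s k x ^ 4)" "(LINT x|PiM J D. s k x ^ 4) \<le> 3 * c * (real (card J))^2" if k: "k < N" for k
  proof -
    have g: "p k \<in> borel_measurable (D i)" "integrable (D i) (\<lambda>x. p k x ^ 4)" "(LINT x|D i. p k x) = 0" "(LINT x|D i. p k x ^ 4) \<le> c"
       "(LINT x|D i. (p k x)^2) = 1" for i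
      using D[of i] k unfolding good_def power2_eq_square by auto
    show "integrable (PiM J D) (\<lambda>x. s k x ^ 4)" unfolding s_def
      by (rule PiM_sum_moments(1)[OF prD g(1,2,3) _ g(4) c1 J(1)]) (rule g(5))
    show "(LINT x|PiM J D. s k x ^ 4) \<le> 3 * c * (real (card J))^2" unfolding s_def
      by (rule PiM_sum_moments(2)[OF prD g(1,2,3) _ g(4) c1 J(1)]) (rule g(5))
  qed
  have iH: "integrable (PiM J D) H" unfolding H_def power_mult_distrib
    using m4(1) by (intro integrable_mult_right Bochner_Integration.integrable_add integrable_divide Bochner_Integration.integrable_sum) auto
  have "cmod ((LINT x|PiM J D. iexp (\<tau> * qf \<kappa> J x) * \<Phi> \<mu> x) - (LINT x|PiM J D. iexp (\<tau> * qf \<kappa> J x) * \<Phi> \<nu> x))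
     = cmod (LINT x|PiM J D. iexp (\<tau> * qf \<kappa> J x) * \<Phi> \<mu> x - iexp (\<tau> * qf \<kappa> J x) * \<Phi> \<nu> x)"
    using int[OF \<mu>] int[OF \<nu>] by simp
  also have "\<dots> \<le> (LINT x|PiM J D. cmod (iexp (\<tau> * qf \<kappa> J x) * \<Phi> \<mu> x - iexp (\<tau> * qf \<kappa> J x) * \<Phi> \<nu> x))"
    by (rule integral_norm_bound)
  also have "\<dots> \<le> (LINT x|PiM J D. 2 * H x)"
  proof (rule integral_mono)
    show "integrable (PiM J D) (\<lambda>x. cmod (iexp (\<tau> * qf \<kappa> J x) * \<Phi> \<mu> x - iexp (\<tau> * qf \<kappa> J x) * \<Phi> \<nu> x))"
      using int[OF \<mu>] int[OF \<nu>] by simp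
    show "integrable (PiM J D) (\<lambda>x. 2 * H x)" using iH by simp
    fix x
    have "cmod (iexp (\<tau> * qf \<kappa> J x) * \<Phi> \<mu> x - iexp (\<tau> * qf \<kappa> J x) * \<Phi> \<nu> x) = cmod ((\<Phi> \<mu> x - G x) - (\<Phi> \<nu> x - G x))"
      by (simp add: norm_mult flip: right_diff_distrib)
    also have "\<dots> \<le> H x + H x" by (rule order_trans[OF norm_triangle_ineq4 add_mono[OF bd[OF \<mu>] bd[OF \<nu>]]])
    finally show "cmod (iexp (\<tau> * qf \<kappa> J x) * \<Phi> \<mu> x - iexp (\<tau> * qf \<kappa> J x) * \<Phi> \<nu> x) \<le> 2 * H x" by simp
  qed
  also have "\<dots> = 2 * \<bar>\<tau>\<bar> ^ 3 * (b ^ 3 + real N ^ 3 * c * (\<Sum>k<N. lam k ^ 4 * (LINT x|PiM J D. s k x ^ 4)) / b)"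
  proof -
    have i: "integrable (PiM J D) (\<lambda>x. \<Sum>k<N. lam k ^ 4 * s k x ^ 4)"
      using m4(1) by (intro Bochner_Integration.integrable_sum) auto
    have e: "(LINT x|PiM J D. (\<Sum>k<N. lam k ^ 4 * s k x ^ 4)) = (\<Sum>k<N. lam k ^ 4 * (LINT x|PiM J D. s k x ^ 4))"
      by (subst Bochner_Integration.integral_sum) (use m4(1) in auto)
    have "(LINT x|PiM J D. 2 * H x) = 2 * \<bar>\<tau>\<bar> ^ 3 * (LINT x|PiM J D. b ^ 3 + real N ^ 3 * c * (\<Sum>k<N. lam k ^ 4 * s k x ^ 4) / b)"
      unfolding H_def power_mult_distrib by (simp add: mult.assoc)
    also have "(LINT x|PiM J D. b ^ 3 + real N ^ 3 * c * (\<Sum>k<N. lam k ^ 4 * s k x ^ 4) / b) =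
       b ^ 3 + real N ^ 3 * c * (\<Sum>k<N. lam k ^ 4 * (LINT x|PiM J D. s k x ^ 4)) / b"
      by (subst Bochner_Integration.integral_add) (use i e in \<open>auto simp: P.prob_space\<close>)
    finally show ?thesis .
  qed
  also have "\<dots> \<le> 2 * \<bar>\<tau>\<bar> ^ 3 * (b ^ 3 + real N ^ 3 * c * (\<Sum>k<N. lam k ^ 4 * (3 * c * (real (card J))^2)) / b)"
    using m4(2) b c1 by (intro mult_left_mono add_left_mono divide_right_mono sum_mono) auto
  finally show ?thesis unfolding red[OF \<mu>] red[OF \<nu>] sum_distrib_right .
qed

text \<open>The linear coefficients are of size sqrt n, so b = sqrt n balances the two error terms.
  Each of the n exchanges costs order n^(-3/2), in total n^(-1/2).\<close>

theorem quadratic_invariance: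
  assumes \<mu>: "good \<mu>" and \<nu>: "good \<nu>"
  shows "(\<lambda>n. (LINT x|PiM {..<n} (\<lambda>_. \<mu>). iexp (\<theta> / real n * qf \<kappa> {..<n} x))
     - (LINT x|PiM {..<n} (\<lambda>_. \<nu>). iexp (\<theta> / real n * qf \<kappa> {..<n} x))) \<longlonglongrightarrow> 0"
proof -
  define C where "C = real N ^ 3 * c * ((\<Sum>k<N. lam k ^ 4) * (3 * c))"
  have C0: "C \<ge> 0" unfolding C_def using c1 by (intro mult_nonneg_nonneg sum_nonneg) auto
  define A where "A n \<rho> = (LINT x|PiM {..<n} (\<lambda>_. \<rho>). iexp (\<theta> / real n * qf \<kappa> {..<n} x))" for n \<rho>
  have main: "cmod (A n \<mu> - A n \<nu>) \<le> 2 * \<bar>\<theta>\<bar> ^ 3 * (1 + C) / sqrt n" if n: "n > 0" for n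
  proof -
    \<comment> \<open>Mixed arrays: the first m coordinates have law \<nu>, the others \<mu>; the
      difference sought telescopes along m.\<close>
    define E where "E m = (LINT x|PiM {..<n} (\<lambda>i. if i < m then \<nu> else \<mu>). iexp (\<theta> / real n * qf \<kappa> {..<n} x))" for m
    have st: "cmod (E m - E (Suc m)) \<le> 2 * \<bar>\<theta> / n\<bar> ^ 3 * (sqrt n ^ 3 + C * (real n)^2 / sqrt n)" if m: "m < n" for m
    proof -
      define D where "D i = (if i < m then \<nu> else \<mu>)" for i
      define J where "J = {..<n} - {m}"
      have J: "finite J" "m \<notin> J" "insert m J = {..<n}" using m by (auto simp: J_def)
      have e1: "D(m := \<mu>) = (\<lambda>i. if i < m then \<nu> else \<mu>)" by (auto simp: D_def)
      have e2: "D(m := \<nu>) = (\<lambda>i. if i < Suc m then \<nu> else \<mu>)" by (auto simp: D_def)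
      have "cmod (E m - E (Suc m)) \<le> 2 * \<bar>\<theta> / n\<bar> ^ 3 * (sqrt n ^ 3 + real N ^ 3 * c * ((\<Sum>k<N. lam k ^ 4) * (3 * c * (real (card J))^2)) / sqrt n)"
        using one_swap[OF \<mu> \<nu>, of D J m "sqrt n" "\<theta> / n"] \<mu> \<nu> J n unfolding E_def e1 e2 J(3)
        by (simp add: D_def)
      also have "\<dots> \<le> 2 * \<bar>\<theta> / n\<bar> ^ 3 * (sqrt n ^ 3 + real N ^ 3 * c * ((\<Sum>k<N. lam k ^ 4) * (3 * c * (real n)^2)) / sqrt n)"
      proof -
        have "card J \<le> n" unfolding J_def using card_mono[of "{..<n}" "{..<n} - {m}"] by simp
        then show ?thesis using c1
          by (intro mult_left_mono add_left_mono divide_right_mono power_mono) (auto intro!: sum_nonneg)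
      qed
      finally show ?thesis by (simp add: C_def mult.assoc)
    qed
    have E0: "E 0 = A n \<mu>" by (simp add: E_def A_def)
    have En: "E n = A n \<nu>" unfolding E_def A_def by (intro arg_cong2[where f=lebesgue_integral] PiM_cong refl) auto
    have "A n \<mu> - A n \<nu> = (\<Sum>m<n. E m - E (Suc m))" unfolding sum_lessThan_telescope' E0 En ..
    also have "cmod \<dots> \<le> (\<Sum>m<n. 2 * \<bar>\<theta> / n\<bar> ^ 3 * (sqrt n ^ 3 + C * (real n)^2 / sqrt n))"
      by (rule order_trans[OF norm_sum sum_mono]) (use st in auto)
    also have "\<dots> = 2 * \<bar>\<theta>\<bar> ^ 3 * (1 + C) / sqrt n"
    proof -
      have s: "sqrt n > 0" "real n = sqrt n * sqrt n" using n by auto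
      define q where "q = sqrt (real n)"
      have q: "q > 0" "real n = q * q" using s by (auto simp: q_def)
      show ?thesis unfolding q_def[symmetric] using q
        by (simp add: power_divide abs_divide power2_eq_square power3_eq_cube field_simps)
    qed
    finally show ?thesis .
  qed
  show ?thesis unfolding A_def[symmetric]
  proof (rule Lim_null_comparison)
    show "\<forall>\<^sub>F n in sequentially. cmod (A n \<mu> - A n \<nu>) \<le> 2 * \<bar>\<theta>\<bar> ^ 3 * (1 + C) / sqrt n"
      using eventually_gt_at_top[of 0] by eventually_elim (rule main)
    have "filterlim (\<lambda>n. sqrt (real n)) at_top sequentially"
      by (intro filterlim_compose[OF sqrt_at_top] filterlim_real_sequentially)
    then show "(\<lambda>n. 2 * \<bar>\<theta>\<bar> ^ 3 * (1 + C) / sqrt n) \<longlonglongrightarrow> 0"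
      by (intro real_tendsto_divide_at_top[OF tendsto_const])
  qed
qed

end

section \<open>Gaussian arrays and the transfer to general types\<close>

lemma PiM_coordinates_indep:
  assumes M: "\<And>i. i \<in> I ==> prob_space (M i)" and I: "I \<noteq> {}"
  shows "prob_space.indep_vars (PiM I M) M (\<lambda>i \<omega>. \<omega> i) I"
proof -
  interpret P: prob_space "PiM I M" by (rule prob_space_PiM[OF M])
  have "distr (PiM I M) (PiM I M) (\<lambda>x. \<lambda>i\<in>I. x i) = PiM I M"
  proof -
    have "distr (PiM I M) (PiM I M) (\<lambda>x. \<lambda>i\<in>I. x i) = distr (PiM I M) (PiM I M) (\<lambda>x. x)"
      by (rule distr_cong) (auto simp: space_PiM PiE_def extensional_restrict)
    then show ?thesis by (simp add: distr_id)
  qed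
  also have "PiM I M = PiM I (\<lambda>i. distr (PiM I M) (M i) (\<lambda>\<omega>. \<omega> i))"
    by (rule PiM_cong[OF refl]) (rule distr_PiM_component[OF M, symmetric])
  finally show ?thesis
    by (subst P.indep_vars_iff_distr_eq_PiM'[OF I]) (auto intro: measurable_component_singleton)
qed

lemma std_normal_facts:
  shows "prob_space stdn" "integrable stdn (\<lambda>z. z ^ k)"
    "(LINT z|stdn. z) = 0" "(LINT z|stdn. z^2) = 1"
    "(LINT z|stdn. z ^ 4) = 3"
  using real_distribution.axioms(1)[OF real_dist_normal_dist] integrable_std_normal_distribution_moment[of k]
    integral_std_normal_distribution_moment_odd[of 1] std_normal_distribution_even_moments(1)[of 1]
    std_normal_distribution_even_moments(1)[of 2] by (auto simp: fact_numeral)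

lemma iexp_lipschitz: "cmod (iexp a - iexp b) \<le> \<bar>a - b\<bar>"
proof -
  have "iexp a - iexp b = iexp b * (iexp (a - b) - 1)"
    by (simp add: algebra_simps flip: exp_add)
  then have "cmod (iexp a - iexp b) = cmod (iexp (a - b) - 1)" by (simp add: norm_mult)
  also have "\<dots> \<le> \<bar>a - b\<bar>" using iexp_approx1[of "a - b" 0] by simp
  finally show ?thesis .
qed

lemma (in prob_space) char_diff_le:
  fixes X Y :: "'a => real"
  assumes [measurable]: "X \<in> borel_measurable M" "Y \<in> borel_measurable M" and i: "integrable M (\<lambda>x. \<bar>X x - Y x\<bar>)"
  shows "cmod ((LINT x|M. iexp (X x)) - (LINT x|M. iexp (Y x))) \<le> (LINT x|M. \<bar>X x - Y x\<bar>)"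
proof -
  have int: "integrable M (\<lambda>x. iexp (X x))" "integrable M (\<lambda>x. iexp (Y x))"
    by (intro integrable_const_bound[where B=1]; simp)+
  then have "cmod ((LINT x|M. iexp (X x)) - (LINT x|M. iexp (Y x))) = cmod (LINT x|M. iexp (X x) - iexp (Y x))" by simp
  also have "\<dots> \<le> (LINT x|M. cmod (iexp (X x) - iexp (Y x)))" by (rule integral_norm_bound)
  also have "\<dots> \<le> (LINT x|M. \<bar>X x - Y x\<bar>)"
    using int i by (intro integral_mono iexp_lipschitz) auto
  finally show ?thesis .
qed

text \<open>The sum over distinct indices is the full square minus the diagonal. After scaling, the
  diagonal converges to 1, the origin of the -1 in the centred squares of the limit.\<close>

lemma qf_sum_squares:
  fixes I :: "'i set" and p :: "nat => 'a => real"
  assumes "finite I"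
  shows "qf (\<lambda>x y. \<Sum>k<N. lam k * (p k x * p k y)) I x = (\<Sum>k<N. lam k * ((\<Sum>i\<in>I. p k (x i))^2 - (\<Sum>i\<in>I. (p k (x i))^2))) / 2"
proof -
  have 1: "(\<Sum>j\<in>I - {i}. f j) = (\<Sum>j\<in>I. f j) - f i" if "i \<in> I" for i and f :: "'i => real"
    using assms that by (simp add: sum_diff1)
  have "(\<Sum>i\<in>I. \<Sum>j\<in>I - {i}. \<Sum>k<N. lam k * (p k (x i) * p k (x j)))
    = (\<Sum>i\<in>I. \<Sum>k<N. \<Sum>j\<in>I - {i}. lam k * (p k (x i) * p k (x j)))" by (intro sum.cong refl sum.swap)
  also have "\<dots> = (\<Sum>k<N. \<Sum>i\<in>I. \<Sum>j\<in>I - {i}. lam k * (p k (x i) * p k (x j)))" by (rule sum.swap)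
  also have "\<dots> = (\<Sum>k<N. \<Sum>i\<in>I. lam k * (p k (x i) * (\<Sum>j\<in>I. p k (x j))) - lam k * (p k (x i))^2)"
    by (intro sum.cong refl) (simp add: 1 sum_distrib_left power2_eq_square)
  also have "\<dots> = (\<Sum>k<N. lam k * ((\<Sum>i\<in>I. p k (x i))^2 - (\<Sum>i\<in>I. (p k (x i))^2)))"
  proof (intro sum.cong refl)
    fix k
    have "(\<Sum>i\<in>I. lam k * (p k (x i) * (\<Sum>j\<in>I. p k (x j)))) = lam k * ((\<Sum>i\<in>I. p k (x i)) * (\<Sum>j\<in>I. p k (x j)))"
      by (simp only: sum_distrib_left[symmetric] sum_distrib_right[symmetric])
    then show "(\<Sum>i\<in>I. lam k * (p k (x i) * (\<Sum>j\<in>I. p k (x j))) - lam k * (p k (x i))^2) =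
        lam k * ((\<Sum>i\<in>I. p k (x i))^2 - (\<Sum>i\<in>I. (p k (x i))^2))"
      by (simp add: sum_subtractf right_diff_distrib power2_eq_square[of "\<Sum>i\<in>I. p k (x i)"] sum_distrib_left)
  qed
  finally show ?thesis by (simp add: qf_def)
qed

context
  fixes N :: nat and lam :: "nat => real"
begin

abbreviation "gvec \<equiv> PiM {..<N} (\<lambda>_. stdn)"

lemma prob_gvec: "prob_space gvec" by (rule prob_space_PiM) (rule std_normal_facts)

lemma gvec_moments:
  assumes k: "k < N" and l: "l < N"
  shows "(\<lambda>x. x k) \<in> borel_measurable gvec" "integrable gvec (\<lambda>x. x k ^ m)" "(LINT x|gvec. x k) = 0"
    "(LINT x|gvec. x k ^ 4) = 3" "(LINT x|gvec. x k * x l) = (if k = l then 1 else 0)"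
    "(LINT x|gvec. (x k)^2) = 1"
proof -
  note c = integrable_PiM_component[of "{..<N}" "\<lambda>_. stdn", OF std_normal_facts(1)]
  have kN: "k \<in> {..<N}" "l \<in> {..<N}" using k l by auto
  show "(\<lambda>x. x k) \<in> borel_measurable gvec"
    using measurable_component_singleton[OF kN(1), of "\<lambda>_. stdn"] by simp
  show "integrable gvec (\<lambda>x. x k ^ m)" using c(1)[OF kN(1) std_normal_facts(2)[of m]] .
  show "(LINT x|gvec. x k) = 0" using c(2)[OF kN(1) std_normal_facts(2)[of 1]] std_normal_facts(3) by simp
  show "(LINT x|gvec. x k ^ 4) = 3" using c(2)[OF kN(1) std_normal_facts(2)[of 4]] std_normal_facts(5) by simp
  show sq: "(LINT x|gvec. (x k)^2) = 1" using c(2)[OF kN(1) std_normal_facts(2)[of 2]] std_normal_facts(4) by simp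
  show "(LINT x|gvec. x k * x l) = (if k = l then 1 else 0)"
  proof (cases "k = l")
    case True then show ?thesis using sq by (simp add: power2_eq_square)
  next
    case False
    interpret product_sigma_finite "\<lambda>_::nat. stdn"
      by (intro product_sigma_finite.intro prob_space_imp_sigma_finite std_normal_facts)
    have pr: "(\<Prod>i<N. if i = k \<or> i = l then x i else 1) = x k * x l" for x :: "nat => real"
    proof -
      have "(\<Prod>i<N. if i = k \<or> i = l then x i else 1) = (\<Prod>i\<in>{k, l}. x i)"
        by (rule prod.mono_neutral_cong_right) (use k l in auto)
      then show ?thesis using False by simp
    qed
    have "(LINT x|gvec. x k * x l) = (LINT x|gvec. (\<Prod>i<N. (if i = k \<or> i = l then (\<lambda>z. z) else (\<lambda>z. 1)) (x i)))"
      unfolding pr[symmetric] by (intro Bochner_Integration.integral_cong refl prod.cong) auto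
    also have "\<dots> = (\<Prod>i<N. (LINT z|stdn. (if i = k \<or> i = l then (\<lambda>z. z) else (\<lambda>z. 1)) z))"
      by (rule product_integral_prod) (use std_normal_facts(2)[of 1] std_normal_facts(2)[of 0] in auto)
    also have "\<dots> = 0" using k std_normal_facts(3) by (intro prod_zero) (auto intro!: bexI[of _ k])
    finally show ?thesis using False by simp
  qed
qed

text \<open>A quantitative law of large numbers in L1 for the diagonal, read off from the fourth
  moment bound.\<close>

lemma sum_squares_concentrate:
  assumes k: "k < N"
  shows "\<exists>C. \<forall>n>0. integrable (PiM {..<n::nat} (\<lambda>_. gvec)) (\<lambda>x. \<bar>(\<Sum>i<n. (x i k)^2) / n - 1\<bar>) \<and>
    (LINT x|PiM {..<n} (\<lambda>_. gvec). \<bar>(\<Sum>i<n. (x i k)^2) / n - 1\<bar>) \<le> C / sqrt n"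
proof -
  interpret G: prob_space gvec by (rule prob_gvec)
  \<comment> \<open>The square of a standard normal has variance 2; the factor sqrt 2 normalises for
    \<open>PiM_sum_moments\<close>.\<close>
  define p where "p x = ((x k)^2 - 1) / sqrt 2" for x :: "nat => real"
  note gm = gvec_moments[OF k k]
  have pm: "p \<in> borel_measurable gvec" unfolding p_def using gm(1) by measurable
  have i4: "integrable gvec (\<lambda>x. p x ^ 4)"
  proof -
    have "(\<lambda>x. p x ^ 4) = (\<lambda>x. (x k ^ 8 - 4 * x k ^ 6 + 6 * x k ^ 4 - 4 * x k ^ 2 + 1) / 4)"
    proof
      fix x
      have "p x ^ 4 = ((x k)^2 - 1) ^ 4 / (sqrt 2 ^ 4)" by (simp add: p_def power_divide)
      also have "sqrt 2 ^ 4 = (4::real)" by (simp add: power4_eq_xxxx)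
      also have "((x k)^2 - 1) ^ 4 = x k ^ 8 - 4 * x k ^ 6 + 6 * x k ^ 4 - 4 * x k ^ 2 + 1"
        by (simp add: power2_eq_square power4_eq_xxxx algebra_simps eval_nat_numeral)
      finally show "p x ^ 4 = (x k ^ 8 - 4 * x k ^ 6 + 6 * x k ^ 4 - 4 * x k ^ 2 + 1) / 4" .
    qed
    then show ?thesis using gm(2) by simp
  qed
  have m1: "(LINT x|gvec. p x) = 0" unfolding p_def using gm(2)[of 2] gm(6) by (simp add: G.prob_space)
  have m2: "(LINT x|gvec. (p x)^2) = 1"
  proof -
    have "(LINT x|gvec. (p x)^2) = (LINT x|gvec. (x k ^ 4 - 2 * (x k)^2 + 1) / 2)"
      by (intro Bochner_Integration.integral_cong) (auto simp: p_def power_divide power2_eq_square power4_eq_xxxx algebra_simps)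
    then show ?thesis using gm(2)[of 2] gm(2)[of 4] gm(4,6) by (simp add: G.prob_space)
  qed
  define c where "c = max 1 (LINT x|gvec. p x ^ 4)"
  have c: "c \<ge> 1" "(LINT x|gvec. p x ^ 4) \<le> c" by (auto simp: c_def)
  note mom = PiM_sum_moments[of "\<lambda>_. gvec", OF prob_gvec pm i4 m1 m2 c(2) c(1)]
  have "integrable (PiM {..<n} (\<lambda>_. gvec)) (\<lambda>x. \<bar>(\<Sum>i<n. (x i k)^2) / n - 1\<bar>) \<and>
    (LINT x|PiM {..<n} (\<lambda>_. gvec). \<bar>(\<Sum>i<n. (x i k)^2) / n - 1\<bar>) \<le> (sqrt 2 * (1 + 3 * c)) / sqrt n" if n: "n > 0" for n :: nat
  proof -
    interpret P: prob_space "PiM {..<n} (\<lambda>_. gvec)" by (rule prob_space_PiM[OF prob_gvec])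
    define s where "s x = (\<Sum>i<n. p (x i))" for x :: "nat => nat => real"
    have s4: "integrable (PiM {..<n} (\<lambda>_. gvec)) (\<lambda>x. s x ^ 4)" "(LINT x|PiM {..<n} (\<lambda>_. gvec). s x ^ 4) \<le> 3 * c * (real n)^2"
      using mom[of "{..<n}"] by (auto simp: s_def)
    have sm: "s \<in> borel_measurable (PiM {..<n} (\<lambda>_. gvec))" unfolding s_def
      by (intro borel_measurable_sum) (rule measurable_compose[OF measurable_component_singleton], assumption, rule pm)
    have si: "integrable (PiM {..<n} (\<lambda>_. gvec)) s" using P.integrable_power_le4[OF sm s4(1), of 1] by simp
    have eq: "(\<Sum>i<n. (x i k)^2) / n - 1 = sqrt 2 / n * s x" for x
    proof -
      have "sqrt 2 * s x = (\<Sum>i<n. (x i k)^2 - 1)" unfolding s_def p_def by (simp add: sum_distrib_left)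
      also have "\<dots> = (\<Sum>i<n. (x i k)^2) - n" by (simp add: sum_subtractf)
      finally show ?thesis using n by (simp add: field_simps)
    qed
    \<comment> \<open>\<open>abs_power_le4\<close> at z / sqrt n: on the natural scale of the sum,
      the fourth moment bounds the first.\<close>
    have ab: "\<bar>z\<bar> \<le> sqrt n * (1 + z ^ 4 / (real n)^2)" for z :: real
    proof -
      define q where "q = sqrt (real n)"
      have q: "q > 0" "real n = q * q" using n by (auto simp: q_def)
      have "\<bar>(z / q) ^ 1\<bar> \<le> 1 + (z / q) ^ 4" by (rule abs_power_le4) simp
      then have "\<bar>z\<bar> \<le> q * (1 + z ^ 4 / q ^ 4)" using q by (simp add: power_divide abs_divide pos_divide_le_eq mult.commute)
      then show ?thesis using q by (simp add: q_def[symmetric] power2_eq_square power4_eq_xxxx mult.assoc)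
    qed
    have "(LINT x|PiM {..<n} (\<lambda>_. gvec). \<bar>s x\<bar>) \<le> (LINT x|PiM {..<n} (\<lambda>_. gvec). sqrt n * (1 + s x ^ 4 / (real n)^2))"
      using si s4(1) by (intro integral_mono ab) auto
    also have "\<dots> = sqrt n * (1 + (LINT x|PiM {..<n} (\<lambda>_. gvec). s x ^ 4) / (real n)^2)"
      using s4(1) by (simp add: P.prob_space)
    also have "\<dots> \<le> sqrt n * (1 + 3 * c)"
    proof -
      have "(LINT x|PiM {..<n} (\<lambda>_. gvec). s x ^ 4) / (real n)^2 \<le> 3 * c" using s4(2) n by (simp add: pos_divide_le_eq)
      then show ?thesis by (intro mult_left_mono) auto
    qed
    finally have b: "(LINT x|PiM {..<n} (\<lambda>_. gvec). \<bar>s x\<bar>) \<le> sqrt n * (1 + 3 * c)" .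
    have "(LINT x|PiM {..<n} (\<lambda>_. gvec). \<bar>(\<Sum>i<n. (x i k)^2) / n - 1\<bar>) = sqrt 2 / n * (LINT x|PiM {..<n} (\<lambda>_. gvec). \<bar>s x\<bar>)"
      unfolding eq by (simp add: abs_mult)
    also have "\<dots> \<le> sqrt 2 / n * (sqrt n * (1 + 3 * c))" using b by (intro mult_left_mono) auto
    also have "\<dots> = (sqrt 2 * (1 + 3 * c)) * (sqrt n / n)" by simp
    also have "sqrt n / n = 1 / sqrt n" using n by (simp add: real_div_sqrt field_simps)
    also have "(sqrt 2 * (1 + 3 * c)) * (1 / sqrt n) = (sqrt 2 * (1 + 3 * c)) / sqrt n" by simp
    finally show ?thesis unfolding eq using integrable_abs[OF integrable_mult_right[OF si, of "sqrt 2 / n"]] by simp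
  qed
  then show ?thesis by blast
qed

text \<open>A product of n Gaussian vectors is the image of one flat array of independent normals,
  which can then be grouped by columns as well. For N = 0 there is no coordinate and both sides are
  the law on a one-point space, so this case is separate.\<close>

lemma distr_gvec_array:
  fixes n :: nat
  assumes n: "n > 0"
  defines "\<Gamma> \<equiv> PiM ({..<n} \<times> {..<N}) (\<lambda>_. stdn)"
  shows "distr \<Gamma> (PiM {..<n} (\<lambda>_. gvec)) (\<lambda>\<omega>. \<lambda>i\<in>{..<n}. \<lambda>k\<in>{..<N}. \<omega> (i, k)) = PiM {..<n} (\<lambda>_. gvec)"
proof (cases "N = 0")
  case False
  interpret P: prob_space \<Gamma> unfolding \<Gamma>_def by (rule prob_space_PiM) (rule std_normal_facts)
  have ne: "{..<n} \<times> {..<N} \<noteq> {}" using n False by auto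
  have ind: "P.indep_vars (\<lambda>_. stdn) (\<lambda>i \<omega>. \<omega> i) ({..<n} \<times> {..<N})"
    unfolding \<Gamma>_def by (rule PiM_coordinates_indep[OF std_normal_facts(1) ne])
  have "P.indep_vars (\<lambda>i. PiM ({i} \<times> {..<N}) (\<lambda>_. stdn)) (\<lambda>i \<omega>. restrict (\<lambda>j. \<omega> j) ({i} \<times> {..<N})) {..<n}"
    by (rule P.indep_vars_restrict[OF ind]) (auto simp: disjoint_family_on_def)
  then have iv': "P.indep_vars (\<lambda>i. gvec) (\<lambda>i \<omega>. \<lambda>k\<in>{..<N}. restrict (\<lambda>j. \<omega> j) ({i} \<times> {..<N}) (i, k)) {..<n}"
  proof (rule P.indep_vars_compose2)
    fix i
    show "(\<lambda>w. \<lambda>k\<in>{..<N}. w (i, k)) \<in> measurable (PiM ({i} \<times> {..<N}) (\<lambda>_. stdn)) gvec"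
      by (intro measurable_restrict measurable_component_singleton) auto
  qed
  have fe: "(\<lambda>i \<omega>. \<lambda>k\<in>{..<N}. restrict (\<lambda>j. \<omega> j) ({i} \<times> {..<N}) (i, k)) = (\<lambda>i (\<omega> :: nat \<times> nat => real). \<lambda>k\<in>{..<N}. \<omega> (i, k))"
    by (intro ext) (auto simp: restrict_def)
  have iv: "P.indep_vars (\<lambda>i. gvec) (\<lambda>i \<omega>. \<lambda>k\<in>{..<N}. \<omega> (i, k)) {..<n}"
    by (rule iffD1[OF arg_cong[OF fe, of "\<lambda>X. P.indep_vars (\<lambda>i. gvec) X {..<n}"] iv'])
  have rv: "(\<lambda>\<omega>. \<lambda>k\<in>{..<N}. \<omega> (i, k)) \<in> measurable \<Gamma> gvec" if "i \<in> {..<n}" for i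
    unfolding \<Gamma>_def using that by (intro measurable_restrict measurable_component_singleton) auto
  have d: "distr \<Gamma> gvec (\<lambda>\<omega>. \<lambda>k\<in>{..<N}. \<omega> (i, k)) = gvec" if "i \<in> {..<n}" for i
    unfolding \<Gamma>_def
    by (rule distr_PiM_reindex[of _ "\<lambda>_. stdn", OF std_normal_facts(1)])
       (use that in \<open>auto simp: inj_on_def\<close>)
  have "distr \<Gamma> (PiM {..<n} (\<lambda>_. gvec)) (\<lambda>\<omega>. \<lambda>i\<in>{..<n}. \<lambda>k\<in>{..<N}. \<omega> (i, k)) = PiM {..<n} (\<lambda>i. distr \<Gamma> gvec (\<lambda>\<omega>. \<lambda>k\<in>{..<N}. \<omega> (i, k)))"
    using iv P.indep_vars_iff_distr_eq_PiM'[where I="{..<n}" and M'="\<lambda>_. gvec" and X="\<lambda>i \<omega>. \<lambda>k\<in>{..<N}. \<omega> (i, k)"] rv n by auto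
  also have "\<dots> = PiM {..<n} (\<lambda>_. gvec)" by (rule PiM_cong) (use d in auto)
  finally show ?thesis .
next
  case True
  have ps: "prob_space \<Gamma>" unfolding \<Gamma>_def by (rule prob_space_PiM) (rule std_normal_facts)
  have e: "gvec = count_space {\<lambda>_. undefined}" unfolding True by (simp add: PiM_empty)
  have m: "(\<lambda>\<omega>. \<lambda>i\<in>{..<n}. \<lambda>k\<in>{..<N}. \<omega> (i, k)) \<in> measurable \<Gamma> (PiM {..<n} (\<lambda>_. gvec))"
    unfolding \<Gamma>_def by (intro measurable_restrict measurable_component_singleton) auto
  have sp: "space (PiM {..<n} (\<lambda>_. gvec)) = {\<lambda>i\<in>{..<n}. \<lambda>_. undefined}"
    unfolding space_PiM e by (auto simp: PiE_def extensional_def fun_eq_iff)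
  have pd: "prob_space (distr \<Gamma> (PiM {..<n} (\<lambda>_. gvec)) (\<lambda>\<omega>. \<lambda>i\<in>{..<n}. \<lambda>k\<in>{..<N}. \<omega> (i, k)))"
    by (rule prob_space.prob_space_distr[OF ps m])
  have pp: "prob_space (PiM {..<n} (\<lambda>_. gvec))" by (rule prob_space_PiM[OF prob_gvec])
  show ?thesis
  proof (rule measure_eqI)
    fix A assume "A \<in> sets (distr \<Gamma> (PiM {..<n} (\<lambda>_. gvec)) (\<lambda>\<omega>. \<lambda>i\<in>{..<n}. \<lambda>k\<in>{..<N}. \<omega> (i, k)))"
    then have "A \<subseteq> space (PiM {..<n} (\<lambda>_. gvec))" using sets.sets_into_space by fastforce
    then have "A = {} \<or> A = space (PiM {..<n} (\<lambda>_. gvec))" unfolding sp by auto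
    then show "emeasure (distr \<Gamma> (PiM {..<n} (\<lambda>_. gvec)) (\<lambda>\<omega>. \<lambda>i\<in>{..<n}. \<lambda>k\<in>{..<N}. \<omega> (i, k))) A = emeasure (PiM {..<n} (\<lambda>_. gvec)) A"
      using prob_space.emeasure_space_1[OF pd] prob_space.emeasure_space_1[OF pp] by auto
  qed simp
qed

text \<open>Normalised column sums of a Gaussian array are exactly independent standard normals for
  every n, so the Gaussian side involves no central limit theorem.\<close>

lemma gvec_normalized_sums:
  fixes g :: "nat => real => complex" and n :: nat
  assumes n: "n > 0" and g: "\<And>k. g k \<in> borel_measurable borel" "\<And>k z. cmod (g k z) \<le> 1"
  shows "(LINT x|PiM {..<n} (\<lambda>_. gvec). (\<Prod>k<N. g k ((\<Sum>i<n. x i k) / sqrt n))) = (\<Prod>k<N. (LINT z|stdn. g k z))"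
proof -
  define \<Gamma> where "\<Gamma> = PiM ({..<n} \<times> {..<N}) (\<lambda>_. stdn)"
  interpret P: prob_space \<Gamma> unfolding \<Gamma>_def by (rule prob_space_PiM) (rule std_normal_facts)
  have m: "(\<lambda>\<omega>. \<lambda>i\<in>{..<n}. \<lambda>k\<in>{..<N}. \<omega> (i, k)) \<in> measurable \<Gamma> (PiM {..<n} (\<lambda>_. gvec))"
    unfolding \<Gamma>_def by (intro measurable_restrict measurable_component_singleton) auto
  have cm: "(\<lambda>x. x i k) \<in> borel_measurable (PiM {..<n} (\<lambda>_. gvec))" if "i < n" "k < N" for i k
    using that by (intro measurable_compose[OF measurable_component_singleton[of i "{..<n}" "\<lambda>_. gvec"] gvec_moments(1)[of k k]]) auto
  have fm: "(\<lambda>x. \<Prod>k<N. g k ((\<Sum>i<n. x i k) / sqrt n)) \<in> borel_measurable (PiM {..<n} (\<lambda>_. gvec))"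
  proof (intro borel_measurable_prod)
    fix k assume "k \<in> {..<N}"
    then have "(\<lambda>x. (\<Sum>i<n. x i k) / sqrt n) \<in> borel_measurable (PiM {..<n} (\<lambda>_. gvec))"
      using cm by (intro borel_measurable_divide borel_measurable_sum) auto
    then show "(\<lambda>x. g k ((\<Sum>i<n. x i k) / sqrt n)) \<in> borel_measurable (PiM {..<n} (\<lambda>_. gvec))"
      by (rule measurable_compose[OF _ g(1)])
  qed
  define Z where "Z k \<omega> = (\<Sum>i<n. \<omega> (i, k)) / sqrt n" for k and \<omega> :: "nat \<times> nat => real"
  have Zm: "Z k \<in> borel_measurable \<Gamma>" if "k < N" for k
    unfolding Z_def \<Gamma>_def
  proof (intro borel_measurable_divide borel_measurable_sum borel_measurable_const)
    fix i assume "i \<in> {..<n}"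
    then have "(i, k) \<in> {..<n} \<times> {..<N}" using that by auto
    then show "(\<lambda>\<omega>. \<omega> (i, k)) \<in> borel_measurable (PiM ({..<n} \<times> {..<N}) (\<lambda>_. stdn))"
      using measurable_component_singleton[of "(i, k)" "{..<n} \<times> {..<N}" "\<lambda>_. stdn"] by simp
  qed
  have "(LINT x|PiM {..<n} (\<lambda>_. gvec). (\<Prod>k<N. g k ((\<Sum>i<n. x i k) / sqrt n))) =
    (LINT \<omega>|\<Gamma>. (\<Prod>k<N. g k (Z k \<omega>)))"
    by (subst distr_gvec_array[OF n, folded \<Gamma>_def, symmetric], subst integral_distr[OF m fm])
       (auto intro!: Bochner_Integration.integral_cong prod.cong simp: Z_def)
  also have "\<dots> = (\<Prod>k<N. (LINT \<omega>|\<Gamma>. g k (Z k \<omega>)))"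
  proof (cases "N = 0")
    case False
    have ne: "{..<n} \<times> {..<N} \<noteq> {}" using n False by auto
    have ind: "P.indep_vars (\<lambda>_. stdn) (\<lambda>i \<omega>. \<omega> i) ({..<n} \<times> {..<N})"
      unfolding \<Gamma>_def by (rule PiM_coordinates_indep[OF std_normal_facts(1) ne])
    have "P.indep_vars (\<lambda>k. PiM ({..<n} \<times> {k}) (\<lambda>_. stdn)) (\<lambda>k \<omega>. restrict (\<lambda>j. \<omega> j) ({..<n} \<times> {k})) {..<N}"
      by (rule P.indep_vars_restrict[OF ind]) (auto simp: disjoint_family_on_def)
    then have "P.indep_vars (\<lambda>_. borel) (\<lambda>k \<omega>. (\<lambda>w. g k ((\<Sum>i<n. w (i, k)) / sqrt n)) (restrict (\<lambda>j. \<omega> j) ({..<n} \<times> {k}))) {..<N}"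
    proof (rule P.indep_vars_compose2)
      fix k :: nat
      have "(\<lambda>w. (\<Sum>i<n. w (i, k)) / sqrt n) \<in> borel_measurable (PiM ({..<n} \<times> {k}) (\<lambda>_. stdn))"
      proof (intro borel_measurable_divide borel_measurable_sum borel_measurable_const)
        fix i assume "i \<in> {..<n}"
        then show "(\<lambda>w. w (i, k)) \<in> borel_measurable (PiM ({..<n} \<times> {k}) (\<lambda>_. stdn))"
          using measurable_component_singleton[of "(i, k)" "{..<n} \<times> {k}" "\<lambda>_. stdn"] by simp
      qed
      then show "(\<lambda>w. g k ((\<Sum>i<n. w (i, k)) / sqrt n)) \<in> measurable (PiM ({..<n} \<times> {k}) (\<lambda>_. stdn)) borel"
        by (rule measurable_compose[OF _ g(1)])
    qed
    moreover have "(\<lambda>w. g k ((\<Sum>i<n. w (i, k)) / sqrt n)) (restrict (\<lambda>j. \<omega> j) ({..<n} \<times> {k})) = g k (Z k \<omega>)" for k \<omega>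
      by (simp add: Z_def)
    ultimately have iv: "P.indep_vars (\<lambda>_. borel) (\<lambda>k \<omega>. g k (Z k \<omega>)) {..<N}" by simp
    show ?thesis
      by (rule P.indep_vars_lebesgue_integral[OF _ iv])
         (use Zm g in \<open>auto intro!: P.integrable_const_bound[where B=1] measurable_compose[OF Zm g(1)]\<close>)
  qed (simp add: P.prob_space)
  also have "\<dots> = (\<Prod>k<N. (LINT z|stdn. g k z))"
  proof (intro prod.cong refl)
    fix k assume "k \<in> {..<N}"
    then have k: "k < N" by simp
    have ne: "{..<n} \<times> {..<N} \<noteq> {}" using n k by auto
    have ind: "P.indep_vars (\<lambda>_. stdn) (\<lambda>i \<omega>. \<omega> i) ({..<n} \<times> {..<N})"
      unfolding \<Gamma>_def by (rule PiM_coordinates_indep[OF std_normal_facts(1) ne])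
    have indk: "P.indep_vars (\<lambda>_. borel) (\<lambda>j \<omega>. \<omega> j) ({..<n} \<times> {k})"
      by (rule P.indep_vars_compose2[OF P.indep_vars_subset[OF ind], where Y="\<lambda>_ z. z"]) (use k in auto)
    have dist: "distributed \<Gamma> lborel (\<lambda>\<omega>. \<omega> j) (normal_density 0 1)" if "j \<in> {..<n} \<times> {k}" for j
    proof -
      have j: "j \<in> {..<n} \<times> {..<N}" using that k by auto
      have "distr \<Gamma> stdn (\<lambda>\<omega>. \<omega> j) = stdn"
        unfolding \<Gamma>_def by (rule distr_PiM_component[of _ "\<lambda>_. stdn", OF std_normal_facts(1) j])
      moreover have "distr \<Gamma> stdn (\<lambda>\<omega>. \<omega> j) = distr \<Gamma> lborel (\<lambda>\<omega>. \<omega> j)" by (rule distr_cong) auto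
      moreover have "(\<lambda>\<omega>. \<omega> j) \<in> measurable \<Gamma> lborel"
        using measurable_component_singleton[OF j, of "\<lambda>_. stdn"] unfolding \<Gamma>_def by simp
      ultimately show ?thesis unfolding distributed_def by simp
    qed
    have "distributed \<Gamma> lborel (\<lambda>\<omega>. \<Sum>j\<in>{..<n} \<times> {k}. \<omega> j) (normal_density (\<Sum>j\<in>{..<n} \<times> {k}. 0) (sqrt (\<Sum>j\<in>{..<n} \<times> {k}. 1^2)))"
      by (rule P.sum_indep_normal[OF _ _ indk]) (use n dist in auto)
    then have "distributed \<Gamma> lborel (\<lambda>\<omega>. \<Sum>j\<in>{..<n} \<times> {k}. \<omega> j) (normal_density 0 (sqrt n))" by simp
    from P.normal_density_affine[OF this, of "1 / sqrt n" 0]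
    have "distributed \<Gamma> lborel (\<lambda>\<omega>. 1 / sqrt n * (\<Sum>j\<in>{..<n} \<times> {k}. \<omega> j)) (normal_density 0 1)" using n by simp
    moreover have "1 / sqrt n * (\<Sum>j\<in>{..<n} \<times> {k}. \<omega> j) = Z k \<omega>" for \<omega>
    proof -
      have "(\<Sum>j\<in>{..<n} \<times> {k}. \<omega> j) = (\<Sum>i<n. \<omega> (i, k))"
      proof -
        have "(\<Sum>i<n. \<Sum>l\<in>{k}. \<omega> (i, l)) = (\<Sum>(i, l)\<in>{..<n} \<times> {k}. \<omega> (i, l))" by (rule sum.cartesian_product)
        then show ?thesis by simp
      qed
      then show ?thesis by (simp add: Z_def)
    qed
    ultimately have "distributed \<Gamma> lborel (Z k) (normal_density 0 1)" by simp
    then have dz: "distr \<Gamma> lborel (Z k) = stdn" unfolding distributed_def by simp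
    have "(LINT \<omega>|\<Gamma>. g k (Z k \<omega>)) = (LINT z|distr \<Gamma> lborel (Z k). g k z)"
      by (rule integral_distr[symmetric]) (use Zm[OF k] g in auto)
    then show "(LINT \<omega>|\<Gamma>. g k (Z k \<omega>)) = (LINT z|stdn. g k z)" unfolding dz .
  qed
  finally show ?thesis .
qed

text \<open>Replacing the diagonal averages by 1 costs order n^(-1/2) in L1; after that the
  characteristic function equals the limit for every n.\<close>

lemma gaussian_quadratic_char:
  "(\<lambda>n. (LINT x|PiM {..<n} (\<lambda>_. gvec). iexp (\<theta> / real n * qf (\<lambda>x y. \<Sum>k<N. lam k * (x k * y k)) {..<n} x)))
     \<longlonglongrightarrow> (\<Prod>k<N. (LINT z|stdn. iexp (\<theta> / 2 * lam k * (z^2 - 1))))"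
proof -
  define L where "L = (\<Prod>k<N. (LINT z|stdn. iexp (\<theta> / 2 * lam k * (z^2 - 1))))"
  define F where "F n = (LINT x|PiM {..<n} (\<lambda>_. gvec). iexp (\<theta> / real n * qf (\<lambda>x y. \<Sum>k<N. lam k * (x k * y k)) {..<n} x))" for n
  have "\<forall>k\<in>{..<N}. \<exists>C. \<forall>n>0. integrable (PiM {..<n::nat} (\<lambda>_. gvec)) (\<lambda>x. \<bar>(\<Sum>i<n. (x i k)^2) / n - 1\<bar>) \<and>
    (LINT x|PiM {..<n} (\<lambda>_. gvec). \<bar>(\<Sum>i<n. (x i k)^2) / n - 1\<bar>) \<le> C / sqrt n"
    using sum_squares_concentrate by blast
  from bchoice[OF this] obtain C where C0: "\<forall>k\<in>{..<N}. \<forall>n>0. integrable (PiM {..<n::nat} (\<lambda>_. gvec)) (\<lambda>x. \<bar>(\<Sum>i<n. (x i k)^2) / n - 1\<bar>) \<and>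
    (LINT x|PiM {..<n} (\<lambda>_. gvec). \<bar>(\<Sum>i<n. (x i k)^2) / n - 1\<bar>) \<le> C k / sqrt n" ..
  have C: "integrable (PiM {..<n::nat} (\<lambda>_. gvec)) (\<lambda>x. \<bar>(\<Sum>i<n. (x i k)^2) / n - 1\<bar>)"
    "(LINT x|PiM {..<n} (\<lambda>_. gvec). \<bar>(\<Sum>i<n. (x i k)^2) / n - 1\<bar>) \<le> C k / sqrt n" if "k < N" "n > 0" for k n
    using C0 that by auto
  have main: "cmod (F n - L) \<le> (\<bar>\<theta>\<bar> / 2 * (\<Sum>k<N. \<bar>lam k\<bar> * C k)) / sqrt n" if n: "n > 0" for n :: nat
  proof -
    interpret P: prob_space "PiM {..<n} (\<lambda>_. gvec)" by (rule prob_space_PiM[OF prob_gvec])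
    have cm: "(\<lambda>x. x i k) \<in> borel_measurable (PiM {..<n} (\<lambda>_. gvec))" if "i < n" "k < N" for i k
      using that by (intro measurable_compose[OF measurable_component_singleton[of i "{..<n}" "\<lambda>_. gvec"] gvec_moments(1)[of k k]]) auto
    define X where "X x = \<theta> / real n * qf (\<lambda>x y. \<Sum>k<N. lam k * (x k * y k)) {..<n} x" for x :: "nat => nat => real"
    define Y where "Y x = (\<Sum>k<N. \<theta> / 2 * lam k * (((\<Sum>i<n. x i k) / sqrt n)^2 - 1))" for x :: "nat => nat => real"
    have X: "X x = (\<Sum>k<N. \<theta> / 2 * lam k * (((\<Sum>i<n. x i k) / sqrt n)^2 - (\<Sum>i<n. (x i k)^2) / n))" for x
    proof -
      have "X x = \<theta> / n * ((\<Sum>k<N. lam k * ((\<Sum>i<n. x i k)^2 - (\<Sum>i<n. (x i k)^2))) / 2)"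
        unfolding X_def by (subst qf_sum_squares[where I="{..<n}" and N=N and lam=lam and p="\<lambda>k x. x k" and x=x]) simp_all
      also have "\<dots> = (\<Sum>k<N. \<theta> / n * (lam k * ((\<Sum>i<n. x i k)^2 - (\<Sum>i<n. (x i k)^2)) / 2))"
        by (simp add: sum_distrib_left sum_divide_distrib)
      also have "\<dots> = (\<Sum>k<N. \<theta> / 2 * lam k * (((\<Sum>i<n. x i k) / sqrt n)^2 - (\<Sum>i<n. (x i k)^2) / n))"
        by (intro sum.cong refl) (use n in \<open>simp add: power_divide field_simps\<close>)
      finally show ?thesis .
    qed
    have m1: "(\<lambda>x. ((\<Sum>i<n. x i k) / sqrt n)^2) \<in> borel_measurable (PiM {..<n} (\<lambda>_. gvec))" if "k < N" for k
      using cm that by (intro borel_measurable_power borel_measurable_divide borel_measurable_sum) auto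
    have m2: "(\<lambda>x. (\<Sum>i<n. (x i k)^2) / n) \<in> borel_measurable (PiM {..<n} (\<lambda>_. gvec))" if "k < N" for k
      using cm that by (intro borel_measurable_divide borel_measurable_sum borel_measurable_power) auto
    have Xm: "X \<in> borel_measurable (PiM {..<n} (\<lambda>_. gvec))"
      unfolding X using m1 m2 by (intro borel_measurable_sum borel_measurable_times borel_measurable_diff) auto
    have Ym: "Y \<in> borel_measurable (PiM {..<n} (\<lambda>_. gvec))"
      unfolding Y_def using m1 by (intro borel_measurable_sum borel_measurable_times borel_measurable_diff) auto
    have XY: "\<bar>X x - Y x\<bar> \<le> (\<Sum>k<N. \<bar>\<theta>\<bar> / 2 * \<bar>lam k\<bar> * \<bar>(\<Sum>i<n. (x i k)^2) / n - 1\<bar>)" for x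
    proof -
      have "X x - Y x = (\<Sum>k<N. \<theta> / 2 * lam k * (1 - (\<Sum>i<n. (x i k)^2) / n))"
        unfolding X Y_def sum_subtractf[symmetric] by (intro sum.cong refl) (simp add: algebra_simps)
      also have "\<bar>\<dots>\<bar> \<le> (\<Sum>k<N. \<bar>\<theta> / 2 * lam k * (1 - (\<Sum>i<n. (x i k)^2) / n)\<bar>)" by (rule sum_abs)
      also have "\<dots> = (\<Sum>k<N. \<bar>\<theta>\<bar> / 2 * \<bar>lam k\<bar> * \<bar>(\<Sum>i<n. (x i k)^2) / n - 1\<bar>)"
        by (intro sum.cong refl) (simp add: abs_mult abs_minus_commute)
      finally show ?thesis .
    qed
    have iB: "integrable (PiM {..<n} (\<lambda>_. gvec)) (\<lambda>x. \<Sum>k<N. \<bar>\<theta>\<bar> / 2 * \<bar>lam k\<bar> * \<bar>(\<Sum>i<n. (x i k)^2) / n - 1\<bar>)"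
      by (intro Bochner_Integration.integrable_sum integrable_mult_right C(1)) (use n in auto)
    have iXY: "integrable (PiM {..<n} (\<lambda>_. gvec)) (\<lambda>x. \<bar>X x - Y x\<bar>)"
    proof (rule Bochner_Integration.integrable_bound[OF iB])
      show "(\<lambda>x. \<bar>X x - Y x\<bar>) \<in> borel_measurable (PiM {..<n} (\<lambda>_. gvec))" using Xm Ym by simp
      show "AE x in PiM {..<n} (\<lambda>_. gvec). norm \<bar>X x - Y x\<bar> \<le> norm (\<Sum>k<N. \<bar>\<theta>\<bar> / 2 * \<bar>lam k\<bar> * \<bar>(\<Sum>i<n. (x i k)^2) / n - 1\<bar>)"
        unfolding real_norm_def abs_abs by (rule AE_I2) (rule order_trans[OF XY abs_ge_self])
    qed
    have EY: "(LINT x|PiM {..<n} (\<lambda>_. gvec). iexp (Y x)) = L"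
    proof -
      have "iexp (Y x) = (\<Prod>k<N. iexp (\<theta> / 2 * lam k * (((\<Sum>i<n. x i k) / sqrt n)^2 - 1)))" for x
        unfolding Y_def of_real_sum sum_distrib_left by (rule exp_sum) simp
      then show ?thesis unfolding L_def
        using gvec_normalized_sums[OF n, of "\<lambda>k z. iexp (\<theta> / 2 * lam k * (z^2 - 1))"] by simp
    qed
    have "cmod (F n - L) \<le> (LINT x|PiM {..<n} (\<lambda>_. gvec). \<bar>X x - Y x\<bar>)"
      using P.char_diff_le[OF Xm Ym iXY] unfolding EY by (simp add: F_def X_def)
    also have "\<dots> \<le> (LINT x|PiM {..<n} (\<lambda>_. gvec). (\<Sum>k<N. \<bar>\<theta>\<bar> / 2 * \<bar>lam k\<bar> * \<bar>(\<Sum>i<n. (x i k)^2) / n - 1\<bar>))"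
      by (rule integral_mono[OF iXY iB XY])
    also have "\<dots> = (\<Sum>k<N. \<bar>\<theta>\<bar> / 2 * \<bar>lam k\<bar> * (LINT x|PiM {..<n} (\<lambda>_. gvec). \<bar>(\<Sum>i<n. (x i k)^2) / n - 1\<bar>))"
      by (subst Bochner_Integration.integral_sum) (use C(1) n in auto)
    also have "\<dots> \<le> (\<Sum>k<N. \<bar>\<theta>\<bar> / 2 * \<bar>lam k\<bar> * (C k / sqrt n))"
      by (intro sum_mono mult_left_mono C(2)) (use n in auto)
    also have "\<dots> = (\<bar>\<theta>\<bar> / 2 * (\<Sum>k<N. \<bar>lam k\<bar> * C k)) / sqrt n"
      by (simp add: sum_distrib_left sum_divide_distrib mult.assoc)
    finally show ?thesis .
  qed
  have "(\<lambda>n. F n - L) \<longlonglongrightarrow> 0"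
  proof (rule Lim_null_comparison)
    show "\<forall>\<^sub>F n in sequentially. cmod (F n - L) \<le> (\<bar>\<theta>\<bar> / 2 * (\<Sum>k<N. \<bar>lam k\<bar> * C k)) / sqrt n"
      using eventually_gt_at_top[of 0] by eventually_elim (rule main)
    have "filterlim (\<lambda>n. sqrt (real n)) at_top sequentially"
      by (intro filterlim_compose[OF sqrt_at_top] filterlim_real_sequentially)
    then show "(\<lambda>n. (\<bar>\<theta>\<bar> / 2 * (\<Sum>k<N. \<bar>lam k\<bar> * C k)) / sqrt n) \<longlonglongrightarrow> 0"
      by (intro real_tendsto_divide_at_top[OF tendsto_const])
  qed
  then have "F \<longlonglongrightarrow> L" by (simp add: LIM_zero_iff)
  then show ?thesis unfolding F_def L_def .
qed

end

text \<open>The types enter only through the vector of the \<phi> k. Its law is compared with the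
  standard Gaussian vector by the exchange argument, and the Gaussian limit is already
  known.\<close>

lemma uniform_quadratic_char:
  fixes \<phi> :: "nat => 'a => real"
  assumes U: "prob_space U" and m: "\<And>k. \<phi> k \<in> borel_measurable U" and bd: "\<And>k. \<exists>B. \<forall>x. \<bar>\<phi> k x\<bar> \<le> B"
    and z: "\<And>k. lam k \<noteq> 0 ==> (LINT x|U. \<phi> k x) = 0"
    and o: "\<And>i j. lam i \<noteq> 0 ==> lam j \<noteq> 0 ==> (LINT x|U. \<phi> i x * \<phi> j x) = (if i = j then 1 else 0)"
  shows "(\<lambda>n. (LINT u|PiM {..<n} (\<lambda>_. U). iexp (\<theta> / real n * qf (\<lambda>x y. \<Sum>k<N. lam k * (\<phi> k x * \<phi> k y)) {..<n} u)))
     \<longlonglongrightarrow> (\<Prod>k<N. (LINT z|stdn. iexp (\<theta> / 2 * lam k * (z^2 - 1))))"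
proof -
  interpret U: prob_space U by (rule U)
  \<comment> \<open>Orthonormality is available only where \<open>lam\<close> is nonzero, so the
    other indices are dropped and the rest renumbered. Dropped factors contribute 0 to sums and 1 to
    products.\<close>
  define K where "K = {k. k < N \<and> lam k \<noteq> 0}"
  have fK: "finite K" unfolding K_def by simp
  define N' where "N' = card K"
  obtain e where e: "bij_betw e {0..<N'} K" using ex_bij_betw_nat_finite[OF fK] unfolding N'_def by blast
  define lam' where "lam' k = lam (e k)" for k
  define f where "f k = \<phi> (e k)" for k
  have eK: "e k \<in> K" if "k < N'" for k using bij_betwE[OF e] that by auto
  have ei: "e k = e l \<longleftrightarrow> k = l" if "k < N'" "l < N'" for k l
    using bij_betw_imp_inj_on[OF e] that by (auto simp: inj_on_def)
  have lne: "lam (e k) \<noteq> 0" if "k < N'" for k using eK[OF that] by (simp add: K_def)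
  have reindex: "(\<Sum>k<N. h k) = (\<Sum>k<N'. h (e k))" if "\<And>k. lam k = 0 ==> h k = 0" for h :: "nat => real"
  proof -
    have "(\<Sum>k<N. h k) = (\<Sum>k\<in>K. h k)" by (rule sum.mono_neutral_right) (auto simp: K_def that)
    also have "\<dots> = (\<Sum>k\<in>{0..<N'}. h (e k))" by (rule sum.reindex_bij_betw[OF e, symmetric])
    finally show ?thesis by (simp add: atLeast0LessThan)
  qed
  have reindexp: "(\<Prod>k<N. h k) = (\<Prod>k<N'. h (e k))" if "\<And>k. lam k = 0 ==> h k = 1" for h :: "nat => complex"
  proof -
    have "(\<Prod>k<N. h k) = (\<Prod>k\<in>K. h k)" by (rule prod.mono_neutral_right) (auto simp: K_def that)
    also have "\<dots> = (\<Prod>k\<in>{0..<N'}. h (e k))" by (rule prod.reindex_bij_betw[OF e, symmetric])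
    finally show ?thesis by (simp add: atLeast0LessThan)
  qed
  define V where "V u = (\<lambda>k\<in>{..<N'}. f k u)" for u
  define E where "E = PiM {..<N'} (\<lambda>_. borel :: real measure)"
  have Vm: "V \<in> measurable U E" unfolding V_def E_def f_def by (intro measurable_restrict m)
  define \<mu> where "\<mu> = distr U E V"
  define \<nu> where "\<nu> = PiM {..<N'} (\<lambda>_. stdn)"
  have cmp: "(\<lambda>x. x k) \<in> borel_measurable E" if "k < N'" for k unfolding E_def using that by (intro measurable_component_singleton) auto
  have fi: "integrable U (\<lambda>u. f k u ^ j)" for k j
  proof -
    obtain B where B: "\<And>x. \<bar>f k x\<bar> \<le> B" using bd[of "e k"] unfolding f_def by blast
    have "\<bar>f k x ^ j\<bar> \<le> B ^ j" for x unfolding power_abs by (intro power_mono B) auto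
    then show ?thesis using m[of "e k"] unfolding f_def by (intro U.integrable_const_bound[where B="B ^ j"]) auto
  qed
  \<comment> \<open>One bound for both laws: 3 is the Gaussian fourth moment, and the sum dominates
    every fourth moment of the f k.\<close>
  define c where "c = 3 + (\<Sum>k<N'. (LINT u|U. f k u ^ 4))"
  have cle: "(LINT u|U. f k u ^ 4) \<le> c" if "k < N'" for k
  proof -
    have "(LINT u|U. f k u ^ 4) \<le> (\<Sum>k<N'. (LINT u|U. f k u ^ 4))" using that by (intro member_le_sum) auto
    then show ?thesis by (simp add: c_def)
  qed
  have c3: "c \<ge> 3" unfolding c_def by (simp add: sum_nonneg)
  interpret Q: quadratic_swap "\<lambda>k x. x k" N' lam' c by unfold_locales (use c3 in simp)
  have gn: "Q.good \<nu>"
    unfolding Q.good_def \<nu>_def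
    using prob_gvec[of N'] gvec_moments[of _ N'] c3 by simp
  have gm: "Q.good \<mu>"
  proof -
    have t: "(LINT x|\<mu>. g x) = (LINT u|U. g (V u))" if "g \<in> borel_measurable E" for g :: "(nat => real) => real"
      unfolding \<mu>_def by (rule integral_distr[OF Vm that])
    have 1: "prob_space \<mu>" unfolding \<mu>_def by (rule U.prob_space_distr[OF Vm])
    have 2: "(\<lambda>x. x k) \<in> borel_measurable \<mu>" if "k < N'" for k using cmp[OF that] by (simp add: \<mu>_def)
    have 3: "integrable \<mu> (\<lambda>x. x k ^ 4)" if "k < N'" for k
      unfolding \<mu>_def using fi[of k 4] that
      by (subst integrable_distr_eq[OF Vm borel_measurable_power[OF cmp[OF that]]]) (simp add: V_def)
    have 4: "(LINT x|\<mu>. x k) = 0" if "k < N'" for k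
      using t[OF cmp[OF that]] that z[OF lne[OF that]] by (simp add: V_def f_def)
    have 5: "(LINT x|\<mu>. x k ^ 4) \<le> c" if "k < N'" for k
      using t[OF borel_measurable_power[OF cmp[OF that]], of 4] that cle[OF that] by (simp add: V_def)
    have 6: "(LINT x|\<mu>. x k * x l) = (if k = l then 1 else 0)" if "k < N'" "l < N'" for k l
      using t[OF borel_measurable_times[OF cmp[OF that(1)] cmp[OF that(2)]]] that o[OF lne[OF that(1)] lne[OF that(2)]]
        ei[OF that] by (simp add: V_def f_def)
    show ?thesis unfolding Q.good_def using 1 2 3 4 5 6 by blast
  qed
  have eq: "(LINT x|PiM {..<n} (\<lambda>_. \<mu>). iexp (\<theta> / real n * qf Q.\<kappa> {..<n} x)) =
    (LINT u|PiM {..<n} (\<lambda>_. U). iexp (\<theta> / real n * qf (\<lambda>x y. \<Sum>k<N. lam k * (\<phi> k x * \<phi> k y)) {..<n} u))" for n :: nat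
  proof -
    have p\<mu>: "prob_space \<mu>" using gm by (simp add: Q.good_def)
    have Vm': "V \<in> measurable U \<mu>" using Vm by (simp add: \<mu>_def)
    have "distr U \<mu> V = \<mu>" unfolding \<mu>_def by (rule distr_cong) auto
    moreover have "distr (PiM {..<n} (\<lambda>_. U)) (PiM {..<n} (\<lambda>_. \<mu>)) (compose {..<n} V) = PiM {..<n} (\<lambda>_. distr U \<mu> V)"
      by (rule distr_PiM_finite_prob_space') (use U Vm' p\<mu> in auto)
    ultimately have d: "distr (PiM {..<n} (\<lambda>_. U)) (PiM {..<n} (\<lambda>_. \<mu>)) (compose {..<n} V) = PiM {..<n} (\<lambda>_. \<mu>)" by simp
    have cm: "compose {..<n} V \<in> measurable (PiM {..<n} (\<lambda>_. U)) (PiM {..<n} (\<lambda>_. \<mu>))"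
      unfolding compose_def
    proof (rule measurable_restrict)
      fix i assume "i \<in> {..<n}"
      then show "(\<lambda>x. V (x i)) \<in> measurable (PiM {..<n} (\<lambda>_. U)) \<mu>"
        by (intro measurable_compose[OF measurable_component_singleton[of i "{..<n}" "\<lambda>_. U"] Vm'])
    qed
    have qm: "qf Q.\<kappa> {..<n} \<in> borel_measurable (PiM {..<n} (\<lambda>_. \<mu>))" by (rule Q.qf_measurable[OF gm])
    have "(LINT x|PiM {..<n} (\<lambda>_. \<mu>). iexp (\<theta> / real n * qf Q.\<kappa> {..<n} x)) =
      (LINT u|PiM {..<n} (\<lambda>_. U). iexp (\<theta> / real n * qf Q.\<kappa> {..<n} (compose {..<n} V u)))"
      by (subst d[symmetric], rule integral_distr[OF cm]) (use qm in simp)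
    also have "\<dots> = (LINT u|PiM {..<n} (\<lambda>_. U). iexp (\<theta> / real n * qf (\<lambda>x y. \<Sum>k<N. lam k * (\<phi> k x * \<phi> k y)) {..<n} u))"
    proof -
      have k: "Q.\<kappa> (V x) (V y) = (\<Sum>k<N. lam k * (\<phi> k x * \<phi> k y))" for x y
      proof -
        have "(\<Sum>k<N. lam k * (\<phi> k x * \<phi> k y)) = (\<Sum>k<N'. lam (e k) * (\<phi> (e k) x * \<phi> (e k) y))" by (rule reindex) simp
        also have "\<dots> = Q.\<kappa> (V x) (V y)" unfolding Q.\<kappa>_def by (intro sum.cong refl) (simp add: V_def f_def lam'_def)
        finally show ?thesis ..
      qed
      have "qf Q.\<kappa> {..<n} (compose {..<n} V u) = qf (\<lambda>x y. \<Sum>k<N. lam k * (\<phi> k x * \<phi> k y)) {..<n} u" for u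
        unfolding qf_def by (intro arg_cong[where f="\<lambda>x. x / 2"] sum.cong refl) (simp add: compose_def k)
      then show ?thesis by simp
    qed
    finally show ?thesis .
  qed
  have P: "(\<Prod>k<N. (LINT z|stdn. iexp (\<theta> / 2 * lam k * (z^2 - 1)))) =
     (\<Prod>k<N'. (LINT z|stdn. iexp (\<theta> / 2 * lam' k * (z^2 - 1))))"
    unfolding lam'_def by (rule reindexp) (use prob_space.prob_space[OF std_normal_facts(1)] in simp)
  have "(\<lambda>n. (LINT x|PiM {..<n} (\<lambda>_. \<nu>). iexp (\<theta> / real n * qf Q.\<kappa> {..<n} x)))
     \<longlonglongrightarrow> (\<Prod>k<N'. (LINT z|stdn. iexp (\<theta> / 2 * lam' k * (z^2 - 1))))"
    unfolding Q.\<kappa>_def \<nu>_def by (rule gaussian_quadratic_char)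
  from tendsto_add[OF Q.quadratic_invariance[OF gm gn, of \<theta>] this]
  show ?thesis unfolding eq P by simp
qed

section \<open>Almost sure and L2 convergence of independent centred series\<close>

context prob_space begin

lemma indep_disjoint_orthogonal:
  fixes X :: "nat => 'a => real"
  assumes ind: "indep_vars (\<lambda>_. borel) X UNIV" and AB: "A \<inter> B = {}"
    and Y: "Y1 \<in> borel_measurable (PiM A (\<lambda>_. borel))" "Y2 \<in> borel_measurable (PiM B (\<lambda>_. borel))"
    and i: "integrable M (\<lambda>x. Y1 (\<lambda>i\<in>A. X i x) :: real)" "integrable M (\<lambda>x. Y2 (\<lambda>i\<in>B. X i x))"
    and z: "(LINT x|M. Y2 (\<lambda>i\<in>B. X i x)) = 0"
  shows "(LINT x|M. Y1 (\<lambda>i\<in>A. X i x) * Y2 (\<lambda>i\<in>B. X i x)) = 0"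
    and "integrable M (\<lambda>x. Y1 (\<lambda>i\<in>A. X i x) * Y2 (\<lambda>i\<in>B. X i x))"
proof -
  have "indep_var (PiM A (\<lambda>_. borel)) (\<lambda>x. \<lambda>i\<in>A. X i x) (PiM B (\<lambda>_. borel)) (\<lambda>x. \<lambda>i\<in>B. X i x)"
    by (rule indep_var_restrict[OF ind AB]) auto
  from indep_var_compose[OF this Y]
  have iv: "indep_var borel (\<lambda>x. Y1 (\<lambda>i\<in>A. X i x)) borel (\<lambda>x. Y2 (\<lambda>i\<in>B. X i x))" by (simp add: comp_def)
  show "(LINT x|M. Y1 (\<lambda>i\<in>A. X i x) * Y2 (\<lambda>i\<in>B. X i x)) = 0"
    using indep_var_lebesgue_integral[OF iv i] z by simp
  show "integrable M (\<lambda>x. Y1 (\<lambda>i\<in>A. X i x) * Y2 (\<lambda>i\<in>B. X i x))"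
    by (rule indep_var_integrable[OF iv i])
qed

context
  fixes X :: "nat => 'a => real"
  assumes ind: "indep_vars (\<lambda>_. borel) X UNIV" and i2: "\<And>i. integrable M (\<lambda>x. (X i x)^2)"
    and m0: "\<And>i. (LINT x|M. X i x) = 0"
begin

definition psum :: "nat => nat => 'a => real" where "psum m j x = (\<Sum>i\<in>{m..<j}. X i x)"

lemma X_measurable: "X i \<in> borel_measurable M"
  using ind by (simp add: indep_vars_def)

lemma X_integrable: "integrable M (X i)"
  by (rule square_integrable_imp_integrable[OF X_measurable i2])

lemma psum_measurable: "psum m j \<in> borel_measurable M"
  unfolding psum_def by (intro borel_measurable_sum X_measurable)

lemma psum_integrable: "integrable M (psum m j)"
  unfolding psum_def by (intro Bochner_Integration.integrable_sum X_integrable)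

lemma psum_mean: "(LINT x|M. psum m j x) = 0"
  unfolding psum_def using X_integrable m0 by simp

lemma psum_square_integrable: "integrable M (\<lambda>x. (psum m j x)^2)"
proof (rule Bochner_Integration.integrable_bound[of _ "\<lambda>x. real (card {m..<j}) * (\<Sum>i\<in>{m..<j}. (X i x)^2)"])
  show "integrable M (\<lambda>x. real (card {m..<j}) * (\<Sum>i\<in>{m..<j}. (X i x)^2))"
    by (intro integrable_mult_right Bochner_Integration.integrable_sum i2)
  show "(\<lambda>x. (psum m j x)^2) \<in> borel_measurable M" by (intro borel_measurable_power psum_measurable)
  have "(psum m j x)^2 \<le> real (card {m..<j}) * (\<Sum>i\<in>{m..<j}. (X i x)^2)" for x
    unfolding psum_def using sum_squared_le_sum_of_squares[of "\<lambda>i. X i x" "{m..<j}"] by (simp add: mult.commute)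
  then show "AE x in M. norm ((psum m j x)^2) \<le> norm (real (card {m..<j}) * (\<Sum>i\<in>{m..<j}. (X i x)^2))"
    by (intro AE_I2) (simp add: sum_nonneg abs_of_nonneg)
qed

lemma sum_PiM_measurable: "C \<subseteq> A ==> (\<lambda>w. \<Sum>i\<in>C. w i) \<in> borel_measurable (PiM A (\<lambda>_. borel :: real measure))"
  by (intro borel_measurable_sum measurable_component_singleton) auto

lemma psum_restrict: "{m..<j} \<subseteq> A ==> (\<Sum>i\<in>{m..<j}. (\<lambda>i\<in>A. X i x) i) = psum m j x"
  unfolding psum_def by (intro sum.cong) auto

lemma psum_second_moment: "m \<le> L ==> (LINT x|M. (psum m L x)^2) = (\<Sum>i\<in>{m..<L}. (LINT x|M. (X i x)^2))"
proof (induction L rule: dec_induct)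
  case base then show ?case by (simp add: psum_def)
next
  case (step L)
  have s: "psum m (Suc L) x = psum m L x + X L x" for x using step by (simp add: psum_def)
  have r1: "(\<Sum>i\<in>{m..<L}. (\<lambda>i\<in>{m..<L}. X i x) i) = psum m L x" for x by (rule psum_restrict) simp
  have r2: "(\<Sum>i\<in>{L}. (\<lambda>i\<in>{L}. X i x) i) = X L x" for x by simp
  note o = indep_disjoint_orthogonal[OF ind, of "{m..<L}" "{L}" "\<lambda>w. \<Sum>i\<in>{m..<L}. w i" "\<lambda>w. \<Sum>i\<in>{L}. w i",
     OF _ sum_PiM_measurable sum_PiM_measurable, unfolded r1 r2]
  have o1: "(LINT x|M. psum m L x * X L x) = 0" "integrable M (\<lambda>x. psum m L x * X L x)"
    by (rule o; (rule psum_integrable X_integrable m0 | simp))+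
  have "(LINT x|M. (psum m (Suc L) x)^2) = (LINT x|M. (psum m L x)^2 + 2 * (psum m L x * X L x) + (X L x)^2)"
    unfolding s by (intro Bochner_Integration.integral_cong) (auto simp: power2_eq_square algebra_simps)
  also have "\<dots> = (LINT x|M. (psum m L x)^2) + (LINT x|M. (X L x)^2)"
    using o1 psum_square_integrable i2 by simp
  finally show ?case using step by simp
qed

text \<open>The event is split by the first index at which the partial sum reaches \<epsilon>. On
  each piece the later increment is independent of the past and centred, so the cross term vanishes
  and the square at L is on average no smaller than the square at the crossing.\<close>

lemma kolmogorov_maximal:
  assumes mL: "m \<le> L" and e: "\<epsilon> > 0"
  shows "\<epsilon>^2 * prob {x\<in>space M. \<exists>j\<in>{m..L}. \<epsilon> \<le> \<bar>psum m j x\<bar>} \<le> (\<Sum>i\<in>{m..<L}. (LINT x|M. (X i x)^2))"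
proof -
  note [measurable] = psum_measurable
  define A where "A k = {x\<in>space M. \<epsilon> \<le> \<bar>psum m k x\<bar> \<and> (\<forall>j\<in>{m..<k}. \<bar>psum m j x\<bar> < \<epsilon>)}" for k
  have A: "A k \<in> sets M" for k unfolding A_def by measurable
  have dis: "disjoint_family_on A {m..L}"
    unfolding disjoint_family_on_def A_def by (auto simp: not_le[symmetric])
  have un: "{x\<in>space M. \<exists>j\<in>{m..L}. \<epsilon> \<le> \<bar>psum m j x\<bar>} = (\<Union>k\<in>{m..L}. A k)"
  proof (intro subset_antisym subsetI)
    fix x assume "x \<in> {x\<in>space M. \<exists>j\<in>{m..L}. \<epsilon> \<le> \<bar>psum m j x\<bar>}"
    then obtain j where x: "x \<in> space M" and j: "j \<in> {m..L}" "\<epsilon> \<le> \<bar>psum m j x\<bar>" by auto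
    define k where "k = (LEAST j. m \<le> j \<and> \<epsilon> \<le> \<bar>psum m j x\<bar>)"
    have k: "m \<le> k \<and> \<epsilon> \<le> \<bar>psum m k x\<bar>" unfolding k_def by (rule LeastI[of _ j]) (use j in auto)
    have kj: "k \<le> j" unfolding k_def by (rule Least_le) (use j in auto)
    have "\<bar>psum m i x\<bar> < \<epsilon>" if "i \<in> {m..<k}" for i
      using not_less_Least[of i "\<lambda>j. m \<le> j \<and> \<epsilon> \<le> \<bar>psum m j x\<bar>"] that unfolding k_def[symmetric] by auto
    then show "x \<in> (\<Union>k\<in>{m..L}. A k)" using k kj j x by (auto simp: A_def intro!: bexI[of _ k])
  qed (auto simp: A_def)
  have step: "\<epsilon>^2 * prob (A k) \<le> (LINT x|M. indicator (A k) x * (psum m L x)^2)" if k: "k \<in> {m..L}" for k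
  proof -
    have sp: "psum m L x = psum m k x + psum k L x" for x
      unfolding psum_def using k by (subst sum.atLeastLessThan_concat) auto
    \<comment> \<open>The first-crossing indicator times the partial sum, written as a function of
      the coordinates m to k-1, the form that independence of disjoint blocks requires.\<close>
    define Y1 where "Y1 w = (if \<epsilon> \<le> \<bar>\<Sum>i\<in>{m..<k}. w i\<bar> \<and> (\<forall>j\<in>{m..<k}. \<bar>\<Sum>i\<in>{m..<j}. w i\<bar> < \<epsilon>) then \<Sum>i\<in>{m..<k}. w i else 0)" for w :: "nat => real"
    have Y1m: "Y1 \<in> borel_measurable (PiM {m..<k} (\<lambda>_. borel))"
    proof -
      have 1[measurable]: "(\<lambda>w. \<Sum>i\<in>{m..<k}. w i) \<in> borel_measurable (PiM {m..<k} (\<lambda>_. borel :: real measure))" by (rule sum_PiM_measurable) simp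
      have 2[measurable]: "(\<lambda>w. \<Sum>i\<in>{m..<j}. w i) \<in> borel_measurable (PiM {m..<k} (\<lambda>_. borel :: real measure))" if "j \<in> {m..<k}" for j
        by (rule sum_PiM_measurable) (use that in auto)
      show ?thesis unfolding Y1_def by measurable
    qed
    have Y1e: "Y1 (\<lambda>i\<in>{m..<k}. X i x) = indicator (A k) x * psum m k x" if "x \<in> space M" for x
    proof -
      have "(\<Sum>i\<in>{m..<j}. (\<lambda>i\<in>{m..<k}. X i x) i) = psum m j x" if "j \<in> {m..<k}" for j by (rule psum_restrict) (use that in auto)
      moreover have "(\<Sum>i\<in>{m..<k}. (\<lambda>i\<in>{m..<k}. X i x) i) = psum m k x" by (rule psum_restrict) auto
      ultimately show ?thesis unfolding Y1_def A_def using that by (auto simp: indicator_def)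
    qed
    have iY1: "integrable M (\<lambda>x. indicator (A k) x * psum m k x)"
      by (rule integrable_real_mult_indicator[OF A psum_integrable, simplified mult.commute])
    have iY1': "integrable M (\<lambda>x. Y1 (\<lambda>i\<in>{m..<k}. X i x))"
      using iY1 Y1e by (simp cong: Bochner_Integration.integrable_cong)
    have r2: "(\<Sum>i\<in>{k..<L}. (\<lambda>i\<in>{k..<L}. X i x) i) = psum k L x" for x by (rule psum_restrict) simp
    note o = indep_disjoint_orthogonal[OF ind, of "{m..<k}" "{k..<L}" Y1 "\<lambda>w. \<Sum>i\<in>{k..<L}. w i", OF _ Y1m sum_PiM_measurable, unfolded r2]
    have "(LINT x|M. Y1 (\<lambda>i\<in>{m..<k}. X i x) * psum k L x) = 0" "integrable M (\<lambda>x. Y1 (\<lambda>i\<in>{m..<k}. X i x) * psum k L x)"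
      by (rule o; (rule iY1' psum_integrable psum_mean | simp))+
    then have o1: "(LINT x|M. indicator (A k) x * psum m k x * psum k L x) = 0" "integrable M (\<lambda>x. indicator (A k) x * psum m k x * psum k L x)"
      using Y1e by (simp_all cong: Bochner_Integration.integrable_cong Bochner_Integration.integral_cong)
    have iq: "integrable M (\<lambda>x. indicator (A k) x * (psum m j x)^2)" for j
      by (rule integrable_real_mult_indicator[OF A psum_square_integrable, simplified mult.commute])
    have "\<epsilon>^2 * prob (A k) = (LINT x|M. indicator (A k) x * \<epsilon>^2)" using A by simp
    also have "\<dots> \<le> (LINT x|M. indicator (A k) x * (psum m k x)^2)"
    proof (rule integral_mono[OF _ iq])
      show "integrable M (\<lambda>x. indicator (A k) x * \<epsilon>^2)"
        using integrable_real_mult_indicator[OF A[of k] integrable_const[of "\<epsilon>^2"]] unfolding mult.commute[of "\<epsilon>^2"] .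
      show "indicator (A k) x * \<epsilon>^2 \<le> indicator (A k) x * (psum m k x)^2" for x
        using e abs_le_square_iff[of \<epsilon> "psum m k x"] by (auto simp: A_def indicator_def)
    qed
    also have "\<dots> = (LINT x|M. indicator (A k) x * (psum m k x)^2 + 2 * (indicator (A k) x * psum m k x * psum k L x))"
      using iq o1 by simp
    also have "\<dots> \<le> (LINT x|M. indicator (A k) x * (psum m L x)^2)"
    proof (rule integral_mono[OF _ iq])
      show "integrable M (\<lambda>x. indicator (A k) x * (psum m k x)^2 + 2 * (indicator (A k) x * psum m k x * psum k L x))"
        using iq o1 by simp
      show "indicator (A k) x * (psum m k x)^2 + 2 * (indicator (A k) x * psum m k x * psum k L x) \<le> indicator (A k) x * (psum m L x)^2" for x
        unfolding sp by (auto simp: indicator_def power2_eq_square algebra_simps)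
    qed
    finally show ?thesis .
  qed
  have iq: "integrable M (\<lambda>x. indicator (A k) x * (psum m L x)^2)" for k
    by (rule integrable_real_mult_indicator[OF A psum_square_integrable, simplified mult.commute])
  have "\<epsilon>^2 * prob {x\<in>space M. \<exists>j\<in>{m..L}. \<epsilon> \<le> \<bar>psum m j x\<bar>} = (\<Sum>k\<in>{m..L}. \<epsilon>^2 * prob (A k))"
    unfolding un using A dis by (subst finite_measure_finite_Union) (auto simp: sum_distrib_left)
  also have "\<dots> \<le> (\<Sum>k\<in>{m..L}. (LINT x|M. indicator (A k) x * (psum m L x)^2))" by (rule sum_mono[OF step])
  also have "\<dots> = (LINT x|M. (\<Sum>k\<in>{m..L}. indicator (A k) x) * (psum m L x)^2)"
    unfolding sum_distrib_right using iq by (subst Bochner_Integration.integral_sum) auto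
  also have "\<dots> \<le> (LINT x|M. (psum m L x)^2)"
  proof (rule integral_mono[OF _ psum_square_integrable])
    show "integrable M (\<lambda>x. (\<Sum>k\<in>{m..L}. indicator (A k) x) * (psum m L x)^2)"
      unfolding sum_distrib_right using iq by (intro Bochner_Integration.integrable_sum) auto
    fix x
    have "(\<Sum>k\<in>{m..L}. indicator (A k) x) = (indicator (\<Union>k\<in>{m..L}. A k) x :: real)"
      by (rule indicator_UN_disjoint[symmetric, OF _ dis]) simp
    then show "(\<Sum>k\<in>{m..L}. indicator (A k) x) * (psum m L x)^2 \<le> (psum m L x)^2" by (simp add: indicator_def)
  qed
  also have "\<dots> = (\<Sum>i\<in>{m..<L}. (LINT x|M. (X i x)^2))" by (rule psum_second_moment[OF mL])
  finally show ?thesis .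
qed

context
  assumes sm: "summable (\<lambda>i. (LINT x|M. (X i x)^2))"
begin

lemma variance_tail: "(\<Sum>i\<in>{m..<L}. (LINT x|M. (X i x)^2)) \<le> (\<Sum>i. (LINT x|M. (X i x)^2)) - (\<Sum>i<m. (LINT x|M. (X i x)^2))"
proof -
  have "(\<Sum>i<m. (LINT x|M. (X i x)^2)) + (\<Sum>i\<in>{m..<L}. (LINT x|M. (X i x)^2)) = (\<Sum>i\<in>{..<m} \<union> {m..<L}. (LINT x|M. (X i x)^2))"
    by (rule sum.union_disjoint[symmetric]) auto
  also have "\<dots> \<le> (\<Sum>i. (LINT x|M. (X i x)^2))" by (rule sum_le_suminf[OF sm]) auto
  finally show ?thesis by simp
qed

lemma variance_tail_null: "(\<lambda>m. (\<Sum>i. (LINT x|M. (X i x)^2)) - (\<Sum>i<m. (LINT x|M. (X i x)^2))) \<longlonglongrightarrow> 0"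
  using tendsto_diff[OF tendsto_const summable_LIMSEQ[OF sm], of "\<Sum>i. (LINT x|M. (X i x)^2)"] by simp

text \<open>By the maximal inequality and an increasing limit in L, the probability that some
  increment after m reaches \<epsilon> is at most the variance tail over \<epsilon>^2. Letting m
  grow along \<epsilon> = 1/(q+1) makes the partial sums almost surely Cauchy.\<close>

lemma kolmogorov_convergence: "AE x in M. summable (\<lambda>i. X i x)"
proof -
  note [measurable] = psum_measurable
  define tail where "tail m = (\<Sum>i. (LINT x|M. (X i x)^2)) - (\<Sum>i<m. (LINT x|M. (X i x)^2))" for m
  have tail: "tail \<longlonglongrightarrow> 0" unfolding tail_def by (rule variance_tail_null)
  have one: "AE x in M. \<exists>m. \<forall>j\<ge>m. \<bar>psum m j x\<bar> < \<epsilon>" if e: "\<epsilon> > 0" for \<epsilon>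
  proof -
    define E where "E m = {x\<in>space M. \<exists>j\<in>{m..}. \<epsilon> \<le> \<bar>psum m j x\<bar>}" for m
    have E: "E m \<in> sets M" for m unfolding E_def by measurable
    have PE: "prob (E m) \<le> tail m / \<epsilon>^2" for m
    proof -
      define F where "F L = {x\<in>space M. \<exists>j\<in>{m..m + L}. \<epsilon> \<le> \<bar>psum m j x\<bar>}" for L
      have F: "F L \<in> sets M" for L unfolding F_def by measurable
      have "(\<lambda>L. prob (F L)) \<longlonglongrightarrow> prob (\<Union>L. F L)"
      proof (rule finite_Lim_measure_incseq)
        show "range F \<subseteq> sets M" using F by auto
        show "incseq F" unfolding incseq_def F_def by fastforce
      qed
      moreover have "(\<Union>L. F L) = E m"
      proof (intro subset_antisym subsetI)
        fix x assume "x \<in> E m"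
        then obtain j where j: "x \<in> space M" "j \<ge> m" "\<epsilon> \<le> \<bar>psum m j x\<bar>" by (auto simp: E_def)
        then have "x \<in> F (j - m)" unfolding F_def by auto
        then show "x \<in> (\<Union>L. F L)" by blast
      qed (auto simp: E_def F_def)
      ultimately have "(\<lambda>L. prob (F L)) \<longlonglongrightarrow> prob (E m)" by simp
      moreover have "prob (F L) \<le> tail m / \<epsilon>^2" for L
      proof -
        have "\<epsilon>^2 * prob (F L) \<le> tail m"
          unfolding F_def tail_def by (rule order_trans[OF kolmogorov_maximal[OF _ e] variance_tail]) simp
        then show ?thesis using e by (simp add: pos_le_divide_eq mult.commute)
      qed
      ultimately show ?thesis by (intro LIMSEQ_le_const2[of "\<lambda>L. prob (F L)"]) auto
    qed
    have "prob (\<Inter>m. E m) \<le> 0"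
    proof (rule LIMSEQ_le_const)
      show "(\<lambda>m. tail m / \<epsilon>^2) \<longlonglongrightarrow> 0" using tendsto_divide[OF tail tendsto_const, of "\<epsilon>^2"] e by simp
      have "prob (\<Inter>m. E m) \<le> tail m / \<epsilon>^2" for m
        using finite_measure_mono[of "\<Inter>m. E m" "E m"] E PE[of m] by (meson INT_lower UNIV_I order_trans)
      then show "\<exists>N. \<forall>n\<ge>N. prob (\<Inter>m. E m) \<le> tail n / \<epsilon>^2" by blast
    qed
    then have z: "emeasure M (\<Inter>m. E m) = 0" by (simp add: emeasure_eq_measure measure_le_0_iff)
    have Em: "(\<Inter>m. E m) \<in> sets M" using E by (intro sets.countable_INT) auto
    show ?thesis
    proof (rule AE_I[OF _ z Em])
      show "{x \<in> space M. \<not> (\<exists>m. \<forall>j\<ge>m. \<bar>psum m j x\<bar> < \<epsilon>)} \<subseteq> (\<Inter>m. E m)"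
        by (auto simp: E_def not_less)
    qed
  qed
  have "AE x in M. \<forall>q::nat. \<exists>m. \<forall>j\<ge>m. \<bar>psum m j x\<bar> < 1 / real (Suc q)"
    unfolding AE_all_countable using one by auto
  then show ?thesis
  proof (rule AE_mp, intro AE_I2 impI)
    fix x assume q: "\<forall>q::nat. \<exists>m. \<forall>j\<ge>m. \<bar>psum m j x\<bar> < 1 / real (Suc q)"
    have ps: "(\<Sum>i<j. X i x) - (\<Sum>i<m. X i x) = psum m j x" if "m \<le> j" for m j
      unfolding psum_def using that by (simp add: sum_diff_nat_ivl lessThan_atLeast0)
    show "summable (\<lambda>i. X i x)"
      unfolding summable_iff_convergent Cauchy_convergent_iff[symmetric]
    proof (rule metric_CauchyI)
      fix e :: real assume "e > 0"
      then obtain p :: nat where p: "1 / real (Suc p) < e / 2" using nat_approx_posE[of "e / 2"] by auto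
      obtain m where m: "\<And>j. j \<ge> m ==> \<bar>psum m j x\<bar> < 1 / real (Suc p)" using q by blast
      have "dist (\<Sum>i<j. X i x) (\<Sum>i<l. X i x) < e" if "j \<ge> m" "l \<ge> m" for j l
        using m[OF that(1)] m[OF that(2)] ps[OF that(1)] ps[OF that(2)] p unfolding dist_real_def by linarith
      then show "\<exists>M. \<forall>m\<ge>M. \<forall>n\<ge>M. dist (\<Sum>i<m. X i x) (\<Sum>i<n. X i x) < e" by blast
    qed
  qed
qed

text \<open>Fatou along L: the distance from the N-th partial sum to the limit is at most the liminf
  of the distances to later partial sums, which the variance tail bounds.\<close>

lemma kolmogorov_L2: "(\<lambda>N. (LINT x|M. ((\<Sum>i<N. X i x) - (\<Sum>i. X i x))^2)) \<longlonglongrightarrow> 0"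
proof (rule tendsto_sandwich[OF _ _ tendsto_const variance_tail_null])
  show "\<forall>\<^sub>F N in sequentially. 0 \<le> (LINT x|M. ((\<Sum>i<N. X i x) - (\<Sum>i. X i x))^2)" by (intro always_eventually) simp
  have "(LINT x|M. ((\<Sum>i<N. X i x) - (\<Sum>i. X i x))^2) \<le> (\<Sum>i. (LINT x|M. (X i x)^2)) - (\<Sum>i<N. (LINT x|M. (X i x)^2))" for N
  proof (rule integral_real_bounded)
    let ?t = "(\<Sum>i. (LINT x|M. (X i x)^2)) - (\<Sum>i<N. (LINT x|M. (X i x)^2))"
    show "0 \<le> ?t" using variance_tail[of N N] by simp
    note [measurable] = X_measurable psum_measurable
    have "(\<integral>\<^sup>+x. ennreal (((\<Sum>i<N. X i x) - (\<Sum>i. X i x))^2) \<partial>M) = (\<integral>\<^sup>+x. liminf (\<lambda>L. ennreal ((psum N (N + L) x)^2)) \<partial>M)"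
    proof (rule nn_integral_cong_AE)
      show "AE x in M. ennreal (((\<Sum>i<N. X i x) - (\<Sum>i. X i x))^2) = liminf (\<lambda>L. ennreal ((psum N (N + L) x)^2))"
        using kolmogorov_convergence
      proof eventually_elim
        case (elim x)
        have ps: "psum N (N + L) x = (\<Sum>i<N + L. X i x) - (\<Sum>i<N. X i x)" for L
          unfolding psum_def by (simp add: sum_diff_nat_ivl lessThan_atLeast0)
        have "(\<lambda>L. \<Sum>i<L + N. X i x) \<longlonglongrightarrow> (\<Sum>i. X i x)"
          by (rule LIMSEQ_ignore_initial_segment[OF summable_LIMSEQ[OF elim]])
        then have "(\<lambda>L. (psum N (N + L) x)^2) \<longlonglongrightarrow> ((\<Sum>i. X i x) - (\<Sum>i<N. X i x))^2"
          unfolding ps by (intro tendsto_power tendsto_diff tendsto_const) (simp add: add.commute)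
        then have "(\<lambda>L. ennreal ((psum N (N + L) x)^2)) \<longlonglongrightarrow> ennreal (((\<Sum>i<N. X i x) - (\<Sum>i. X i x))^2)"
          by (intro tendsto_ennrealI) (simp add: power2_commute)
        then show ?case by (intro lim_imp_Liminf[symmetric]) auto
      qed
    qed
    also have "\<dots> \<le> liminf (\<lambda>L. \<integral>\<^sup>+x. ennreal ((psum N (N + L) x)^2) \<partial>M)"
      by (rule nn_integral_liminf) measurable
    also have "\<dots> \<le> ennreal ?t"
    proof -
      have "(\<integral>\<^sup>+x. ennreal ((psum N (N + L) x)^2) \<partial>M) \<le> ennreal ?t" for L
      proof -
        have "(\<integral>\<^sup>+x. ennreal ((psum N (N + L) x)^2) \<partial>M) = ennreal (LINT x|M. (psum N (N + L) x)^2)"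
          by (rule nn_integral_eq_integral[OF psum_square_integrable]) simp
        also have "\<dots> \<le> ennreal ?t" unfolding psum_second_moment[OF le_add1] by (rule ennreal_leI[OF variance_tail])
        finally show ?thesis .
      qed
      then show ?thesis by (intro Liminf_le) (auto intro!: always_eventually)
    qed
    finally show "(\<integral>\<^sup>+x. ennreal (((\<Sum>i<N. X i x) - (\<Sum>i. X i x))^2) \<partial>M) \<le> ennreal ?t" .
  qed
  then show "\<forall>\<^sub>F N in sequentially. (LINT x|M. ((\<Sum>i<N. X i x) - (\<Sum>i. X i x))^2) \<le> (\<Sum>i. (LINT x|M. (X i x)^2)) - (\<Sum>i<N. (LINT x|M. (X i x)^2))"
    by (intro always_eventually) simp
qed

end
end
end

section \<open>The limit law and its characteristic function\<close>

lemma iexp_measurable: "X \<in> borel_measurable N ==> (\<lambda>x. iexp (s * X x)) \<in> borel_measurable N"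
  by (rule measurable_compose[where g="\<lambda>v. iexp (s * v)" and N=borel]) auto

lemma prob_Nspace: "prob_space Nspace"
  unfolding Nspace_def by (rule prob_space_PiM) (rule std_normal_facts)

lemma Nspace_component_measurable: "(\<lambda>\<xi>. \<xi> i) \<in> borel_measurable Nspace"
  using measurable_component_singleton[of i UNIV "\<lambda>_. stdn"] unfolding Nspace_def by simp

context
  fixes lam :: "nat => real"
  assumes sml: "summable (\<lambda>k. (lam k)^2)"
begin

text \<open>The k-th term is centred with variance 2 (lam k)^2, so square summability of
  \<open>lam\<close> is exactly what Kolmogorov's theorem asks for.\<close>

lemma chi_series:
  defines "P \<equiv> PiM (UNIV :: nat set) (\<lambda>_. stdn)"
  shows "AE \<xi> in P. summable (\<lambda>k. lam k * ((\<xi> k)^2 - 1))"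
    "(\<lambda>N. (LINT \<xi>|P. ((\<Sum>k<N. lam k * ((\<xi> k)^2 - 1)) - (\<Sum>k. lam k * ((\<xi> k)^2 - 1)))^2)) \<longlonglongrightarrow> 0"
proof -
  interpret P: prob_space P unfolding P_def by (rule prob_space_PiM) (rule std_normal_facts)
  interpret Z: prob_space stdn by (rule std_normal_facts)
  define X where "X k \<xi> = lam k * ((\<xi> k)^2 - 1)" for k and \<xi> :: "nat => real"
  have "P.indep_vars (\<lambda>_. stdn) (\<lambda>i \<omega>. \<omega> i) UNIV"
    unfolding P_def by (rule PiM_coordinates_indep[OF std_normal_facts(1)]) simp
  then have ind: "P.indep_vars (\<lambda>_. borel) X UNIV"
    unfolding X_def by (rule P.indep_vars_compose2[where Y="\<lambda>k z. lam k * (z^2 - 1)"]) simp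
  have q: "(lam k * (z^2 - 1))^2 = (lam k)^2 * (z ^ 4 - 2 * z^2 + 1)" for k and z :: real
    by (simp add: power2_eq_square power4_eq_xxxx algebra_simps)
  have zi: "integrable stdn (\<lambda>z. lam k * (z^2 - 1))" "integrable stdn (\<lambda>z. (lam k * (z^2 - 1))^2)" for k
    unfolding q using std_normal_facts(2)[of 2] std_normal_facts(2)[of 4] by simp_all
  have ze: "(LINT z|stdn. lam k * (z^2 - 1)) = 0" "(LINT z|stdn. (lam k * (z^2 - 1))^2) = 2 * (lam k)^2" for k
    unfolding q using std_normal_facts(2)[of 2] std_normal_facts(2)[of 4] std_normal_facts(4,5) Z.prob_space by simp_all
  note c = integrable_PiM_component[of "UNIV :: nat set" "\<lambda>_. stdn", OF std_normal_facts(1) UNIV_I, folded P_def]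
  have i2: "integrable P (\<lambda>x. (X k x)^2)" for k unfolding X_def by (rule c(1)[OF zi(2)])
  have m0: "(LINT x|P. X k x) = 0" for k unfolding X_def using c(2)[OF zi(1)] ze(1) by (rule trans)
  have v: "(LINT x|P. (X k x)^2) = 2 * (lam k)^2" for k unfolding X_def using c(2)[OF zi(2)] ze(2) by (rule trans)
  have sm: "summable (\<lambda>i. (LINT x|P. (X i x)^2))" unfolding v using sml by (rule summable_mult)
  show "AE \<xi> in P. summable (\<lambda>k. lam k * ((\<xi> k)^2 - 1))"
    using P.kolmogorov_convergence[OF ind i2 m0 sm] unfolding X_def .
  show "(\<lambda>N. (LINT \<xi>|P. ((\<Sum>k<N. lam k * ((\<xi> k)^2 - 1)) - (\<Sum>k. lam k * ((\<xi> k)^2 - 1)))^2)) \<longlonglongrightarrow> 0"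
    using P.kolmogorov_L2[OF ind i2 m0 sm] unfolding X_def .
qed

text \<open>The coordinates \<open>Some k\<close> form a sequence of independent standard normals,
  so the result for sequences is carried over by an image measure.\<close>

lemma Nspace_chi_series:
  "AE \<xi> in Nspace. summable (\<lambda>k. lam k * ((\<xi> (Some k))^2 - 1))"
  "(\<lambda>N. (LINT \<xi>|Nspace. ((\<Sum>k<N. lam k * ((\<xi> (Some k))^2 - 1)) - (\<Sum>k. lam k * ((\<xi> (Some k))^2 - 1)))^2)) \<longlonglongrightarrow> 0"
proof -
  define P where "P = PiM (UNIV :: nat set) (\<lambda>_. stdn)"
  have m: "(\<lambda>\<xi> k. \<xi> (Some k)) \<in> measurable Nspace P"
  proof -
    have "(\<lambda>\<xi>. \<lambda>k\<in>UNIV. \<xi> (Some k)) \<in> measurable Nspace P"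
      unfolding P_def by (rule measurable_restrict) (use Nspace_component_measurable in simp)
    then show ?thesis unfolding restrict_UNIV .
  qed
  have d: "distr Nspace P (\<lambda>\<xi> k. \<xi> (Some k)) = P"
    using distr_PiM_reindex[of UNIV "\<lambda>_. stdn" Some UNIV, OF std_normal_facts(1)]
    unfolding P_def Nspace_def by (simp add: restrict_UNIV)
  have Xm: "(\<lambda>\<xi>. lam k * ((\<xi> k)^2 - 1)) \<in> borel_measurable P" for k
    using measurable_component_singleton[of k UNIV "\<lambda>_. stdn"] unfolding P_def by simp
  show "AE \<xi> in Nspace. summable (\<lambda>k. lam k * ((\<xi> (Some k))^2 - 1))"
    using AE_distrD[OF m, of "\<lambda>\<xi>. summable (\<lambda>k. lam k * ((\<xi> k)^2 - 1))"] chi_series(1) unfolding d P_def[symmetric] by simp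
  have fm: "(\<lambda>\<xi>. ((\<Sum>k<N. lam k * ((\<xi> k)^2 - 1)) - (\<Sum>k. lam k * ((\<xi> k)^2 - 1)))^2) \<in> borel_measurable P" for N
    by (intro borel_measurable_power borel_measurable_diff borel_measurable_sum borel_measurable_suminf Xm)
  have "(LINT \<xi>|Nspace. ((\<Sum>k<N. lam k * ((\<xi> (Some k))^2 - 1)) - (\<Sum>k. lam k * ((\<xi> (Some k))^2 - 1)))^2) =
     (LINT \<xi>|P. ((\<Sum>k<N. lam k * ((\<xi> k)^2 - 1)) - (\<Sum>k. lam k * ((\<xi> k)^2 - 1)))^2)" for N
    using integral_distr[OF m fm, of N] unfolding d by simp
  then show "(\<lambda>N. (LINT \<xi>|Nspace. ((\<Sum>k<N. lam k * ((\<xi> (Some k))^2 - 1)) - (\<Sum>k. lam k * ((\<xi> (Some k))^2 - 1)))^2)) \<longlonglongrightarrow> 0"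
    using chi_series(2) unfolding P_def by simp
qed

text \<open>For a truncated series the characteristic function factors over \<open>None\<close> and
  the first N coordinates; the almost sure limit is taken by dominated convergence. This is the form
  in which finite-rank limits arrive.\<close>

lemma Nspace_limit_char:
  fixes \<sigma> a s :: real
  defines "T \<equiv> \<lambda>\<xi>. \<Sum>k. lam k * ((\<xi> (Some k))^2 - 1)"
  shows "(\<lambda>N. complex_of_real (exp (- (s * \<sigma>)\<^sup>2 / 2)) * (\<Prod>k<N. (LINT z|stdn. iexp (s * a * lam k * (z^2 - 1)))))
     \<longlonglongrightarrow> (LINT \<xi>|Nspace. iexp (s * (\<sigma> * \<xi> None + a * T \<xi>)))"
    and "(\<lambda>\<xi>. \<sigma> * \<xi> None + a * T \<xi>) \<in> borel_measurable Nspace"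
proof -
  interpret P: prob_space Nspace by (rule prob_Nspace)
  interpret Z: prob_space stdn by (rule std_normal_facts)
  define h where "h i z = (case i of None => iexp (s * \<sigma> * z) | Some k => iexp (s * a * lam k * (z^2 - 1)))" for i :: "nat option" and z :: real
  have hm: "h i \<in> borel_measurable stdn" for i unfolding h_def by (cases i) auto
  have hn: "cmod (h i z) = 1" for i z unfolding h_def by (cases i) auto
  have hi: "integrable stdn (h i)" for i
    using hm hn by (intro Z.integrable_const_bound[where B=1]) auto
  have fin: "(LINT \<xi>|Nspace. iexp (s * (\<sigma> * \<xi> None + a * (\<Sum>k<N. lam k * ((\<xi> (Some k))^2 - 1))))) =
    complex_of_real (exp (- (s * \<sigma>)\<^sup>2 / 2)) * (\<Prod>k<N. (LINT z|stdn. iexp (s * a * lam k * (z^2 - 1))))" for N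
  proof -
    define I where "I = insert None (Some ` {..<N})"
    have fI: "finite I" by (simp add: I_def)
    interpret product_sigma_finite "\<lambda>_::nat option. stdn"
      by (intro product_sigma_finite.intro prob_space_imp_sigma_finite std_normal_facts)
    have e: "iexp (s * (\<sigma> * \<xi> None + a * (\<Sum>k<N. lam k * ((\<xi> (Some k))^2 - 1)))) = (\<Prod>i\<in>I. h i (\<xi> i))" for \<xi> :: "nat option => real"
    proof -
      have "(\<Prod>i\<in>I. h i (\<xi> i)) = h None (\<xi> None) * (\<Prod>k<N. h (Some k) (\<xi> (Some k)))"
        unfolding I_def by (subst prod.insert) (auto simp: prod.reindex)
      also have "(\<Prod>k<N. h (Some k) (\<xi> (Some k))) = iexp (\<Sum>k<N. s * a * lam k * ((\<xi> (Some k))^2 - 1))"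
        unfolding h_def option.case of_real_sum sum_distrib_left by (rule exp_sum[symmetric]) simp
      also have "h None (\<xi> None) * \<dots> = iexp (s * \<sigma> * \<xi> None + (\<Sum>k<N. s * a * lam k * ((\<xi> (Some k))^2 - 1)))"
        unfolding h_def option.case by (simp add: exp_add distrib_left)
      also have "s * \<sigma> * \<xi> None + (\<Sum>k<N. s * a * lam k * ((\<xi> (Some k))^2 - 1)) = s * (\<sigma> * \<xi> None + a * (\<Sum>k<N. lam k * ((\<xi> (Some k))^2 - 1)))"
        by (simp add: distrib_left sum_distrib_left mult.assoc)
      finally show ?thesis ..
    qed
    have m: "(\<lambda>\<xi>. \<lambda>i\<in>I. \<xi> i) \<in> measurable Nspace (PiM I (\<lambda>_. stdn))"
      using Nspace_component_measurable by (intro measurable_restrict) simp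
    have d: "distr Nspace (PiM I (\<lambda>_. stdn)) (\<lambda>\<xi>. \<lambda>i\<in>I. \<xi> i) = PiM I (\<lambda>_. stdn)"
      using distr_PiM_reindex[of UNIV "\<lambda>_. stdn" "\<lambda>i. i" I, OF std_normal_facts(1)]
      unfolding Nspace_def by simp
    have pm: "(\<lambda>\<xi>. \<Prod>i\<in>I. h i (\<xi> i)) \<in> borel_measurable (PiM I (\<lambda>_. stdn))"
      by (intro borel_measurable_prod) (rule measurable_compose[OF measurable_component_singleton], assumption, rule hm)
    have "(LINT \<xi>|Nspace. (\<Prod>i\<in>I. h i (\<xi> i))) = (LINT \<xi>|Nspace. (\<Prod>i\<in>I. h i ((\<lambda>i\<in>I. \<xi> i) i)))"
      by (intro Bochner_Integration.integral_cong refl prod.cong) auto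
    also have "\<dots> = (LINT \<xi>|PiM I (\<lambda>_. stdn). (\<Prod>i\<in>I. h i (\<xi> i)))"
      using integral_distr[OF m pm] unfolding d by simp
    also have "\<dots> = (\<Prod>i\<in>I. (LINT z|stdn. h i z))"
      by (rule product_integral_prod[OF fI hi])
    also have "\<dots> = (LINT z|stdn. h None z) * (\<Prod>k<N. (LINT z|stdn. h (Some k) z))"
      unfolding I_def by (subst prod.insert) (auto simp: prod.reindex)
    also have "(LINT z|stdn. h None z) = char stdn (s * \<sigma>)"
      unfolding char_def h_def by simp
    also have "\<dots> = complex_of_real (exp (- (s * \<sigma>)\<^sup>2 / 2))" by (simp add: char_std_normal_distribution)
    finally show ?thesis unfolding e by (simp add: h_def)
  qed
  have Xm: "(\<lambda>\<xi>. lam k * ((\<xi> (Some k))^2 - 1)) \<in> borel_measurable Nspace" for k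
    by (intro borel_measurable_times borel_measurable_diff borel_measurable_power Nspace_component_measurable) auto
  have Tm: "T \<in> borel_measurable Nspace" unfolding T_def by (intro borel_measurable_suminf Xm)
  show Lm: "(\<lambda>\<xi>. \<sigma> * \<xi> None + a * T \<xi>) \<in> borel_measurable Nspace"
    using Tm Nspace_component_measurable[of None] by simp
  have Nm: "(\<lambda>\<xi>. \<sigma> * \<xi> None + a * (\<Sum>k<N. lam k * ((\<xi> (Some k))^2 - 1))) \<in> borel_measurable Nspace" for N
    by (intro borel_measurable_add borel_measurable_times borel_measurable_const borel_measurable_sum Nspace_component_measurable Xm)
  have "(\<lambda>N. (LINT \<xi>|Nspace. iexp (s * (\<sigma> * \<xi> None + a * (\<Sum>k<N. lam k * ((\<xi> (Some k))^2 - 1))))))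
     \<longlonglongrightarrow> (LINT \<xi>|Nspace. iexp (s * (\<sigma> * \<xi> None + a * T \<xi>)))"
  proof (rule integral_dominated_convergence[where w="\<lambda>_. 1"])
    show "(\<lambda>\<xi>. iexp (s * (\<sigma> * \<xi> None + a * T \<xi>))) \<in> borel_measurable Nspace" by (rule iexp_measurable[OF Lm])
    show "(\<lambda>\<xi>. iexp (s * (\<sigma> * \<xi> None + a * (\<Sum>k<N. lam k * ((\<xi> (Some k))^2 - 1))))) \<in> borel_measurable Nspace" for N
      by (rule iexp_measurable[OF Nm])
    show "AE \<xi> in Nspace. (\<lambda>N. iexp (s * (\<sigma> * \<xi> None + a * (\<Sum>k<N. lam k * ((\<xi> (Some k))^2 - 1))))) \<longlonglongrightarrow> iexp (s * (\<sigma> * \<xi> None + a * T \<xi>))"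
      using Nspace_chi_series(1)
    proof eventually_elim
      case (elim \<xi>)
      have "(\<lambda>N. \<Sum>k<N. lam k * ((\<xi> (Some k))^2 - 1)) \<longlonglongrightarrow> T \<xi>" unfolding T_def by (rule summable_LIMSEQ[OF elim])
      then show ?case by (intro tendsto_exp tendsto_mult tendsto_const tendsto_of_real tendsto_add)
    qed
  qed auto
  then show "(\<lambda>N. complex_of_real (exp (- (s * \<sigma>)\<^sup>2 / 2)) * (\<Prod>k<N. (LINT z|stdn. iexp (s * a * lam k * (z^2 - 1)))))
     \<longlonglongrightarrow> (LINT \<xi>|Nspace. iexp (s * (\<sigma> * \<xi> None + a * T \<xi>)))" unfolding fin .
qed

end

abbreviation UP :: "'i set => ('i => real) measure" where "UP I \<equiv> PiM I (\<lambda>_. unif)"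

section \<open>Functions of finitely many uniform coordinates\<close>

text \<open>Quantified over all functions, not only the extensional points of a product space. Thus
  F may be evaluated at merged, restricted or composed arguments without side conditions.\<close>

definition dep :: "(('i => real) => 'b) => 'i set => bool" where
  "dep F K \<longleftrightarrow> (\<forall>\<omega> \<omega>'. (\<forall>c\<in>K. \<omega> c = \<omega>' c) \<longrightarrow> F \<omega> = F \<omega>')"

lemma depD: "dep F K ==> (\<And>c. c \<in> K ==> \<omega> c = \<omega>' c) ==> F \<omega> = F \<omega>'"
  unfolding dep_def by blast

lemma dep_mono: "dep F K ==> K \<subseteq> L ==> dep F L"
  unfolding dep_def by blast

lemma prob_unif: "prob_space unif" by (rule U.prob_space_axioms)

lemma prob_UP: "prob_space (UP I)" by (rule prob_space_PiM[OF prob_unif])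

lemma psf_unif: "product_sigma_finite (\<lambda>_. unif)"
  by (intro product_sigma_finite.intro prob_space_imp_sigma_finite prob_unif)

lemma UP_component: "i \<in> I ==> (\<lambda>\<omega>. \<omega> i) \<in> borel_measurable (UP I)"
  using measurable_component_singleton[of i I "\<lambda>_. unif"] by simp

lemma restrict_UP: "K \<subseteq> I ==> (\<lambda>\<omega>. \<lambda>n\<in>K. \<omega> n) \<in> measurable (UP I) (UP K)"
  by (intro measurable_restrict measurable_component_singleton) auto

lemma distr_restrict_UP: "K \<subseteq> I ==> distr (UP I) (UP K) (\<lambda>\<omega>. \<lambda>n\<in>K. \<omega> n) = UP K"
  using distr_PiM_reindex[of I "\<lambda>_. unif" "\<lambda>i. i" K, OF prob_unif] by (auto simp: inj_on_def)

lemma dep_restrict: "dep F K ==> F (\<lambda>n\<in>K. \<omega> n) = F \<omega>"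
  by (rule depD) auto

lemma dep_measurable:
  assumes "dep F K" "K \<subseteq> I" "F \<in> measurable (UP K) N" shows "F \<in> measurable (UP I) N"
  using measurable_compose[OF restrict_UP[OF assms(2)] assms(3)] by (simp add: dep_restrict[OF assms(1)])

lemma integral_dep:
  fixes F :: "('i => real) => 'b::{banach, second_countable_topology}"
  assumes "dep F K" "K \<subseteq> I" "F \<in> borel_measurable (UP K)"
  shows "(LINT \<omega>|UP I. F \<omega>) = (LINT \<omega>|UP K. F \<omega>)"
  using integral_distr[OF restrict_UP[OF assms(2)] assms(3)]
  by (simp add: dep_restrict[OF assms(1)] distr_restrict_UP[OF assms(2)])

lemma AE_dep:
  assumes "AE \<omega> in UP K. Q \<omega>" "K \<subseteq> I" "dep Q K"
  shows "AE \<omega> in UP I. Q \<omega>"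
proof -
  have "AE \<omega> in distr (UP I) (UP K) (\<lambda>\<omega>. \<lambda>n\<in>K. \<omega> n). Q \<omega>"
    using assms(1) unfolding distr_restrict_UP[OF assms(2)] .
  from AE_distrD[OF restrict_UP[OF assms(2)] this] show ?thesis unfolding dep_restrict[OF assms(3)] .
qed

definition bmf :: "'i set => (('i => real) => real) => bool" where
  "bmf I F \<longleftrightarrow> dep F I \<and> F \<in> borel_measurable (UP I) \<and> (\<exists>B. \<forall>\<omega>. \<bar>F \<omega>\<bar> \<le> B)"

lemma bmf_integrable: "bmf I F ==> integrable (UP I) F"
proof -
  assume F: "bmf I F"
  interpret prob_space "UP I" by (rule prob_UP)
  obtain B where B: "\<And>x. \<bar>F x\<bar> \<le> B" using F by (auto simp: bmf_def)
  show ?thesis by (rule integrable_const_bound[where B=B]) (use B F in \<open>auto simp: bmf_def\<close>)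
qed

lemma bmf_mono: "bmf K F ==> K \<subseteq> I ==> bmf I F"
  unfolding bmf_def using dep_measurable dep_mono by blast

lemma bmf_dep: "bmf I F ==> dep F I" by (simp add: bmf_def)
lemma bmf_measurable: "bmf I F ==> F \<in> borel_measurable (UP I)" by (simp add: bmf_def)

lemma bmf_const: "bmf I (\<lambda>_. c)" by (auto simp: bmf_def dep_def)

lemma dep_comp2: "dep F K ==> dep G K ==> dep (\<lambda>\<omega>. h (F \<omega>) (G \<omega>)) K"
  unfolding dep_def by metis

lemma bmf_add: "bmf I F ==> bmf I G ==> bmf I (\<lambda>\<omega>. F \<omega> + G \<omega>)"
proof -
  assume a: "bmf I F" "bmf I G"
  then obtain A B where "\<And>x. \<bar>F x\<bar> \<le> A" "\<And>x. \<bar>G x\<bar> \<le> B" by (auto simp: bmf_def)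
  then have "\<bar>F x + G x\<bar> \<le> A + B" for x by (intro order_trans[OF abs_triangle_ineq] add_mono)
  then show ?thesis using a dep_comp2[of F I G "(+)"] unfolding bmf_def by auto
qed

lemma bmf_mult: "bmf I F ==> bmf I G ==> bmf I (\<lambda>\<omega>. F \<omega> * G \<omega>)"
proof -
  assume a: "bmf I F" "bmf I G"
  then obtain A B where "\<And>x. \<bar>F x\<bar> \<le> A" "\<And>x. \<bar>G x\<bar> \<le> B" by (auto simp: bmf_def)
  then have "\<bar>F x * G x\<bar> \<le> \<bar>A\<bar> * \<bar>B\<bar>" for x by (intro abs_mult_le_bounds) auto
  then show ?thesis using a dep_comp2[of F I G "(*)"] unfolding bmf_def by auto
qed

lemma bmf_diff: "bmf I F ==> bmf I G ==> bmf I (\<lambda>\<omega>. F \<omega> - G \<omega>)"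
  using bmf_add[of I F "\<lambda>x. (-1) * G x"] bmf_mult[OF bmf_const[of I "-1"], of G] by simp

lemma bmf_sum: "(\<And>k. k \<in> J ==> bmf I (F k)) ==> bmf I (\<lambda>\<omega>. \<Sum>k\<in>J. F k \<omega>)"
  by (induction J rule: infinite_finite_induct) (auto intro: bmf_add bmf_const)

lemma bmf_prod: "(\<And>k. k \<in> J ==> bmf I (F k)) ==> bmf I (\<lambda>\<omega>. \<Prod>k\<in>J. F k \<omega>)"
  by (induction J rule: infinite_finite_induct) (auto intro: bmf_mult bmf_const)

lemma bmf_L1_le_L2: "bmf I G ==> (LINT \<omega>|UP I. \<bar>G \<omega>\<bar>) \<le> sqrt (LINT \<omega>|UP I. (G \<omega>)^2)"
proof (rule real_le_rsqrt)
  assume G: "bmf I G"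
  interpret prob_space "UP I" by (rule prob_UP)
  have i2: "integrable (UP I) (\<lambda>\<omega>. (G \<omega>)^2)" unfolding power2_eq_square by (rule bmf_integrable[OF bmf_mult[OF G G]])
  have "(LINT \<omega>|UP I. \<bar>G \<omega>\<bar> * 1)^2 \<le> (LINT \<omega>|UP I. \<bar>G \<omega>\<bar>^2) * (LINT \<omega>|UP I. 1^2)"
    by (rule Cauchy_Schwarz_integral) (use i2 bmf_integrable[OF G] in auto)
  then show "(LINT \<omega>|UP I. \<bar>G \<omega>\<bar>)^2 \<le> (LINT \<omega>|UP I. (G \<omega>)^2)" by (simp add: prob_space)
qed

lemma bmf_fold:
  assumes K: "finite K" "finite L" "K \<inter> L = {}" and F: "bmf (K \<union> L) F"
  shows "(LINT \<omega>|UP (K \<union> L). F \<omega>) = (LINT x|UP K. (LINT y|UP L. F (merge K L (x, y))))"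
  by (rule product_sigma_finite.product_integral_fold[OF psf_unif K(3,1,2) bmf_integrable[OF F]])

lemma bmf_merge_measurable:
  assumes F: "bmf (K \<union> L) F"
  shows "(\<lambda>(x, y). F (merge K L (x, y))) \<in> borel_measurable (UP K \<Otimes>\<^sub>M UP L)"
  using measurable_compose[OF measurable_merge bmf_measurable[OF F]] by (simp add: split_beta')

lemma bmf_partial:
  assumes F: "bmf (K \<union> L) F" and K: "K \<inter> L = {}"
  shows "bmf K (\<lambda>x. (LINT y|UP L. F (merge K L (x, y))))"
proof -
  interpret L: prob_space "UP L" by (rule prob_UP)
  obtain B where B: "\<And>x. \<bar>F x\<bar> \<le> B" using F by (auto simp: bmf_def)
  have "(\<lambda>x. (LINT y|UP L. F (merge K L (x, y)))) \<in> borel_measurable (UP K)"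
    by (rule L.borel_measurable_lebesgue_integral[OF bmf_merge_measurable[OF F]])
  moreover have "dep (\<lambda>x. (LINT y|UP L. F (merge K L (x, y)))) K"
    unfolding dep_def
  proof (intro allI impI)
    fix \<omega> \<omega>' :: "'a => real" assume "\<forall>c\<in>K. \<omega> c = \<omega>' c"
    then have "merge K L (\<omega>, y) = merge K L (\<omega>', y)" for y by (auto simp: merge_def)
    then show "(LINT y|UP L. F (merge K L (\<omega>, y))) = (LINT y|UP L. F (merge K L (\<omega>', y)))" by simp
  qed
  moreover have "\<bar>(LINT y|UP L. F (merge K L (x, y)))\<bar> \<le> B" for x
  proof (cases "integrable (UP L) (\<lambda>y. F (merge K L (x, y)))")
    case True
    have "\<bar>(LINT y|UP L. F (merge K L (x, y)))\<bar> \<le> (LINT y|UP L. \<bar>F (merge K L (x, y))\<bar>)" by (rule integral_abs_bound)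
    also have "\<dots> \<le> (LINT y|UP L. B)" using True B by (intro integral_mono) auto
    finally show ?thesis by (simp add: L.prob_space)
  next
    case False then show ?thesis using order_trans[OF abs_ge_zero B] by (simp add: not_integrable_integral_eq)
  qed
  ultimately show ?thesis unfolding bmf_def by blast
qed

lemma bmf_section:
  assumes F: "bmf (K \<union> L) F"
  shows "bmf L (\<lambda>y. F (merge K L (x, y)))"
proof -
  have "(\<lambda>y. F (merge K L (\<lambda>n\<in>K. x n, y))) \<in> borel_measurable (UP L)"
  proof -
    have "(\<lambda>n\<in>K. x n) \<in> space (UP K)" by (auto simp: space_PiM)
    from measurable_Pair2[OF bmf_merge_measurable[OF F] this] show ?thesis by simp
  qed
  moreover have "F (merge K L (\<lambda>n\<in>K. x n, y)) = F (merge K L (x, y))" for y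
    by (intro arg_cong[where f=F]) (auto simp: merge_def)
  moreover have "dep (\<lambda>y. F (merge K L (x, y))) L"
    unfolding dep_def
  proof (intro allI impI)
    fix \<omega> \<omega>' :: "'a => real" assume "\<forall>c\<in>L. \<omega> c = \<omega>' c"
    then have "merge K L (x, \<omega>) = merge K L (x, \<omega>')" by (auto simp: merge_def)
    then show "F (merge K L (x, \<omega>)) = F (merge K L (x, \<omega>'))" by simp
  qed
  ultimately show ?thesis using F unfolding bmf_def by auto
qed

text \<open>Fubini in the coordinates of A outside B: G is constant along them, and F averages to 0
  for almost every value of the shared coordinates. All orthogonality relations of the Hoeffding
  decomposition are instances.\<close>

lemma orthogonal_dep:
  assumes I: "finite I" "A \<subseteq> I" "B \<subseteq> I" and F: "bmf A F" and G: "bmf B G"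
    and z: "AE x in UP (A \<inter> B). (LINT y|UP (A - B). F (merge (A \<inter> B) (A - B) (x, y))) = 0"
  shows "(LINT \<omega>|UP I. F \<omega> * G \<omega>) = 0"
proof -
  have fin: "finite B" "finite (A - B)" using I by (auto intro: finite_subset)
  have un: "B \<union> (A - B) = A \<union> B" by auto
  have FG: "bmf (B \<union> (A - B)) (\<lambda>\<omega>. F \<omega> * G \<omega>)" unfolding un
    by (rule bmf_mult[OF bmf_mono[OF F] bmf_mono[OF G]]) auto
  have "(LINT \<omega>|UP I. F \<omega> * G \<omega>) = (LINT \<omega>|UP (B \<union> (A - B)). F \<omega> * G \<omega>)"
    by (rule integral_dep) (use FG I in \<open>auto simp: bmf_def\<close>)
  also have "\<dots> = (LINT x|UP B. (LINT y|UP (A - B). F (merge B (A - B) (x, y)) * G (merge B (A - B) (x, y))))"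
    by (rule bmf_fold[OF fin _ FG]) auto
  also have "\<dots> = (LINT x|UP B. 0)"
  proof (rule integral_cong_AE)
    have Gm: "G (merge B (A - B) (x, y)) = G x" for x y by (rule depD[OF bmf_dep[OF G]]) (auto simp: merge_def)
    have Fm: "F (merge B (A - B) (x, y)) = F (merge (A \<inter> B) (A - B) (x, y))" for x y
      by (rule depD[OF bmf_dep[OF F]]) (auto simp: merge_def)
    have "AE x in UP B. (LINT y|UP (A - B). F (merge (A \<inter> B) (A - B) (x, y))) = 0"
    proof (rule AE_dep[OF z])
      show "dep (\<lambda>x. (LINT y|UP (A - B). F (merge (A \<inter> B) (A - B) (x, y))) = 0) (A \<inter> B)"
        unfolding dep_def
      proof (intro allI impI)
        fix \<omega> \<omega>' :: "'a => real" assume "\<forall>c\<in>A \<inter> B. \<omega> c = \<omega>' c"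
        then have "merge (A \<inter> B) (A - B) (\<omega>, y) = merge (A \<inter> B) (A - B) (\<omega>', y)" for y by (auto simp: merge_def)
        then show "((LINT y|UP (A - B). F (merge (A \<inter> B) (A - B) (\<omega>, y))) = 0) = ((LINT y|UP (A - B). F (merge (A \<inter> B) (A - B) (\<omega>', y))) = 0)" by simp
      qed
    qed auto
    then show "AE x in UP B. (LINT y|UP (A - B). F (merge B (A - B) (x, y)) * G (merge B (A - B) (x, y))) = 0"
      unfolding Gm Fm by eventually_elim simp
    show "(\<lambda>x. (LINT y|UP (A - B). F (merge B (A - B) (x, y)) * G (merge B (A - B) (x, y)))) \<in> borel_measurable (UP B)"
      by (rule bmf_measurable[OF bmf_partial[OF FG]]) auto
  qed auto
  finally show ?thesis by simp
qed

lemma unif_less_integral: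
  assumes "0 \<le> c" "c \<le> 1" shows "(LINT y|unif. (if y < c then 1 else 0 :: real)) = c"
proof -
  have "(LINT y|unif. (if y < c then 1 else 0 :: real)) = (LINT y|unif. indicator {..<c} y)"
    by (intro Bochner_Integration.integral_cong) (auto simp: indicator_def)
  also have "\<dots> = measure unif {..<c}" by simp
  also have "\<dots> = measure lborel ({0..1} \<inter> {..<c})" by (subst measure_uniform_measure) auto
  also have "{0..1} \<inter> {..<c} = {0..<c}" using assms by auto
  finally show ?thesis using assms by simp
qed

section \<open>Coordinates of the random graph attached to a vertex set\<close>

definition edges :: "nat set => nat set set" where "edges S = {e. e \<subseteq> S \<and> card e = 2}"

definition ei :: "nat set => nat + nat \<times> nat" where "ei e = Inr (Min e, Max e)"

text \<open>The types of S and the edge variables of pairs inside S: all the randomness of the graph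
  induced on S. The edge coordinates follow the ordered-pair encoding of
  \<open>Gidx\<close>.\<close>

definition crd :: "nat set => (nat + nat \<times> nat) set" where "crd S = Inl ` S \<union> ei ` edges S"

lemma edgesE:
  assumes "e \<in> edges S" obtains a b where "e = {a, b}" "a \<in> S" "b \<in> S" "a < b" "Min e = a" "Max e = b"
proof -
  obtain a b where ab: "e = {a, b}" "a \<noteq> b" using assms by (auto simp: edges_def card_2_iff)
  show ?thesis
  proof (cases "a < b")
    case True then show ?thesis using ab assms by (intro that[of a b]) (auto simp: edges_def)
  next
    case False then show ?thesis using ab assms by (intro that[of b a]) (auto simp: edges_def)
  qed
qed

lemma finite_edges: "finite S ==> finite (edges S)"
  unfolding edges_def by (rule finite_subset[of _ "Pow S"]) auto

lemma edges_Int: "edges S \<inter> edges T = edges (S \<inter> T)" by (auto simp: edges_def)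
lemma edges_mono: "S \<subseteq> T ==> edges S \<subseteq> edges T" by (auto simp: edges_def)

lemma ei_set: "e \<in> edges S ==> {Min e, Max e} = e" by (erule edgesE) auto

lemma ei_inj: "inj_on ei (edges UNIV)"
  unfolding inj_on_def ei_def using ei_set by (metis Pair_inject sum.inject(2))

lemma ei_eq: "e \<in> edges S ==> e' \<in> edges T ==> ei e = ei e' \<longleftrightarrow> e = e'"
proof
  assume e: "e \<in> edges S" "e' \<in> edges T" and "ei e = ei e'"
  then have "Min e = Min e'" "Max e = Max e'" by (auto simp: ei_def)
  then have "{Min e, Max e} = {Min e', Max e'}" by (simp only:)
  then show "e = e'" unfolding ei_set[OF e(1)] ei_set[OF e(2)] .
qed simp

lemma finite_crd: "finite S ==> finite (crd S)" by (simp add: crd_def finite_edges)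
lemma crd_mono: "S \<subseteq> T ==> crd S \<subseteq> crd T" unfolding crd_def by (intro Un_mono image_mono edges_mono)

abbreviation GP :: "nat => (nat + nat \<times> nat => real) measure" where "GP n \<equiv> UP (crd {..<n})"

lemma crd_Inl: "Inl i \<in> crd S \<longleftrightarrow> i \<in> S" by (auto simp: crd_def ei_def)
lemma crd_ei: "e \<in> edges T ==> ei e \<in> crd S \<longleftrightarrow> e \<in> edges S"
proof -
  assume e: "e \<in> edges T"
  have "ei e \<notin> Inl ` S" by (auto simp: ei_def)
  then show ?thesis using ei_eq[OF e] unfolding crd_def by blast
qed

text \<open>An edge variable is shared only when both endpoints are. Hence the dependence between
  two subgraphs is governed by the intersection of their vertex sets.\<close>

lemma crd_Int: "crd S \<inter> crd T = crd (S \<inter> T)"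
proof (intro subset_antisym subsetI)
  fix c assume c: "c \<in> crd S \<inter> crd T"
  show "c \<in> crd (S \<inter> T)"
  proof (cases "\<exists>i. c = Inl i")
    case True then show ?thesis using c by (auto simp: crd_Inl)
  next
    case False
    then obtain e where e: "c = ei e" "e \<in> edges S" using c by (auto simp: crd_def)
    then have "e \<in> edges T" using c crd_ei by auto
    then show ?thesis using e edges_Int by (auto simp: crd_ei)
  qed
qed (use crd_mono[of "S \<inter> T"] in auto)

lemma Gidx_crd: "Gidx n = crd {..<n}"
proof -
  have "ei ` edges {..<n} = Inr ` {(i, j). i < j \<and> j < n}"
  proof (intro subset_antisym subsetI)
    fix c :: "nat + nat \<times> nat" assume "c \<in> ei ` edges {..<n}" then show "c \<in> Inr ` {(i, j). i < j \<and> j < n}"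
      by (auto simp: ei_def elim!: edgesE)
  next
    fix c :: "nat + nat \<times> nat" assume "c \<in> Inr ` {(i, j). i < j \<and> j < n}"
    then obtain i j where ij: "c = Inr (i, j)" "i < j" "j < n" by auto
    then have "c = ei {i, j}" "{i, j} \<in> edges {..<n}" by (auto simp: ei_def edges_def)
    then show "c \<in> ei ` edges {..<n}" by blast
  qed
  then show ?thesis by (simp add: Gidx_def crd_def)
qed

text \<open>Assembles a sample point from vertex types u and edge variables w, the latter indexed by two-element sets.\<close>

definition jn :: "nat set => nat set set => (nat => real) => (nat set => real) => nat + nat \<times> nat => real" where
  "jn V E u w = (\<lambda>c\<in>Inl ` V \<union> ei ` E. case c of Inl i => u i | Inr p => w {fst p, snd p})"

text \<open>Integrates first over edge variables with the types fixed. Vertices and edges are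
  separate arguments because the differences \<open>crd S - crd P\<close> to be integrated contain
  edges with one endpoint outside the free vertices.\<close>

lemma vertex_edge_fold:
  fixes F :: "(nat + nat \<times> nat => real) => 'b::{banach, second_countable_topology}"
  assumes V: "finite V" and E: "finite E" "E \<subseteq> edges UNIV" and F: "integrable (UP (Inl ` V \<union> ei ` E)) F"
  shows "(LINT \<omega>|UP (Inl ` V \<union> ei ` E). F \<omega>) = (LINT u|UP V. (LINT w|UP E. F (jn V E u w)))"
proof -
  interpret product_sigma_finite "\<lambda>_ :: nat + nat \<times> nat. unif" by (rule psf_unif)
  interpret PV: prob_space "UP (ei ` E)" by (rule prob_UP)
  have dis: "Inl ` V \<inter> ei ` E = {}" by (auto simp: ei_def)
  have inj: "inj_on ei E" by (rule inj_on_subset[OF ei_inj E(2)])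
  have se: "{Min e, Max e} = e" if "e \<in> E" for e using ei_set E(2) that by blast
  have Fm: "F \<in> borel_measurable (UP (Inl ` V \<union> ei ` E))" using F by auto
  have 1: "(LINT \<omega>|UP (Inl ` V \<union> ei ` E). F \<omega>) = (LINT x|UP (Inl ` V). (LINT y|UP (ei ` E). F (merge (Inl ` V) (ei ` E) (x, y))))"
    by (rule product_integral_fold[OF dis _ _ F]) (use V E in auto)
  define g where "g w = (\<lambda>c\<in>ei ` E. case c of Inl i => 0 | Inr p => w {fst p, snd p})" for w :: "nat set => real"
  define k :: "(nat => real) => nat + nat \<times> nat => real"
    where "k u = (\<lambda>c\<in>Inl ` V. case c of Inl i => u i | Inr p => 0)" for u
  have d2: "distr (UP E) (UP (ei ` E)) g = UP (ei ` E)"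
  proof -
    have "g = (\<lambda>w. \<lambda>c\<in>ei ` E. w (inv_into E ei c))"
    proof (intro ext)
      fix w c show "g w c = (\<lambda>c\<in>ei ` E. w (inv_into E ei c)) c"
      proof (cases "c \<in> ei ` E")
        case True
        then obtain e where e: "e \<in> E" "c = ei e" by auto
        have "g w (ei e) = w e" using se[OF e(1)] e(1) by (simp add: g_def ei_def)
        then show ?thesis using e inv_into_f_f[OF inj e(1)] by simp
      qed (simp add: g_def)
    qed
    then show ?thesis
      using distr_PiM_reindex[of E "\<lambda>_. unif" "inv_into E ei" "ei ` E", OF prob_unif] by (auto intro: inj_on_inv_into inv_into_into)
  qed
  have d1: "distr (UP V) (UP (Inl ` V)) k = UP (Inl ` V)"
  proof -
    have ji: "inj_on Inl V" by auto
    have "k = (\<lambda>w. \<lambda>c\<in>Inl ` V. w (inv_into V Inl c))"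
      unfolding k_def by (intro ext) (auto simp: inv_into_f_f[OF ji] restrict_def)
    then show ?thesis
      using distr_PiM_reindex[of V "\<lambda>_. unif" "inv_into V Inl" "Inl ` V", OF prob_unif] by (auto intro: inj_on_inv_into inv_into_into)
  qed
  have gm: "g \<in> measurable (UP E) (UP (ei ` E))" unfolding g_def
  proof (rule measurable_restrict)
    fix c assume "c \<in> ei ` E"
    then obtain e where e: "e \<in> E" "c = ei e" by auto
    show "(\<lambda>w. case c of Inl i => 0 | Inr p => w {fst p, snd p}) \<in> measurable (UP E) unif"
      using e se[OF e(1)] measurable_component_singleton[OF e(1), of "\<lambda>_. unif"] by (simp add: ei_def)
  qed
  have km: "k \<in> measurable (UP V) (UP (Inl ` V))" unfolding k_def
  proof (rule measurable_restrict)
    fix c assume "c \<in> Inl ` V"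
    then obtain i where i: "i \<in> V" "c = Inl i" by auto
    show "(\<lambda>u. case c of Inl i => u i | Inr p => 0) \<in> measurable (UP V) unif"
      using i measurable_component_singleton[OF i(1), of "\<lambda>_. unif"] by simp
  qed
  have mm: "(\<lambda>(x, y). F (merge (Inl ` V) (ei ` E) (x, y))) \<in> borel_measurable (UP (Inl ` V) \<Otimes>\<^sub>M UP (ei ` E))"
    using measurable_compose[OF measurable_merge Fm] by (simp add: split_beta')
  have jm: "merge (Inl ` V) (ei ` E) (k u, g w) = jn V E u w" for u w
    unfolding jn_def k_def g_def merge_def by (auto simp: fun_eq_iff restrict_def ei_def split: sum.splits)
  have "(LINT x|UP (Inl ` V). (LINT y|UP (ei ` E). F (merge (Inl ` V) (ei ` E) (x, y)))) =
    (LINT u|UP V. (LINT y|UP (ei ` E). F (merge (Inl ` V) (ei ` E) (k u, y))))"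
    by (subst d1[symmetric], rule integral_distr[OF km]) (rule PV.borel_measurable_lebesgue_integral[OF mm])
  also have "\<dots> = (LINT u|UP V. (LINT w|UP E. F (merge (Inl ` V) (ei ` E) (k u, g w))))"
  proof (intro Bochner_Integration.integral_cong refl)
    fix u
    have ks: "k u \<in> space (UP (Inl ` V))" by (auto simp: k_def space_PiM)
    have "(\<lambda>y. F (merge (Inl ` V) (ei ` E) (k u, y))) \<in> borel_measurable (UP (ei ` E))"
      using measurable_Pair2[OF mm ks] by simp
    then show "(LINT y|UP (ei ` E). F (merge (Inl ` V) (ei ` E) (k u, y))) = (LINT w|UP E. F (merge (Inl ` V) (ei ` E) (k u, g w)))"
      by (subst d2[symmetric], intro integral_distr[OF gm])
  qed
  finally show ?thesis unfolding 1 jm .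
qed

lemma prod_edges:
  fixes f :: "nat => nat => real"
  shows "(\<Prod>i<k. \<Prod>j\<in>{i<..<k}. f i j) = (\<Prod>e\<in>edges {..<k}. f (Min e) (Max e))"
proof -
  have "(\<Prod>i<k. \<Prod>j\<in>{i<..<k}. f i j) = (\<Prod>p\<in>(SIGMA i:{..<k}. {i<..<k}). f (fst p) (snd p))"
    by (subst prod.Sigma) (auto simp: split_beta')
  also have "\<dots> = (\<Prod>e\<in>edges {..<k}. f (Min e) (Max e))"
  proof (rule prod.reindex_bij_witness[of _ "\<lambda>e. (Min e, Max e)" "\<lambda>p. {fst p, snd p}"])
    show "\<And>e. e \<in> edges {..<k} ==> {fst (Min e, Max e), snd (Min e, Max e)} = e" using ei_set by simp
    show "\<And>e. e \<in> edges {..<k} ==> (Min e, Max e) \<in> (SIGMA i:{..<k}. {i<..<k})" by (erule edgesE) auto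
    show "\<And>p. p \<in> (SIGMA i:{..<k}. {i<..<k}) ==> {fst p, snd p} \<in> edges {..<k}" by (auto simp: edges_def)
  qed auto
  finally show ?thesis .
qed

lemma bmf_Inl:
  assumes G: "bmf P G" and P: "Inl ` P \<subseteq> K"
  shows "bmf K (\<lambda>\<omega>. G (\<lambda>i. \<omega> (Inl i)))"
proof -
  have m: "(\<lambda>\<omega>. \<lambda>i\<in>P. \<omega> (Inl i)) \<in> measurable (UP K) (UP P)"
  proof (rule measurable_restrict)
    fix i assume "i \<in> P"
    then show "(\<lambda>\<omega>. \<omega> (Inl i)) \<in> measurable (UP K) unif"
      using measurable_component_singleton[of "Inl i" K "\<lambda>_. unif"] P by auto
  qed
  have "G (\<lambda>i\<in>P. \<omega> (Inl i)) = G (\<lambda>i. \<omega> (Inl i))" for \<omega> :: "'a + 'b => real" by (rule depD[OF bmf_dep[OF G]]) auto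
  then have "(\<lambda>\<omega>. G (\<lambda>i. \<omega> (Inl i))) \<in> borel_measurable (UP K)"
    using measurable_compose[OF m bmf_measurable[OF G]] by simp
  moreover have "dep (\<lambda>\<omega>. G (\<lambda>i. \<omega> (Inl i))) K"
    unfolding dep_def by (intro allI impI depD[OF bmf_dep[OF G]]) (use P in auto)
  ultimately show ?thesis using G unfolding bmf_def by auto
qed

lemma crd_diff: "P \<subseteq> S ==> crd S - crd P = Inl ` (S - P) \<union> ei ` (edges S - edges P)"
proof (intro subset_antisym subsetI)
  fix c assume "c \<in> crd S - crd P"
  then show "c \<in> Inl ` (S - P) \<union> ei ` (edges S - edges P)" using crd_ei by (auto simp: crd_def)
next
  fix c assume "c \<in> Inl ` (S - P) \<union> ei ` (edges S - edges P)"
  then show "c \<in> crd S - crd P" using crd_ei by (auto simp: crd_Inl)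
qed

text \<open>Statements about a small set P are derived from an r-set around it, where the clique
  indicator lives.\<close>

lemma ext_card: "finite P ==> card P \<le> r ==> \<exists>S :: nat set. P \<subseteq> S \<and> finite S \<and> card S = r"
proof -
  assume P: "finite P" "card P \<le> r"
  have "infinite (UNIV - P)" using P by (simp add: Diff_infinite_finite)
  then obtain T where T: "finite T" "card T = r - card P" "T \<subseteq> UNIV - P" using infinite_arbitrarily_large by metis
  then have "card (P \<union> T) = r" using P by (subst card_Un_disjoint) auto
  then show ?thesis using P T by (intro exI[of _ "P \<union> T"]) auto
qed

section \<open>Projections of the clique indicator\<close>

text \<open>Symmetry and the bounds are required everywhere here; a graphon only has them on the unit square
  and is truncated to 0 outside it at the end.\<close>

locale good_graphon =
  fixes W :: "real => real => real" and r :: nat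
  assumes Wm: "(\<lambda>(x, y). W x y) \<in> borel_measurable borel" and Wsym: "\<And>x y. W x y = W y x"
    and W0: "\<And>x y. 0 \<le> W x y" and W1: "\<And>x y. W x y \<le> 1" and r2: "2 \<le> r"
begin

lemma W_measurable: "f \<in> borel_measurable N ==> g \<in> borel_measurable N ==> (\<lambda>x. W (f x) (g x)) \<in> borel_measurable N"
  using measurable_compose[OF borel_measurable_Pair Wm] by simp

definition we :: "(nat => real) => nat set => real" where "we u e = W (u (Min e)) (u (Max e))"

lemma we_pair: "a \<noteq> b ==> we u {a, b} = W (u a) (u b)"
  unfolding we_def by (cases "a < b") (auto simp: Wsym min_def max_def)

lemma we01: "0 \<le> we u e" "we u e \<le> 1" unfolding we_def using W0 W1 by auto

lemma prod_we01: "0 \<le> (\<Prod>e\<in>E. we u e)" "(\<Prod>e\<in>E. we u e) \<le> 1"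
  by (auto intro!: prod_nonneg prod_le_1 simp: we01)

lemma we_cong: "e \<in> edges S ==> (\<And>i. i \<in> S ==> u i = v i) ==> we u e = we v e"
  by (erule edgesE) (simp add: we_def)

lemma bmf_we: "e \<in> edges S ==> bmf S (\<lambda>u. we u e)"
proof -
  assume e: "e \<in> edges S"
  then have "Min e \<in> S" "Max e \<in> S" by (auto elim: edgesE)
  then have "(\<lambda>u. we u e) \<in> borel_measurable (UP S)" unfolding we_def by (intro W_measurable UP_component)
  moreover have "dep (\<lambda>u. we u e) S" unfolding dep_def using we_cong[OF e] by blast
  moreover have "\<bar>we u e\<bar> \<le> 1" for u using we01[of u e] by simp
  ultimately show ?thesis unfolding bmf_def by blast
qed

definition ind :: "(nat + nat \<times> nat => real) => nat set => real" where
  "ind \<omega> e = (if \<omega> (ei e) < we (\<lambda>i. \<omega> (Inl i)) e then 1 else 0)"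

definition A :: "nat set => (nat + nat \<times> nat => real) => real" where
  "A S \<omega> = (\<Prod>e\<in>edges S. ind \<omega> e)"

lemma bmf_ind: "e \<in> edges S ==> bmf (crd S) (\<lambda>\<omega>. ind \<omega> e)"
proof -
  assume e: "e \<in> edges S"
  have w: "bmf (crd S) (\<lambda>\<omega>. we (\<lambda>i. \<omega> (Inl i)) e)" by (rule bmf_Inl[OF bmf_we[OF e]]) (auto simp: crd_def)
  have c: "ei e \<in> crd S" using e by (auto simp: crd_def)
  have "(\<lambda>\<omega>. ind \<omega> e) \<in> borel_measurable (UP (crd S))"
    unfolding ind_def using bmf_measurable[OF w] UP_component[OF c] by measurable
  moreover have "dep (\<lambda>\<omega>. ind \<omega> e) (crd S)" unfolding dep_def
  proof (intro allI impI)
    fix \<omega> \<omega>' :: "nat + nat \<times> nat => real" assume a: "\<forall>c\<in>crd S. \<omega> c = \<omega>' c"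
    then have "we (\<lambda>i. \<omega> (Inl i)) e = we (\<lambda>i. \<omega>' (Inl i)) e" using bmf_dep[OF w] unfolding dep_def by blast
    then show "ind \<omega> e = ind \<omega>' e" using a c by (simp add: ind_def)
  qed
  moreover have "\<bar>ind \<omega> e\<bar> \<le> 1" for \<omega> by (simp add: ind_def)
  ultimately show ?thesis unfolding bmf_def by blast
qed

lemma bmf_A: "bmf (crd S) (A S)"
  unfolding A_def[abs_def] by (rule bmf_prod[OF bmf_ind])

lemma A01: "0 \<le> A S \<omega>" "A S \<omega> \<le> 1"
  unfolding A_def by (auto intro!: prod_nonneg prod_le_1 simp: ind_def)

text \<open>Given the types on P, this is the conditional probability that all pairs of S not inside
  P are joined.\<close>

definition hh :: "nat set => nat set => (nat => real) => real" where
  "hh P S u = (LINT v|UP (S - P). (\<Prod>e\<in>edges S - edges P. we (merge P (S - P) (u, v)) e))"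

lemma bmf_prod_we: "E \<subseteq> edges S ==> bmf S (\<lambda>u. \<Prod>e\<in>E. we u e)"
  by (rule bmf_prod) (use bmf_we in auto)

lemma bmf_hh: "P \<subseteq> S ==> bmf P (hh P S)"
proof -
  assume P: "P \<subseteq> S"
  have "P \<union> (S - P) = S" using P by auto
  then have "bmf (P \<union> (S - P)) (\<lambda>u. \<Prod>e\<in>edges S - edges P. we u e)" using bmf_prod_we[of "edges S - edges P" S] by simp
  from bmf_partial[OF this] show ?thesis unfolding hh_def[abs_def] by auto
qed

lemma hh01: assumes P: "P \<subseteq> S" shows "0 \<le> hh P S u" "hh P S u \<le> 1"
proof -
  interpret prob_space "UP (S - P)" by (rule prob_UP)
  have "P \<union> (S - P) = S" using P by auto
  then have "bmf (P \<union> (S - P)) (\<lambda>u. \<Prod>e\<in>edges S - edges P. we u e)" using bmf_prod_we[of "edges S - edges P" S] by simp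
  from bmf_integrable[OF bmf_section[OF this]]
  have i: "integrable (UP (S - P)) (\<lambda>v. \<Prod>e\<in>edges S - edges P. we (merge P (S - P) (u, v)) e)" .
  show "0 \<le> hh P S u" unfolding hh_def by (intro Bochner_Integration.integral_nonneg prod_we01)
  have "hh P S u \<le> (LINT v|UP (S - P). 1)" unfolding hh_def by (intro integral_mono i prod_we01) auto
  then show "hh P S u \<le> 1" by (simp add: prob_space)
qed

lemma integral_edge_indicators:
  assumes E: "finite E"
  shows "(LINT w|UP E. (\<Prod>e\<in>E. if w e < we u e then 1 else 0 :: real)) = (\<Prod>e\<in>E. we u e)"
proof -
  interpret product_sigma_finite "\<lambda>_ :: nat set. unif" by (rule psf_unif)
  have "integrable unif (\<lambda>y. if y < c then 1 else 0 :: real)" for c :: real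
  proof -
    have "U.bm1 (\<lambda>y. if y < c then 1 else 0 :: real)" unfolding U.bm1_def by (auto intro!: exI[of _ 1])
    then show ?thesis by (rule U.bm1_integrable)
  qed
  then have "(LINT w|UP E. (\<Prod>e\<in>E. if w e < we u e then 1 else 0 :: real)) = (\<Prod>e\<in>E. (LINT y|unif. (if y < we u e then 1 else 0 :: real)))"
    by (intro product_integral_prod[OF E])
  then show ?thesis using unif_less_integral[OF we01] by simp
qed

text \<open>The clique on S is the clique on P times the remaining edge indicators. Given all types
  these are independent with means \<open>we\<close>, and averaging over the types outside P yields
  \<open>hh\<close>.\<close>

lemma condexp_A:
  assumes S: "finite S" and P: "P \<subseteq> S"
  shows "(LINT y|UP (crd S - crd P). A S (merge (crd P) (crd S - crd P) (x, y))) = A P x * hh P S (\<lambda>i. x (Inl i))"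
proof -
  define V where "V = S - P"
  define E where "E = edges S - edges P"
  have fin: "finite V" "finite E" using S finite_edges by (auto simp: V_def E_def)
  have E: "E \<subseteq> edges UNIV" by (auto simp: E_def edges_def)
  have d: "crd S - crd P = Inl ` V \<union> ei ` E" unfolding V_def E_def by (rule crd_diff[OF P])
  have un: "crd P \<union> (crd S - crd P) = crd S" using crd_mono[OF P] by auto
  have bF: "bmf (crd S - crd P) (\<lambda>y. A S (merge (crd P) (crd S - crd P) (x, y)))"
    by (rule bmf_section) (unfold un, rule bmf_A)
  have F: "A S (merge (crd P) (crd S - crd P) (x, jn V E u w)) = A P x * (\<Prod>e\<in>E. if w e < we (merge P V (\<lambda>i. x (Inl i), u)) e then 1 else 0)" for u w
  proof -
    define z where "z = merge (crd P) (crd S - crd P) (x, jn V E u w)"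
    have zl: "z (Inl i) = merge P V (\<lambda>i. x (Inl i), u) i" if "i \<in> S" for i
      using that unfolding z_def d by (auto simp: merge_def crd_Inl jn_def V_def)
    have ze: "z (ei e) = w e" if e: "e \<in> E" for e
    proof -
      have "e \<in> edges S" "e \<notin> edges P" using e by (auto simp: E_def)
      then have "ei e \<notin> crd P" "ei e \<in> Inl ` V \<union> ei ` E" "{Min e, Max e} = e" using crd_ei ei_set e by auto
      then show ?thesis unfolding z_def d merge_def jn_def by (simp add: ei_def)
    qed
    have zp: "ind z e = ind x e" if e: "e \<in> edges P" for e
      by (rule depD[OF bmf_dep[OF bmf_ind[OF e]]]) (simp add: z_def merge_def)
    have zw: "we (\<lambda>i. z (Inl i)) e = we (merge P V (\<lambda>i. x (Inl i), u)) e" if "e \<in> edges S" for e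
      by (rule we_cong[OF that]) (simp add: zl)
    have "A S z = (\<Prod>e\<in>E. ind z e) * (\<Prod>e\<in>edges P. ind z e)"
      unfolding A_def E_def by (rule prod.subset_diff[OF edges_mono[OF P] finite_edges[OF S]])
    also have "(\<Prod>e\<in>edges P. ind z e) = A P x" unfolding A_def using zp by (intro prod.cong) auto
    also have "(\<Prod>e\<in>E. ind z e) = (\<Prod>e\<in>E. if w e < we (merge P V (\<lambda>i. x (Inl i), u)) e then 1 else 0)"
    proof (rule prod.cong[OF refl])
      fix e assume e: "e \<in> E"
      then have eS: "e \<in> edges S" by (auto simp: E_def)
      show "ind z e = (if w e < we (merge P V (\<lambda>i. x (Inl i), u)) e then 1 else 0)"
        unfolding ind_def ze[OF e] zw[OF eS] by (rule refl)
    qed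
    finally show ?thesis by (simp add: z_def mult.commute)
  qed
  have "(LINT y|UP (crd S - crd P). A S (merge (crd P) (crd S - crd P) (x, y))) =
    (LINT u|UP V. (LINT w|UP E. A S (merge (crd P) (crd S - crd P) (x, jn V E u w))))"
    using vertex_edge_fold[OF fin E, of "\<lambda>y. A S (merge (crd P) (crd S - crd P) (x, y))"] bmf_integrable[OF bF]
    unfolding d by blast
  also have "\<dots> = (LINT u|UP V. A P x * (\<Prod>e\<in>E. we (merge P V (\<lambda>i. x (Inl i), u)) e))"
    unfolding F by (simp add: integral_edge_indicators[OF fin(2)])
  also have "\<dots> = A P x * hh P S (\<lambda>i. x (Inl i))" unfolding hh_def V_def E_def by simp
  finally show ?thesis .
qed

text \<open>The free types are exchangeable and W is symmetric, so a relabelling that carries P to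
  an initial segment preserves the integral. Symmetry enters because the relabelling need not
  respect the order of the endpoints.\<close>

lemma hh_reindex:
  assumes \<beta>: "bij_betw \<beta> {..<r} S" and P: "\<beta> ` {..<d} = P" and d: "d \<le> r"
  shows "hh P S u = hh {..<d} {..<r} (\<lambda>a. u (\<beta> a))"
proof -
  define I where "I = {..<r} - {..<d}"
  have inj: "inj_on \<beta> {..<r}" and im: "\<beta> ` {..<r} = S" using \<beta> by (auto simp: bij_betw_def)
  have imI: "\<beta> ` I = S - P"
    unfolding I_def im[symmetric] P[symmetric] using d inj by (intro inj_on_image_set_diff) auto
  have mem: "\<beta> a \<in> P \<longleftrightarrow> a < d" if "a < r" for a
    unfolding P[symmetric] using inj_on_image_mem_iff[OF inj, of a "{..<d}"] that d by auto
  have dist: "distr (UP (S - P)) (UP I) (\<lambda>\<omega>. \<lambda>n\<in>I. \<omega> (\<beta> n)) = UP I"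
    by (rule distr_PiM_reindex[of _ "\<lambda>_. unif", OF prob_unif]) (use inj imI in \<open>auto simp: I_def inj_on_def\<close>)
  have m: "(\<lambda>\<omega>. \<lambda>n\<in>I. \<omega> (\<beta> n)) \<in> measurable (UP (S - P)) (UP I)"
    by (intro measurable_restrict measurable_component_singleton) (use imI in auto)
  define g where "g v = (\<Prod>e\<in>edges {..<r} - edges {..<d}. we (merge {..<d} I (\<lambda>a. u (\<beta> a), v)) e)" for v
  have gm: "g \<in> borel_measurable (UP I)"
  proof -
    have "{..<d} \<union> I = {..<r}" using d by (auto simp: I_def)
    then have "bmf ({..<d} \<union> I) (\<lambda>u. \<Prod>e\<in>edges {..<r} - edges {..<d}. we u e)"
      using bmf_prod_we[of "edges {..<r} - edges {..<d}" "{..<r}"] by simp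
    from bmf_measurable[OF bmf_section[OF this]] show ?thesis unfolding g_def .
  qed
  have key: "g (\<lambda>n\<in>I. v (\<beta> n)) = (\<Prod>e\<in>edges S - edges P. we (merge P (S - P) (u, v)) e)" for v
  proof -
    define M where "M = merge P (S - P) (u, v)"
    have M: "merge {..<d} I (\<lambda>a. u (\<beta> a), \<lambda>n\<in>I. v (\<beta> n)) a = M (\<beta> a)" if "a < r" for a
    proof (cases "a < d")
      case True then show ?thesis using mem[OF that] by (simp add: M_def merge_def)
    next
      case False
      then have "a \<in> I" using that by (simp add: I_def)
      then have "\<beta> a \<in> S - P" using imI by blast
      then show ?thesis using False \<open>a \<in> I\<close> by (auto simp: M_def merge_def)
    qed
    have bij: "bij_betw (image \<beta>) (edges {..<r} - edges {..<d}) (edges S - edges P)"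
    proof (rule bij_betw_imageI)
      show "inj_on ((`) \<beta>) (edges {..<r} - edges {..<d})"
        by (rule inj_on_subset[OF inj_on_image_Pow[OF inj]]) (auto simp: edges_def)
      show "(`) \<beta> ` (edges {..<r} - edges {..<d}) = edges S - edges P"
      proof (intro subset_antisym subsetI)
        fix e' assume "e' \<in> (`) \<beta> ` (edges {..<r} - edges {..<d})"
        then obtain e where e: "e' = \<beta> ` e" "e \<subseteq> {..<r}" "card e = 2" "\<not> e \<subseteq> {..<d}" by (auto simp: edges_def)
        then have "card e' = 2" "e' \<subseteq> S" using card_image[OF inj_on_subset[OF inj e(2)]] im by auto
        moreover have "\<not> e' \<subseteq> P" using e mem by auto
        ultimately show "e' \<in> edges S - edges P" by (auto simp: edges_def)
      next
        fix e' assume "e' \<in> edges S - edges P"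
        then have e': "e' \<subseteq> \<beta> ` {..<r}" "card e' = 2" "\<not> e' \<subseteq> P" using im by (auto simp: edges_def)
        then obtain e where e: "e \<subseteq> {..<r}" "e' = \<beta> ` e" by (auto simp: subset_image_iff)
        then have "card e = 2" using e' card_image[OF inj_on_subset[OF inj e(1)]] by simp
        moreover have "\<not> e \<subseteq> {..<d}" using e e'(3) P by auto
        ultimately show "e' \<in> (`) \<beta> ` (edges {..<r} - edges {..<d})" using e by (auto simp: edges_def)
      qed
    qed
    have "g (\<lambda>n\<in>I. v (\<beta> n)) = (\<Prod>e\<in>edges {..<r} - edges {..<d}. we M (\<beta> ` e))"
      unfolding g_def
    proof (rule prod.cong[OF refl])
      fix e assume "e \<in> edges {..<r} - edges {..<d}"
      then have "e \<in> edges {..<r}" by simp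
      then obtain a b where ab: "e = {a, b}" "a < r" "b < r" "a < b" "Min e = a" "Max e = b" by (auto elim: edgesE)
      have "\<beta> a \<noteq> \<beta> b" using inj ab by (auto simp: inj_on_def)
      then have "we M (\<beta> ` e) = W (M (\<beta> a)) (M (\<beta> b))" unfolding ab(1) using we_pair by simp
      then show "we (merge {..<d} I (\<lambda>a. u (\<beta> a), \<lambda>n\<in>I. v (\<beta> n))) e = we M (\<beta> ` e)"
        unfolding we_def[of _ e] ab(5,6) M[OF ab(2)] M[OF ab(3)] by simp
    qed
    also have "\<dots> = (\<Prod>e\<in>edges S - edges P. we M e)" by (rule prod.reindex_bij_betw[OF bij])
    finally show ?thesis unfolding M_def .
  qed
  have "hh {..<d} {..<r} (\<lambda>a. u (\<beta> a)) = (LINT v|UP I. g v)" unfolding hh_def g_def I_def ..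
  also have "\<dots> = (LINT v|UP (S - P). g (\<lambda>n\<in>I. v (\<beta> n)))"
    by (subst dist[symmetric], rule integral_distr[OF m gm])
  also have "\<dots> = hh P S u" unfolding key hh_def ..
  finally show ?thesis ..
qed

text \<open>By \<open>hh_reindex\<close> the value of \<open>hh P S\<close> is the same for every
  r-set S around P. Listing P in increasing order fixes a representative that does not mention
  S.\<close>

definition hP :: "nat set => (nat => real) => real" where
  "hP P u = hh {..<card P} {..<r} (\<lambda>a. u (sorted_list_of_set P ! a))"

lemma hh_hP:
  assumes S: "finite S" "card S = r" and P: "P \<subseteq> S"
  shows "hh P S u = hP P u"
proof -
  define d where "d = card P"
  have fP: "finite P" using S P finite_subset by auto
  have d: "d \<le> r" unfolding d_def using card_mono[OF S(1) P] S by simp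
  let ?s = "\<lambda>a. sorted_list_of_set P ! a"
  have b1: "bij_betw ?s {..<d} P"
    by (rule bij_betw_nth) (use fP in \<open>auto simp: d_def\<close>)
  have "card {d..<r} = card (S - P)" using S P fP by (simp add: card_Diff_subset d_def)
  then obtain g where g: "bij_betw g {d..<r} (S - P)" using finite_same_card_bij[of "{d..<r}" "S - P"] S by auto
  define \<beta> where "\<beta> a = (if a < d then ?s a else g a)" for a
  have 1: "bij_betw \<beta> {..<d} P" using b1 by (rule bij_betw_cong[THEN iffD1, rotated]) (simp add: \<beta>_def)
  have 2: "bij_betw \<beta> {d..<r} (S - P)" using g by (rule bij_betw_cong[THEN iffD1, rotated]) (simp add: \<beta>_def)
  have "bij_betw \<beta> ({..<d} \<union> {d..<r}) (P \<union> (S - P))" by (rule bij_betw_combine[OF 1 2]) auto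
  moreover have "{..<d} \<union> {d..<r} = {..<r}" "P \<union> (S - P) = S" using d P by auto
  ultimately have \<beta>: "bij_betw \<beta> {..<r} S" by simp
  have "hh P S u = hh {..<d} {..<r} (\<lambda>a. u (\<beta> a))"
    by (rule hh_reindex[OF \<beta> _ d]) (use 1 in \<open>simp add: bij_betw_def\<close>)
  also have "\<dots> = hh {..<d} {..<r} (\<lambda>a. u (?s a))"
    by (rule depD[OF bmf_dep[OF bmf_hh]]) (use d in \<open>auto simp: \<beta>_def\<close>)
  finally show ?thesis by (simp add: hP_def d_def)
qed

text \<open>The conditional expectation of the clique indicator of any r-set containing P given the coordinates on P.\<close>

definition B :: "nat set => (nat + nat \<times> nat => real) => real" where
  "B P \<omega> = A P \<omega> * hP P (\<lambda>i. \<omega> (Inl i))"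

lemma bmf_hP: "finite P ==> card P \<le> r ==> bmf P (hP P)"
proof -
  assume "finite P" "card P \<le> r"
  then obtain S where S: "P \<subseteq> S" "finite S" "card S = r" using ext_card by blast
  have "hP P = hh P S" using hh_hP[OF S(2,3,1)] by (intro ext) simp
  then show ?thesis using bmf_hh[OF S(1)] by simp
qed

lemma hP01: "card P \<le> r ==> 0 \<le> hP P u" "card P \<le> r ==> hP P u \<le> 1"
  unfolding hP_def using hh01[of "{..<card P}" "{..<r}"] by auto

lemma bmf_B: "finite P ==> card P \<le> r ==> bmf (crd P) (B P)"
  unfolding B_def[abs_def] by (intro bmf_mult bmf_A bmf_Inl[OF bmf_hP]) (auto simp: crd_def)

lemma B01: "card P \<le> r ==> 0 \<le> B P \<omega>" "card P \<le> r ==> B P \<omega> \<le> 1"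
  unfolding B_def using A01 hP01 by (auto intro: mult_nonneg_nonneg mult_le_one)

lemma condexp_AB:
  assumes "finite S" "card S = r" "P \<subseteq> S"
  shows "(LINT y|UP (crd S - crd P). A S (merge (crd P) (crd S - crd P) (x, y))) = B P x"
  unfolding condexp_A[OF assms(1,3)] hh_hP[OF assms] B_def ..

text \<open>Both sides are conditional expectations of the same A S; the integral over the
  coordinates outside Q is split at those of P.\<close>

lemma tower_B:
  assumes P: "finite P" "card P \<le> r" and Q: "Q \<subseteq> P"
  shows "(LINT y|UP (crd P - crd Q). B P (merge (crd Q) (crd P - crd Q) (x, y))) = B Q x"
proof -
  obtain S where S: "P \<subseteq> S" "finite S" "card S = r" using ext_card[OF P] by blast
  have QS: "Q \<subseteq> S" using Q S by auto
  define K where "K = crd P - crd Q"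
  define L where "L = crd S - crd P"
  have KL: "K \<union> L = crd S - crd Q" "K \<inter> L = {}" using crd_mono[OF Q] crd_mono[OF S(1)] by (auto simp: K_def L_def)
  have fin: "finite K" "finite L" using finite_crd S P by (auto simp: K_def L_def)
  have un: "crd Q \<union> (crd S - crd Q) = crd S" using crd_mono[OF QS] by auto
  have bF: "bmf (K \<union> L) (\<lambda>v. A S (merge (crd Q) (crd S - crd Q) (x, v)))"
    unfolding KL by (rule bmf_section) (unfold un, rule bmf_A)
  have "B Q x = (LINT v|UP (K \<union> L). A S (merge (crd Q) (crd S - crd Q) (x, v)))"
    unfolding KL(1) by (rule condexp_AB[OF S(2,3) QS, symmetric])
  also have "\<dots> = (LINT y|UP K. (LINT y'|UP L. A S (merge (crd Q) (crd S - crd Q) (x, merge K L (y, y')))))"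
    by (rule bmf_fold[OF fin KL(2) bF])
  also have "\<dots> = (LINT y|UP K. (LINT y'|UP L. A S (merge (crd P) L (merge (crd Q) K (x, y), y'))))"
  proof -
    have "A S (merge (crd Q) (crd S - crd Q) (x, merge K L (y, y'))) = A S (merge (crd P) L (merge (crd Q) K (x, y), y'))" for y y'
      by (rule depD[OF bmf_dep[OF bmf_A]]) (use crd_mono[OF Q] in \<open>auto simp: merge_def K_def L_def\<close>)
    then show ?thesis by simp
  qed
  also have "\<dots> = (LINT y|UP K. B P (merge (crd Q) K (x, y)))"
    unfolding L_def condexp_AB[OF S(2,3,1)] ..
  finally show ?thesis by (simp add: K_def)
qed

lemma hdens_hh:
  assumes d: "d \<le> r"
  shows "hdens W r (Kr r) {..<d} x = (\<Prod>e\<in>edges {..<d}. we x e) * hh {..<d} {..<r} x"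
proof -
  have sub: "edges {..<d} \<subseteq> edges {..<r}" using d by (intro edges_mono) auto
  have "(\<Prod>i<r. \<Prod>j\<in>{i<..<r}. W (if i \<in> {..<d} then x i else \<omega> i) (if j \<in> {..<d} then x j else \<omega> j) ^ Kr r i j)
     = (\<Prod>e\<in>edges {..<d}. we x e) * (\<Prod>e\<in>edges {..<r} - edges {..<d}. we (merge {..<d} ({..<r} - {..<d}) (x, \<omega>)) e)" for \<omega>
  proof -
    define M where "M = merge {..<d} ({..<r} - {..<d}) (x, \<omega>)"
    have "(\<Prod>i<r. \<Prod>j\<in>{i<..<r}. W (if i \<in> {..<d} then x i else \<omega> i) (if j \<in> {..<d} then x j else \<omega> j) ^ Kr r i j)
      = (\<Prod>e\<in>edges {..<r}. W (if Min e \<in> {..<d} then x (Min e) else \<omega> (Min e)) (if Max e \<in> {..<d} then x (Max e) else \<omega> (Max e)) ^ Kr r (Min e) (Max e))"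
      by (rule prod_edges)
    also have "\<dots> = (\<Prod>e\<in>edges {..<r}. we M e)"
    proof (rule prod.cong[OF refl])
      fix e assume "e \<in> edges {..<r}"
      then obtain a b where ab: "a < r" "b < r" "a < b" "Min e = a" "Max e = b" by (auto elim: edgesE)
      then show "W (if Min e \<in> {..<d} then x (Min e) else \<omega> (Min e)) (if Max e \<in> {..<d} then x (Max e) else \<omega> (Max e)) ^ Kr r (Min e) (Max e) = we M e"
        unfolding we_def ab(4,5) M_def merge_def Kr_def by simp
    qed
    also have "\<dots> = (\<Prod>e\<in>edges {..<r} - edges {..<d}. we M e) * (\<Prod>e\<in>edges {..<d}. we M e)"
      by (rule prod.subset_diff[OF sub]) (simp add: finite_edges)
    also have "(\<Prod>e\<in>edges {..<d}. we M e) = (\<Prod>e\<in>edges {..<d}. we x e)"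
      by (intro prod.cong refl we_cong) (auto simp: M_def merge_def)
    finally show ?thesis by (simp add: M_def mult.commute)
  qed
  then show ?thesis unfolding hdens_def hh_def by simp
qed

text \<open>Given the types of the s shared vertices, the two copies use disjoint sets of further
  vertices and edges, so their completion probabilities multiply to a square. The exponent m is the
  multiplicity of a shared edge: 1 for the simple graph and 2 for the doubled edge.\<close>

lemma two_copies_density:
  assumes s: "s \<le> r"
    and E0: "\<And>i j. i < j ==> j < s ==> E i j = m"
    and E1: "\<And>i j. i < j ==> s \<le> j ==> j < r ==> E i j = 1"
    and E2: "\<And>i j. i < j ==> r \<le> j ==> j < 2 * r - s ==> i < s \<or> r \<le> i ==> E i j = 1"
    and E3: "\<And>i j. r \<le> j ==> s \<le> i ==> i < r ==> E i j = 0"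
  shows "tdens W (2 * r - s) E = (LINT u|UP {..<s}. (\<Prod>e\<in>edges {..<s}. we u e ^ m) * (hP {..<s} u)^2)"
proof -
  define k where "k = 2 * r - s"
  define D where "D = {..<s}"
  define C1 where "C1 = {..<r}"
  define C2 where "C2 = D \<union> {r..<k}"
  define V1 where "V1 = C1 - D"
  define V2 where "V2 = C2 - D"
  have D1: "D \<subseteq> C1" and D2: "D \<subseteq> C2" and Dk: "C1 \<union> C2 = {..<k}" and Di: "C1 \<inter> C2 = D"
    using s by (auto simp: D_def C1_def C2_def k_def)
  have c1: "finite C1" "card C1 = r" by (auto simp: C1_def)
  have dj: "{..<s} \<inter> {r..<2 * r - s} = {}" using s by auto
  have c2: "finite C2" "card C2 = r"
    using s card_Un_disjoint[OF _ _ dj] by (auto simp: C2_def D_def k_def)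
  define p0 where "p0 u = (\<Prod>e\<in>edges D. we u e ^ m)" for u
  define p1 where "p1 u = (\<Prod>e\<in>edges C1 - edges D. we u e)" for u
  define p2 where "p2 u = (\<Prod>e\<in>edges C2 - edges D. we u e)" for u
  have disj: "(edges C1 - edges D) \<inter> (edges C2 - edges D) = {}" using edges_Int[of C1 C2] unfolding Di by auto
  have prod: "(\<Prod>i<k. \<Prod>j\<in>{i<..<k}. W (\<omega> i) (\<omega> j) ^ E i j) = p0 \<omega> * (p1 \<omega> * p2 \<omega>)" for \<omega>
  proof -
    have "(\<Prod>i<k. \<Prod>j\<in>{i<..<k}. W (\<omega> i) (\<omega> j) ^ E i j) = (\<Prod>e\<in>edges {..<k}. we \<omega> e ^ E (Min e) (Max e))"
      unfolding we_def by (rule prod_edges)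
    also have "\<dots> = (\<Prod>e\<in>edges D \<union> ((edges C1 - edges D) \<union> (edges C2 - edges D)). we \<omega> e ^ E (Min e) (Max e))"
    proof (rule prod.mono_neutral_right)
      show "finite (edges {..<k})" by (simp add: finite_edges)
      show "edges D \<union> ((edges C1 - edges D) \<union> (edges C2 - edges D)) \<subseteq> edges {..<k}"
        using edges_mono[of C1 "{..<k}"] edges_mono[of C2 "{..<k}"] edges_mono[of D "{..<k}"] Dk D1 by auto
      show "\<forall>e\<in>edges {..<k} - (edges D \<union> ((edges C1 - edges D) \<union> (edges C2 - edges D))). we \<omega> e ^ E (Min e) (Max e) = 1"
      proof
        fix e assume e: "e \<in> edges {..<k} - (edges D \<union> ((edges C1 - edges D) \<union> (edges C2 - edges D)))"
        then have "e \<in> edges {..<k}" by simp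
        then obtain a b where ab: "e = {a, b}" "a < k" "b < k" "a < b" "Min e = a" "Max e = b" by (auto elim: edgesE)
        have "e \<notin> edges C1" "e \<notin> edges C2" using e by auto
        then have "\<not> (a < r \<and> b < r)" "\<not> ((a < s \<or> r \<le> a) \<and> (b < s \<or> r \<le> b))"
          using ab by (auto simp: edges_def C1_def C2_def D_def)
        then have "r \<le> b" "s \<le> a" "a < r" using ab s by auto
        then show "we \<omega> e ^ E (Min e) (Max e) = 1" unfolding ab(5,6) using E3 by simp
      qed
    qed
    also have "\<dots> = (\<Prod>e\<in>edges D. we \<omega> e ^ E (Min e) (Max e)) *
        ((\<Prod>e\<in>edges C1 - edges D. we \<omega> e ^ E (Min e) (Max e)) * (\<Prod>e\<in>edges C2 - edges D. we \<omega> e ^ E (Min e) (Max e)))"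
    proof -
      have f: "finite (edges D)" "finite (edges C1 - edges D)" "finite (edges C2 - edges D)"
        using c1 c2 by (auto simp: finite_edges D_def)
      show ?thesis using f disj by (subst prod.union_disjoint) (auto simp: prod.union_disjoint)
    qed
    also have "(\<Prod>e\<in>edges D. we \<omega> e ^ E (Min e) (Max e)) = p0 \<omega>"
      unfolding p0_def by (intro prod.cong refl) (auto simp: D_def E0 elim!: edgesE)
    also have "(\<Prod>e\<in>edges C1 - edges D. we \<omega> e ^ E (Min e) (Max e)) = p1 \<omega>"
      unfolding p1_def
    proof (intro prod.cong refl)
      fix e assume e: "e \<in> edges C1 - edges D"
      then have "e \<in> edges C1" by simp
      then obtain a b where ab: "e = {a, b}" "a < r" "b < r" "a < b" "Min e = a" "Max e = b" by (auto simp: C1_def elim: edgesE)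
      have "\<not> b < s" using e ab by (auto simp: edges_def D_def)
      then show "we \<omega> e ^ E (Min e) (Max e) = we \<omega> e" unfolding ab(5,6) using E1 ab by simp
    qed
    also have "(\<Prod>e\<in>edges C2 - edges D. we \<omega> e ^ E (Min e) (Max e)) = p2 \<omega>"
      unfolding p2_def
    proof (intro prod.cong refl)
      fix e assume e: "e \<in> edges C2 - edges D"
      then have "e \<in> edges C2" by simp
      then obtain a b where ab: "e = {a, b}" "a \<in> C2" "b \<in> C2" "a < b" "Min e = a" "Max e = b" by (auto elim: edgesE)
      have "\<not> b < s" using e ab by (auto simp: edges_def D_def)
      then have "r \<le> b" "b < k" "a < s \<or> r \<le> a" using ab by (auto simp: C2_def D_def)
      then show "we \<omega> e ^ E (Min e) (Max e) = we \<omega> e" unfolding ab(5,6) using E2 ab by (simp add: k_def)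
    qed
    finally show ?thesis .
  qed
  have b0: "bmf D p0"
  proof -
    have "bmf D (\<lambda>u. we u e ^ m)" if "e \<in> edges D" for e
    proof -
      have "(\<lambda>u. we u e ^ m) = (\<lambda>u. \<Prod>i<m. we u e)" by simp
      then show ?thesis using bmf_prod[of "{..<m}" D "\<lambda>_ u. we u e"] bmf_we[OF that] by simp
    qed
    then show ?thesis unfolding p0_def[abs_def] by (rule bmf_prod)
  qed
  have b1: "bmf C1 p1" unfolding p1_def[abs_def] by (rule bmf_prod_we) auto
  have b2: "bmf C2 p2" unfolding p2_def[abs_def] by (rule bmf_prod_we) auto
  have u1: "D \<union> V1 = C1" and u2: "D \<union> V2 = C2" using D1 D2 by (auto simp: V1_def V2_def)
  have uk: "C1 \<union> V2 = {..<k}" "C1 \<inter> V2 = {}" "finite V2" "finite V1" "finite D" "D \<inter> V1 = {}"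
    using Dk Di c1 c2 by (auto simp: V1_def V2_def D_def)
  have bk: "bmf (C1 \<union> V2) (\<lambda>\<omega>. p0 \<omega> * (p1 \<omega> * p2 \<omega>))" unfolding uk(1)
    by (intro bmf_mult bmf_mono[OF b0] bmf_mono[OF b1] bmf_mono[OF b2]) (use Dk D1 in auto)
  have h1: "hP D u = (LINT v|UP V1. p1 (merge D V1 (u, v)))" for u
    using hh_hP[OF c1 D1, of u] unfolding hh_def p1_def V1_def by simp
  have h2: "hP D u = (LINT v|UP V2. p2 (merge D V2 (u, v)))" for u
    using hh_hP[OF c2 D2, of u] unfolding hh_def p2_def V2_def by simp
  have bhD: "bmf D (hP D)" by (rule bmf_hP) (use s in \<open>auto simp: D_def\<close>)
  have "tdens W k E = (LINT \<omega>|UP (C1 \<union> V2). p0 \<omega> * (p1 \<omega> * p2 \<omega>))"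
    unfolding tdens_def hdens_def uk(1) by (simp add: prod)
  also have "\<dots> = (LINT x|UP C1. (LINT y|UP V2. p0 (merge C1 V2 (x, y)) * (p1 (merge C1 V2 (x, y)) * p2 (merge C1 V2 (x, y)))))"
    by (rule bmf_fold[OF c1(1) uk(3,2) bk])
  also have "\<dots> = (LINT x|UP C1. p0 x * p1 x * hP D x)"
  proof (intro Bochner_Integration.integral_cong refl)
    fix x
    have "p0 (merge C1 V2 (x, y)) = p0 x" for y by (rule depD[OF bmf_dep[OF b0]]) (use D1 in \<open>auto simp: merge_def\<close>)
    moreover have "p1 (merge C1 V2 (x, y)) = p1 x" for y by (rule depD[OF bmf_dep[OF b1]]) (auto simp: merge_def)
    moreover have "p2 (merge C1 V2 (x, y)) = p2 (merge D V2 (x, y))" for y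
      by (rule depD[OF bmf_dep[OF b2]]) (use D1 uk(2) u2 in \<open>auto simp: merge_def\<close>)
    ultimately show "(LINT y|UP V2. p0 (merge C1 V2 (x, y)) * (p1 (merge C1 V2 (x, y)) * p2 (merge C1 V2 (x, y)))) = p0 x * p1 x * hP D x"
      by (simp add: h2 mult.assoc)
  qed
  also have "\<dots> = (LINT x|UP (D \<union> V1). p0 x * p1 x * hP D x)" unfolding u1 ..
  also have "\<dots> = (LINT u|UP D. (LINT v|UP V1. p0 (merge D V1 (u, v)) * p1 (merge D V1 (u, v)) * hP D (merge D V1 (u, v))))"
    by (rule bmf_fold[OF uk(5,4,6)]) (unfold u1, intro bmf_mult bmf_mono[OF b0 D1] b1 bmf_mono[OF bhD D1])
  also have "\<dots> = (LINT u|UP D. p0 u * (hP D u)^2)"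
  proof (intro Bochner_Integration.integral_cong refl)
    fix u
    have "p0 (merge D V1 (u, v)) = p0 u" for v by (rule depD[OF bmf_dep[OF b0]]) (auto simp: merge_def)
    moreover have "hP D (merge D V1 (u, v)) = hP D u" for v by (rule depD[OF bmf_dep[OF bhD]]) (auto simp: merge_def)
    ultimately have "(LINT v|UP V1. p0 (merge D V1 (u, v)) * p1 (merge D V1 (u, v)) * hP D (merge D V1 (u, v)))
      = (LINT v|UP V1. (p0 u * hP D u) * p1 (merge D V1 (u, v)))" by (simp add: ac_simps)
    also have "\<dots> = (p0 u * hP D u) * (LINT v|UP V1. p1 (merge D V1 (u, v)))" by simp
    also have "\<dots> = p0 u * (hP D u)^2" unfolding h1[symmetric] by (simp add: power2_eq_square)
    finally show "(LINT v|UP V1. p0 (merge D V1 (u, v)) * p1 (merge D V1 (u, v)) * hP D (merge D V1 (u, v))) = p0 u * (hP D u)^2" .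
  qed
  finally show ?thesis unfolding k_def D_def p0_def .
qed

end

section \<open>Counting vertex subsets and their overlaps\<close>

definition Sub :: "nat => nat => nat set set" where "Sub k n = {S. S \<subseteq> {..<n} \<and> card S = k}"

lemma finite_Sub: "finite (Sub k n)" unfolding Sub_def by (rule finite_subset[of _ "Pow {..<n}"]) auto

lemma card_Sub: "card (Sub k n) = n choose k" unfolding Sub_def using n_subsets[of "{..<n}" k] by simp

lemma Sub_finite: "S \<in> Sub k n ==> finite S" unfolding Sub_def by (auto intro: finite_subset)

lemma SubD: "S \<in> Sub k n ==> finite S \<and> S \<subseteq> {..<n} \<and> card S = k"
  using Sub_finite unfolding Sub_def by blast

lemma binomial_le_power: "n choose k \<le> n ^ k"
proof (cases "k \<le> n")
  case True then show ?thesis by (rule binomial_le_pow)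
next
  case False then show ?thesis by (simp add: binomial_eq_0)
qed

lemma card_Sub_le: "real (card (Sub k n)) \<le> real n ^ k"
  unfolding card_Sub using binomial_le_power[of n k] by (metis of_nat_le_iff of_nat_power)

lemma card_Sub_super:
  assumes Q: "Q \<in> Sub d n" and d: "d \<le> r"
  shows "card {S \<in> Sub r n. Q \<subseteq> S} = (n - d) choose (r - d)"
proof -
  have fQ: "finite Q" and Qn: "Q \<subseteq> {..<n}" and cQ: "card Q = d" using SubD[OF Q] by auto
  have "bij_betw (\<lambda>S. S - Q) {S \<in> Sub r n. Q \<subseteq> S} {X. X \<subseteq> {..<n} - Q \<and> card X = r - d}"
  proof (rule bij_betw_byWitness[where f'="\<lambda>X. X \<union> Q"])
    show "(\<lambda>S. S - Q) ` {S \<in> Sub r n. Q \<subseteq> S} \<subseteq> {X. X \<subseteq> {..<n} - Q \<and> card X = r - d}"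
      using fQ cQ by (auto simp: Sub_def card_Diff_subset)
    show "(\<lambda>X. X \<union> Q) ` {X. X \<subseteq> {..<n} - Q \<and> card X = r - d} \<subseteq> {S \<in> Sub r n. Q \<subseteq> S}"
    proof
      fix S assume "S \<in> (\<lambda>X. X \<union> Q) ` {X. X \<subseteq> {..<n} - Q \<and> card X = r - d}"
      then obtain X where X: "S = X \<union> Q" "X \<subseteq> {..<n} - Q" "card X = r - d" by auto
      then have "finite X" by (auto intro: finite_subset)
      then have "card S = r" using X fQ cQ d by (subst X(1), subst card_Un_disjoint) auto
      then show "S \<in> {S \<in> Sub r n. Q \<subseteq> S}" using X Qn by (auto simp: Sub_def)
    qed
  qed auto
  then have "card {S \<in> Sub r n. Q \<subseteq> S} = card {X. X \<subseteq> {..<n} - Q \<and> card X = r - d}" by (rule bij_betw_same_card)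
  also have "\<dots> = card ({..<n} - Q) choose (r - d)" by (rule n_subsets) simp
  also have "card ({..<n} - Q) = n - d" using card_Diff_subset[OF fQ Qn] cQ by simp
  finally show ?thesis .
qed

lemma card_Sub_super_le:
  assumes Q: "Q \<in> Sub d n"
  shows "real (card {S \<in> Sub r n. Q \<subseteq> S}) * real n ^ d \<le> real n ^ r"
proof (cases "d \<le> r")
  case True
  have "real (card {S \<in> Sub r n. Q \<subseteq> S}) \<le> real n ^ (r - d)"
  proof -
    have "(n - d) choose (r - d) \<le> (n - d) ^ (r - d)" by (rule binomial_le_power)
    also have "\<dots> \<le> n ^ (r - d)" by (rule power_mono) auto
    finally show ?thesis unfolding card_Sub_super[OF Q True] by (metis of_nat_le_iff of_nat_power)
  qed
  then have "real (card {S \<in> Sub r n. Q \<subseteq> S}) * real n ^ d \<le> real n ^ (r - d) * real n ^ d"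
    by (rule mult_right_mono) simp
  also have "\<dots> = real n ^ r" using True by (simp flip: power_add)
  finally show ?thesis .
next
  case False
  have "{S \<in> Sub r n. Q \<subseteq> S} = {}"
  proof (rule ccontr)
    assume "{S \<in> Sub r n. Q \<subseteq> S} \<noteq> {}"
    then obtain S where S: "S \<in> Sub r n" "Q \<subseteq> S" by auto
    then have "card Q \<le> card S" using SubD[of S r n] card_mono[of S Q] by auto
    then show False using SubD[OF S(1)] SubD[OF Q] False by simp
  qed
  then show ?thesis by (simp only: card.empty) simp
qed

text \<open>A set meeting S in at least k points contains one of the at most 2^r k-subsets of S. The
  count is of order n^(r-k); multiplying by n^k avoids subtraction in the exponent.\<close>

lemma card_overlap:
  assumes S: "S \<in> Sub r n"
  shows "real (card {T \<in> Sub r n. k \<le> card (S \<inter> T)}) * real n ^ k \<le> 2 ^ r * real n ^ r"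
proof -
  have fS: "finite S" "card S = r" using SubD[OF S] by auto
  define Qs where "Qs = {Q. Q \<subseteq> S \<and> card Q = k}"
  have fQ: "finite Qs" unfolding Qs_def using fS by (auto intro: finite_subset[of _ "Pow S"])
  have cQ: "card Qs \<le> 2 ^ r"
  proof -
    have "card Qs \<le> card (Pow S)" unfolding Qs_def using fS by (intro card_mono) auto
    then show ?thesis using fS by (simp add: card_Pow)
  qed
  have "{T \<in> Sub r n. k \<le> card (S \<inter> T)} \<subseteq> (\<Union>Q\<in>Qs. {T \<in> Sub r n. Q \<subseteq> T})"
  proof
    fix T assume T: "T \<in> {T \<in> Sub r n. k \<le> card (S \<inter> T)}"
    then have "k \<le> card (S \<inter> T)" by simp
    then obtain Q where "Q \<subseteq> S \<inter> T" "card Q = k" by (rule obtain_subset_with_card_n)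
    then show "T \<in> (\<Union>Q\<in>Qs. {T \<in> Sub r n. Q \<subseteq> T})" using T by (auto simp: Qs_def)
  qed
  then have "card {T \<in> Sub r n. k \<le> card (S \<inter> T)} \<le> card (\<Union>Q\<in>Qs. {T \<in> Sub r n. Q \<subseteq> T})"
    by (rule card_mono[rotated]) (rule finite_UN_I[OF fQ], rule finite_subset[OF _ finite_Sub[of r n]], blast)
  also have "\<dots> \<le> (\<Sum>Q\<in>Qs. card {T \<in> Sub r n. Q \<subseteq> T})" by (rule card_UN_le[OF fQ])
  finally have "real (card {T \<in> Sub r n. k \<le> card (S \<inter> T)}) \<le> real (\<Sum>Q\<in>Qs. card {T \<in> Sub r n. Q \<subseteq> T})"
    unfolding of_nat_le_iff .
  then have "real (card {T \<in> Sub r n. k \<le> card (S \<inter> T)}) \<le> (\<Sum>Q\<in>Qs. real (card {T \<in> Sub r n. Q \<subseteq> T}))"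
    unfolding of_nat_sum .
  then have "real (card {T \<in> Sub r n. k \<le> card (S \<inter> T)}) * real n ^ k \<le> (\<Sum>Q\<in>Qs. real (card {T \<in> Sub r n. Q \<subseteq> T})) * real n ^ k"
    by (rule mult_right_mono) simp
  also have "\<dots> = (\<Sum>Q\<in>Qs. real (card {T \<in> Sub r n. Q \<subseteq> T}) * real n ^ k)" by (rule sum_distrib_right)
  also have "\<dots> \<le> (\<Sum>Q\<in>Qs. real n ^ r)"
  proof (rule sum_mono)
    fix Q assume "Q \<in> Qs"
    then have "Q \<in> Sub k n" using S by (auto simp: Qs_def Sub_def)
    then show "real (card {T \<in> Sub r n. Q \<subseteq> T}) * real n ^ k \<le> real n ^ r" by (rule card_Sub_super_le)
  qed
  also have "\<dots> = real (card Qs) * real n ^ r" by simp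
  also have "\<dots> \<le> 2 ^ r * real n ^ r"
  proof (rule mult_right_mono)
    have "real (card Qs) \<le> real (2 ^ r)" unfolding of_nat_le_iff by (rule cQ)
    then show "real (card Qs) \<le> 2 ^ r" by simp
  qed simp
  finally show ?thesis .
qed

section \<open>Hoeffding projection of the clique count and its remainder\<close>

context good_graphon begin

definition tt :: real where "tt = tdens W r (Kr r)"

lemma A_no_edges: "edges S = {} ==> A S \<omega> = 1" by (simp add: A_def)

lemma edges_small: "edges {} = {}" "edges {i} = {}"
  by (auto simp: edges_def subset_singleton_iff)

lemma B_empty: "B {} \<omega> = tt"
proof -
  have "B {} \<omega> = hh {..<0} {..<r} (\<lambda>a. \<omega> (Inl (sorted_list_of_set {} ! a)))"
    by (simp add: B_def A_no_edges edges_small hP_def)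
  also have "\<dots> = hh {..<0} {..<r} (\<lambda>_. 0)" by (rule depD[OF bmf_dep[OF bmf_hh]]) auto
  also have "\<dots> = tt" using hdens_hh[of 0 "\<lambda>_. 0"] by (simp add: tt_def tdens_def edges_small)
  finally show ?thesis .
qed

lemma tt01: "0 \<le> tt" "tt \<le> 1" using B01[of "{}"] B_empty by auto

lemma B_single: "B {i} \<omega> = t1 r W (\<omega> (Inl i))"
proof -
  have z: "{..<1::nat} = {0}" by auto
  have "B {i} \<omega> = hh {..<1} {..<r} (\<lambda>a. \<omega> (Inl (sorted_list_of_set {i} ! a)))"
    by (simp add: B_def A_no_edges edges_small hP_def)
  also have "\<dots> = hh {..<1} {..<r} (\<lambda>_. \<omega> (Inl i))" by (rule depD[OF bmf_dep[OF bmf_hh]]) (use r2 in auto)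
  also have "\<dots> = t1 r W (\<omega> (Inl i))"
    using hdens_hh[of 1 "\<lambda>_. \<omega> (Inl i)"] r2 unfolding t1_def z by (simp add: edges_small)
  finally show ?thesis .
qed

text \<open>The density of K_r with two marked vertices and the edge between them removed.\<close>

definition h2 :: "real => real => real" where "h2 x y = hh {..<2} {..<r} (\<lambda>a. if a = 0 then x else y)"

text \<open>Relabelling by the transposition \<beta> of the two marked vertices.\<close>

lemma h2_sym: "h2 x y = h2 y x"
proof -
  define \<beta> where "\<beta> a = (if a = 0 then 1 else if a = 1 then 0 else a)" for a :: nat
  have inv: "\<beta> (\<beta> a) = a" for a by (simp add: \<beta>_def)
  have "bij_betw \<beta> {..<r} {..<r}" by (rule bij_betw_byWitness[where f'=\<beta>]) (use r2 inv in \<open>auto simp: \<beta>_def\<close>)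
  moreover have "\<beta> ` {..<2} = {..<2}" by (auto simp: \<beta>_def image_iff less_2_cases_iff)
  ultimately have "h2 x y = hh {..<2} {..<r} (\<lambda>a. if \<beta> a = 0 then x else y)" unfolding h2_def using hh_reindex r2 by blast
  also have "\<dots> = hh {..<2} {..<r} (\<lambda>a. if a = 0 then y else x)"
    by (rule depD[OF bmf_dep[OF bmf_hh]]) (use r2 in \<open>auto simp: \<beta>_def less_2_cases_iff\<close>)
  finally show ?thesis by (simp add: h2_def)
qed

lemma h2_01: "0 \<le> h2 x y" "h2 x y \<le> 1" unfolding h2_def using hh01[of "{..<2}" "{..<r}"] r2 by auto

lemma hP_pair: "i \<noteq> j ==> hP {i, j} u = h2 (u i) (u j)"
proof -
  have *: "hP {i, j} u = h2 (u i) (u j)" if ij: "i < j" for i j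
  proof -
    have s: "sorted_list_of_set {i, j} = [i, j]" using ij sorted_list_of_set.idem_if_sorted_distinct[of "[i, j]"] by simp
    have c: "card {i, j} = 2" using ij by simp
    show ?thesis unfolding hP_def h2_def s c
      by (rule depD[OF bmf_dep[OF bmf_hh]]) (use r2 in \<open>auto simp: less_2_cases_iff\<close>)
  qed
  assume "i \<noteq> j"
  then show ?thesis
  proof (cases "i < j")
    case False
    then have "hP {j, i} u = h2 (u j) (u i)" using \<open>i \<noteq> j\<close> by (intro *) auto
    then show ?thesis by (simp add: insert_commute h2_sym)
  qed (rule *)
qed

lemma edges_doubleton: "i \<noteq> j ==> edges {i, j} = {{i, j}}"
  unfolding edges_def
proof (intro subset_antisym subsetI)
  fix e assume "i \<noteq> j" "e \<in> {e. e \<subseteq> {i, j} \<and> card e = 2}"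
  then show "e \<in> {{i, j}}" using card_subset_eq[of "{i, j}" e] by auto
qed auto

lemma B_pair: "i \<noteq> j ==> B {i, j} \<omega> = ind \<omega> {i, j} * h2 (\<omega> (Inl i)) (\<omega> (Inl j))"
  by (simp add: B_def A_def edges_doubleton hP_pair)

lemma VW_eq: "VW r W x y = W x y * h2 x y"
proof -
  have z: "{..<2::nat} = {0, 1}" by auto
  have e: "edges {0, 1::nat} = {{0, 1}}" by (rule edges_doubleton) simp
  have "VW r W x y = (\<Prod>e\<in>edges {0, 1}. we (\<lambda>a. if a = 0 then x else y) e) * hh {..<2} {..<r} (\<lambda>a. if a = 0 then x else y)"
    unfolding VW_def using hdens_hh[of 2 "\<lambda>a. if a = 0 then x else y"] r2 by (simp only: z)
  then show ?thesis unfolding e h2_def using we_pair[of 0 1] by simp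
qed

lemma clique_count_sum: "real (clique_count W n r \<omega>) = (\<Sum>S\<in>Sub r n. A S \<omega>)"
proof -
  have AS: "A S \<omega> = (if \<forall>i\<in>S. \<forall>j\<in>S. i \<noteq> j \<longrightarrow> Gedge W \<omega> i j then 1 else 0)" if S: "S \<in> Sub r n" for S
  proof -
    have i: "ind \<omega> {i, j} = (if Gedge W \<omega> i j then 1 else 0)" if "i \<noteq> j" for i j
      unfolding ind_def we_pair[OF that] Gedge_def ei_def using that by (simp add: min_def max_def)
    show ?thesis
    proof (cases "\<forall>i\<in>S. \<forall>j\<in>S. i \<noteq> j \<longrightarrow> Gedge W \<omega> i j")
      case True
      have "ind \<omega> e = 1" if e: "e \<in> edges S" for e
      proof -
        obtain a b where "e = {a, b}" "a \<in> S" "b \<in> S" "a < b" using edgesE[OF e] by blast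
        then show ?thesis using True i[of a b] by auto
      qed
      then show ?thesis using True by (simp add: A_def)
    next
      case False
      then obtain a b where ab: "a \<in> S" "b \<in> S" "a \<noteq> b" "\<not> Gedge W \<omega> a b" by auto
      have "{a, b} \<in> edges S" "ind \<omega> {a, b} = 0" using ab i[of a b] by (auto simp: edges_def)
      then have "A S \<omega> = 0" unfolding A_def using finite_edges[OF Sub_finite[OF S]] by (intro prod_zero) auto
      then show ?thesis using False by simp
    qed
  qed
  have "(\<Sum>S\<in>Sub r n. A S \<omega>) = (\<Sum>S\<in>Sub r n. if \<forall>i\<in>S. \<forall>j\<in>S. i \<noteq> j \<longrightarrow> Gedge W \<omega> i j then 1 else 0)"
    by (rule sum.cong[OF refl AS])
  also have "\<dots> = real (card {S \<in> Sub r n. \<forall>i\<in>S. \<forall>j\<in>S. i \<noteq> j \<longrightarrow> Gedge W \<omega> i j})"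
    using finite_Sub[of r n] by (simp add: sum.If_cases Int_def)
  finally show ?thesis by (simp add: clique_count_def Sub_def conj_assoc)
qed

text \<open>The part of A S orthogonal to all functions of d vertices, provided that the projections of lower order are constant.\<close>

definition F :: "nat => nat set => (nat + nat \<times> nat => real) => real" where
  "F d S \<omega> = A S \<omega> - tt - (\<Sum>P | P \<subseteq> S \<and> card P = d. B P \<omega> - tt)"

text \<open>All projections of order below d are constant. Order 1 always holds, since the only
  projection is the mean; order 2 follows from regularity.\<close>

definition degenerate :: "nat => bool" where
  "degenerate d \<longleftrightarrow> (\<forall>Q. finite Q \<and> card Q < d \<longrightarrow> (AE x in UP (crd Q). B Q x = tt))"

lemma condexp_B:
  assumes P: "finite P" "card P \<le> r" "P \<subseteq> S" and Q: "Q \<subseteq> S"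
  shows "(LINT y|UP (crd S - crd Q). B P (merge (crd Q) (crd S - crd Q) (x, y))) = B (P \<inter> Q) x"
proof -
  define L where "L = crd P - crd (P \<inter> Q)"
  have PQ: "crd P \<inter> crd Q = crd (P \<inter> Q)" by (rule crd_Int)
  have L: "L \<subseteq> crd S - crd Q" using crd_mono[OF P(3)] PQ by (auto simp: L_def)
  have un: "crd (P \<inter> Q) \<union> L = crd P" using PQ by (auto simp: L_def)
  have e: "B P (merge (crd Q) (crd S - crd Q) (x, y)) = B P (merge (crd (P \<inter> Q)) L (x, y))" for y
  proof (rule depD[OF bmf_dep[OF bmf_B[OF P(1,2)]]])
    fix c assume "c \<in> crd P"
    then show "merge (crd Q) (crd S - crd Q) (x, y) c = merge (crd (P \<inter> Q)) L (x, y) c"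
      using PQ crd_mono[OF P(3)] by (auto simp: merge_def L_def)
  qed
  have b: "bmf L (\<lambda>y. B P (merge (crd (P \<inter> Q)) L (x, y)))"
    by (rule bmf_section) (unfold un, rule bmf_B[OF P(1,2)])
  have "(LINT y|UP (crd S - crd Q). B P (merge (crd Q) (crd S - crd Q) (x, y))) = (LINT y|UP L. B P (merge (crd (P \<inter> Q)) L (x, y)))"
    unfolding e by (rule integral_dep[OF bmf_dep[OF b] L bmf_measurable[OF b]])
  also have "\<dots> = B (P \<inter> Q) x" unfolding L_def by (rule tower_B[OF P(1,2)]) auto
  finally show ?thesis .
qed

lemma degenerate_AE:
  assumes H: "degenerate d" and Q: "finite Q" "card Q < d" "card Q \<le> r" "Q \<subseteq> Q'"
  shows "AE x in UP (crd Q'). B Q x = tt"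
proof (rule AE_dep)
  show "AE x in UP (crd Q). B Q x = tt" using H Q by (auto simp: degenerate_def)
  show "crd Q \<subseteq> crd Q'" by (rule crd_mono[OF Q(4)])
  show "dep (\<lambda>x. B Q x = tt) (crd Q)" using bmf_dep[OF bmf_B[OF Q(1,3)]] unfolding dep_def by metis
qed

lemma bmf_F: "finite S ==> card S \<le> r ==> bmf (crd S) (F d S)"
  unfolding F_def[abs_def]
proof (intro bmf_diff bmf_A bmf_const bmf_sum)
  fix P assume S: "finite S" "card S \<le> r" and "P \<in> {P. P \<subseteq> S \<and> card P = d}"
  then have P: "P \<subseteq> S" by auto
  have "bmf (crd P) (B P)" using bmf_B[of P] P S card_mono[OF S(1) P] finite_subset by auto
  then show "bmf (crd S) (B P)" by (rule bmf_mono) (rule crd_mono[OF P])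
qed

text \<open>Conditioning on Q replaces each B P by B (P \<inter> Q). If Q has fewer than d vertices
  everything is constant by degeneracy; if it has exactly d, only the summand P = Q survives and
  cancels B Q - t.\<close>

lemma F_condexp:
  assumes H: "degenerate d" and S: "finite S" "card S = r" and Q: "Q \<subseteq> S" "card Q \<le> d" and d: "d \<le> r"
  shows "AE x in UP (crd Q). (LINT y|UP (crd S - crd Q). F d S (merge (crd Q) (crd S - crd Q) (x, y))) = 0"
proof -
  define Ps where "Ps = {P. P \<subseteq> S \<and> card P = d}"
  have fPs: "finite Ps" unfolding Ps_def using S by (auto intro: finite_subset[of _ "Pow S"])
  have Pf: "finite P" "card P \<le> r" "P \<subseteq> S" if "P \<in> Ps" for P using that S d by (auto simp: Ps_def intro: finite_subset)
  have un: "crd Q \<union> (crd S - crd Q) = crd S" using crd_mono[OF Q(1)] by auto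
  have fQ: "finite Q" using S Q finite_subset by auto
  have eq: "(LINT y|UP (crd S - crd Q). F d S (merge (crd Q) (crd S - crd Q) (x, y))) = B Q x - tt - (\<Sum>P\<in>Ps. B (P \<inter> Q) x - tt)" for x
  proof -
    interpret prob_space "UP (crd S - crd Q)" by (rule prob_UP)
    have iA: "integrable (UP (crd S - crd Q)) (\<lambda>y. A S (merge (crd Q) (crd S - crd Q) (x, y)))"
      by (rule bmf_integrable[OF bmf_section]) (unfold un, rule bmf_A)
    have iB: "integrable (UP (crd S - crd Q)) (\<lambda>y. B P (merge (crd Q) (crd S - crd Q) (x, y)) - tt)" if "P \<in> Ps" for P
    proof -
      have "bmf (crd Q \<union> (crd S - crd Q)) (B P)" unfolding un
        by (rule bmf_mono[OF bmf_B[OF Pf(1,2)[OF that]] crd_mono[OF Pf(3)[OF that]]])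
      from bmf_integrable[OF bmf_section[OF this]] show ?thesis by simp
    qed
    have "(LINT y|UP (crd S - crd Q). F d S (merge (crd Q) (crd S - crd Q) (x, y))) =
      (LINT y|UP (crd S - crd Q). A S (merge (crd Q) (crd S - crd Q) (x, y)) - tt) - (LINT y|UP (crd S - crd Q). (\<Sum>P\<in>Ps. B P (merge (crd Q) (crd S - crd Q) (x, y)) - tt))"
      unfolding F_def Ps_def[symmetric] using iA iB by (intro Bochner_Integration.integral_diff Bochner_Integration.integrable_sum) auto
    also have "(LINT y|UP (crd S - crd Q). A S (merge (crd Q) (crd S - crd Q) (x, y)) - tt) = B Q x - tt"
      using iA condexp_AB[OF S Q(1), of x] by (simp add: prob_space)
    also have "(LINT y|UP (crd S - crd Q). (\<Sum>P\<in>Ps. B P (merge (crd Q) (crd S - crd Q) (x, y)) - tt)) = (\<Sum>P\<in>Ps. B (P \<inter> Q) x - tt)"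
    proof (subst Bochner_Integration.integral_sum[OF iB], assumption, rule sum.cong[OF refl])
      fix P assume P: "P \<in> Ps"
      have "integrable (UP (crd S - crd Q)) (\<lambda>y. B P (merge (crd Q) (crd S - crd Q) (x, y)) - tt + tt)" using iB[OF P] by (intro Bochner_Integration.integrable_add) auto
      then show "(LINT y|UP (crd S - crd Q). B P (merge (crd Q) (crd S - crd Q) (x, y)) - tt) = B (P \<inter> Q) x - tt"
        using condexp_B[OF Pf[OF P] Q(1), of x] by (simp add: prob_space)
    qed
    finally show ?thesis .
  qed
  have "AE x in UP (crd Q). \<forall>P\<in>{P\<in>Ps. card (P \<inter> Q) < d}. B (P \<inter> Q) x = tt"
  proof (rule AE_finite_allI)
    show "finite {P\<in>Ps. card (P \<inter> Q) < d}" using fPs by simp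
    fix P assume "P \<in> {P\<in>Ps. card (P \<inter> Q) < d}"
    then show "AE x in UP (crd Q). B (P \<inter> Q) x = tt" using fQ d by (intro degenerate_AE[OF H]) auto
  qed
  moreover have "AE x in UP (crd Q). card Q < d \<longrightarrow> B Q x = tt"
  proof (cases "card Q < d")
    case True then show ?thesis using degenerate_AE[OF H fQ True] d by auto
  qed simp
  ultimately show ?thesis unfolding eq
  proof eventually_elim
    case (elim x)
    show ?case
    proof (cases "card Q < d")
      case True
      have "card (P \<inter> Q) < d" for P using card_mono[OF fQ, of "P \<inter> Q"] True by auto
      then show ?thesis using elim True by (simp add: sum.neutral)
    next
      case False
      then have cQ: "card Q = d" using Q by simp
      then have QP: "Q \<in> Ps" using Q by (simp add: Ps_def)
      have "B (P \<inter> Q) x = tt" if P: "P \<in> Ps - {Q}" for P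
      proof -
        have "card (P \<inter> Q) \<noteq> d"
        proof
          assume c: "card (P \<inter> Q) = d"
          have "P \<inter> Q = Q" using c cQ fQ by (intro card_subset_eq) auto
          moreover have "P \<inter> Q = P" using c P Pf(1)[of P] by (intro card_subset_eq) (auto simp: Ps_def)
          ultimately show False using P by auto
        qed
        moreover have "card (P \<inter> Q) \<le> d" using card_mono[OF fQ, of "P \<inter> Q"] cQ by auto
        ultimately have "card (P \<inter> Q) < d" by simp
        then show ?thesis using elim(1) P by auto
      qed
      then have "(\<Sum>P\<in>Ps. B (P \<inter> Q) x - tt) = B Q x - tt"
        using fPs QP by (subst sum.remove[OF fPs QP]) (simp add: sum.neutral)
      then show ?thesis by simp
    qed
  qed
qed

lemma F_orthogonal:
  assumes H: "degenerate d" and S: "S \<in> Sub r n" and T: "T \<in> Sub r n" and c: "card (S \<inter> T) \<le> d" and d: "d \<le> r"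
  shows "(LINT \<omega>|GP n. F d S \<omega> * F d T \<omega>) = 0"
proof -
  have s: "finite S" "card S = r" "S \<subseteq> {..<n}" "finite T" "card T = r" "T \<subseteq> {..<n}"
    using SubD[OF S] SubD[OF T] by auto
  have i: "crd S \<inter> crd T = crd (S \<inter> T)" by (rule crd_Int)
  have df: "crd S - crd T = crd S - crd (S \<inter> T)" using i by auto
  show ?thesis
  proof (rule orthogonal_dep[where A="crd S" and B="crd T"])
    show "AE x in UP (crd S \<inter> crd T). (LINT y|UP (crd S - crd T). F d S (merge (crd S \<inter> crd T) (crd S - crd T) (x, y))) = 0"
      unfolding i df by (rule F_condexp[OF H s(1,2) _ c d]) auto
  qed (use s in \<open>auto simp: finite_crd bmf_F intro: crd_mono[THEN subsetD]\<close>)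
qed

lemma F_bound: "finite S ==> card S \<le> r ==> \<bar>F d S \<omega>\<bar> \<le> 1 + 2 ^ r"
proof -
  assume S: "finite S" "card S \<le> r"
  have ab: "\<bar>a - b\<bar> \<le> 1" if "0 \<le> a" "a \<le> 1" "0 \<le> b" "b \<le> 1" for a b :: real using that by simp
  have "\<bar>\<Sum>P | P \<subseteq> S \<and> card P = d. B P \<omega> - tt\<bar> \<le> (\<Sum>P | P \<subseteq> S \<and> card P = d. \<bar>B P \<omega> - tt\<bar>)" by (rule sum_abs)
  also have "\<dots> \<le> (\<Sum>P | P \<subseteq> S \<and> card P = d. 1)"
  proof (rule sum_mono)
    fix P assume "P \<in> {P. P \<subseteq> S \<and> card P = d}"
    then have "card P \<le> r" using card_mono[OF S(1)] S(2) by (auto intro: order_trans)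
    then show "\<bar>B P \<omega> - tt\<bar> \<le> 1" using B01 tt01 by (intro ab)
  qed
  also have "\<dots> = real (card {P. P \<subseteq> S \<and> card P = d})" by simp
  also have "\<dots> \<le> 2 ^ r"
  proof -
    have "card {P. P \<subseteq> S \<and> card P = d} \<le> card (Pow S)" using S by (intro card_mono) auto
    also have "\<dots> = 2 ^ card S" using S by (simp add: card_Pow)
    also have "\<dots> \<le> 2 ^ r" using S by (intro power_increasing) auto
    finally have "real (card {P. P \<subseteq> S \<and> card P = d}) \<le> real (2 ^ r)" unfolding of_nat_le_iff .
    then show ?thesis by simp
  qed
  finally have "\<bar>\<Sum>P | P \<subseteq> S \<and> card P = d. B P \<omega> - tt\<bar> \<le> 2 ^ r" .
  moreover have "\<bar>A S \<omega> - tt\<bar> \<le> 1" using A01 tt01 by (intro ab)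
  ultimately show ?thesis unfolding F_def by linarith
qed

text \<open>By orthogonality only pairs of r-sets sharing at least d+1 vertices contribute, and
  there are O(n^(2r-d-1)) of them. This is a factor n below the square n^(2r-d) of the
  normalisation.\<close>

lemma F_second_moment:
  assumes H: "degenerate d" and d: "d \<le> r"
  shows "(LINT \<omega>|GP n. (\<Sum>S\<in>Sub r n. F d S \<omega>)^2) * real n ^ Suc d \<le> (1 + 2 ^ r)^2 * 2 ^ r * real n ^ (2 * r)"
proof -
  interpret prob_space "GP n" by (rule prob_UP)
  define C where "C = (1 + 2 ^ r :: real)^2"
  have bF: "bmf (crd {..<n}) (F d S)" if "S \<in> Sub r n" for S
  proof -
    have "finite S" "card S \<le> r" "S \<subseteq> {..<n}" using SubD[OF that] by auto
    then show ?thesis by (intro bmf_mono[OF bmf_F crd_mono])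
  qed
  have iFF: "integrable (GP n) (\<lambda>\<omega>. F d S \<omega> * F d T \<omega>)" if "S \<in> Sub r n" "T \<in> Sub r n" for S T
    by (rule bmf_integrable[OF bmf_mult[OF bF[OF that(1)] bF[OF that(2)]]])
  have le: "(LINT \<omega>|GP n. F d S \<omega> * F d T \<omega>) \<le> (if Suc d \<le> card (S \<inter> T) then C else 0)" if ST: "S \<in> Sub r n" "T \<in> Sub r n" for S T
  proof (cases "Suc d \<le> card (S \<inter> T)")
    case True
    have "F d S \<omega> * F d T \<omega> \<le> C" for \<omega>
    proof -
      have "\<bar>F d S \<omega>\<bar> \<le> 1 + 2 ^ r" "\<bar>F d T \<omega>\<bar> \<le> 1 + 2 ^ r" using F_bound SubD[OF ST(1)] SubD[OF ST(2)] by auto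
      then have "\<bar>F d S \<omega> * F d T \<omega>\<bar> \<le> (1 + 2 ^ r) * (1 + 2 ^ r)" unfolding abs_mult by (intro mult_mono) auto
      then show ?thesis unfolding C_def power2_eq_square by linarith
    qed
    then have "(LINT \<omega>|GP n. F d S \<omega> * F d T \<omega>) \<le> (LINT \<omega>|GP n. C)"
      using iFF[OF ST] by (intro integral_mono) auto
    then show ?thesis using True by (simp add: prob_space)
  next
    case False then show ?thesis using F_orthogonal[OF H ST _ d] by simp
  qed
  have "(LINT \<omega>|GP n. (\<Sum>S\<in>Sub r n. F d S \<omega>)^2) = (LINT \<omega>|GP n. (\<Sum>S\<in>Sub r n. \<Sum>T\<in>Sub r n. F d S \<omega> * F d T \<omega>))"
    unfolding power2_eq_square sum_product ..
  also have "\<dots> = (\<Sum>S\<in>Sub r n. \<Sum>T\<in>Sub r n. (LINT \<omega>|GP n. F d S \<omega> * F d T \<omega>))"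
    by (subst Bochner_Integration.integral_sum) (auto intro!: sum.cong Bochner_Integration.integral_sum Bochner_Integration.integrable_sum iFF)
  also have "\<dots> \<le> (\<Sum>S\<in>Sub r n. \<Sum>T\<in>Sub r n. if Suc d \<le> card (S \<inter> T) then C else 0)"
    by (intro sum_mono le)
  also have "\<dots> = (\<Sum>S\<in>Sub r n. C * real (card {T\<in>Sub r n. Suc d \<le> card (S \<inter> T)}))"
    using finite_Sub[of r n] by (simp add: sum.If_cases Int_def mult.commute)
  finally have "(LINT \<omega>|GP n. (\<Sum>S\<in>Sub r n. F d S \<omega>)^2) * real n ^ Suc d
     \<le> (\<Sum>S\<in>Sub r n. C * real (card {T\<in>Sub r n. Suc d \<le> card (S \<inter> T)})) * real n ^ Suc d"
    by (rule mult_right_mono) simp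
  also have "\<dots> = (\<Sum>S\<in>Sub r n. C * (real (card {T\<in>Sub r n. Suc d \<le> card (S \<inter> T)}) * real n ^ Suc d))"
    by (simp add: sum_distrib_right mult.assoc)
  also have "\<dots> \<le> (\<Sum>S\<in>Sub r n. C * (2 ^ r * real n ^ r))"
    by (intro sum_mono mult_left_mono card_overlap) (auto simp: C_def)
  also have "\<dots> = real (card (Sub r n)) * (C * (2 ^ r * real n ^ r))" by simp
  also have "\<dots> \<le> real n ^ r * (C * (2 ^ r * real n ^ r))"
    by (intro mult_right_mono card_Sub_le) (auto simp: C_def)
  also have "\<dots> = C * 2 ^ r * real n ^ (2 * r)" by (simp add: mult_2 power_add)
  finally show ?thesis unfolding C_def .
qed

definition Y :: "nat => nat => (nat + nat \<times> nat => real) => real" where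
  "Y d n \<omega> = (\<Sum>P\<in>Sub d n. B P \<omega> - tt)"

lemma bmf_Y: "d \<le> r ==> bmf (crd {..<n}) (Y d n)"
  unfolding Y_def[abs_def]
proof (intro bmf_sum bmf_diff bmf_const)
  fix P assume "d \<le> r" "P \<in> Sub d n"
  then have "finite P" "card P \<le> r" "P \<subseteq> {..<n}" using SubD[of P d n] by auto
  then show "bmf (crd {..<n}) (B P)" by (intro bmf_mono[OF bmf_B crd_mono])
qed

text \<open>Distinct d-sets share fewer than d vertices, so degeneracy makes their terms orthogonal
  and only the diagonal counts.\<close>

lemma Y_second_moment:
  assumes H: "degenerate d" and d: "d \<le> r"
  shows "(LINT \<omega>|GP n. (Y d n \<omega>)^2) \<le> real n ^ d"
proof -
  interpret prob_space "GP n" by (rule prob_UP)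
  define G where "G P \<omega> = B P \<omega> - tt" for P \<omega>
  have Pf: "finite P" "card P \<le> r" "P \<subseteq> {..<n}" "card P = d" if "P \<in> Sub d n" for P
    using SubD[OF that] d by auto
  have bG: "bmf (crd P) (G P)" if "P \<in> Sub d n" for P
    unfolding G_def[abs_def] by (intro bmf_diff bmf_const bmf_B Pf that)
  have bG': "bmf (crd {..<n}) (G P)" if "P \<in> Sub d n" for P
    by (rule bmf_mono[OF bG[OF that] crd_mono[OF Pf(3)[OF that]]])
  have iGG: "integrable (GP n) (\<lambda>\<omega>. G P \<omega> * G Q \<omega>)" if "P \<in> Sub d n" "Q \<in> Sub d n" for P Q
    by (rule bmf_integrable[OF bmf_mult[OF bG'[OF that(1)] bG'[OF that(2)]]])
  have G1: "\<bar>G P \<omega>\<bar> \<le> 1" if "P \<in> Sub d n" for P \<omega>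
    using B01[OF Pf(2)[OF that], of \<omega>] tt01 unfolding G_def by simp
  have le: "(LINT \<omega>|GP n. G P \<omega> * G Q \<omega>) \<le> (if Q = P then 1 else 0)" if PQ: "P \<in> Sub d n" "Q \<in> Sub d n" for P Q
  proof (cases "Q = P")
    case True
    have "G P \<omega> * G Q \<omega> \<le> 1" for \<omega>
    proof -
      have "\<bar>G P \<omega> * G Q \<omega>\<bar> \<le> 1 * 1" unfolding abs_mult by (intro mult_mono G1 PQ) auto
      then show ?thesis by linarith
    qed
    then have "(LINT \<omega>|GP n. G P \<omega> * G Q \<omega>) \<le> (LINT \<omega>|GP n. 1)"
      using iGG[OF PQ] by (intro integral_mono) auto
    then show ?thesis using True by (simp add: prob_space)
  next
    case False
    note p = Pf[OF PQ(1)] and q = Pf[OF PQ(2)]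
    have i: "crd P \<inter> crd Q = crd (P \<inter> Q)" by (rule crd_Int)
    have df: "crd P - crd Q = crd P - crd (P \<inter> Q)" using i by auto
    have "card (P \<inter> Q) \<noteq> d"
    proof
      assume c: "card (P \<inter> Q) = d"
      have "P \<inter> Q = Q" using c q by (intro card_subset_eq) auto
      moreover have "P \<inter> Q = P" using c p by (intro card_subset_eq) auto
      ultimately show False using False by auto
    qed
    then have cl: "card (P \<inter> Q) < d" using card_mono[OF p(1), of "P \<inter> Q"] p by auto
    have z: "AE x in UP (crd (P \<inter> Q)). (LINT y|UP (crd P - crd (P \<inter> Q)). G P (merge (crd (P \<inter> Q)) (crd P - crd (P \<inter> Q)) (x, y))) = 0"
    proof -
      interpret L: prob_space "UP (crd P - crd (P \<inter> Q))" by (rule prob_UP)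
      have un: "crd (P \<inter> Q) \<union> (crd P - crd (P \<inter> Q)) = crd P" using i by auto
      have iB: "integrable (UP (crd P - crd (P \<inter> Q))) (\<lambda>y. B P (merge (crd (P \<inter> Q)) (crd P - crd (P \<inter> Q)) (x, y)))" for x
        by (rule bmf_integrable[OF bmf_section]) (unfold un, rule bmf_B[OF p(1,2)])
      have "(LINT y|UP (crd P - crd (P \<inter> Q)). G P (merge (crd (P \<inter> Q)) (crd P - crd (P \<inter> Q)) (x, y))) = B (P \<inter> Q) x - tt" for x
        unfolding G_def using iB tower_B[OF p(1,2), of "P \<inter> Q" x] by (simp add: L.prob_space)
      moreover have "AE x in UP (crd (P \<inter> Q)). B (P \<inter> Q) x = tt" using p cl d by (intro degenerate_AE[OF H]) auto
      ultimately show ?thesis by simp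
    qed
    have "(LINT \<omega>|GP n. G P \<omega> * G Q \<omega>) = 0"
      by (rule orthogonal_dep[OF finite_crd crd_mono[OF p(3)] crd_mono[OF q(3)] bG[OF PQ(1)] bG[OF PQ(2)]])
         (unfold i df, simp, rule z)
    then show ?thesis using False by simp
  qed
  have "(LINT \<omega>|GP n. (Y d n \<omega>)^2) = (LINT \<omega>|GP n. (\<Sum>S\<in>Sub d n. \<Sum>T\<in>Sub d n. G S \<omega> * G T \<omega>))"
    unfolding Y_def power2_eq_square sum_product G_def ..
  also have "\<dots> = (\<Sum>S\<in>Sub d n. \<Sum>T\<in>Sub d n. (LINT \<omega>|GP n. G S \<omega> * G T \<omega>))"
    by (subst Bochner_Integration.integral_sum) (auto intro!: sum.cong Bochner_Integration.integral_sum Bochner_Integration.integrable_sum iGG)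
  also have "\<dots> \<le> (\<Sum>S\<in>Sub d n. \<Sum>T\<in>Sub d n. if T = S then 1 else 0)" by (intro sum_mono le)
  also have "\<dots> = real (card (Sub d n))" using finite_Sub[of d n] by simp
  also have "\<dots> \<le> real n ^ d" by (rule card_Sub_le)
  finally show ?thesis .
qed

text \<open>Double counting: each d-set lies in (n-d choose r-d) of the r-sets, which is the
  coefficient of the main term.\<close>

lemma clique_decomposition:
  assumes d: "d \<le> r"
  shows "real (clique_count W n r \<omega>) - real (n choose r) * tt = (\<Sum>S\<in>Sub r n. F d S \<omega>) + real ((n - d) choose (r - d)) * Y d n \<omega>"
proof -
  have "(\<Sum>S\<in>Sub r n. \<Sum>P | P \<subseteq> S \<and> card P = d. B P \<omega> - tt) = (\<Sum>S\<in>Sub r n. \<Sum>P\<in>{P\<in>Sub d n. P \<subseteq> S}. B P \<omega> - tt)"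
    by (intro sum.cong refl) (auto simp: Sub_def)
  also have "\<dots> = (\<Sum>P\<in>Sub d n. \<Sum>S\<in>{S\<in>Sub r n. P \<subseteq> S}. B P \<omega> - tt)"
    by (rule sum.swap_restrict[OF finite_Sub finite_Sub])
  also have "\<dots> = (\<Sum>P\<in>Sub d n. real ((n - d) choose (r - d)) * (B P \<omega> - tt))"
    by (intro sum.cong refl) (simp add: card_Sub_super[OF _ d])
  also have "\<dots> = real ((n - d) choose (r - d)) * Y d n \<omega>" by (simp add: Y_def sum_distrib_left)
  finally have 1: "(\<Sum>S\<in>Sub r n. \<Sum>P | P \<subseteq> S \<and> card P = d. B P \<omega> - tt) = real ((n - d) choose (r - d)) * Y d n \<omega>" .
  show ?thesis unfolding F_def clique_count_sum sum_subtractf using 1 by (simp add: card_Sub sum_subtractf)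
qed

lemma (in -) binomial_ratio_limit: "(\<lambda>n. real ((n - d) choose k) / real n ^ k) \<longlonglongrightarrow> 1 / fact k"
proof -
  have lim: "(\<lambda>n. (\<Prod>i<k. (real (n - d) - real i) / real n) / fact k) \<longlonglongrightarrow> (\<Prod>i<k. 1) / fact k"
  proof (intro tendsto_divide tendsto_prod tendsto_const)
    fix i
    have "(\<lambda>n. 1 - (real d + real i) / real n) \<longlonglongrightarrow> 1 - 0"
      by (intro tendsto_diff tendsto_const real_tendsto_divide_at_top[OF tendsto_const] filterlim_real_sequentially)
    moreover have "\<forall>\<^sub>F n in sequentially. 1 - (real d + real i) / real n = (real (n - d) - real i) / real n"
      using eventually_ge_at_top[of "Suc d"] by eventually_elim (auto simp: field_simps of_nat_diff)
    ultimately show "(\<lambda>n. (real (n - d) - real i) / real n) \<longlonglongrightarrow> 1" using tendsto_cong by force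
  qed simp
  have "real (m choose k) / real n ^ k = (\<Prod>i<k. (real m - real i) / real n) / fact k" for m n
    by (simp add: binomial_gbinomial gbinomial_prod_rev prod_dividef atLeast0LessThan)
  then show ?thesis using lim by simp
qed

text \<open>M n stands for n^(d/2) and is given through positivity and its square, so that sqrt n
  and n are treated alike.\<close>

lemma clique_first_approximation:
  assumes H: "degenerate d" and d: "d \<le> r" and M: "\<And>n. n > 0 ==> M n > 0" "\<And>n. n > 0 ==> (M n)^2 = real n ^ d"
    and N: "\<And>n. n > 0 ==> N n = real n ^ (r - d) * M n"
  shows "(\<lambda>n. (LINT \<omega>|GP n. \<bar>(real (clique_count W n r \<omega>) - real (n choose r) * tt) / N n - Y d n \<omega> / M n / fact (r - d)\<bar>)) \<longlonglongrightarrow> 0"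
proof -
  define K where "K = (1 + 2 ^ r :: real)^2 * 2 ^ r"
  define c where "c n = real ((n - d) choose (r - d)) / real n ^ (r - d) - 1 / fact (r - d)" for n
  define Z where "Z n \<omega> = (real (clique_count W n r \<omega>) - real (n choose r) * tt) / N n - Y d n \<omega> / M n / fact (r - d)" for n \<omega>
  have bd: "(LINT \<omega>|GP n. \<bar>Z n \<omega>\<bar>) \<le> sqrt (K / n) + \<bar>c n\<bar>" if n: "n > 0" for n
  proof -
    interpret prob_space "GP n" by (rule prob_UP)
    have Mn: "M n > 0" "(M n)^2 = real n ^ d" "N n = real n ^ (r - d) * M n" using M N n by auto
    have Nn: "N n > 0" unfolding Mn(3) using Mn n by simp
    define D where "D \<omega> = (\<Sum>S\<in>Sub r n. F d S \<omega>)" for \<omega>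
    have bD: "bmf (crd {..<n}) D" unfolding D_def
    proof (rule bmf_sum)
      fix S assume "S \<in> Sub r n"
      then have "finite S" "card S \<le> r" "S \<subseteq> {..<n}" using SubD[of S r n] by auto
      then show "bmf (crd {..<n}) (F d S)" by (intro bmf_mono[OF bmf_F crd_mono])
    qed
    have bY: "bmf (crd {..<n}) (Y d n)" by (rule bmf_Y[OF d])
    \<comment> \<open>Two sources of error: the orthogonal remainder D, of relative order n^(-1/2),
      and the deviation c n of the normalised binomial coefficient from its limit, which multiplies
      a quantity bounded in L1.\<close>
    have Zeq: "Z n \<omega> = D \<omega> / N n + c n * (Y d n \<omega> / M n)" for \<omega>
      unfolding Z_def clique_decomposition[OF d] D_def[symmetric] c_def Mn(3) using Mn(1) n
      by (simp add: field_simps)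
    have "(LINT \<omega>|GP n. \<bar>Z n \<omega>\<bar>) \<le> (LINT \<omega>|GP n. \<bar>D \<omega>\<bar> / N n + \<bar>c n\<bar> * (\<bar>Y d n \<omega>\<bar> / M n))"
    proof (rule integral_mono)
      show "integrable (GP n) (\<lambda>\<omega>. \<bar>Z n \<omega>\<bar>)" unfolding Zeq using bmf_integrable[OF bD] bmf_integrable[OF bY] by simp
      show "integrable (GP n) (\<lambda>\<omega>. \<bar>D \<omega>\<bar> / N n + \<bar>c n\<bar> * (\<bar>Y d n \<omega>\<bar> / M n))" using bmf_integrable[OF bD] bmf_integrable[OF bY] by simp
      show "\<bar>Z n \<omega>\<bar> \<le> \<bar>D \<omega>\<bar> / N n + \<bar>c n\<bar> * (\<bar>Y d n \<omega>\<bar> / M n)" for \<omega>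
        unfolding Zeq using Nn Mn(1) by (intro order_trans[OF abs_triangle_ineq]) (simp add: abs_mult)
    qed
    also have "\<dots> = (LINT \<omega>|GP n. \<bar>D \<omega>\<bar>) / N n + \<bar>c n\<bar> * ((LINT \<omega>|GP n. \<bar>Y d n \<omega>\<bar>) / M n)"
      using bmf_integrable[OF bD] bmf_integrable[OF bY] by simp
    also have "\<dots> \<le> sqrt (K / n) + \<bar>c n\<bar> * 1"
    proof (intro add_mono mult_left_mono)
      have "(LINT \<omega>|GP n. (D \<omega>)^2) * real n ^ Suc d \<le> K * real n ^ (2 * r)"
        unfolding D_def K_def by (rule F_second_moment[OF H d])
      also have "real n ^ (2 * r) = (N n)^2 * real n ^ d"
      proof -
        have "(N n)^2 * real n ^ d = real n ^ (r - d) * real n ^ (r - d) * (real n ^ d * real n ^ d)"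
          unfolding Mn(3) power_mult_distrib Mn(2) by (simp add: power2_eq_square)
        also have "\<dots> = real n ^ (r - d + (r - d) + (d + d))" by (simp add: power_add)
        also have "r - d + (r - d) + (d + d) = 2 * r" using d by simp
        finally show ?thesis ..
      qed
      finally have "(LINT \<omega>|GP n. (D \<omega>)^2) * real n * real n ^ d \<le> K * (N n)^2 * real n ^ d" by (simp add: mult.assoc)
      then have "(LINT \<omega>|GP n. (D \<omega>)^2) * real n \<le> K * (N n)^2" using n by simp
      then have "(LINT \<omega>|GP n. (D \<omega>)^2) \<le> K / n * (N n)^2" using n by (simp add: field_simps)
      then have "sqrt (LINT \<omega>|GP n. (D \<omega>)^2) \<le> sqrt (K / n * (N n)^2)" by (rule real_sqrt_le_mono)
      also have "\<dots> = sqrt (K / n) * N n" using Nn by (simp only: real_sqrt_mult real_sqrt_abs abs_of_pos)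
      finally have "(LINT \<omega>|GP n. \<bar>D \<omega>\<bar>) \<le> sqrt (K / n) * N n" using bmf_L1_le_L2[OF bD] by linarith
      then show "(LINT \<omega>|GP n. \<bar>D \<omega>\<bar>) / N n \<le> sqrt (K / n)" using Nn by (simp add: pos_divide_le_eq)
      have "sqrt (LINT \<omega>|GP n. (Y d n \<omega>)^2) \<le> sqrt ((M n)^2)"
        unfolding Mn(2) by (intro real_sqrt_le_mono Y_second_moment[OF H d])
      then have "(LINT \<omega>|GP n. \<bar>Y d n \<omega>\<bar>) \<le> M n" using bmf_L1_le_L2[OF bY] Mn(1) by simp
      then show "(LINT \<omega>|GP n. \<bar>Y d n \<omega>\<bar>) / M n \<le> 1" using Mn(1) by (simp add: pos_divide_le_eq)
    qed auto
    finally show ?thesis by simp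
  qed
  have "(\<lambda>n. (LINT \<omega>|GP n. \<bar>Z n \<omega>\<bar>)) \<longlonglongrightarrow> 0"
  proof (rule tendsto_sandwich[OF _ _ tendsto_const])
    show "\<forall>\<^sub>F n in sequentially. 0 \<le> (LINT \<omega>|GP n. \<bar>Z n \<omega>\<bar>)" by (intro always_eventually) simp
    show "\<forall>\<^sub>F n in sequentially. (LINT \<omega>|GP n. \<bar>Z n \<omega>\<bar>) \<le> sqrt (K / n) + \<bar>c n\<bar>"
      using eventually_gt_at_top[of 0] by eventually_elim (rule bd)
    have "(\<lambda>n. sqrt (K / real n)) \<longlonglongrightarrow> sqrt 0"
      by (intro tendsto_real_sqrt real_tendsto_divide_at_top[OF tendsto_const] filterlim_real_sequentially)
    moreover have "c \<longlonglongrightarrow> 0" unfolding c_def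
      using tendsto_diff[OF binomial_ratio_limit[of d "r - d"] tendsto_const[of "1 / fact (r - d)"]] by simp
    ultimately have "(\<lambda>n. sqrt (K / real n) + \<bar>c n\<bar>) \<longlonglongrightarrow> sqrt 0 + \<bar>0\<bar>" by (intro tendsto_add tendsto_rabs)
    then show "(\<lambda>n. sqrt (K / real n) + \<bar>c n\<bar>) \<longlonglongrightarrow> 0" by simp
  qed
  then show ?thesis unfolding Z_def .
qed

end

section \<open>The limit in the non-regular case\<close>

text \<open>Levy's theorem for image laws; the sample spaces change with n and differ from that of
  the limit.\<close>

lemma weak_conv_by_char:
  fixes P :: "nat => 'a measure" and Q :: "'b measure" and X :: "nat => 'a => real"
  assumes P: "\<And>n. prob_space (P n)" and X: "\<And>n. X n \<in> borel_measurable (P n)"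
    and Q: "prob_space Q" and Z: "Z \<in> borel_measurable Q"
    and lim: "\<And>s. (\<lambda>n. (LINT \<omega>|P n. iexp (s * X n \<omega>))) \<longlonglongrightarrow> (LINT \<omega>|Q. iexp (s * Z \<omega>))"
  shows "weak_conv_m (\<lambda>n. distr (P n) borel (X n)) (distr Q borel Z)"
proof (rule levy_continuity)
  show "real_distribution (distr (P n) borel (X n))" for n by (rule prob_space.real_distribution_distr[OF P X])
  show "real_distribution (distr Q borel Z)" by (rule prob_space.real_distribution_distr[OF Q Z])
  have c: "char (distr N borel V) s = (LINT \<omega>|N. iexp (s * V \<omega>))" if "V \<in> borel_measurable N" for N :: "'c measure" and V s
    unfolding char_def by (rule integral_distr[OF that]) simp
  show "(\<lambda>n. char (distr (P n) borel (X n)) s) \<longlonglongrightarrow> char (distr Q borel Z) s" for s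
    unfolding c[OF X] c[OF Z] by (rule lim)
qed

text \<open>Writes the normal limit as the law of a random variable, the shape that
  \<open>weak_conv_by_char\<close> expects.\<close>

lemma normal_as_distr:
  assumes "\<sigma> > 0"
  shows "density lborel (normal_density 0 \<sigma>) = distr stdn borel (\<lambda>z. \<sigma> * z)"
proof -
  interpret Z: prob_space stdn by (rule std_normal_facts)
  have "distr stdn lborel (\<lambda>x. x) = stdn" by (rule distr_id2) simp
  then have "distributed stdn lborel (\<lambda>x. x) std_normal_density"
    unfolding distributed_def by (auto intro!: measurable_compose[OF _ measurable_ennreal])
  then have "distributed stdn lborel (\<lambda>x. 0 + \<sigma> * x) (normal_density (0 + \<sigma> * 0) (\<bar>\<sigma>\<bar> * 1))"
    by (intro Z.normal_density_affine) (use assms in auto)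
  then have "distr stdn lborel (\<lambda>x. \<sigma> * x) = density lborel (normal_density 0 \<sigma>)"
    using assms by (auto dest: distributed_distr_eq_density)
  moreover have "distr stdn lborel (\<lambda>x. \<sigma> * x) = distr stdn borel (\<lambda>x. \<sigma> * x)"
    by (rule distr_cong) auto
  ultimately show ?thesis by simp
qed

lemma std_normal_iexp: "(LINT z|stdn. iexp (s * z)) = complex_of_real (exp (- s\<^sup>2 / 2))"
  using fun_cong[OF char_std_normal_distribution, of s] by (simp add: char_def)

lemma integral_Inl:
  fixes G :: "('i => real) => 'b::{banach, second_countable_topology}" and K :: "('i + 'j) set"
  assumes G: "dep G V" "G \<in> borel_measurable (UP V)" and V: "Inl ` V \<subseteq> K"
  shows "(LINT \<omega>|UP K. G (\<lambda>i. \<omega> (Inl i))) = (LINT u|UP V. G u)"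
proof -
  have d: "distr (UP K) (UP V) (\<lambda>\<omega>. \<lambda>i\<in>V. \<omega> (Inl i)) = UP V"
    by (rule distr_PiM_reindex[of K "\<lambda>_. unif" Inl V]) (use prob_unif V in auto)
  have m: "(\<lambda>\<omega>. \<lambda>i\<in>V. \<omega> (Inl i)) \<in> measurable (UP K) (UP V)"
    by (rule measurable_restrict) (use measurable_component_singleton[of _ K "\<lambda>_. unif"] V in auto)
  have "(LINT \<omega>|UP K. G (\<lambda>i\<in>V. \<omega> (Inl i))) = (LINT u|UP V. G u)"
    using integral_distr[OF m G(2)] d by simp
  moreover have "G (\<lambda>i\<in>V. \<omega> (Inl i)) = G (\<lambda>i. \<omega> (Inl i))" for \<omega> :: "'i + 'j => real" by (rule depD[OF G(1)]) simp
  ultimately show ?thesis by simp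
qed

lemma bmf_component: "U.bm1 f ==> i \<in> I ==> bmf I (\<lambda>\<omega>. f (\<omega> i))"
  unfolding bmf_def dep_def U.bm1_def
  by (auto intro!: measurable_compose[OF measurable_component_singleton[of i I "\<lambda>_. unif"], of f])

lemma bmf_component2: "U.bm2 G ==> i \<in> I ==> j \<in> I ==> bmf I (\<lambda>\<omega>. G (\<omega> i) (\<omega> j))"
proof -
  assume G: "U.bm2 G" and i: "i \<in> I" "j \<in> I"
  have "(\<lambda>\<omega>. G (\<omega> i) (\<omega> j)) \<in> borel_measurable (UP I)"
    using measurable_component_singleton[of _ I "\<lambda>_. unif"] i by (intro U.bm2_measurable'[OF G]) auto
  then show ?thesis using G i unfolding bmf_def dep_def U.bm2_def by auto
qed

lemma integral_component: "U.bm1 f ==> i \<in> I ==> (LINT \<omega>|UP I. f (\<omega> i)) = (LINT x|unif. f x)"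
  by (rule integrable_PiM_component(2)) (auto intro: prob_unif U.bm1_integrable)

lemma integral_component2:
  assumes G: "U.bm2 G" and i: "i \<in> I" "j \<in> I" "i \<noteq> j"
  shows "(LINT \<omega>|UP I. G (\<omega> i) (\<omega> j)) = (LINT x|unif. (LINT y|unif. G x y))"
proof -
  interpret product_sigma_finite "\<lambda>_ :: 'a. unif" by (rule psf_unif)
  have b: "bmf {j, i} (\<lambda>\<omega>. G (\<omega> i) (\<omega> j))" by (rule bmf_component2[OF G]) auto
  have "(LINT \<omega>|UP I. G (\<omega> i) (\<omega> j)) = (LINT \<omega>|UP {j, i}. G (\<omega> i) (\<omega> j))"
    by (rule integral_dep[OF bmf_dep[OF b] _ bmf_measurable[OF b]]) (use i in auto)
  also have "\<dots> = (LINT x|UP {i}. (LINT y|unif. G ((x(j := y)) i) ((x(j := y)) j)))"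
    by (rule product_integral_insert) (use i bmf_integrable[OF b] in auto)
  also have "\<dots> = (LINT x|UP {i}. (LINT y|unif. G (x i) y))" using i by simp
  also have "\<dots> = (LINT x|unif. (LINT y|unif. G x y))" by (rule integral_component[OF U.bm2_int[OF G]]) simp
  finally show ?thesis .
qed

lemma bm1_bmf: "bmf {a} F ==> U.bm1 (\<lambda>x. F (\<lambda>_. x))"
proof -
  assume F: "bmf {a} F"
  have m: "(\<lambda>x. \<lambda>i\<in>{a}. x) \<in> measurable unif (UP {a})" by (rule measurable_restrict) simp
  have "F (\<lambda>i\<in>{a}. x) = F (\<lambda>_. x)" for x by (rule depD[OF bmf_dep[OF F]]) simp
  then show ?thesis using measurable_compose[OF m bmf_measurable[OF F]] F unfolding U.bm1_def bmf_def by auto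
qed

lemma bm2_bmf: "bmf {a, b} F ==> U.bm2 (\<lambda>x y. F (\<lambda>i. if i = a then x else y))"
proof -
  assume F: "bmf {a, b} F"
  have "(\<lambda>p. \<lambda>i\<in>{a, b}. if i = a then fst p else snd p) \<in> measurable (unif \<Otimes>\<^sub>M unif) (UP {a, b})"
  proof (rule measurable_restrict)
    show "(\<lambda>p. if i = a then fst p else snd p) \<in> measurable (unif \<Otimes>\<^sub>M unif) unif" for i by (cases "i = a") auto
  qed
  from measurable_compose[OF this bmf_measurable[OF F]]
  have "(\<lambda>p. F (\<lambda>i\<in>{a, b}. if i = a then fst p else snd p)) \<in> borel_measurable (unif \<Otimes>\<^sub>M unif)" .
  moreover have "F (\<lambda>i\<in>{a, b}. if i = a then x else y) = F (\<lambda>i. if i = a then x else y)" for x y by (rule depD[OF bmf_dep[OF F]]) simp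
  ultimately show ?thesis using F unfolding U.bm2_def bmf_def by (auto simp: split_beta')
qed

lemma AE_zero_of_integral:
  assumes F: "bmf I F" and p: "\<And>\<omega>. 0 \<le> F \<omega>" and z: "(LINT \<omega>|UP I. F \<omega>) = 0"
  shows "AE \<omega> in UP I. F \<omega> = 0"
  using integral_nonneg_eq_0_iff_AE[OF bmf_integrable[OF F]] p z by auto

text \<open>The central limit theorem is applied on one infinite product space. Each partial sum
  depends on n coordinates only, so its characteristic function is the integral over the finite
  product.\<close>

lemma iid_clt_char:
  assumes f: "U.bm1 f" "(LINT x|unif. f x) = 0" and v: "(LINT x|unif. (f x)^2) = v" "v > 0"
  shows "(\<lambda>n. (LINT u|UP {..<n}. iexp (s * ((\<Sum>i<n. f (u (i::nat))) / sqrt n)))) \<longlonglongrightarrow> complex_of_real (exp (- (s * sqrt v)\<^sup>2 / 2))"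
proof -
  let ?P = "UP (UNIV :: nat set)"
  interpret P: prob_space ?P by (rule prob_UP)
  define X where "X i = (\<lambda>\<omega> :: nat => real. f (\<omega> i))" for i :: nat
  have bX: "bmf UNIV (X i)" for i unfolding X_def by (rule bmf_component[OF f(1)]) simp
  have fm: "f \<in> borel_measurable unif" by (rule U.bm1_measurable[OF f(1)])
  have m: "(\<lambda>\<omega>. \<omega> i) \<in> measurable ?P unif" for i by (rule measurable_component_singleton) simp
  have "P.indep_vars (\<lambda>_. unif) (\<lambda>i \<omega>. \<omega> i) UNIV" by (rule PiM_coordinates_indep) (use prob_unif in auto)
  then have ind: "P.indep_vars (\<lambda>_. borel) X UNIV"
    unfolding X_def by (rule P.indep_vars_compose2) (rule fm)
  have dX: "distr ?P borel (X i) = distr unif borel f" for i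
  proof -
    have "distr unif borel f = distr (distr ?P unif (\<lambda>\<omega>. \<omega> i)) borel f"
      using distr_PiM_component[of UNIV "\<lambda>_. unif" i] prob_unif by simp
    also have "\<dots> = distr ?P borel (f \<circ> (\<lambda>\<omega>. \<omega> i))" by (rule distr_distr[OF fm m])
    finally show ?thesis by (simp add: X_def comp_def)
  qed
  have EX: "P.expectation (X i) = 0" for i unfolding X_def using integral_component[OF f(1), of i UNIV] f(2) by simp
  have VX: "P.variance (X i) = (sqrt v)^2" for i
    using integral_component[OF U.bm1_power2[OF f(1)], of i UNIV] v EX[of i] by (simp add: X_def)
  have wc: "weak_conv_m (\<lambda>n. distr ?P borel (\<lambda>x. (\<Sum>i<n. X i x) / sqrt (n * (sqrt v)^2))) stdn"
  proof (rule P.central_limit_theorem_zero_mean[where \<mu>="distr unif borel f", OF ind EX _ _ VX dX])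
    show "sqrt v > 0" using v by simp
    show "integrable ?P (\<lambda>x. (X i x)^2)" for i unfolding power2_eq_square by (rule bmf_integrable[OF bmf_mult[OF bX bX]])
  qed
  have Sm: "(\<lambda>x. (\<Sum>i<n. X i x) / sqrt (n * (sqrt v)^2)) \<in> borel_measurable ?P" for n
    by (intro borel_measurable_divide borel_measurable_sum bmf_measurable[OF bX] borel_measurable_const)
  have lim: "(\<lambda>n. char (distr ?P borel (\<lambda>x. (\<Sum>i<n. X i x) / sqrt (n * (sqrt v)^2))) (s * sqrt v)) \<longlonglongrightarrow> char stdn (s * sqrt v)"
    by (rule levy_continuity1[OF _ real_dist_normal_dist wc]) (rule P.real_distribution_distr[OF Sm])
  have "char (distr ?P borel (\<lambda>x. (\<Sum>i<n. X i x) / sqrt (n * (sqrt v)^2))) (s * sqrt v)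
     = (LINT u|UP {..<n}. iexp (s * ((\<Sum>i<n. f (u i)) / sqrt n)))" (is "?L = ?R") for n :: nat
  proof -
    have bS: "bmf {..<n} (\<lambda>u. \<Sum>i<n. f (u i))" by (intro bmf_sum bmf_component[OF f(1)]) simp
    have "?L = (LINT u|?P. iexp (s * sqrt v * ((\<Sum>i<n. X i u) / sqrt (n * (sqrt v)^2))))"
      unfolding char_def by (rule integral_distr[OF Sm]) simp
    also have "\<dots> = (LINT u|?P. iexp (s * ((\<Sum>i<n. f (u i)) / sqrt n)))"
      unfolding X_def real_sqrt_mult using v by simp
    also have "\<dots> = ?R"
    proof (rule integral_dep)
      show "dep (\<lambda>u. iexp (s * ((\<Sum>i<n. f (u i)) / sqrt n))) {..<n}" unfolding dep_def by simp
      show "(\<lambda>u. iexp (s * ((\<Sum>i<n. f (u i)) / sqrt n))) \<in> borel_measurable (UP {..<n})"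
        by (rule iexp_measurable) (intro borel_measurable_divide bmf_measurable[OF bS] borel_measurable_const)
    qed simp
    finally show ?thesis .
  qed
  then show ?thesis using lim by (simp add: char_std_normal_distribution)
qed

context good_graphon
begin

lemma hP_single: "hP {i} u = t1 r W (u i)"
  using B_single[of i "case_sum u (\<lambda>_. 0)"] by (simp add: B_def A_no_edges edges_small)

lemma bm1_t1: "U.bm1 (t1 r W)"
  using bm1_bmf[OF bmf_hP[of "{0}"]] r2 by (simp add: hP_single)

lemma integral_A: "finite S ==> card S = r ==> (LINT \<omega>|UP (crd S). A S \<omega>) = tt"
proof -
  assume S: "finite S" "card S = r"
  have "crd {} = {}" by (simp add: crd_def edges_small)
  moreover have "A S (merge {} (crd S) (x, y)) = A S y" for x y
    by (rule depD[OF bmf_dep[OF bmf_A]]) (simp add: merge_def)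
  ultimately show ?thesis using condexp_AB[OF S, of "{}"] by (simp add: B_empty)
qed

lemma integral_B: "finite P ==> card P \<le> r ==> (LINT \<omega>|UP (crd P). B P \<omega>) = tt"
proof -
  assume P: "finite P" "card P \<le> r"
  have "crd {} = {}" by (simp add: crd_def edges_small)
  moreover have "B P (merge {} (crd P) (x, y)) = B P y" for x y
    by (rule depD[OF bmf_dep[OF bmf_B[OF P]]]) (simp add: merge_def)
  ultimately show ?thesis using tower_B[OF P, of "{}"] by (simp add: B_empty)
qed

lemma integral_t1: "(LINT x|unif. t1 r W x) = tt"
  using integral_B[of "{0}"] r2 integral_component[OF bm1_t1, of "Inl 0" "crd {0}"] by (simp add: B_single crd_Inl)

lemma Kfree_no_cliques:
  assumes "Kfree r W"
  shows "AE \<omega> in GP n. clique_count W n r \<omega> = 0"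
proof -
  have "AE \<omega> in GP n. \<forall>S\<in>Sub r n. A S \<omega> = 0"
  proof (rule AE_finite_allI[OF finite_Sub])
    fix S assume "S \<in> Sub r n"
    then have S: "finite S" "S \<subseteq> {..<n}" "card S = r" using SubD[of S r n] by auto
    have b: "bmf (crd {..<n}) (A S)" by (rule bmf_mono[OF bmf_A crd_mono[OF S(2)]])
    have "(LINT \<omega>|GP n. A S \<omega>) = (LINT \<omega>|UP (crd S). A S \<omega>)"
      by (rule integral_dep[OF bmf_dep[OF bmf_A] crd_mono[OF S(2)] bmf_measurable[OF bmf_A]])
    also have "\<dots> = 0" using integral_A[OF S(1,3)] assms by (simp add: Kfree_def tt_def)
    finally show "AE \<omega> in GP n. A S \<omega> = 0" by (rule AE_zero_of_integral[OF b A01(1)])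
  qed
  then show ?thesis
  proof eventually_elim
    case (elim \<omega>)
    then have "real (clique_count W n r \<omega>) = 0" unfolding clique_count_sum by simp
    then show ?case by simp
  qed
qed

lemma bm2_W: "U.bm2 W"
proof -
  have "(\<lambda>p. W (fst p) (snd p)) \<in> borel_measurable (unif \<Otimes>\<^sub>M unif)"
    using measurable_fst[of unif unif] measurable_snd[of unif unif] by (intro W_measurable) simp_all
  moreover have "\<bar>W x y\<bar> \<le> 1" for x y using W0[of x y] W1[of x y] by simp
  ultimately show ?thesis unfolding U.bm2_def split_beta' by blast
qed

lemma complete_all_cliques:
  assumes "complete_graphon W"
  shows "AE \<omega> in GP n. clique_count W n r \<omega> = n choose r"
proof -
  have b1: "U.bm2 (\<lambda>x y. 1 - W x y)" by (intro U.bm2_diff U.bm2_const bm2_W)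
  have "(LINT x|unif. (LINT y|unif. 1 - W x y)) = (LINT p|(unif \<Otimes>\<^sub>M unif). 1 - W (fst p) (snd p))"
    using U.bm2_pair[OF b1] by simp
  also have "\<dots> = (LINT p|(unif \<Otimes>\<^sub>M unif). 0)"
  proof (rule integral_cong_AE)
    show "(\<lambda>p. 1 - W (fst p) (snd p)) \<in> borel_measurable (unif \<Otimes>\<^sub>M unif)"
      using U.bm2_measurable[OF b1] by (simp add: split_beta')
  qed (use assms in \<open>auto simp: complete_graphon_def\<close>)
  finally have z: "(LINT x|unif. (LINT y|unif. 1 - W x y)) = 0" by simp
  \<comment> \<open>Edges are decided by a strict inequality, so an auxiliary uniform equal to 1
    would miss an edge of probability 1; this happens with probability 0.\<close>
  have u1: "AE y in unif. y < 1"
  proof (rule AE_uniform_measureI)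
    show "AE x in lborel. x \<in> {0..1} \<longrightarrow> x < (1::real)" using AE_lborel_singleton[of 1] by eventually_elim auto
  qed simp
  have "AE \<omega> in GP n. \<forall>e\<in>edges {..<n}. ind \<omega> e = 1"
  proof (rule AE_finite_allI[OF finite_edges])
    fix e assume e: "e \<in> edges {..<n}"
    then obtain a b where ab: "e = {a, b}" "a \<in> {..<n}" "b \<in> {..<n}" "a < b" by (rule edgesE) blast
    have "AE \<omega> in GP n. 1 - W (\<omega> (Inl a)) (\<omega> (Inl b)) = 0"
    proof (rule AE_zero_of_integral)
      show "bmf (crd {..<n}) (\<lambda>\<omega>. 1 - W (\<omega> (Inl a)) (\<omega> (Inl b)))" by (rule bmf_component2[OF b1]) (use ab crd_Inl in auto)
      show "(LINT \<omega>|GP n. 1 - W (\<omega> (Inl a)) (\<omega> (Inl b))) = 0"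
        using integral_component2[OF b1, of "Inl a" "crd {..<n}" "Inl b"] ab z by (simp add: crd_Inl)
    qed (use W1 in simp)
    moreover have "AE \<omega> in GP n. \<omega> (ei e) < 1"
      by (rule AE_PiM_component[OF prob_unif]) (use e crd_ei u1 in auto)
    ultimately show "AE \<omega> in GP n. ind \<omega> e = 1"
      by eventually_elim (use ab in \<open>simp add: ind_def we_pair\<close>)
  qed simp
  then show ?thesis
  proof eventually_elim
    case (elim \<omega>)
    have "A S \<omega> = 1" if "S \<in> Sub r n" for S
    proof -
      have "edges S \<subseteq> edges {..<n}" using SubD[OF that] by (intro edges_mono) auto
      then show ?thesis unfolding A_def using elim by (intro prod.neutral) auto
    qed
    then have "real (clique_count W n r \<omega>) = real (n choose r)" unfolding clique_count_sum by (simp add: card_Sub)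
    then show ?case by simp
  qed
qed

lemma degenerate_1: "degenerate 1" unfolding degenerate_def by (auto simp: B_empty card_eq_0_iff)

lemma Y_1: "Y 1 n \<omega> = (\<Sum>i<n. t1 r W (\<omega> (Inl i)) - tt)"
proof -
  have "Sub 1 n = (\<lambda>i. {i}) ` {..<n}" by (auto simp: Sub_def card_1_singleton_iff)
  then show ?thesis unfolding Y_def by (simp add: sum.reindex B_single)
qed

text \<open>Two cliques through one common vertex have density equal to the second moment of
  \<open>t1\<close>, so the expression under the root is the variance of \<open>t1\<close>. It
  vanishes only if \<open>t1\<close> is almost surely constant, that is, under regularity.\<close>

lemma sigma_hat_variance:
  defines "v \<equiv> (LINT x|unif. (t1 r W x - tt)^2)"
  shows "sigma_hat_rW r W = 1 / fact (r - 1) * sqrt v" "\<not> Kregular r W ==> v > 0"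
proof -
  have b: "U.bm1 (\<lambda>x. t1 r W x - tt)" by (intro U.bm1_diff U.bm1_const bm1_t1)
  have z: "{..<1::nat} = {0}" by auto
  have "tdens W (2 * r - 1) (Kr_ominus r 1) = (LINT u|UP {..<1}. (\<Prod>e\<in>edges {..<1}. we u e ^ 1) * (hP {..<1} u)^2)"
    by (rule two_copies_density) (use r2 in \<open>auto simp: Kr_ominus_def two_copies_mult_def in_copy2_def\<close>)
  also have "\<dots> = (LINT x|unif. (t1 r W x)^2)"
    unfolding z hP_single using integral_component[OF U.bm1_power2[OF bm1_t1], of "0::nat" "{0}"] by (simp add: edges_small)
  finally have 1: "tdens W (2 * r - 1) (Kr_ominus r 1) = (LINT x|unif. (t1 r W x)^2)" .
  have "v = (LINT x|unif. (t1 r W x)^2 - 2 * tt * t1 r W x + tt^2)"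
    unfolding v_def by (intro Bochner_Integration.integral_cong) (auto simp: power2_eq_square algebra_simps)
  also have "\<dots> = (LINT x|unif. (t1 r W x)^2) - tt\<^sup>2"
    using U.bm1_integrable[OF U.bm1_power2[OF bm1_t1]] U.bm1_integrable[OF bm1_t1] integral_t1
    by (simp add: U.prob_space power2_eq_square)
  finally have 2: "v = (LINT x|unif. (t1 r W x)^2) - tt\<^sup>2" .
  show "sigma_hat_rW r W = 1 / fact (r - 1) * sqrt v"
    unfolding sigma_hat_rW_def 1 2 tt_def ..
  assume n: "\<not> Kregular r W"
  have "v \<noteq> 0"
  proof
    assume "v = 0"
    then have "AE x in unif. (t1 r W x - tt)^2 = 0" unfolding v_def
      using integral_nonneg_eq_0_iff_AE[OF U.bm1_integrable[OF U.bm1_power2[OF b]]] by simp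
    then have "Kregular r W" unfolding Kregular_def tt_def[symmetric] by eventually_elim simp
    then show False using n by simp
  qed
  moreover have "v \<ge> 0" unfolding v_def by simp
  ultimately show "v > 0" by simp
qed

lemma clique_char_limit:
  assumes H: "degenerate d" and d: "d \<le> r" and M: "\<And>n. n > 0 ==> M n > 0" "\<And>n. n > 0 ==> (M n)^2 = real n ^ d"
    and N: "\<And>n. n > 0 ==> N n = real n ^ (r - d) * M n"
    and lim: "(\<lambda>n. (LINT \<omega>|GP n. iexp (s / fact (r - d) * (Y d n \<omega> / M n)))) \<longlonglongrightarrow> L"
  shows "(\<lambda>n. (LINT \<omega>|GP n. iexp (s * ((real (clique_count W n r \<omega>) - real (n choose r) * tt) / N n)))) \<longlonglongrightarrow> L"
proof -
  let ?X = "\<lambda>n \<omega>. (real (clique_count W n r \<omega>) - real (n choose r) * tt) / N n" and ?Z = "\<lambda>n \<omega>. Y d n \<omega> / M n / fact (r - d)"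
  have a: "(\<lambda>n. \<bar>s\<bar> * (LINT \<omega>|GP n. \<bar>?X n \<omega> - ?Z n \<omega>\<bar>)) \<longlonglongrightarrow> 0"
    using tendsto_mult_right_zero[OF clique_first_approximation[OF H d M N]] by simp
  have "cmod ((LINT \<omega>|GP n. iexp (s * ?X n \<omega>)) - (LINT \<omega>|GP n. iexp (s / fact (r - d) * (Y d n \<omega> / M n))))
      \<le> \<bar>s\<bar> * (LINT \<omega>|GP n. \<bar>?X n \<omega> - ?Z n \<omega>\<bar>)" for n
  proof -
    interpret prob_space "GP n" by (rule prob_UP)
    have bX: "bmf (crd {..<n}) (\<lambda>\<omega>. real (clique_count W n r \<omega>))" unfolding clique_count_sum
      by (intro bmf_sum bmf_mono[OF bmf_A crd_mono]) (use SubD in blast)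
    have iX: "integrable (GP n) (?X n)" and iZ: "integrable (GP n) (?Z n)"
      using bmf_integrable[OF bX] bmf_integrable[OF bmf_Y[OF d]] by auto
    have "cmod ((LINT \<omega>|GP n. iexp (s * ?X n \<omega>)) - (LINT \<omega>|GP n. iexp (s * ?Z n \<omega>)))
      \<le> (LINT \<omega>|GP n. \<bar>s * ?X n \<omega> - s * ?Z n \<omega>\<bar>)"
      by (rule char_diff_le) (intro borel_measurable_times borel_measurable_const borel_measurable_integrable[OF iX] borel_measurable_integrable[OF iZ] integrable_abs Bochner_Integration.integrable_diff integrable_mult_right impI iX iZ)+
    also have "\<dots> = \<bar>s\<bar> * (LINT \<omega>|GP n. \<bar>?X n \<omega> - ?Z n \<omega>\<bar>)"
      unfolding right_diff_distrib[symmetric] abs_mult by simp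
    finally show ?thesis by (simp add: ac_simps)
  qed
  then have "(\<lambda>n. (LINT \<omega>|GP n. iexp (s * ?X n \<omega>)) - (LINT \<omega>|GP n. iexp (s / fact (r - d) * (Y d n \<omega> / M n)))) \<longlonglongrightarrow> 0"
    by (intro Lim_null_comparison[OF _ a] always_eventually) simp
  from tendsto_add[OF this lim] show ?thesis by simp
qed

lemma clique_count_measurable: "(\<lambda>\<omega>. (real (clique_count W n r \<omega>) - c) / k) \<in> borel_measurable (GP n)"
proof -
  have "bmf (crd {..<n}) (\<lambda>\<omega>. real (clique_count W n r \<omega>))" unfolding clique_count_sum
    by (intro bmf_sum bmf_mono[OF bmf_A crd_mono]) (use SubD in blast)
  from bmf_measurable[OF this] show ?thesis by simp
qed

theorem nonregular_limit:
  assumes n: "\<not> Kregular r W"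
  shows "sigma_hat_rW r W > 0"
    "weak_conv_m (\<lambda>n. distr (GP n) borel (\<lambda>\<omega>. (real (clique_count W n r \<omega>) - real (n choose r) * tt) / real n powr (real r - 1/2)))
       (density lborel (normal_density 0 (sigma_hat_rW r W)))"
proof -
  define v where "v = (LINT x|unif. (t1 r W x - tt)^2)"
  have \<sigma>: "sigma_hat_rW r W = 1 / fact (r - 1) * sqrt v" and v: "v > 0"
    using sigma_hat_variance n unfolding v_def by auto
  show pos: "sigma_hat_rW r W > 0" unfolding \<sigma> using v by simp
  define f where "f x = t1 r W x - tt" for x
  have f: "U.bm1 f" unfolding f_def by (intro U.bm1_diff U.bm1_const bm1_t1)
  have f0: "(LINT x|unif. f x) = 0" unfolding f_def
    using U.bm1_integrable[OF bm1_t1] integral_t1 by (simp add: U.prob_space)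
  have f2: "(LINT x|unif. (f x)^2) = v" unfolding f_def v_def ..
  show "weak_conv_m (\<lambda>n. distr (GP n) borel (\<lambda>\<omega>. (real (clique_count W n r \<omega>) - real (n choose r) * tt) / real n powr (real r - 1/2)))
       (density lborel (normal_density 0 (sigma_hat_rW r W)))"
    unfolding normal_as_distr[OF pos]
  proof (rule weak_conv_by_char[OF prob_UP clique_count_measurable std_normal_facts(1)])
    fix s :: real
    have e: "(LINT z|stdn. iexp (s * (sigma_hat_rW r W * z))) = complex_of_real (exp (- (s / fact (r - 1) * sqrt v)\<^sup>2 / 2))"
      using std_normal_iexp[of "s * sigma_hat_rW r W"] by (simp add: \<sigma> mult.assoc)
    have "(LINT \<omega>|GP n. iexp (s / fact (r - 1) * (Y 1 n \<omega> / sqrt n)))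
       = (LINT u|UP {..<n}. iexp (s / fact (r - 1) * ((\<Sum>i<n. f (u i)) / sqrt n)))" for n :: nat
    proof -
      have b: "bmf {..<n} (\<lambda>u. \<Sum>i<n. f (u i))" by (intro bmf_sum bmf_component[OF f]) simp
      show ?thesis unfolding Y_1 f_def[symmetric]
      proof (rule integral_Inl[where G="\<lambda>u. iexp (s / fact (r - 1) * ((\<Sum>i<n. f (u i)) / sqrt n))"])
        show "dep (\<lambda>u. iexp (s / fact (r - 1) * ((\<Sum>i<n. f (u i)) / sqrt n))) {..<n}" unfolding dep_def by simp
        show "(\<lambda>u. iexp (s / fact (r - 1) * ((\<Sum>i<n. f (u i)) / sqrt n))) \<in> borel_measurable (UP {..<n})"
          by (rule iexp_measurable) (intro borel_measurable_divide bmf_measurable[OF b] borel_measurable_const)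
      qed (auto simp: crd_Inl)
    qed
    then have lim: "(\<lambda>n. (LINT \<omega>|GP n. iexp (s / fact (r - 1) * (Y 1 n \<omega> / sqrt n)))) \<longlonglongrightarrow> complex_of_real (exp (- (s / fact (r - 1) * sqrt v)\<^sup>2 / 2))"
      by (simp only: iid_clt_char[OF f f0 f2 v, of "s / fact (r - 1)"])
    show "(\<lambda>n. (LINT \<omega>|GP n. iexp (s * ((real (clique_count W n r \<omega>) - real (n choose r) * tt) / real n powr (real r - 1/2)))))
       \<longlonglongrightarrow> (LINT z|stdn. iexp (s * (sigma_hat_rW r W * z)))"
      unfolding e
    proof (rule clique_char_limit[OF degenerate_1 _ _ _ _ lim])
      show "1 \<le> r" using r2 by linarith
      show "sqrt (real n) > 0" if "n > 0" for n :: nat using that by simp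
      show "(sqrt (real n))^2 = real n ^ 1" for n :: nat by simp
      show "real n powr (real r - 1/2) = real n ^ (r - 1) * sqrt n" if "n > 0" for n :: nat
      proof -
        have "real r - 1/2 = real (r - 1) + 1/2" using r2 by (simp add: of_nat_diff)
        then have "real n powr (real r - 1/2) = real n powr real (r - 1) * real n powr (1/2)" by (simp only: powr_add)
        moreover have "real n powr real (r - 1) = real n ^ (r - 1)" by (rule powr_realpow) (use that in simp)
        moreover have "real n powr (1/2) = sqrt n" by (rule powr_half_sqrt) simp
        ultimately show ?thesis by simp
      qed
    qed
  qed simp
qed

end

section \<open>The limit in the regular case\<close>

definition ke :: "(real => real => real) => (nat => real) => nat set => real" where
  "ke G u e = G (u (Min e)) (u (Max e))"

lemma ke_pair: "(\<And>x y. G x y = G y x) ==> a \<noteq> b ==> ke G u {a, b} = G (u a) (u b)"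
  by (cases "a < b") (simp_all add: ke_def)

lemma bmf_ke: "U.bm2 G ==> e \<in> edges S ==> S \<subseteq> I ==> bmf I (\<lambda>u. ke G u e)"
  unfolding ke_def by (rule bmf_component2) (auto elim!: edgesE)

lemma integral_ke:
  assumes G: "U.bm2 G" and e: "e \<in> edges I"
  shows "(LINT u|UP I. ke G u e) = (LINT x|unif. (LINT y|unif. G x y))"
proof -
  obtain a b where "Min e = a" "Max e = b" "a \<in> I" "b \<in> I" "a < b" using e by (rule edgesE) blast
  then show ?thesis unfolding ke_def using integral_component2[OF G, of a I b] by simp
qed

text \<open>Disjoint edges are independent, so mean zero suffices. For edges sharing one vertex, the
  kernel must average to 0 in the other variable. The two alternatives serve the law of large
  numbers and the degenerate bound.\<close>

lemma ke_orthogonal: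
  assumes G: "U.bm2 G" and sym: "\<And>x y. G x y = G y x" and z: "(LINT x|unif. (LINT y|unif. G x y)) = 0"
    and e: "e \<in> edges {..<n}" "e' \<in> edges {..<n}"
    and d: "e \<inter> e' = {} \<or> (e \<noteq> e' \<and> (AE x in unif. (LINT y|unif. G x y) = 0))"
  shows "(LINT u|UP {..<n}. ke G u e * ke G u e') = 0"
proof (rule orthogonal_dep)
  have sub: "e \<subseteq> {..<n}" "e' \<subseteq> {..<n}" "e \<in> edges e" "e' \<in> edges e'" using e by (auto simp: edges_def)
  then show "e \<subseteq> {..<n}" "e' \<subseteq> {..<n}" "bmf e (\<lambda>u. ke G u e)" "bmf e' (\<lambda>u. ke G u e')" by (auto intro: bmf_ke[OF G])
  show "AE x in UP (e \<inter> e'). (LINT y|UP (e - e'). ke G (merge (e \<inter> e') (e - e') (x, y)) e) = 0"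
  proof (cases "e \<inter> e' = {}")
    case True
    have "e - e' = e" using True by auto
    moreover have "ke G (merge {} e (x, y)) e = ke G y e" for x y
      by (rule depD[OF bmf_dep[OF bmf_ke[OF G sub(3)]], of e]) (simp_all add: merge_def)
    ultimately show ?thesis using integral_ke[OF G sub(3)] z True by simp
  next
    case False
    then have ne: "e \<noteq> e'" and A: "AE x in unif. (LINT y|unif. G x y) = 0" using d by auto
    have c: "card e = 2" "card e' = 2" "finite e" "finite e'" using e finite_subset[OF sub(1)] finite_subset[OF sub(2)] by (auto simp: edges_def)
    obtain a where a: "a \<in> e" "a \<in> e'" using False by auto
    have "\<not> e \<subseteq> e'" using card_subset_eq[of e' e] c ne by auto
    then obtain b where b: "b \<in> e" "b \<notin> e'" by auto
    have ab: "a \<noteq> b" using a b by auto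
    have eab: "e = {a, b}" using card_subset_eq[of e "{a, b}"] c a b ab by auto
    have i: "e \<inter> e' = {a}" "e - e' = {b}" using a b eab by auto
    have "ke G (merge {a} {b} (x, y)) e = G (x a) (y b)" for x y
      unfolding eab using ke_pair[OF sym ab] ab by (simp add: merge_def)
    then have "(LINT y|UP {b}. ke G (merge {a} {b} (x, y)) e) = (LINT y|unif. G (x a) y)" for x
      using integral_component[OF U.bm2_sec1[OF G], of b "{b}"] by simp
    moreover have "AE x in UP {a}. (LINT y|unif. G (x a) y) = 0" by (rule AE_PiM_component[OF prob_unif _ A]) simp
    ultimately show ?thesis unfolding i by simp
  qed
qed simp

lemma Sub_2: "Sub 2 n = edges {..<n}" by (simp add: Sub_def edges_def)

text \<open>Degeneracy leaves only the diagonal of the double sum, so the order is n^2 instead of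
  the n^3 of a general centred kernel. Kernel approximation in L2 is thus uniform in n after
  division by n.\<close>

lemma ke_L2_degenerate:
  assumes G: "U.bm2 G" and sym: "\<And>x y. G x y = G y x" and z: "AE x in unif. (LINT y|unif. G x y) = 0"
  shows "(LINT u|UP {..<n}. (\<Sum>e\<in>edges {..<n}. ke G u e)^2) \<le> (real n)^2 * (LINT x|unif. (LINT y|unif. (G x y)^2))"
proof -
  let ?E = "edges {..<n}"
  have zz: "(LINT x|unif. (LINT y|unif. G x y)) = 0"
    using integral_cong_AE[OF _ _ z] U.bm1_measurable[OF U.bm2_int[OF G]] by simp
  have bk: "bmf {..<n} (\<lambda>u. ke G u e)" if "e \<in> ?E" for e by (rule bmf_ke[OF G that]) simp
  have "(LINT u|UP {..<n}. (\<Sum>e\<in>?E. ke G u e)^2) = (LINT u|UP {..<n}. (\<Sum>e\<in>?E. \<Sum>e'\<in>?E. ke G u e * ke G u e'))"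
    by (simp add: power2_eq_square sum_product)
  also have "\<dots> = (\<Sum>e\<in>?E. \<Sum>e'\<in>?E. (LINT u|UP {..<n}. ke G u e * ke G u e'))"
    by (simp add: Bochner_Integration.integral_sum bmf_integrable[OF bmf_mult[OF bk bk]] bmf_integrable[OF bmf_sum[OF bmf_mult[OF bk bk]]])
  also have "\<dots> = (\<Sum>e\<in>?E. \<Sum>e'\<in>?E. if e' = e then (LINT x|unif. (LINT y|unif. (G x y)^2)) else 0)"
  proof (intro sum.cong refl)
    fix e e' assume e: "e \<in> ?E" "e' \<in> ?E"
    show "(LINT u|UP {..<n}. ke G u e * ke G u e') = (if e' = e then (LINT x|unif. (LINT y|unif. (G x y)^2)) else 0)"
    proof (cases "e' = e")
      case True
      then show ?thesis using integral_ke[OF U.bm2_power2[OF G] e(1)] by (simp add: ke_def power2_eq_square)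
    next
      case False
      then show ?thesis using ke_orthogonal[OF G sym zz e] z by auto
    qed
  qed
  also have "\<dots> = real (card ?E) * (LINT x|unif. (LINT y|unif. (G x y)^2))" by (simp add: finite_edges)
  also have "\<dots> \<le> (real n)^2 * (LINT x|unif. (LINT y|unif. (G x y)^2))"
    using card_Sub_le[of 2 n] by (intro mult_right_mono) (auto simp: Sub_2)
  finally show ?thesis .
qed

text \<open>The limit carries 1/2 because there are about n^2/2 edges. For the centred kernel only
  intersecting pairs of edges contribute, at most 4 n for each edge by \<open>card_overlap\<close>,
  so the normalised second moment is at most 4/n.\<close>

lemma ke_lln:
  assumes G: "U.bm2 G" and sym: "\<And>x y. G x y = G y x" and bd: "\<And>x y. 0 \<le> G x y" "\<And>x y. G x y \<le> 1"
  defines "v \<equiv> (LINT x|unif. (LINT y|unif. G x y))"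
  shows "(\<lambda>n. (LINT u|UP {..<n}. \<bar>(\<Sum>e\<in>edges {..<n}. ke G u e) / (real n)^2 - v / 2\<bar>)) \<longlonglongrightarrow> 0"
proof -
  define H where "H x y = G x y - v" for x y
  have H: "U.bm2 H" unfolding H_def by (intro U.bm2_diff G U.bm2_const)
  have Hs: "H x y = H y x" for x y unfolding H_def by (simp add: sym)
  have i1: "(LINT y|unif. G x y - v) = (LINT y|unif. G x y) - v" for x
    using U.bm1_integrable[OF U.bm2_sec1[OF G]] by (simp add: U.prob_space)
  have Hz: "(LINT x|unif. (LINT y|unif. H x y)) = 0"
    unfolding H_def i1 using U.bm1_integrable[OF U.bm2_int[OF G]] by (simp add: U.prob_space v_def)
  have g01: "0 \<le> (LINT y|unif. G x y)" "(LINT y|unif. G x y) \<le> 1" for x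
    using bd U.integral_le_const[OF U.bm1_integrable[OF U.bm2_sec1[OF G]], where c=1] by auto
  have v01: "0 \<le> v" "v \<le> 1" unfolding v_def
    using g01 U.integral_le_const[OF U.bm1_integrable[OF U.bm2_int[OF G]], where c=1] by auto
  have Hb: "\<bar>H x y\<bar> \<le> 1" for x y unfolding H_def using v01 bd[of x y] by auto
  have bnd: "(LINT u|UP {..<n}. \<bar>(\<Sum>e\<in>edges {..<n}. ke G u e) / (real n)^2 - v / 2\<bar>)
     \<le> sqrt (4 / n) + \<bar>real (n choose 2) / (real n)^2 - 1 / 2\<bar>" if n: "n > 0" for n
  proof -
    let ?E = "edges {..<n}"
    interpret prob_space "UP {..<n}" by (rule prob_UP)
    define c where "c = real (n choose 2) / (real n)^2 - 1 / 2"
    have bk: "bmf {..<n} (\<lambda>u. ke H u e)" if "e \<in> ?E" for e by (rule bmf_ke[OF H that]) simp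
    have bS: "bmf {..<n} (\<lambda>u. \<Sum>e\<in>?E. ke H u e)" by (rule bmf_sum[OF bk])
    have "(LINT u|UP {..<n}. (\<Sum>e\<in>?E. ke H u e)^2) = (LINT u|UP {..<n}. (\<Sum>e\<in>?E. \<Sum>e'\<in>?E. ke H u e * ke H u e'))"
      by (simp add: power2_eq_square sum_product)
    also have "\<dots> = (\<Sum>e\<in>?E. \<Sum>e'\<in>?E. (LINT u|UP {..<n}. ke H u e * ke H u e'))"
      by (simp add: Bochner_Integration.integral_sum bmf_integrable[OF bmf_mult[OF bk bk]] bmf_integrable[OF bmf_sum[OF bmf_mult[OF bk bk]]])
    also have "\<dots> \<le> (\<Sum>e\<in>?E. \<Sum>e'\<in>?E. if 1 \<le> card (e \<inter> e') then 1 else 0)"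
    proof (intro sum_mono)
      fix e e' assume e: "e \<in> ?E" "e' \<in> ?E"
      show "(LINT u|UP {..<n}. ke H u e * ke H u e') \<le> (if 1 \<le> card (e \<inter> e') then 1 else 0)"
      proof (cases "e \<inter> e' = {}")
        case True
        then show ?thesis using ke_orthogonal[OF H Hs Hz e] by simp
      next
        case False
        have fe: "finite e" using e(1) by (auto simp: edges_def intro: card_ge_0_finite)
        have "\<bar>ke H u e * ke H u e'\<bar> \<le> \<bar>1\<bar> * \<bar>1\<bar>" for u by (rule abs_mult_le_bounds) (simp_all add: ke_def Hb)
        then have "ke H u e * ke H u e' \<le> 1" for u by (simp add: abs_le_iff)
        then have "(LINT u|UP {..<n}. ke H u e * ke H u e') \<le> 1"
          by (intro integral_le_const bmf_integrable[OF bmf_mult[OF bk[OF e(1)] bk[OF e(2)]]]) simp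
        moreover have "1 \<le> card (e \<inter> e')" using False fe by (simp add: Suc_le_eq card_gt_0_iff)
        ultimately show ?thesis by simp
      qed
    qed
    also have "\<dots> = (\<Sum>e\<in>?E. real (card {e' \<in> ?E. 1 \<le> card (e \<inter> e')}))"
      by (intro sum.cong refl) (simp add: sum.If_cases finite_edges Int_def)
    also have "\<dots> \<le> (\<Sum>e\<in>?E. 4 * real n)"
    proof (intro sum_mono)
      fix e assume "e \<in> ?E"
      then have "real (card {e' \<in> ?E. 1 \<le> card (e \<inter> e')}) * real n \<le> 4 * real n * real n"
        using card_overlap[of e 2 n 1] by (simp add: Sub_2 power2_eq_square)
      then show "real (card {e' \<in> ?E. 1 \<le> card (e \<inter> e')}) \<le> 4 * real n" using n by simp
    qed
    also have "\<dots> \<le> 4 * real n * (real n)^2" using card_Sub_le[of 2 n] by (simp add: Sub_2 mult.commute mult_right_mono)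
    finally have s2: "(LINT u|UP {..<n}. (\<Sum>e\<in>?E. ke H u e)^2) \<le> 4 / n * ((real n)^2)^2"
      using n by (simp add: power2_eq_square mult.assoc)
    have "(LINT u|UP {..<n}. \<bar>\<Sum>e\<in>?E. ke H u e\<bar>) \<le> sqrt (4 / n * ((real n)^2)^2)"
      using bmf_L1_le_L2[OF bS] real_sqrt_le_mono[OF s2] by linarith
    also have "\<dots> = sqrt (4 / n) * (real n)^2" by (simp only: real_sqrt_mult real_sqrt_abs abs_power2)
    finally have L: "(LINT u|UP {..<n}. \<bar>\<Sum>e\<in>?E. ke H u e\<bar>) / (real n)^2 \<le> sqrt (4 / n)" using n by (simp add: pos_divide_le_eq)
    have eq: "(\<Sum>e\<in>?E. ke G u e) / (real n)^2 - v / 2 = (\<Sum>e\<in>?E. ke H u e) / (real n)^2 + c * v" for u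
    proof -
      have "(\<Sum>e\<in>?E. ke H u e) = (\<Sum>e\<in>?E. ke G u e) - real (n choose 2) * v"
        unfolding ke_def H_def sum_subtractf using card_Sub[of 2 n] by (simp add: Sub_2)
      then show ?thesis unfolding c_def by (simp add: diff_divide_distrib left_diff_distrib)
    qed
    have iH: "integrable (UP {..<n}) (\<lambda>u. \<Sum>e\<in>?E. ke H u e)" by (rule bmf_integrable[OF bS])
    have "(LINT u|UP {..<n}. \<bar>(\<Sum>e\<in>?E. ke G u e) / (real n)^2 - v / 2\<bar>) \<le> (LINT u|UP {..<n}. \<bar>\<Sum>e\<in>?E. ke H u e\<bar> / (real n)^2 + \<bar>c\<bar>)"
      unfolding eq
    proof (rule integral_mono)
      show "integrable (UP {..<n}) (\<lambda>u. \<bar>(\<Sum>e\<in>?E. ke H u e) / (real n)^2 + c * v\<bar>)"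
        by (intro integrable_abs Bochner_Integration.integrable_add integrable_divide iH integrable_const)
      show "integrable (UP {..<n}) (\<lambda>u. \<bar>\<Sum>e\<in>?E. ke H u e\<bar> / (real n)^2 + \<bar>c\<bar>)"
        by (intro Bochner_Integration.integrable_add integrable_divide integrable_abs iH integrable_const)
      have "\<bar>c * v\<bar> \<le> \<bar>c\<bar>" using v01 by (simp add: abs_mult mult_left_le)
      then show "\<bar>(\<Sum>e\<in>?E. ke H u e) / (real n)^2 + c * v\<bar> \<le> \<bar>\<Sum>e\<in>?E. ke H u e\<bar> / (real n)^2 + \<bar>c\<bar>" for u
        by (intro order_trans[OF abs_triangle_ineq] add_mono) simp_all
    qed
    also have "\<dots> = (LINT u|UP {..<n}. \<bar>\<Sum>e\<in>?E. ke H u e\<bar>) / (real n)^2 + \<bar>c\<bar>"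
      using integrable_abs[OF iH] by (simp add: prob_space)
    finally show ?thesis unfolding c_def[symmetric] using L by linarith
  qed
  show ?thesis
  proof (rule tendsto_sandwich[OF _ _ tendsto_const])
    show "\<forall>\<^sub>F n in sequentially. 0 \<le> (LINT u|UP {..<n}. \<bar>(\<Sum>e\<in>edges {..<n}. ke G u e) / (real n)^2 - v / 2\<bar>)"
      by (intro always_eventually) simp
    show "\<forall>\<^sub>F n in sequentially. (LINT u|UP {..<n}. \<bar>(\<Sum>e\<in>edges {..<n}. ke G u e) / (real n)^2 - v / 2\<bar>)
       \<le> sqrt (4 / real n) + \<bar>real (n choose 2) / (real n)^2 - 1 / 2\<bar>"
      using eventually_gt_at_top[of 0] by eventually_elim (rule bnd)
    have "(\<lambda>n. sqrt (4 / real n)) \<longlonglongrightarrow> sqrt 0"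
      by (intro tendsto_real_sqrt real_tendsto_divide_at_top[OF tendsto_const] filterlim_real_sequentially)
    moreover have "(\<lambda>n. real (n choose 2) / (real n)^2 - 1 / 2) \<longlonglongrightarrow> 1 / 2 - 1 / 2"
      using tendsto_diff[OF binomial_ratio_limit[of 0 2] tendsto_const[of "1/2"]] by (simp add: fact_2)
    ultimately have "(\<lambda>n. sqrt (4 / real n) + \<bar>real (n choose 2) / (real n)^2 - 1 / 2\<bar>) \<longlonglongrightarrow> sqrt 0 + \<bar>1 / 2 - 1 / 2\<bar>"
      by (intro tendsto_add tendsto_rabs)
    then show "(\<lambda>n. sqrt (4 / real n) + \<bar>real (n choose 2) / (real n)^2 - 1 / 2\<bar>) \<longlonglongrightarrow> 0" by simp
  qed
qed

text \<open>Identifies edge sums of the graph with the quadratic form over ordered pairs on which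
  the exchange argument works.\<close>

lemma sum_ke_qf:
  assumes sym: "\<And>x y. G x y = G y x"
  shows "(\<Sum>e\<in>edges {..<n}. ke G u e) = qf G {..<n} u"
proof (induction n)
  case 0
  have "edges {..<0} = {}" by (auto simp: edges_def)
  then show ?case by (simp add: qf_def)
next
  case (Suc n)
  have "edges {..<Suc n} = edges {..<n} \<union> (\<lambda>j. {n, j}) ` {..<n}"
  proof (intro subset_antisym subsetI)
    fix e assume "e \<in> edges {..<Suc n}"
    then obtain a b where ab: "e = {a, b}" "a \<in> {..<Suc n}" "b \<in> {..<Suc n}" "a < b" by (rule edgesE) blast
    show "e \<in> edges {..<n} \<union> (\<lambda>j. {n, j}) ` {..<n}"
    proof (cases "b = n")
      case True
      then show ?thesis using ab by auto
    next
      case False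
      then have "e \<in> edges {..<n}" using ab by (auto simp: edges_def)
      then show ?thesis ..
    qed
  qed (auto simp: edges_def less_Suc_eq)
  moreover have "edges {..<n} \<inter> (\<lambda>j. {n, j}) ` {..<n} = {}" by (auto simp: edges_def)
  moreover have "inj_on (\<lambda>j. {n, j}) {..<n}" by (auto simp: inj_on_def doubleton_eq_iff)
  ultimately have "(\<Sum>e\<in>edges {..<Suc n}. ke G u e) = (\<Sum>e\<in>edges {..<n}. ke G u e) + (\<Sum>j<n. ke G u {n, j})"
    by (simp add: sum.union_disjoint finite_edges sum.reindex)
  also have "(\<Sum>j<n. ke G u {n, j}) = (\<Sum>j<n. G (u n) (u j))"
    by (intro sum.cong refl ke_pair[OF sym]) auto
  finally show ?case using qf_insert[of "{..<n}" n G u] sym Suc by (simp add: lessThan_Suc)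
qed

text \<open>The characteristic function at \<theta> of h times a centred Bernoulli variable with mean w.\<close>

definition psi :: "real => real => real => complex" where
  "psi \<theta> w h = of_real w * iexp (\<theta> * ((1 - w) * h)) + of_real (1 - w) * iexp (- (\<theta> * (w * h)))"

lemma iexp_taylor2: "cmod (iexp x - (1 + \<i> * x - x\<^sup>2 / 2)) \<le> \<bar>x\<bar> ^ 3 / 6"
  using iexp_approx1[of x 2] by (simp add: eval_nat_numeral power_mult_distrib)

lemma norm_psi: "0 \<le> w ==> w \<le> 1 ==> cmod (psi \<theta> w h) \<le> 1"
proof -
  assume w: "0 \<le> w" "w \<le> 1"
  have "cmod (psi \<theta> w h) \<le> cmod (of_real w * iexp (\<theta> * ((1 - w) * h))) + cmod (of_real (1 - w) * iexp (- (\<theta> * (w * h))))"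
    unfolding psi_def by (rule norm_triangle_ineq)
  also have "\<dots> = w + (1 - w)" unfolding norm_mult norm_exp_i_times norm_of_real using w by simp
  finally show ?thesis by simp
qed

text \<open>The centred variable has variance q = w (1-w) h^2. Its characteristic function and that
  of a Gaussian with the same variance both equal 1 - \<theta>^2 q / 2 up to errors of third and
  fourth order.\<close>

lemma psi_gauss:
  assumes w: "0 \<le> w" "w \<le> 1" and h: "0 \<le> h" "h \<le> 1"
  shows "cmod (psi \<theta> w h - of_real (exp (- (\<theta>^2 * (w * (1 - w) * h^2) / 2)))) \<le> \<bar>\<theta>\<bar> ^ 3 + \<theta> ^ 4"
proof -
  define a b q where "a = \<theta> * ((1 - w) * h)" and "b = - (\<theta> * (w * h))" and "q = w * (1 - w) * h^2"
  have h2: "h^2 \<le> 1" "0 \<le> h^2" using h by (auto simp: power_le_one)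
  have q: "0 \<le> q" "q \<le> 1" unfolding q_def using w h2 by (auto intro!: mult_le_one mult_nonneg_nonneg)
  have r1: "w * a + (1 - w) * b = 0" and r2: "w * a^2 + (1 - w) * b^2 = \<theta>^2 * q"
    unfolding a_def b_def q_def by (simp_all add: algebra_simps power2_eq_square)
  have "psi \<theta> w h - (1 - of_real (\<theta>^2 * q / 2)) =
      of_real w * (iexp a - (1 + \<i> * a - a\<^sup>2 / 2)) + of_real (1 - w) * (iexp b - (1 + \<i> * b - b\<^sup>2 / 2))
      + \<i> * of_real (w * a + (1 - w) * b) - of_real (w * a^2 + (1 - w) * b^2 - \<theta>\<^sup>2 * q) / 2"
    unfolding psi_def a_def[symmetric] b_def[symmetric] by (simp add: algebra_simps diff_divide_distrib add_divide_distrib)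
  then have "psi \<theta> w h - (1 - of_real (\<theta>^2 * q / 2)) =
      of_real w * (iexp a - (1 + \<i> * a - a\<^sup>2 / 2)) + of_real (1 - w) * (iexp b - (1 + \<i> * b - b\<^sup>2 / 2))"
    unfolding r1 r2 by simp
  then have "cmod (psi \<theta> w h - (1 - of_real (\<theta>^2 * q / 2))) \<le> cmod (of_real w * (iexp a - (1 + \<i> * a - a\<^sup>2 / 2))) + cmod (of_real (1 - w) * (iexp b - (1 + \<i> * b - b\<^sup>2 / 2)))"
    using norm_triangle_ineq by simp
  also have "\<dots> \<le> w * (\<bar>\<theta>\<bar> ^ 3 / 6) + (1 - w) * (\<bar>\<theta>\<bar> ^ 3 / 6)"
  proof -
    have ab: "\<bar>a\<bar> \<le> \<bar>\<theta>\<bar>" "\<bar>b\<bar> \<le> \<bar>\<theta>\<bar>" unfolding a_def b_def using w h by (auto simp: abs_mult intro!: mult_left_le mult_le_one)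
    have "cmod (iexp x - (1 + \<i> * x - x\<^sup>2 / 2)) \<le> \<bar>\<theta>\<bar> ^ 3 / 6" if "\<bar>x\<bar> \<le> \<bar>\<theta>\<bar>" for x
      by (rule order_trans[OF iexp_taylor2]) (use power_mono[OF that, of 3] in simp)
    from this[OF ab(1)] this[OF ab(2)] show ?thesis unfolding norm_mult norm_of_real using w by (intro add_mono mult_mono) auto
  qed
  also have "\<dots> = \<bar>\<theta>\<bar> ^ 3 / 6" by (simp add: field_simps)
  finally have 1: "cmod (psi \<theta> w h - (1 - of_real (\<theta>^2 * q / 2))) \<le> \<bar>\<theta>\<bar> ^ 3 / 6" .
  define x where "x = \<theta>^2 * q / 2"
  have x: "0 \<le> x" "x \<le> \<theta>^2 / 2" unfolding x_def using q by (auto simp: mult_left_le)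
  have lo: "1 - x \<le> exp (- x)" using exp_ge_add_one_self[of "- x"] by simp
  \<comment> \<open>For x at most 1 this comes from exp (-x) at most 1/(1+x); beyond 1 the right
    side already exceeds 1.\<close>
  have up: "exp (- x) \<le> 1 - x + x^2"
  proof (cases "x \<le> 1")
    case True
    have "1 + x \<le> exp x" by (rule exp_ge_add_one_self)
    then have "exp (- x) \<le> 1 / (1 + x)" using x by (simp add: exp_minus field_simps)
    also have "\<dots> \<le> 1 - x + x^2" using x by (simp add: field_simps power2_eq_square)
    finally show ?thesis .
  next
    case False
    have "x * 1 \<le> x * x" by (rule mult_left_mono) (use False in auto)
    moreover have "exp (- x) \<le> 1" using x by simp
    ultimately show ?thesis unfolding power2_eq_square by linarith
  qed
  have "x^2 \<le> (\<theta>^2 / 2)^2" using x by (rule power_mono[rotated])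
  also have "\<dots> \<le> \<theta> ^ 4" by (simp add: power_divide)
  finally have "\<bar>(1 - x) - exp (- x)\<bar> \<le> \<theta> ^ 4" using lo up by linarith
  then have 2: "cmod ((1 - of_real x) - of_real (exp (- x))) \<le> \<theta> ^ 4"
    by (metis norm_of_real of_real_diff of_real_1)
  have "psi \<theta> w h - of_real (exp (- x)) = (psi \<theta> w h - (1 - of_real x)) + ((1 - of_real x) - of_real (exp (- x)))" by simp
  then have "cmod (psi \<theta> w h - of_real (exp (- x))) \<le> \<bar>\<theta>\<bar> ^ 3 / 6 + \<theta> ^ 4"
    using order_trans[OF norm_triangle_ineq add_mono[OF 1[folded x_def] 2]] by simp
  moreover have "0 \<le> \<bar>\<theta>\<bar> ^ 3" by simp
  ultimately show ?thesis unfolding x_def q_def by linarith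
qed

lemma prod_iexp: "finite E ==> (\<Prod>e\<in>E. iexp (c e)) = iexp (\<Sum>e\<in>E. c e)"
  by (simp add: exp_sum sum_distrib_left)

lemma psi_integral:
  fixes \<theta> w h :: real
  assumes w: "0 \<le> w" "w \<le> 1"
  defines "f \<equiv> \<lambda>y. iexp (\<theta> * (((if y < w then 1 else 0) - w) * h))"
  shows "integrable unif f" "(LINT y|unif. f y) = psi \<theta> w h"
proof -
  define a b where "a = iexp (\<theta> * ((1 - w) * h))" and "b = iexp (- (\<theta> * (w * h)))"
  have eq: "f = (\<lambda>y. b + complex_of_real (if y < w then 1 else 0) * (a - b))"
    unfolding f_def a_def b_def by (auto simp: fun_eq_iff)
  have "U.bm1 (\<lambda>y. if y < w then 1 else 0 :: real)" unfolding U.bm1_def by (auto intro!: exI[of _ 1])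
  then have i: "integrable unif (\<lambda>y. complex_of_real (if y < w then 1 else 0))"
    by (intro integrable_of_real U.bm1_integrable)
  show "integrable unif f" unfolding eq
    by (intro Bochner_Integration.integrable_add integrable_mult_left U.integrable_const i)
  have "(LINT y|unif. f y) = b + complex_of_real (LINT y|unif. (if y < w then 1 else 0)) * (a - b)"
    unfolding eq using i by (simp add: U.prob_space del: of_real_eq_0_iff)
  then show "(LINT y|unif. f y) = psi \<theta> w h"
    unfolding unif_less_integral[OF w] psi_def a_def b_def by (simp add: algebra_simps)
qed

lemma exp_minus_lipschitz: "0 \<le> x ==> 0 \<le> y ==> \<bar>exp (- x) - exp (- y)\<bar> \<le> \<bar>x - y\<bar>" for x y :: real
proof -
  have *: "exp (- x) - exp (- y) \<le> y - x" if "0 \<le> x" "x \<le> y" for x y :: real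
  proof -
    have "exp (- x) - exp (- y) = exp (- x) * (1 - exp (- (y - x)))" by (simp add: right_diff_distrib exp_add[symmetric])
    also have "\<dots> \<le> 1 * (y - x)"
    proof (rule mult_mono)
      show "1 - exp (- (y - x)) \<le> y - x" using exp_ge_add_one_self[of "- (y - x)"] by linarith
    qed (use that in auto)
    finally show ?thesis by simp
  qed
  assume "0 \<le> x" "0 \<le> y"
  then show ?thesis using *[of x y] *[of y x] by (cases "x \<le> y") auto
qed

text \<open>The approximation error d N is uniform in n > 0, so N can be fixed first and n sent to
  infinity afterwards.\<close>

lemma double_limit:
  fixes x :: "nat => complex"
  assumes b: "\<And>N n. n > 0 ==> cmod (x n - y N n) \<le> d N" and d: "d \<longlonglongrightarrow> 0"
    and y: "\<And>N. y N \<longlonglongrightarrow> p N" and p: "(\<lambda>N. c * p N) \<longlonglongrightarrow> L"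
  shows "(\<lambda>n. c * x n) \<longlonglongrightarrow> L"
proof (rule LIMSEQ_I)
  fix \<epsilon> :: real assume e: "0 < \<epsilon>"
  have "(\<lambda>N. cmod c * d N) \<longlonglongrightarrow> cmod c * 0" by (intro tendsto_mult tendsto_const d)
  then have "\<forall>\<^sub>F N in sequentially. cmod c * d N < \<epsilon> / 3" by (rule order_tendstoD) (use e in simp)
  moreover have "\<forall>\<^sub>F N in sequentially. cmod (c * p N - L) < \<epsilon> / 3"
    using p e by (auto simp: tendsto_iff dist_norm elim: allE[of _ "\<epsilon> / 3"])
  ultimately have "\<forall>\<^sub>F N in sequentially. cmod c * d N < \<epsilon> / 3 \<and> cmod (c * p N - L) < \<epsilon> / 3" by eventually_elim simp
  then obtain N where N: "cmod c * d N < \<epsilon> / 3" "cmod (c * p N - L) < \<epsilon> / 3"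
    unfolding eventually_sequentially by auto
  have "(\<lambda>n. c * y N n) \<longlonglongrightarrow> c * p N" by (intro tendsto_mult tendsto_const y)
  then obtain n0 where n0: "\<And>n. n \<ge> n0 ==> cmod (c * y N n - c * p N) < \<epsilon> / 3"
    using LIMSEQ_D[of "\<lambda>n. c * y N n" "c * p N" "\<epsilon> / 3"] e by auto
  show "\<exists>n0. \<forall>n\<ge>n0. cmod (c * x n - L) < \<epsilon>"
  proof (intro exI allI impI)
    fix n assume n: "Suc n0 \<le> n"
    have "cmod (c * x n - c * y N n) = cmod c * cmod (x n - y N n)" by (simp add: norm_mult[symmetric] right_diff_distrib)
    also have "\<dots> \<le> cmod c * d N" using b[of n N] n by (intro mult_left_mono) auto
    finally have 1: "cmod (c * x n - c * y N n) < \<epsilon> / 3" using N by simp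
    have "c * x n - L = (c * x n - c * y N n) + (c * y N n - c * p N) + (c * p N - L)" by simp
    then have "cmod (c * x n - L) \<le> cmod (c * x n - c * y N n) + cmod (c * y N n - c * p N) + cmod (c * p N - L)"
      by (metis norm_triangle_le norm_triangle_ineq add_right_mono)
    then show "cmod (c * x n - L) < \<epsilon>" using 1 N(2) n0[of n] n by simp
  qed
qed

section \<open>The second-order term: edge noise given the types, and a form in the types\<close>

context good_graphon
begin

lemma bm2_h2: "U.bm2 h2"
proof -
  have "bmf {0, 1} (hP {0, 1})" by (rule bmf_hP) (use r2 in auto)
  from bm2_bmf[OF this] show ?thesis by (simp add: hP_pair)
qed

lemma VW_fun: "VW r W = (\<lambda>x y. W x y * h2 x y)" by (intro ext) (rule VW_eq)

lemma bm2_VW: "U.bm2 (VW r W)" unfolding VW_fun by (rule U.bm2_mult[OF bm2_W bm2_h2])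

lemma VW_sym: "VW r W x y = VW r W y x" unfolding VW_fun using Wsym h2_sym by metis

text \<open>The tower property from two vertices to one. The coordinates integrated out are one type
  and one edge variable; the latter turns the edge indicator into W.\<close>

lemma integral_VW: "(LINT y|unif. VW r W x y) = t1 r W x"
proof -
  define e K where "e = {0, 1::nat}" and "K = crd {0, 1} - crd {0}"
  have c0: "crd {0} = {Inl 0}" by (simp add: crd_def edges_small)
  have eie: "ei e = Inr (0, 1)" by (simp add: ei_def e_def)
  have e1: "{e} \<subseteq> edges UNIV" by (simp add: e_def edges_def)
  have K: "K = Inl ` {1} \<union> ei ` {e}"
  proof -
    have "{0, 1} - {0} = {1::nat}" by auto
    then show ?thesis unfolding K_def e_def using crd_diff[of "{0}" "{0, 1}"] by (simp add: edges_doubleton edges_small)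
  qed
  define F where "F y = B {0, 1} (merge (crd {0}) K (\<lambda>_. x, y))" for y
  have "crd {0} \<union> K = crd {0, 1}" unfolding K_def using crd_mono[of "{0}" "{0, 1}"] by auto
  then have bF: "bmf K F" unfolding F_def using bmf_section[of "crd {0}" K "B {0, 1}"] bmf_B[of "{0, 1}"] r2 by simp
  have Fj: "F (jn {1} {e} u w) = (if w e < W x (u 1) then 1 else 0) * h2 x (u 1)" for u w
  proof -
    define M where "M = merge (crd {0}) K (\<lambda>_. x, jn {1} {e} u w)"
    have M: "M (Inl 0) = x" "M (Inl 1) = u 1" "M (ei e) = w e"
      unfolding M_def merge_def c0 K eie by (simp_all add: jn_def eie) (simp add: e_def)
    have "F (jn {1} {e} u w) = ind M e * h2 (M (Inl 0)) (M (Inl 1))"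
      unfolding F_def using B_pair[of 0 1 M] by (simp add: M_def e_def)
    also have "ind M e = (if w e < W x (u 1) then 1 else 0)"
      unfolding ind_def M(3) unfolding e_def using we_pair[of 0 1] M by simp
    finally show ?thesis unfolding M .
  qed
  have "t1 r W x = (LINT y|UP K. F y)"
    using tower_B[of "{0, 1}" "{0}" "\<lambda>_. x"] r2 by (simp add: B_single F_def K_def)
  also have "\<dots> = (LINT u|UP {1}. (LINT w|UP {e}. F (jn {1} {e} u w)))"
    unfolding K by (rule vertex_edge_fold[OF _ _ e1]) (use bmf_integrable[OF bF] K in auto)
  also have "\<dots> = (LINT u|UP {1::nat}. VW r W x (u 1))"
  proof (intro Bochner_Integration.integral_cong refl)
    fix u :: "nat => real"
    have b: "U.bm1 (\<lambda>y. if y < W x (u 1) then 1 else 0 :: real)" unfolding U.bm1_def by (auto intro!: exI[of _ 1])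
    show "(LINT w|UP {e}. F (jn {1} {e} u w)) = VW r W x (u 1)"
      unfolding Fj VW_fun using integral_component[OF b, of e "{e}"] unif_less_integral[OF W0 W1] by simp
  qed
  also have "\<dots> = (LINT y|unif. VW r W x y)" by (rule integral_component[OF U.bm2_sec1[OF bm2_VW]]) simp
  finally show ?thesis ..
qed

lemma degenerate_2: "Kregular r W ==> degenerate 2"
  unfolding degenerate_def
proof (intro allI impI)
  fix Q :: "nat set" assume K: "Kregular r W" and Q: "finite Q \<and> card Q < 2"
  then consider "Q = {}" | i where "Q = {i}" by (cases "card Q") (auto simp: card_1_singleton_iff)
  then show "AE x in UP (crd Q). B Q x = tt"
  proof cases
    case 1
    then show ?thesis by (simp add: B_empty)
  next
    case 2
    have "AE x in UP (crd {i}). t1 r W (x (Inl i)) = tt"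
      by (rule AE_PiM_component[OF prob_unif]) (use K in \<open>auto simp: crd_Inl Kregular_def tt_def\<close>)
    then show ?thesis unfolding 2 B_single .
  qed
qed

lemma Y_2_jn: "Y 2 n (jn {..<n} (edges {..<n}) u w) = (\<Sum>e\<in>edges {..<n}. (if w e < we u e then 1 else 0) * ke h2 u e - tt)"
  unfolding Y_def Sub_2
proof (intro sum.cong refl)
  fix e assume e: "e \<in> edges {..<n}"
  define M where "M = jn {..<n} (edges {..<n}) u w"
  obtain a b where ab: "e = {a, b}" "a \<in> {..<n}" "b \<in> {..<n}" "a < b" "Min e = a" "Max e = b" using e by (rule edgesE) blast
  have M1: "M (Inl i) = u i" if "i \<in> {..<n}" for i unfolding M_def jn_def using that by simp
  have "ei e \<in> ei ` edges {..<n}" using e by simp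
  then have M2: "M (ei e) = w e" unfolding M_def jn_def using ei_set[OF e] by (simp add: ei_def)
  have "we (\<lambda>i. M (Inl i)) e = we u e" by (rule we_cong[OF e M1])
  moreover have "B e M = ind M e * h2 (M (Inl a)) (M (Inl b))" using B_pair[of a b M] ab by simp
  ultimately show "B e M - tt = (if w e < we u e then 1 else 0) * ke h2 u e - tt"
    unfolding ind_def M2 ke_def using M1 ab by simp
qed

text \<open>Each edge indicator is its mean W plus a centred Bernoulli variable. The means
  reassemble into V - t; the centred parts are independent given the types and contribute one factor
  \<open>psi\<close> per edge.\<close>

lemma edge_fold_char:
  "(LINT \<omega>|GP n. iexp (\<theta> * Y 2 n \<omega>)) =
   (LINT u|UP {..<n}. iexp (\<theta> * (\<Sum>e\<in>edges {..<n}. ke (VW r W) u e - tt)) * (\<Prod>e\<in>edges {..<n}. psi \<theta> (we u e) (ke h2 u e)))"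
proof -
  let ?E = "edges {..<n}"
  interpret product_sigma_finite "\<lambda>_ :: nat set. unif" by (rule psf_unif)
  interpret P: prob_space "GP n" by (rule prob_UP)
  have fE: "finite ?E" by (simp add: finite_edges)
  have "(\<lambda>\<omega>. iexp (\<theta> * Y 2 n \<omega>)) \<in> borel_measurable (GP n)" by (rule iexp_measurable[OF bmf_measurable[OF bmf_Y[OF r2]]])
  then have i: "integrable (GP n) (\<lambda>\<omega>. iexp (\<theta> * Y 2 n \<omega>))"
    by (rule P.integrable_const_bound[where B=1, rotated]) simp
  have "(LINT \<omega>|GP n. iexp (\<theta> * Y 2 n \<omega>)) = (LINT u|UP {..<n}. (LINT w|UP ?E. iexp (\<theta> * Y 2 n (jn {..<n} ?E u w))))"
    unfolding crd_def by (rule vertex_edge_fold[OF finite_lessThan fE _ i[unfolded crd_def]]) (auto simp: edges_def)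
  also have "\<dots> = (LINT u|UP {..<n}. iexp (\<theta> * (\<Sum>e\<in>?E. ke (VW r W) u e - tt)) * (\<Prod>e\<in>?E. psi \<theta> (we u e) (ke h2 u e)))"
  proof (intro Bochner_Integration.integral_cong refl)
    fix u :: "nat => real"
    define f where "f e y = iexp (\<theta> * (((if y < we u e then 1 else 0) - we u e) * ke h2 u e))" for e and y :: real
    have f: "integrable unif (f e)" "(LINT y|unif. f e y) = psi \<theta> (we u e) (ke h2 u e)" for e
      unfolding f_def using psi_integral[OF we01] by auto
    have "iexp (\<theta> * Y 2 n (jn {..<n} ?E u w)) = iexp (\<theta> * (\<Sum>e\<in>?E. ke (VW r W) u e - tt)) * (\<Prod>e\<in>?E. f e (w e))" for w
    proof -
      have "\<theta> * Y 2 n (jn {..<n} ?E u w) = \<theta> * (\<Sum>e\<in>?E. ke (VW r W) u e - tt)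
          + (\<Sum>e\<in>?E. \<theta> * (((if w e < we u e then 1 else 0) - we u e) * ke h2 u e))"
        unfolding Y_2_jn sum_distrib_left[symmetric] distrib_left[symmetric] sum.distrib[symmetric]
        by (intro arg_cong[where f="(*) \<theta>"] sum.cong refl) (simp add: ke_def VW_fun we_def algebra_simps)
      then show ?thesis unfolding f_def prod_iexp[OF fE] by (simp only: of_real_add distrib_left exp_add)
    qed
    then have "(LINT w|UP ?E. iexp (\<theta> * Y 2 n (jn {..<n} ?E u w))) = iexp (\<theta> * (\<Sum>e\<in>?E. ke (VW r W) u e - tt)) * (LINT w|UP ?E. (\<Prod>e\<in>?E. f e (w e)))"
      by (simp only: integral_mult_right_zero)
    also have "(LINT w|UP ?E. (\<Prod>e\<in>?E. f e (w e))) = (\<Prod>e\<in>?E. psi \<theta> (we u e) (ke h2 u e))"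
      using product_integral_prod[OF fE, of f] f by simp
    finally show "(LINT w|UP ?E. iexp (\<theta> * Y 2 n (jn {..<n} ?E u w))) = iexp (\<theta> * (\<Sum>e\<in>?E. ke (VW r W) u e - tt)) * (\<Prod>e\<in>?E. psi \<theta> (we u e) (ke h2 u e))" .
  qed
  finally show ?thesis .
qed

text \<open>The conditional variance, given the two types, of the edge indicator times
  \<open>h2\<close>.\<close>

definition qW :: "real => real => real" where "qW x y = W x y * (1 - W x y) * (h2 x y)^2"

definition vW :: real where "vW = (LINT x|unif. (LINT y|unif. qW x y))"

lemma bm2_qW: "U.bm2 qW"
proof -
  have "qW = (\<lambda>x y. W x y * (1 - W x y) * (h2 x y)^2)" by (intro ext) (rule qW_def)
  then show ?thesis using U.bm2_mult[OF U.bm2_mult[OF bm2_W U.bm2_diff[OF U.bm2_const[of 1] bm2_W]] U.bm2_power2[OF bm2_h2]] by simp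
qed

lemma qW_sym: "qW x y = qW y x" unfolding qW_def using Wsym[of x y] h2_sym[of x y] by simp

lemma qW01: "0 \<le> qW x y" "qW x y \<le> 1"
proof -
  have "(h2 x y)^2 \<le> 1" using h2_01[of x y] by (simp add: power_le_one)
  then show "0 \<le> qW x y" "qW x y \<le> 1"
    unfolding qW_def using W0[of x y] W1[of x y] by (auto intro!: mult_le_one mult_nonneg_nonneg)
qed

lemma vW_nonneg: "0 \<le> vW" unfolding vW_def using qW01 by simp

text \<open>The two densities are the means of W h2^2 and W^2 h2^2, and their difference is the mean
  of \<open>qW\<close>. This identifies the variance in the statement with that of the edge
  noise.\<close>

lemma sigma_rW_variance: "sigma_rW r W = sqrt (vW / (2 * (fact (r - 2))^2))"
proof -
  have z: "{..<2::nat} = {0, 1}" by auto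
  have e: "edges {0, 1::nat} = {{0, 1}}" by (rule edges_doubleton) simp
  define G where "G m x y = W x y ^ m * (h2 x y)^2" for m :: nat and x y
  have "U.bm2 (\<lambda>x y. W x y ^ m)" for m by (induction m) (use U.bm2_const U.bm2_mult[OF bm2_W] in auto)
  moreover have "G m = (\<lambda>x y. W x y ^ m * (h2 x y)^2)" for m by (intro ext) (rule G_def)
  ultimately have bG: "U.bm2 (G m)" for m using U.bm2_mult[OF _ U.bm2_power2[OF bm2_h2]] by simp
  have d: "(LINT u|UP {..<2}. (\<Prod>e\<in>edges {..<2}. we u e ^ m) * (hP {..<2} u)^2) = (LINT u|UP {0, 1::nat}. G m (u 0) (u 1))" for m
    unfolding z e G_def using we_pair[of 0 1] hP_pair[of 0 1] by simp
  have "tdens W (2 * r - 2) (Kr_ominus r 2) = (LINT u|UP {..<2}. (\<Prod>e\<in>edges {..<2}. we u e ^ 1) * (hP {..<2} u)^2)"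
    by (rule two_copies_density[OF r2]) (use r2 in \<open>auto simp: Kr_ominus_def two_copies_mult_def in_copy2_def\<close>)
  moreover have "tdens W (2 * r - 2) (Kr_oplus2 r) = (LINT u|UP {..<2}. (\<Prod>e\<in>edges {..<2}. we u e ^ 2) * (hP {..<2} u)^2)"
    by (rule two_copies_density[OF r2]) (use r2 in \<open>auto simp: Kr_oplus2_def two_copies_mult_def in_copy2_def\<close>)
  ultimately have "tdens W (2 * r - 2) (Kr_ominus r 2) - tdens W (2 * r - 2) (Kr_oplus2 r)
      = (LINT u|UP {0, 1::nat}. G 1 (u 0) (u 1)) - (LINT u|UP {0, 1::nat}. G 2 (u 0) (u 1))" unfolding d by simp
  also have "\<dots> = (LINT u|UP {0, 1::nat}. G 1 (u 0) (u 1) - G 2 (u 0) (u 1))"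
    by (rule Bochner_Integration.integral_diff[symmetric]) (auto intro!: bmf_integrable bmf_component2[OF bG])
  also have "\<dots> = (LINT u|UP {0, 1::nat}. qW (u 0) (u 1))"
    by (intro Bochner_Integration.integral_cong refl) (simp add: G_def qW_def algebra_simps power2_eq_square)
  also have "\<dots> = vW" unfolding vW_def by (rule integral_component2[OF bm2_qW]) auto
  finally show ?thesis by (simp add: sigma_rW_def)
qed

text \<open>Given the types, the product of the \<open>psi\<close> factors is close to exp (-
  \<tau>^2 Q / 2) with Q the normalised sum of conditional variances. By \<open>ke_lln\<close> this
  Q tends to \<open>vW / 2\<close> in L1, so the noise becomes a constant factor in front of the
  characteristic function of the type part.\<close>

lemma edge_noise_limit:
  "(\<lambda>n. (LINT \<omega>|GP n. iexp (\<tau> * (Y 2 n \<omega> / real n)))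
     - complex_of_real (exp (- (\<tau>^2 * vW / 4))) * (LINT u|UP {..<n}. iexp (\<tau> / real n * qf (\<lambda>x y. VW r W x y - tt) {..<n} u))) \<longlonglongrightarrow> 0"
  (is "(\<lambda>n. ?D n) \<longlonglongrightarrow> 0")
proof -
  define err where "err n = (LINT u|UP {..<n}. \<bar>(\<Sum>e\<in>edges {..<n}. ke qW u e) / (real n)^2 - vW / 2\<bar>)" for n
  have err: "err \<longlonglongrightarrow> 0" unfolding err_def vW_def by (rule ke_lln[OF bm2_qW qW_sym qW01])
  have bound: "cmod (?D n) \<le> \<bar>\<tau>\<bar> ^ 3 / real n + \<tau> ^ 4 / (real n)^2 + \<tau>^2 / 2 * err n" if n: "n > 0" for n
  proof -
    let ?E = "edges {..<n}"
    interpret prob_space "UP {..<n}" by (rule prob_UP)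
    define \<theta> where "\<theta> = \<tau> / real n"
    define S where "S u = (\<Sum>e\<in>?E. ke (VW r W) u e - tt)" for u
    define Q where "Q u = (\<Sum>e\<in>?E. ke qW u e) / (real n)^2" for u
    define Ps where "Ps u = (\<Prod>e\<in>?E. psi \<theta> (we u e) (ke h2 u e))" for u
    define g where "g = exp (- (\<tau>^2 * vW / 4))"
    have g: "0 \<le> g" "g \<le> 1" unfolding g_def using vW_nonneg by auto
    have Sqf: "S u = qf (\<lambda>x y. VW r W x y - tt) {..<n} u" for u
      unfolding S_def using sum_ke_qf[of "\<lambda>x y. VW r W x y - tt" u n] VW_sym by (simp add: ke_def)
    have bS: "bmf {..<n} S" unfolding S_def by (intro bmf_sum bmf_diff bmf_ke[OF bm2_VW] bmf_const) auto
    have bQ0: "bmf {..<n} (\<lambda>u. \<Sum>e\<in>?E. ke qW u e)" by (intro bmf_sum bmf_ke[OF bm2_qW]) auto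
    have iQ: "integrable (UP {..<n}) (\<lambda>u. \<bar>Q u - vW / 2\<bar>)"
      unfolding Q_def by (intro integrable_abs Bochner_Integration.integrable_diff integrable_divide bmf_integrable[OF bQ0] integrable_const)
    have im: "(\<lambda>u. iexp (\<theta> * S u)) \<in> borel_measurable (UP {..<n})" by (rule iexp_measurable[OF bmf_measurable[OF bS]])
    have Pm: "Ps \<in> borel_measurable (UP {..<n})" unfolding Ps_def
    proof (rule borel_measurable_prod)
      fix e assume e: "e \<in> ?E"
      have [measurable]: "(\<lambda>u. we u e) \<in> borel_measurable (UP {..<n})" "(\<lambda>u. ke h2 u e) \<in> borel_measurable (UP {..<n})"
        by (rule bmf_measurable[OF bmf_we[OF e]]) (rule bmf_measurable[OF bmf_ke[OF bm2_h2 e]], simp)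
      show "(\<lambda>u. psi \<theta> (we u e) (ke h2 u e)) \<in> borel_measurable (UP {..<n})" unfolding psi_def by measurable
    qed
    have nP: "cmod (Ps u) \<le> 1" for u unfolding Ps_def prod_norm[symmetric]
      by (intro prod_le_1) (auto intro: norm_psi we01)
    have i1: "integrable (UP {..<n}) (\<lambda>u. iexp (\<theta> * S u) * Ps u)"
      by (rule integrable_const_bound[where B=1]) (use im Pm nP in \<open>auto simp: norm_mult\<close>)
    have i2: "integrable (UP {..<n}) (\<lambda>u. complex_of_real g * iexp (\<theta> * S u))"
      by (rule integrable_const_bound[where B=1]) (use im g in \<open>auto simp: norm_mult\<close>)
    have pw: "cmod (Ps u - complex_of_real g) \<le> \<bar>\<tau>\<bar> ^ 3 / real n + \<tau> ^ 4 / (real n)^2 + \<tau>^2 / 2 * \<bar>Q u - vW / 2\<bar>" for u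
    proof -
      \<comment> \<open>The Gaussian factor with the variance of the edge e. Comparing products
        factor by factor adds up at most n^2 errors of order n^(-3).\<close>
      define z where "z e = exp (- (\<theta>^2 * ke qW u e / 2))" for e
      have q0: "0 \<le> ke qW u e" for e unfolding ke_def by (rule qW01)
      have "cmod (Ps u - (\<Prod>e\<in>?E. complex_of_real (z e))) \<le> (\<Sum>e\<in>?E. cmod (psi \<theta> (we u e) (ke h2 u e) - complex_of_real (z e)))"
        unfolding Ps_def by (rule norm_prod_diff) (use q0 in \<open>auto intro: norm_psi we01 simp: z_def\<close>)
      also have "\<dots> \<le> (\<Sum>e\<in>?E. \<bar>\<theta>\<bar> ^ 3 + \<theta> ^ 4)"
      proof (rule sum_mono)
        fix e
        have "ke qW u e = we u e * (1 - we u e) * (ke h2 u e)^2" by (simp add: ke_def qW_def we_def)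
        moreover have "0 \<le> ke h2 u e" "ke h2 u e \<le> 1" unfolding ke_def by (rule h2_01)+
        ultimately show "cmod (psi \<theta> (we u e) (ke h2 u e) - complex_of_real (z e)) \<le> \<bar>\<theta>\<bar> ^ 3 + \<theta> ^ 4"
          unfolding z_def using psi_gauss[OF we01] by simp
      qed
      also have "\<dots> \<le> (real n)^2 * (\<bar>\<theta>\<bar> ^ 3 + \<theta> ^ 4)"
        using card_Sub_le[of 2 n] by (simp add: Sub_2 mult_right_mono)
      also have "\<dots> = \<bar>\<tau>\<bar> ^ 3 / real n + \<tau> ^ 4 / (real n)^2"
        unfolding \<theta>_def using n by (simp add: power_divide field_simps eval_nat_numeral)
      finally have 1: "cmod (Ps u - (\<Prod>e\<in>?E. complex_of_real (z e))) \<le> \<bar>\<tau>\<bar> ^ 3 / real n + \<tau> ^ 4 / (real n)^2" .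
      have "(\<Prod>e\<in>?E. z e) = exp (\<Sum>e\<in>?E. - (\<theta>^2 * ke qW u e / 2))" unfolding z_def by (simp add: exp_sum finite_edges)
      also have "(\<Sum>e\<in>?E. - (\<theta>^2 * ke qW u e / 2)) = - (\<tau>^2 / 2 * Q u)"
        unfolding Q_def \<theta>_def by (simp add: sum_negf sum_divide_distrib[symmetric] sum_distrib_left[symmetric] power_divide)
      finally have z: "(\<Prod>e\<in>?E. z e) = exp (- (\<tau>^2 / 2 * Q u))" .
      have Q0: "0 \<le> Q u" unfolding Q_def using q0 by (simp add: sum_nonneg)
      have "\<bar>exp (- (\<tau>^2 / 2 * Q u)) - g\<bar> \<le> \<bar>\<tau>^2 / 2 * Q u - \<tau>\<^sup>2 * vW / 4\<bar>"
        unfolding g_def by (rule exp_minus_lipschitz) (use Q0 vW_nonneg in auto)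
      also have "\<tau>^2 / 2 * Q u - \<tau>\<^sup>2 * vW / 4 = \<tau>^2 / 2 * (Q u - vW / 2)" by (simp add: algebra_simps)
      finally have "\<bar>(\<Prod>e\<in>?E. z e) - g\<bar> \<le> \<tau>^2 / 2 * \<bar>Q u - vW / 2\<bar>" unfolding z by (simp add: abs_mult)
      then have 2: "cmod ((\<Prod>e\<in>?E. complex_of_real (z e)) - complex_of_real g) \<le> \<tau>^2 / 2 * \<bar>Q u - vW / 2\<bar>"
        by (metis norm_of_real of_real_diff of_real_prod)
      have "Ps u - complex_of_real g = (Ps u - (\<Prod>e\<in>?E. complex_of_real (z e))) + ((\<Prod>e\<in>?E. complex_of_real (z e)) - complex_of_real g)" by simp
      then show ?thesis using order_trans[OF norm_triangle_ineq add_mono[OF 1 2]] by simp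
    qed
    have "(LINT \<omega>|GP n. iexp (\<tau> * (Y 2 n \<omega> / real n))) = (LINT u|UP {..<n}. iexp (\<theta> * S u) * Ps u)"
      using edge_fold_char[where \<theta>=\<theta> and n=n] unfolding S_def Ps_def \<theta>_def by simp
    moreover have "complex_of_real g * (LINT u|UP {..<n}. iexp (\<tau> / real n * qf (\<lambda>x y. VW r W x y - tt) {..<n} u)) = (LINT u|UP {..<n}. complex_of_real g * iexp (\<theta> * S u))"
      unfolding Sqf \<theta>_def by (simp only: integral_mult_right_zero)
    ultimately have "?D n = (LINT u|UP {..<n}. iexp (\<theta> * S u) * Ps u - complex_of_real g * iexp (\<theta> * S u))"
      unfolding g_def[symmetric] using Bochner_Integration.integral_diff[OF i1 i2] by simp
    also have "cmod \<dots> \<le> (LINT u|UP {..<n}. cmod (iexp (\<theta> * S u) * Ps u - complex_of_real g * iexp (\<theta> * S u)))" by (rule integral_norm_bound)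
    also have "\<dots> \<le> (LINT u|UP {..<n}. \<bar>\<tau>\<bar> ^ 3 / real n + \<tau> ^ 4 / (real n)^2 + \<tau>^2 / 2 * \<bar>Q u - vW / 2\<bar>)"
    proof (rule integral_mono)
      show "integrable (UP {..<n}) (\<lambda>u. cmod (iexp (\<theta> * S u) * Ps u - complex_of_real g * iexp (\<theta> * S u)))"
        by (intro integrable_norm Bochner_Integration.integrable_diff i1 i2)
      show "integrable (UP {..<n}) (\<lambda>u. \<bar>\<tau>\<bar> ^ 3 / real n + \<tau> ^ 4 / (real n)^2 + \<tau>^2 / 2 * \<bar>Q u - vW / 2\<bar>)"
        by (intro Bochner_Integration.integrable_add integrable_mult_right integrable_const iQ)
      fix u
      have "iexp (\<theta> * S u) * Ps u - complex_of_real g * iexp (\<theta> * S u) = iexp (\<theta> * S u) * (Ps u - complex_of_real g)" by (simp add: algebra_simps)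
      then show "cmod (iexp (\<theta> * S u) * Ps u - complex_of_real g * iexp (\<theta> * S u)) \<le> \<bar>\<tau>\<bar> ^ 3 / real n + \<tau> ^ 4 / (real n)^2 + \<tau>^2 / 2 * \<bar>Q u - vW / 2\<bar>"
        using pw[of u] by (simp only: norm_mult norm_exp_i_times mult_1)
    qed
    also have "\<dots> = \<bar>\<tau>\<bar> ^ 3 / real n + \<tau> ^ 4 / (real n)^2 + \<tau>^2 / 2 * err n"
      unfolding err_def Q_def[symmetric] using iQ by (simp add: prob_space)
    finally show ?thesis .
  qed
  have "(\<lambda>n. \<bar>\<tau>\<bar> ^ 3 / real n + \<tau> ^ 4 / (real n)^2 + \<tau>^2 / 2 * err n) \<longlonglongrightarrow> 0 + 0 + \<tau>^2 / 2 * 0"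
    by (intro tendsto_add tendsto_mult tendsto_const err real_tendsto_divide_at_top[OF tendsto_const]
      filterlim_real_sequentially filterlim_pow_at_top) simp
  then have lim: "(\<lambda>n. \<bar>\<tau>\<bar> ^ 3 / real n + \<tau> ^ 4 / (real n)^2 + \<tau>^2 / 2 * err n) \<longlonglongrightarrow> 0" by simp
  show ?thesis
    by (rule Lim_null_comparison[OF eventually_mono[OF eventually_gt_at_top[of 0] bound] lim])
qed


text \<open>A degenerate difference kernel contributes at most n times its L2 norm, and the scaling
  1/n cancels that factor. The bound is free of n, as \<open>double_limit\<close> requires.\<close>

lemma qf_char_diff:
  assumes K: "U.bm2 K" "\<And>x y. K x y = K y x" and L: "U.bm2 L" "\<And>x y. L x y = L y x"
    and z: "AE x in unif. (LINT y|unif. K x y - L x y) = 0" and n: "n > 0"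
  shows "cmod ((LINT u|UP {..<n}. iexp (\<tau> / real n * qf K {..<n} u)) - (LINT u|UP {..<n}. iexp (\<tau> / real n * qf L {..<n} u)))
     \<le> \<bar>\<tau>\<bar> * sqrt (LINT x|unif. (LINT y|unif. (K x y - L x y)^2))"
proof -
  interpret prob_space "UP {..<n}" by (rule prob_UP)
  define R where "R = (\<lambda>x y. K x y - L x y)"
  have bR: "U.bm2 R" unfolding R_def by (rule U.bm2_diff[OF K(1) L(1)])
  have Rs: "R x y = R y x" for x y unfolding R_def using K(2)[of x y] L(2)[of x y] by simp
  have b: "bmf {..<n} (\<lambda>u. \<Sum>e\<in>edges {..<n}. ke G u e)" if "U.bm2 G" for G by (intro bmf_sum bmf_ke[OF that]) auto
  have iK: "integrable (UP {..<n}) (qf K {..<n})" and iL: "integrable (UP {..<n}) (qf L {..<n})"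
    using bmf_integrable[OF b[OF K(1)]] bmf_integrable[OF b[OF L(1)]] unfolding sum_ke_qf[OF K(2)] sum_ke_qf[OF L(2)] by auto
  have d: "qf K {..<n} u - qf L {..<n} u = (\<Sum>e\<in>edges {..<n}. ke R u e)" for u
    unfolding sum_ke_qf[OF K(2), symmetric] sum_ke_qf[OF L(2), symmetric] by (simp add: ke_def R_def sum_subtractf)
  have "cmod ((LINT u|UP {..<n}. iexp (\<tau> / real n * qf K {..<n} u)) - (LINT u|UP {..<n}. iexp (\<tau> / real n * qf L {..<n} u)))
     \<le> (LINT u|UP {..<n}. \<bar>\<tau> / real n * qf K {..<n} u - \<tau> / real n * qf L {..<n} u\<bar>)"
    by (rule char_diff_le) (intro borel_measurable_times borel_measurable_const borel_measurable_integrable[OF iK] borel_measurable_integrable[OF iL]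
      integrable_abs Bochner_Integration.integrable_diff integrable_mult_right impI iK iL)+
  also have "\<dots> = \<bar>\<tau>\<bar> / n * (LINT u|UP {..<n}. \<bar>\<Sum>e\<in>edges {..<n}. ke R u e\<bar>)"
    unfolding right_diff_distrib[symmetric] d abs_mult by simp
  also have "\<dots> \<le> \<bar>\<tau>\<bar> / n * sqrt ((real n)^2 * (LINT x|unif. (LINT y|unif. (R x y)^2)))"
  proof (rule mult_left_mono)
    have "AE x in unif. (LINT y|unif. R x y) = 0" using z unfolding R_def .
    from real_sqrt_le_mono[OF ke_L2_degenerate[OF bR Rs this, of n]] bmf_L1_le_L2[OF b[OF bR]]
    show "(LINT u|UP {..<n}. \<bar>\<Sum>e\<in>edges {..<n}. ke R u e\<bar>) \<le> sqrt ((real n)^2 * (LINT x|unif. (LINT y|unif. (R x y)^2)))" by linarith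
  qed simp
  also have "\<dots> = \<bar>\<tau>\<bar> * sqrt (LINT x|unif. (LINT y|unif. (R x y)^2))" unfolding real_sqrt_mult using n by simp
  finally show ?thesis unfolding R_def .
qed

theorem regular_limit:
  fixes lam :: "nat => real"
  assumes K: "Kregular r W" and nf: "\<not> Kfree r W"
    and mult: "\<forall>\<mu>. \<mu> \<noteq> 0 \<longrightarrow> finite {i. lam i = \<mu>} \<and> enat (card {i. lam i = \<mu>}) = spec_minus_mult r W \<mu>"
  defines "T \<equiv> \<lambda>\<xi>. \<Sum>k. lam k * ((\<xi> (Some k))^2 - 1)"
  shows "AE \<xi> in Nspace. summable (\<lambda>k. lam k * ((\<xi> (Some k))^2 - 1))"
    "(\<lambda>N. (LINT \<xi>|Nspace. ((\<Sum>k<N. lam k * ((\<xi> (Some k))^2 - 1)) - T \<xi>)^2)) \<longlonglongrightarrow> 0"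
    "weak_conv_m (\<lambda>n. distr (GP n) borel (\<lambda>\<omega>. (real (clique_count W n r \<omega>) - real (n choose r) * tt) / real n ^ (r - 1)))
       (distr Nspace borel (\<lambda>\<xi>. sigma_rW r W * \<xi> None + 1 / (2 * fact (r - 2)) * T \<xi>))"
proof -
  have t: "tt \<noteq> 0" using nf by (simp add: Kfree_def tt_def)
  have one: "AE x in unif. (LINT y|unif. VW r W x y) = tt" unfolding integral_VW using K by (simp add: Kregular_def tt_def)
  have "\<forall>\<mu>. \<mu> \<noteq> 0 \<longrightarrow> finite {i. lam i = \<mu>} \<and> enat (card {i. lam i = \<mu>}) = eig_mult (VW r W) \<mu> - (if \<mu> = tt then 1 else 0)"
    using mult unfolding spec_minus_mult_def tt_def[symmetric] by simp
  from graphon_spectral_expansion[OF bm2_VW VW_sym t one this]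
  obtain \<phi> where \<phi>: "\<And>k. U.bm1 (\<phi> k)"
    and orth: "\<And>i j. lam i \<noteq> 0 ==> lam j \<noteq> 0 ==> (LINT x|unif. \<phi> i x * \<phi> j x) = (if i = j then 1 else 0)"
    and mean: "\<And>k. lam k \<noteq> 0 ==> (LINT x|unif. \<phi> k x) = 0"
    and sm: "summable (\<lambda>k. (lam k)^2)"
    and L2: "(\<lambda>N. (LINT x|unif. (LINT y|unif. (VW r W x y - tt - (\<Sum>k<N. lam k * (\<phi> k x * \<phi> k y)))^2))) \<longlonglongrightarrow> 0" by blast
  show "AE \<xi> in Nspace. summable (\<lambda>k. lam k * ((\<xi> (Some k))^2 - 1))"
    "(\<lambda>N. (LINT \<xi>|Nspace. ((\<Sum>k<N. lam k * ((\<xi> (Some k))^2 - 1)) - T \<xi>)^2)) \<longlonglongrightarrow> 0"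
    unfolding T_def by (rule Nspace_chi_series[OF sm])+
  define \<sigma> a where "\<sigma> = sigma_rW r W" and "a = 1 / (2 * fact (r - 2) :: real)"
  define KN where "KN N = (\<lambda>x y. \<Sum>k<N. lam k * (\<phi> k x * \<phi> k y))" for N
  define V0 where "V0 = (\<lambda>x y. VW r W x y - tt)"
  have bV: "U.bm2 V0" unfolding V0_def by (rule U.bm2_diff[OF bm2_VW U.bm2_const])
  have bK: "U.bm2 (KN N)" for N unfolding KN_def
    by (rule U.bm2_sum, rule U.bm2_mult[OF U.bm2_const], rule U.bm2_mult[OF U.bm2_fst[OF \<phi>] U.bm2_snd[OF \<phi>]])
  have sV: "V0 x y = V0 y x" for x y unfolding V0_def using VW_sym[of x y] by simp
  have sK: "KN N x y = KN N y x" for N x y unfolding KN_def by (simp add: mult.commute)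
  have zK: "(LINT y|unif. KN N x y) = 0" for N x
  proof -
    have "(LINT y|unif. KN N x y) = (\<Sum>k<N. (LINT y|unif. lam k * (\<phi> k x * \<phi> k y)))" unfolding KN_def
      by (rule Bochner_Integration.integral_sum) (intro integrable_mult_right impI U.bm1_integrable[OF \<phi>])
    also have "\<dots> = 0" by (intro sum.neutral) (use mean in auto)
    finally show ?thesis .
  qed
  have zz: "AE x in unif. (LINT y|unif. V0 x y - KN N x y) = 0" for N
    using one
  proof eventually_elim
    case (elim x)
    have "(LINT y|unif. V0 x y - KN N x y) = (LINT y|unif. V0 x y) - (LINT y|unif. KN N x y)"
      by (rule Bochner_Integration.integral_diff[OF U.bm1_integrable[OF U.bm2_sec1[OF bV]] U.bm1_integrable[OF U.bm2_sec1[OF bK]]])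
    also have "(LINT y|unif. V0 x y) = (LINT y|unif. VW r W x y) - tt" unfolding V0_def
      using Bochner_Integration.integral_diff[OF U.bm1_integrable[OF U.bm2_sec1[OF bm2_VW]] U.integrable_const[of tt], of x] by (simp add: U.prob_space)
    finally show ?case using zK elim by simp
  qed
  show "weak_conv_m (\<lambda>n. distr (GP n) borel (\<lambda>\<omega>. (real (clique_count W n r \<omega>) - real (n choose r) * tt) / real n ^ (r - 1)))
       (distr Nspace borel (\<lambda>\<xi>. sigma_rW r W * \<xi> None + 1 / (2 * fact (r - 2)) * T \<xi>))"
    unfolding \<sigma>_def[symmetric] a_def[symmetric] T_def
  proof (rule weak_conv_by_char[OF prob_UP clique_count_measurable prob_Nspace Nspace_limit_char(2)[OF sm]])
    fix s :: real
    define \<tau> where "\<tau> = s / fact (r - 2)"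
    define c where "c = exp (- (\<tau>^2 * vW / 4))"
    \<comment> \<open>With \<tau> = s / (r-2)! and \<sigma>^2 = vW / (2 (r-2)!^2), the Gaussian
      exponents of the edge noise and of \<sigma> Z coincide.\<close>
    have cs: "- (s * \<sigma>)\<^sup>2 / 2 = - (\<tau>^2 * vW / 4)"
      unfolding \<sigma>_def sigma_rW_variance \<tau>_def using vW_nonneg by (simp add: power_mult_distrib power_divide)
    have sa: "s * a = \<tau> / 2" by (simp add: a_def \<tau>_def)
    have "(\<lambda>n. complex_of_real c * (LINT u|UP {..<n}. iexp (\<tau> / real n * qf V0 {..<n} u)))
      \<longlonglongrightarrow> (LINT \<xi>|Nspace. iexp (s * (\<sigma> * \<xi> None + a * (\<Sum>k. lam k * ((\<xi> (Some k))^2 - 1)))))"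
    \<comment> \<open>For each rank N the limit in n is known; the truncation error of the spectral
      expansion vanishes in N uniformly in n.\<close>
    proof (rule double_limit)
      show "cmod ((LINT u|UP {..<n}. iexp (\<tau> / real n * qf V0 {..<n} u)) - (LINT u|UP {..<n}. iexp (\<tau> / real n * qf (KN N) {..<n} u)))
        \<le> \<bar>\<tau>\<bar> * sqrt (LINT x|unif. (LINT y|unif. (V0 x y - KN N x y)^2))" if "n > 0" for N n
        by (rule qf_char_diff[OF bV sV bK sK zz that])
      have "(\<lambda>N. \<bar>\<tau>\<bar> * sqrt (LINT x|unif. (LINT y|unif. (V0 x y - KN N x y)^2))) \<longlonglongrightarrow> \<bar>\<tau>\<bar> * sqrt 0"
        unfolding V0_def KN_def by (intro tendsto_mult tendsto_const tendsto_real_sqrt L2)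
      then show "(\<lambda>N. \<bar>\<tau>\<bar> * sqrt (LINT x|unif. (LINT y|unif. (V0 x y - KN N x y)^2))) \<longlonglongrightarrow> 0" by simp
      show "(\<lambda>n. (LINT u|UP {..<n}. iexp (\<tau> / real n * qf (KN N) {..<n} u)))
        \<longlonglongrightarrow> (\<Prod>k<N. (LINT z|stdn. iexp (\<tau> / 2 * lam k * (z^2 - 1))))" for N
        unfolding KN_def by (rule uniform_quadratic_char[OF prob_unif])
          (use U.bm1_measurable[OF \<phi>] \<phi>[unfolded U.bm1_def] mean orth in blast)+
      show "(\<lambda>N. complex_of_real c * (\<Prod>k<N. (LINT z|stdn. iexp (\<tau> / 2 * lam k * (z^2 - 1)))))
        \<longlonglongrightarrow> (LINT \<xi>|Nspace. iexp (s * (\<sigma> * \<xi> None + a * (\<Sum>k. lam k * ((\<xi> (Some k))^2 - 1)))))"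
        using Nspace_limit_char(1)[OF sm, of s \<sigma> a] unfolding cs sa c_def .
    qed
    from tendsto_add[OF edge_noise_limit[of \<tau>] this[unfolded c_def V0_def]]
    have lim: "(\<lambda>n. (LINT \<omega>|GP n. iexp (s / fact (r - 2) * (Y 2 n \<omega> / real n))))
      \<longlonglongrightarrow> (LINT \<xi>|Nspace. iexp (s * (\<sigma> * \<xi> None + a * (\<Sum>k. lam k * ((\<xi> (Some k))^2 - 1)))))"
      unfolding \<tau>_def by (simp only: diff_add_cancel add_0)
    show "(\<lambda>n. (LINT \<omega>|GP n. iexp (s * ((real (clique_count W n r \<omega>) - real (n choose r) * tt) / real n ^ (r - 1)))))
      \<longlonglongrightarrow> (LINT \<xi>|Nspace. iexp (s * (\<sigma> * \<xi> None + a * (\<Sum>k. lam k * ((\<xi> (Some k))^2 - 1)))))"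
    proof (rule clique_char_limit[OF degenerate_2[OF K] r2 _ _ _ lim])
      have "r - 1 = Suc (r - 2)" using r2 by simp
      then show "real n ^ (r - 1) = real n ^ (r - 2) * real n" for n by simp
    qed simp_all
  qed
qed

end

section \<open>From the unit square to the real line\<close>

definition clip :: "(real => real => real) => real => real => real" where
  "clip W x y = (if (x, y) \<in> {0..1} \<times> {0..1} then W x y else 0)"

lemma clip_eq: "x \<in> {0..1} ==> y \<in> {0..1} ==> clip W x y = W x y" by (simp add: clip_def)

lemma good_clip: "graphon W ==> 2 \<le> r ==> good_graphon (clip W) r"
proof (unfold_locales)
  assume W: "graphon W"
  have "(\<lambda>p. if p \<in> {0..1} \<times> {0..1} then (\<lambda>(x, y). W x y) p else 0) \<in> borel_measurable borel"
  proof (rule measurable_If_set)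
    show "{0..1} \<times> {0..1} \<inter> space borel \<in> sets (borel :: (real \<times> real) measure)"
      using borel_closed[OF closed_Times[OF closed_atLeastAtMost closed_atLeastAtMost]] by simp
  qed (use W in \<open>auto simp: graphon_def\<close>)
  moreover have "(\<lambda>(x, y). clip W x y) = (\<lambda>p. if p \<in> {0..1} \<times> {0..1} then (\<lambda>(x, y). W x y) p else 0)"
    by (auto simp: clip_def fun_eq_iff)
  ultimately show "(\<lambda>(x, y). clip W x y) \<in> borel_measurable borel" by simp
  show "clip W x y = clip W y x" "0 \<le> clip W x y" "clip W x y \<le> 1" for x y
    using W by (auto simp: clip_def graphon_def)
qed

lemma measurable_2: "(\<lambda>(x, y). W x y) \<in> borel_measurable borel ==> f \<in> borel_measurable N ==> g \<in> borel_measurable N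
    ==> (\<lambda>x. W (f x) (g x)) \<in> borel_measurable N" for W :: "real => real => real"
proof -
  assume W: "(\<lambda>(x, y). W x y) \<in> borel_measurable borel" and f: "f \<in> borel_measurable N" and g: "g \<in> borel_measurable N"
  show ?thesis using measurable_compose[OF borel_measurable_Pair[OF f g] W] by simp
qed

lemma AE_unif01: "AE x in unif. x \<in> {0..1}" by (rule AE_uniform_measureI) auto

lemma AE_UP01: "finite I ==> I \<subseteq> J ==> AE \<omega> in UP J. \<forall>i\<in>I. \<omega> i \<in> {0..1}"
  by (intro AE_finite_allI AE_PiM_component[OF prob_unif _ AE_unif01]) auto

lemma hdens_integrand_measurable:
  fixes W :: "real => real => real"
  assumes W: "(\<lambda>(x, y). W x y) \<in> borel_measurable borel" and f: "\<And>i. i < k ==> f i \<in> borel_measurable N"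
  shows "(\<lambda>p. \<Prod>i<k. \<Prod>j\<in>{i<..<k}. W (f i p) (f j p) ^ E i j) \<in> borel_measurable N"
  by (intro borel_measurable_prod borel_measurable_power measurable_2[OF W] f) auto

text \<open>Free types lie in [0,1] almost surely and marked ones by assumption, so densities see W
  only on the unit square.\<close>

lemma hdens_cong_unit:
  assumes W: "(\<lambda>(x, y). W x y) \<in> borel_measurable borel" "(\<lambda>(x, y). W' x y) \<in> borel_measurable borel"
    and eq: "\<And>x y. x \<in> {0..1} ==> y \<in> {0..1} ==> W x y = W' x y" and x: "\<And>j. j \<in> J ==> x j \<in> {0..1}"
  shows "hdens W k E J x = hdens W' k E J x"
  unfolding hdens_def
proof (rule integral_cong_AE)
  have f: "(\<lambda>\<omega>. if i \<in> J then x i else \<omega> i) \<in> borel_measurable (UP ({..<k} - J))" if "i < k" for i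
    by (cases "i \<in> J") (use that UP_component[of i "{..<k} - J"] in auto)
  show "(\<lambda>\<omega>. \<Prod>i<k. \<Prod>j\<in>{i<..<k}. W (if i \<in> J then x i else \<omega> i) (if j \<in> J then x j else \<omega> j) ^ E i j) \<in> borel_measurable (UP ({..<k} - J))"
    by (rule hdens_integrand_measurable[OF W(1) f])
  show "(\<lambda>\<omega>. \<Prod>i<k. \<Prod>j\<in>{i<..<k}. W' (if i \<in> J then x i else \<omega> i) (if j \<in> J then x j else \<omega> j) ^ E i j) \<in> borel_measurable (UP ({..<k} - J))"
    by (rule hdens_integrand_measurable[OF W(2) f])
  show "AE \<omega> in UP ({..<k} - J). (\<Prod>i<k. \<Prod>j\<in>{i<..<k}. W (if i \<in> J then x i else \<omega> i) (if j \<in> J then x j else \<omega> j) ^ E i j)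
     = (\<Prod>i<k. \<Prod>j\<in>{i<..<k}. W' (if i \<in> J then x i else \<omega> i) (if j \<in> J then x j else \<omega> j) ^ E i j)"
    using AE_UP01[OF finite_Diff[OF finite_lessThan] subset_refl]
  proof eventually_elim
    case (elim \<omega>)
    have "(if i \<in> J then x i else \<omega> i) \<in> {0..1}" if "i < k" for i using x[of i] elim that by simp
    then show ?case by (intro prod.cong refl arg_cong2[where f="(^)"] eq) auto
  qed
qed

text \<open>Outside the unit square W may be unbounded and asymmetric, so the results for
  \<open>good_graphon\<close> do not reach it; \<open>eig_mult_cong\<close> needs this for both
  kernels.\<close>

lemma VW_section_measurable:
  assumes W: "(\<lambda>(x, y). W x y) \<in> borel_measurable borel"
  shows "(\<lambda>y. VW r W x y) \<in> borel_measurable unif"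
proof -
  interpret P: prob_space "UP ({..<r} - {0, 1})" by (rule prob_UP)
  have "(\<lambda>p. \<Prod>i<r. \<Prod>j\<in>{i<..<r}. W (if i \<in> {0, 1} then if i = 0 then x else fst p else snd p i)
      (if j \<in> {0, 1} then if j = 0 then x else fst p else snd p j) ^ Kr r i j) \<in> borel_measurable (unif \<Otimes>\<^sub>M UP ({..<r} - {0, 1}))"
  proof (rule hdens_integrand_measurable[OF W])
    fix i assume "i < r"
    then show "(\<lambda>p. if i \<in> {0, 1} then if i = 0 then x else fst p else snd p i) \<in> borel_measurable (unif \<Otimes>\<^sub>M UP ({..<r} - {0, 1}))"
    proof (cases "i \<in> {0, 1}")
      case True
      then show ?thesis using measurable_fst[of unif "UP ({..<r} - {0, 1})"] by (cases "i = 0") simp_all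
    next
      case False
      then show ?thesis using measurable_compose[OF measurable_snd[of unif "UP ({..<r} - {0, 1})"] UP_component[of i "{..<r} - {0, 1}"]] \<open>i < r\<close> by simp
    qed
  qed
  then show ?thesis unfolding VW_def hdens_def by (intro P.borel_measurable_lebesgue_integral) (simp add: split_beta')
qed

text \<open>The operator integrates over [0,1] and the eigenvalue equation is tested almost
  everywhere there, so the same families of functions qualify for both kernels.\<close>

lemma eig_mult_cong:
  assumes m: "\<And>x. V x \<in> borel_measurable unif" "\<And>x. V' x \<in> borel_measurable unif"
    and eq: "\<And>x y. x \<in> {0..1} ==> y \<in> {0..1} ==> V x y = V' x y"
  shows "eig_mult V \<mu> = eig_mult V' \<mu>"
proof -
  have "(AE x in unif. (LINT y|unif. V x y * f y) = \<mu> * f x) \<longleftrightarrow> (AE x in unif. (LINT y|unif. V' x y * f y) = \<mu> * f x)"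
    if f: "f \<in> borel_measurable borel" for f
  proof -
    have "(LINT y|unif. V x y * f y) = (LINT y|unif. V' x y * f y)" if x: "x \<in> {0..1}" for x
    proof (rule integral_cong_AE)
      have fm: "f \<in> borel_measurable unif" using f by simp
      show "(\<lambda>y. V x y * f y) \<in> borel_measurable unif" "(\<lambda>y. V' x y * f y) \<in> borel_measurable unif"
        by (rule borel_measurable_times[OF m(1) fm], rule borel_measurable_times[OF m(2) fm])
      show "AE y in unif. V x y * f y = V' x y * f y" using AE_unif01 by eventually_elim (simp add: eq[OF x])
    qed
    then have "AE x in unif. ((LINT y|unif. V x y * f y) = \<mu> * f x) = ((LINT y|unif. V' x y * f y) = \<mu> * f x)"
      using AE_unif01 by (auto elim: eventually_mono)
    then show ?thesis by (rule eventually_subst)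
  qed
  then show ?thesis unfolding eig_mult_def by (intro arg_cong[where f=Sup] image_cong Collect_cong ex_cong refl) (auto simp: conj_commute)
qed

text \<open>Concerns the original W on the whole line. It is what allows two almost surely equal
  counts to be given the same law.\<close>

lemma clique_count_measurable_graphon:
  assumes W: "(\<lambda>(x, y). W x y) \<in> borel_measurable borel"
  shows "(\<lambda>\<omega>. real (clique_count W n r \<omega>)) \<in> borel_measurable (GP n)"
proof -
  let ?M = "GP n"
  have G: "{\<omega> \<in> space ?M. i \<noteq> j \<longrightarrow> Gedge W \<omega> i j} \<in> sets ?M" if "i < n" "j < n" for i j
  proof (cases "i = j")
    case False
    have e: "Inr (min i j, max i j) \<in> crd {..<n}" using that False unfolding Gidx_crd[symmetric] Gidx_def by (auto simp: min_def max_def)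
    have "(\<lambda>\<omega>. W (\<omega> (Inl i)) (\<omega> (Inl j))) \<in> borel_measurable ?M"
      by (rule measurable_2[OF W UP_component UP_component]) (use that crd_Inl in auto)
    with UP_component[OF e] have "{\<omega> \<in> space ?M. \<omega> (Inr (min i j, max i j)) < W (\<omega> (Inl i)) (\<omega> (Inl j))} \<in> sets ?M"
      by (rule borel_measurable_less)
    then show ?thesis using False unfolding Gedge_def by simp
  qed simp
  have cc: "real (clique_count W n r \<omega>) = (\<Sum>S\<in>Sub r n. if \<forall>i\<in>S. \<forall>j\<in>S. i \<noteq> j \<longrightarrow> Gedge W \<omega> i j then 1 else 0)" for \<omega>
  proof -
    have "clique_count W n r \<omega> = card {S \<in> Sub r n. \<forall>i\<in>S. \<forall>j\<in>S. i \<noteq> j \<longrightarrow> Gedge W \<omega> i j}"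
      by (simp add: clique_count_def Sub_def conj_assoc)
    then show ?thesis using finite_Sub[of r n] by (simp add: sum.If_cases Int_def)
  qed
  show ?thesis unfolding cc
  proof (rule borel_measurable_sum)
    fix S assume "S \<in> Sub r n"
    then have S: "finite S" "S \<subseteq> {..<n}" using SubD[of S r n] by auto
    have "{\<omega> \<in> space ?M. \<forall>i\<in>S. \<forall>j\<in>S. i \<noteq> j \<longrightarrow> Gedge W \<omega> i j} \<in> sets ?M"
    proof (rule sets.sets_Collect_finite_All[OF sets.sets_Collect_finite_All S(1)])
      fix i j assume "i \<in> S" "j \<in> S"
      then have "i < n" "j < n" using S(2) by auto
      then show "{\<omega> \<in> space ?M. i \<noteq> j \<longrightarrow> Gedge W \<omega> i j} \<in> sets ?M" by (rule G)
    qed (rule S)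
    then show "(\<lambda>\<omega>. if \<forall>i\<in>S. \<forall>j\<in>S. i \<noteq> j \<longrightarrow> Gedge W \<omega> i j then 1 else 0 :: real) \<in> borel_measurable ?M"
      by (rule measurable_If[OF borel_measurable_const borel_measurable_const])
  qed
qed

lemma clique_count_clip: "AE \<omega> in GP n. clique_count W n r \<omega> = clique_count (clip W) n r \<omega>"
proof -
  have "AE \<omega> in GP n. \<forall>c\<in>Inl ` {..<n}. \<omega> c \<in> {0..1}" by (rule AE_UP01) (auto simp: crd_def)
  then show ?thesis
  proof eventually_elim
    case (elim \<omega>)
    have G: "Gedge W \<omega> i j = Gedge (clip W) \<omega> i j" if "i < n" "j < n" for i j
      unfolding Gedge_def using elim that by (simp add: clip_eq)
    have "(\<forall>i\<in>S. \<forall>j\<in>S. i \<noteq> j \<longrightarrow> Gedge W \<omega> i j) = (\<forall>i\<in>S. \<forall>j\<in>S. i \<noteq> j \<longrightarrow> Gedge (clip W) \<omega> i j)" if "S \<subseteq> {..<n}" for S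
      using that by (intro ball_cong refl) (simp add: G subset_iff)
    then show ?case unfolding clique_count_def by (intro arg_cong[where f=card] Collect_cong) auto
  qed
qed

theorem theorem1p2:
  fixes W :: "real \<Rightarrow> real \<Rightarrow> real" and r :: nat
  assumes "graphon W" and "r \<ge> 2"
  defines "t \<equiv> tdens W r (Kr r)"
  shows
    "(Kfree r W \<longrightarrow> (\<forall>n. AE \<omega> in Gspace n. clique_count W n r \<omega> = 0)) \<and>
     (complete_graphon W \<longrightarrow> (\<forall>n. AE \<omega> in Gspace n. clique_count W n r \<omega> = n choose r)) \<and>
     (\<not> Kregular r W \<longrightarrow>
        sigma_hat_rW r W > 0 \<and>
        weak_conv_m
          (\<lambda>n. distr (Gspace n) borel
             (\<lambda>\<omega>. (real (clique_count W n r \<omega>) - real (n choose r) * t) / real n powr (real r - 1/2)))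
          (density lborel (normal_density 0 (sigma_hat_rW r W)))) \<and>
     (Kregular r W \<and> \<not> Kfree r W \<and> \<not> complete_graphon W \<longrightarrow>
        (\<forall>lam :: nat \<Rightarrow> real.
           (\<forall>\<mu>. \<mu> \<noteq> 0 \<longrightarrow> finite {i. lam i = \<mu>} \<and> enat (card {i. lam i = \<mu>}) = spec_minus_mult r W \<mu>)
           \<longrightarrow>
           (let S = (\<lambda>\<xi>. \<Sum>k. lam k * ((\<xi> (Some k))^2 - 1)) in
             (AE \<xi> in Nspace. summable (\<lambda>k. lam k * ((\<xi> (Some k))^2 - 1))) \<and>
             (\<lambda>N. \<integral>\<xi>. ((\<Sum>k<N. lam k * ((\<xi> (Some k))^2 - 1)) - S \<xi>)^2 \<partial>Nspace) \<longlonglongrightarrow> 0 \<and>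
             weak_conv_m
               (\<lambda>n. distr (Gspace n) borel
                  (\<lambda>\<omega>. (real (clique_count W n r \<omega>) - real (n choose r) * t) / real n ^ (r - 1)))
               (distr Nspace borel
                  (\<lambda>\<xi>. sigma_rW r W * \<xi> None + (1 / (2 * fact (r - 2))) * S \<xi>)))))"
proof -
  interpret g: good_graphon "clip W" r by (rule good_clip[OF assms(1,2)])
  have Wm: "(\<lambda>(x, y). W x y) \<in> borel_measurable borel" using assms(1) by (simp add: graphon_def)
  have hd: "hdens W k E J x = hdens (clip W) k E J x" if "\<And>j. j \<in> J ==> x j \<in> {0..1}" for k E J x
    by (rule hdens_cong_unit[OF Wm g.Wm _ that]) (simp_all add: clip_eq)
  have td: "tdens W k E = tdens (clip W) k E" for k E unfolding tdens_def by (rule hd) simp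
  have tt: "g.tt = t" unfolding g.tt_def t_def td ..
  have sh: "sigma_hat_rW r W = sigma_hat_rW r (clip W)" and sr: "sigma_rW r W = sigma_rW r (clip W)"
    and Kf: "Kfree r W = Kfree r (clip W)"
    unfolding sigma_hat_rW_def sigma_rW_def Kfree_def td by simp_all
  have VWe: "VW r W x y = VW r (clip W) x y" if "x \<in> {0..1}" "y \<in> {0..1}" for x y
    unfolding VW_def by (rule hd) (use that in auto)
  have Kr: "Kregular r W = Kregular r (clip W)"
  proof -
    have "t1 r W x = t1 r (clip W) x" if "x \<in> {0..1}" for x unfolding t1_def by (rule hd) (use that in auto)
    then have "AE x in unif. (t1 r W x = tdens (clip W) r (Kr r)) = (t1 r (clip W) x = tdens (clip W) r (Kr r))"
      using AE_unif01 by (auto elim: eventually_mono)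
    then show ?thesis unfolding Kregular_def td by (rule eventually_subst)
  qed
  have ee: "eig_mult (VW r W) \<mu> = eig_mult (VW r (clip W)) \<mu>" for \<mu>
    by (rule eig_mult_cong[OF VW_section_measurable[OF Wm] VW_section_measurable[OF g.Wm] VWe])
  have sp: "spec_minus_mult r W \<mu> = spec_minus_mult r (clip W) \<mu>" for \<mu>
    unfolding spec_minus_mult_def td ee ..
  have Gs: "Gspace n = GP n" for n unfolding Gspace_def Gidx_crd ..
  \<comment> \<open>The counts for W and for its truncation agree almost surely, so the limit
    theorems proved for the truncation transfer to W by equality of laws.\<close>
  have ds: "distr (Gspace n) borel (\<lambda>\<omega>. (real (clique_count W n r \<omega>) - a) / b)
      = distr (GP n) borel (\<lambda>\<omega>. (real (clique_count (clip W) n r \<omega>) - a) / b)" for n a b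
    unfolding Gs
  proof (rule distr_cong_AE)
    show "AE \<omega> in GP n. (real (clique_count W n r \<omega>) - a) / b = (real (clique_count (clip W) n r \<omega>) - a) / b"
      using clique_count_clip[of W n r] by eventually_elim simp
    show "(\<lambda>\<omega>. (real (clique_count W n r \<omega>) - a) / b) \<in> borel_measurable (GP n)"
      by (intro borel_measurable_divide borel_measurable_diff borel_measurable_const clique_count_measurable_graphon[OF Wm])
    show "(\<lambda>\<omega>. (real (clique_count (clip W) n r \<omega>) - a) / b) \<in> borel_measurable (GP n)" by (rule g.clique_count_measurable)
  qed simp_all
  have A: "AE \<omega> in Gspace n. clique_count W n r \<omega> = 0" if "Kfree r W" for n
    using g.Kfree_no_cliques[OF that[unfolded Kf], of n] clique_count_clip[of W n r] unfolding Gs by eventually_elim simp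
  have B: "AE \<omega> in Gspace n. clique_count W n r \<omega> = n choose r" if c: "complete_graphon W" for n
  proof -
    have "AE p in unif \<Otimes>\<^sub>M unif. fst p \<in> {0..1} \<and> snd p \<in> {0..1}"
    proof (rule U.PP.AE_pair_measure)
      show "{p \<in> space (unif \<Otimes>\<^sub>M unif). fst p \<in> {0..1} \<and> snd p \<in> {0..1}} \<in> sets (unif \<Otimes>\<^sub>M unif)" by measurable
      show "AE x in unif. AE y in unif. fst (x, y) \<in> {0..1} \<and> snd (x, y) \<in> {0..1}"
        using AE_unif01 by eventually_elim (use AE_unif01 in simp)
    qed
    with c[unfolded complete_graphon_def] have "complete_graphon (clip W)"
      unfolding complete_graphon_def by eventually_elim (simp add: clip_eq)
    from g.complete_all_cliques[OF this, of n] show ?thesis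
      using clique_count_clip[of W n r] unfolding Gs by eventually_elim simp
  qed
  have C: "sigma_hat_rW r W > 0 \<and> weak_conv_m (\<lambda>n. distr (Gspace n) borel (\<lambda>\<omega>. (real (clique_count W n r \<omega>) - real (n choose r) * t) / real n powr (real r - 1/2)))
      (density lborel (normal_density 0 (sigma_hat_rW r W)))" if "\<not> Kregular r W"
    unfolding ds sh using g.nonregular_limit[unfolded tt] that[unfolded Kr] by blast
  show ?thesis unfolding Let_def
  proof (intro conjI impI allI A B)
    fix lam :: "nat => real"
    assume K: "Kregular r W \<and> \<not> Kfree r W \<and> \<not> complete_graphon W"
      and m: "\<forall>\<mu>. \<mu> \<noteq> 0 \<longrightarrow> finite {i. lam i = \<mu>} \<and> enat (card {i. lam i = \<mu>}) = spec_minus_mult r W \<mu>"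
    have K': "Kregular r (clip W)" "\<not> Kfree r (clip W)" using K Kr Kf by auto
    note L = g.regular_limit[unfolded tt, OF K' m[unfolded sp]]
    show "AE \<xi> in Nspace. summable (\<lambda>k. lam k * ((\<xi> (Some k))^2 - 1))" by (rule L(1))
    show "(\<lambda>N. (LINT \<xi>|Nspace. ((\<Sum>k<N. lam k * ((\<xi> (Some k))^2 - 1)) - (\<Sum>k. lam k * ((\<xi> (Some k))^2 - 1)))^2)) \<longlonglongrightarrow> 0" by (rule L(2))
    show "weak_conv_m (\<lambda>n. distr (Gspace n) borel (\<lambda>\<omega>. (real (clique_count W n r \<omega>) - real (n choose r) * t) / real n ^ (r - 1)))
       (distr Nspace borel (\<lambda>\<xi>. sigma_rW r W * \<xi> None + 1 / (2 * fact (r - 2)) * (\<Sum>k. lam k * ((\<xi> (Some k))^2 - 1))))"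
      unfolding ds sr by (rule L(3))
  qed (use C in blast)+
qed

end
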